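(* Consider the Jacobi hypergroup with parameters $\alpha\ge\beta\ge-\tfrac12$, $\alpha\ne-\tfrac12$, and let $1<p\le 2$. If $f\in\mathcal{B}^{p,1}_{\frac{2(\alpha+1)}{p},\alpha}\cap\mathcal{B}^{p,1}_{\frac{3}{p},\alpha}$, then $\mathcal{F}(f)\in L^1(\mathbb{R}_+,|c(\lambda)|^{-2}d\lambda)$, i.e. $\int_0^\infty|\mathcal F(f)(t)|\,\frac{dt}{|c(t)|^2}<\infty$.
   Context: Jacobi hypergroup: $A(x)=2^{2\rho}(\sinh x)^{2\alpha+1}(\cosh x)^{2\beta+1}$ on $\mathbb{R}_+$ with $\alpha\ge\beta\ge-\tfrac12$, $\alpha\neq-\tfrac12$, $\rho=\alpha+\beta+1>0$. For $\lambda\in\mathbb{C}$, $\varphi_\lambda(x)={}_2F_1\big(\tfrac12(\rho-i\lambda),\tfrac12(\rho+i\lambda);\alpha+1;-\sinh^2 x\big)$ (Jacobi function). $L^p_A(\mathbb{R}_+)=L^p(\mathbb{R}_+,A(x)dx)$ with norm $\|\cdot\|_{A,p}$. For $f\in L^1_A$, $\mathcal{F}(f)(\lambda)=\int_0^\infty f(x)\varphi_\lambda(x)A(x)dx$; $|c(\lambda)|^{-2}$ is the (even, continuous) Plancherel density, so that $\mathcal F$ extends to an isometry of $L^2_A$ onto $L^2(\mathbb{R}_+,|c(\lambda)|^{-2}d\lambda)$, and by interpolation $\mathcal F$ is defined on $L^p_A$ for $1\le p\le2$. The hypergroup convolution $\delta_x*\delta_y$ is the probability measure on $[|x-y|,x+y]$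 with $\int\varphi_\lambda\,d(\delta_x*\delta_y)=\varphi_\lambda(x)\varphi_\lambda(y)$; the generalized translation is $\tau_xf(y)=\int f\,d(\delta_x*\delta_y)$, a contraction on each $L^p_A$. The modulus of continuity is $\omega_{A,p}(f)(x)=\|\tau_xf-f\|_{A,p}$. Besov-type space: for $\gamma>0$, $1\le p\le\infty$, $1\le q\le\infty$, $\mathcal{B}^{p,q}_{\gamma,\alpha}$ is the set of $f\in L^p_A(\mathbb{R}_+)$ with $\int_0^\infty\big(\omega_{A,p}(f)(x)/x^\gamma\big)^q\frac{dx}{x}<\infty$ if $q<\infty$, and $\sup_{x>0}\omega_{A,p}(f)(x)/x^\gamma<\infty$ if $q=\infty$. *)

theory Defs
  imports "HOL-Probability.Probability"
begin

definition jac_rho :: "real \<Rightarrow> real \<Rightarrow> real" where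
  "jac_rho a b = a + b + 1"

definition jac_A :: "real \<Rightarrow> real \<Rightarrow> real \<Rightarrow> real" where
  "jac_A a b x = 2 powr (2 * jac_rho a b) * sinh x powr (2 * a + 1) * cosh x powr (2 * b + 1)"

definition hyp2F1 :: "complex \<Rightarrow> complex \<Rightarrow> complex \<Rightarrow> complex \<Rightarrow> complex" where
  "hyp2F1 a b c z =
     (\<Sum>n. pochhammer a n * pochhammer b n / (pochhammer c n * fact n) * z ^ n)"

text \<open>Jacobi function phi_l(x) = 2F1((rho - i l)/2, (rho + i l)/2; a+1; -sinh^2 x), where
  the hypergeometric function at the argument -sinh^2 x (which may be < -1) is its analytic
  continuation, written via Pfaff's transformation
  2F1(A,B;C;z) = (1-z)^(-A) 2F1(A, C-B; C; z/(z-1)), z/(z-1) = tanh^2 x in [0,1).\<close>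
definition jacobi_phi :: "real \<Rightarrow> real \<Rightarrow> complex \<Rightarrow> real \<Rightarrow> complex" where
  "jacobi_phi a b l x =
     (complex_of_real (cosh x)) powr (\<i> * l - complex_of_real (jac_rho a b)) *
     hyp2F1 ((complex_of_real (jac_rho a b) - \<i> * l) / 2)
            ((complex_of_real (a - b + 1) - \<i> * l) / 2)
            (complex_of_real (a + 1))
            (complex_of_real ((tanh x)\<^sup>2))"

definition jac_c :: "real \<Rightarrow> real \<Rightarrow> real \<Rightarrow> complex" where
  "jac_c a b l =
     2 powr (complex_of_real (jac_rho a b) - \<i> * complex_of_real l) *
     Gamma (complex_of_real (a + 1)) * Gamma (\<i> * complex_of_real l) /
     (Gamma ((\<i> * complex_of_real l + complex_of_real (jac_rho a b)) / 2) *
      Gamma ((\<i> * complex_of_real l + complex_of_real (a - b + 1)) / 2))"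

definition jac_planch :: "real \<Rightarrow> real \<Rightarrow> real \<Rightarrow> real" where
  "jac_planch a b l = 1 / (cmod (jac_c a b l))\<^sup>2"

definition hyp_conv :: "real \<Rightarrow> real \<Rightarrow> real \<Rightarrow> real \<Rightarrow> real measure" where
  "hyp_conv a b x y =
     (THE \<mu>. prob_space \<mu> \<and> sets \<mu> = sets borel \<and> emeasure \<mu> {\<bar>x - y\<bar>..x + y} = 1 \<and>
        (\<forall>l::complex. (\<integral>t. jacobi_phi a b l t \<partial>\<mu>) = jacobi_phi a b l x * jacobi_phi a b l y))"

definition jac_tau :: "real \<Rightarrow> real \<Rightarrow> real \<Rightarrow> (real \<Rightarrow> complex) \<Rightarrow> real \<Rightarrow> complex" where
  "jac_tau a b x f y = (\<integral>t. f t \<partial>(hyp_conv a b x y))"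

definition jac_Lp :: "real \<Rightarrow> real \<Rightarrow> real \<Rightarrow> (real \<Rightarrow> complex) \<Rightarrow> bool" where
  "jac_Lp a b p f \<longleftrightarrow> set_borel_measurable borel {0<..} f \<and>
     (\<integral>\<^sup>+ x\<in>{0<..}. ennreal (cmod (f x) powr p * jac_A a b x) \<partial>lborel) < \<infinity>"

definition enn_powr :: "ennreal \<Rightarrow> real \<Rightarrow> ennreal" where
  "enn_powr z q = (if z = \<infinity> then \<infinity> else ennreal (enn2real z powr q))"

definition jac_omega :: "real \<Rightarrow> real \<Rightarrow> real \<Rightarrow> (real \<Rightarrow> complex) \<Rightarrow> real \<Rightarrow> ennreal" where
  "jac_omega a b p f x =
     enn_powr (\<integral>\<^sup>+ y\<in>{0<..}. ennreal (cmod (jac_tau a b x f y - f y) powr p * jac_A a b y) \<partial>lborel) (1 / p)"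

definition jac_besov :: "real \<Rightarrow> real \<Rightarrow> real \<Rightarrow> real \<Rightarrow> real \<Rightarrow> (real \<Rightarrow> complex) \<Rightarrow> bool" where
  "jac_besov a b p q \<gamma> f \<longleftrightarrow> jac_Lp a b p f \<and>
     (\<integral>\<^sup>+ x\<in>{0<..}. enn_powr (jac_omega a b p f x * ennreal (x powr (- \<gamma>))) q
        * ennreal (1 / x) \<partial>lborel) < \<infinity>"

text \<open>Fourier-Jacobi transform of the truncation f 1_(0,R] (which lies in L^1_A).\<close>
definition jac_FT_trunc :: "real \<Rightarrow> real \<Rightarrow> (real \<Rightarrow> complex) \<Rightarrow> real \<Rightarrow> real \<Rightarrow> complex" where
  "jac_FT_trunc a b f R l =
     set_lebesgue_integral lborel {0<..R}
       (\<lambda>x. f x * jacobi_phi a b (complex_of_real l) x * complex_of_real (jac_A a b x))"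

text \<open>g is (a version of) the Fourier transform F(f) of f in L^p_A, 1 < p <= 2: the
  limit in L^(p')(R_+, |c|^(-2) dl) of the transforms of the truncations, i.e. of the
  unique bounded (Hausdorff-Young / interpolation) extension of F.\<close>
definition is_jac_FT :: "real \<Rightarrow> real \<Rightarrow> real \<Rightarrow> (real \<Rightarrow> complex) \<Rightarrow> (real \<Rightarrow> complex) \<Rightarrow> bool" where
  "is_jac_FT a b p f g \<longleftrightarrow> g \<in> borel_measurable borel \<and>
     ((\<lambda>R. \<integral>\<^sup>+ l\<in>{0<..}. ennreal (cmod (jac_FT_trunc a b f R l - g l) powr (p / (p - 1))
              * jac_planch a b l) \<partial>lborel) \<longlongrightarrow> 0) at_top"

end

theory Submission
  imports Defs "HOL-Real_Asymp.Real_Asymp" "HOL-Computational_Algebra.Polynomial"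
begin

text \<open>
  Write \<open>q = p/(p-1)\<close>. The transform multiplies by \<open>\<phi>\<^sub>l(x)\<close> under translation by \<open>x\<close>, so the
  Hausdorff--Young inequality bounds \<open>(1 - \<phi>\<^sub>l(x)) F(f)(l)\<close> in \<open>L\<^sup>q(|c|\<^sup>-\<^sup>2 dl)\<close> by the modulus of
  continuity \<open>\<omega>(x)\<close>. For \<open>l x \<ge> 1\<close> the factor \<open>|1 - \<phi>\<^sub>l(x)|\<close> is bounded below, and Hoelder's
  inequality on the window \<open>1/x \<le> l \<le> 2/x\<close>, whose mass is at most a constant times
  \<open>x powr (-2(a+1))\<close> for \<open>x \<le> 1\<close> and \<open>x powr (-3)\<close> for \<open>x > 1\<close>, turns this into
  a bound \<open>\<omega>(x) x powr (-\<gamma>)\<close> for the integral of \<open>|F(f)|\<close> over the window, \<open>\<gamma>\<close> being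
  \<open>2(a+1)/p\<close> or \<open>3/p\<close>. Integrating against \<open>dx/x\<close> gives the claim.

  The convolution measures exist because the solution of the wave equation
  \<open>u\<^sub>x\<^sub>x + B u\<^sub>x = u\<^sub>y\<^sub>y + B u\<^sub>y\<close> with \<open>B = A'/A\<close> preserves positivity, which makes the functional
  prescribed on polynomials in \<open>sinh\<^sup>2\<close> a Hausdorff moment functional. The transform is bounded
  from \<open>L\<^sup>2\<close> to \<open>L\<^sup>2(w dl)\<close>, where the power weight \<open>w\<close> dominates \<open>|c|\<^sup>-\<^sup>2\<close>: up to an
  error controlled by Schur's test, \<open>sqrt A \<phi>\<^sub>l\<close> is a combination of \<open>exp (\<plusminus> i l x)\<close>, to which
  Plancherel's inequality on the line applies. The \<open>L\<^sup>p\<close> case follows by Marcinkiewicz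
  interpolation with the bound from \<open>L\<^sup>1\<close> to \<open>L\<^sup>\<infinity>\<close>.
\<close>

subsection \<open>The Plancherel density\<close>

text \<open>\<open>hyp_conv\<close> is a definite description, so nothing can be said about
  translation before the measure is known to exist and to be unique for each pair of points. The
  wave equation yields it for all \<open>b \<le> a\<close> at once, the sign of B' doing the work.
  The identity for the transform of a translate is proved for integrable functions, whereas f lies
  in L^p only; hence all estimates are made for truncations. Truncation does not commute with
  translation, and the defect is absorbed by the tail of f. Membership in L^p restricts f on the
  positive axis only, while \<open>jac_tau\<close> integrates over a measure on the whole line. If f
  is not Borel there, its translates are 0 by convention and the modulus of continuity becomes the
  norm of f; this case is treated apart. The weight w is elementary and has the orders of the
  Plancherel density, l^2 at 0 and l^(2a+1) at infinity. The solutions are of size w^(-1/2), and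
  integrating these orders over a window of length 1/x gives the exponents 3 and 2(a+1), which
  Hoelder's inequality divides by p.\<close>

lemma ln_one_plus_inverse_square_convex:
  fixes y :: real
  shows "convex_on {0<..} (\<lambda>x::real. ln (x\<^sup>2 + y\<^sup>2) - 2 * ln x)"
proof (rule f''_ge0_imp_convex)
  show "convex {0::real<..}" by simp
  fix t :: real assume "t \<in> {0<..}"
  then have t: "t > 0" by simp
  then have p: "t\<^sup>2 + y\<^sup>2 > 0" by (simp add: add_pos_nonneg)
  show "((\<lambda>x. ln (x\<^sup>2 + y\<^sup>2) - 2 * ln x) has_real_derivative 2 * t / (t\<^sup>2 + y\<^sup>2) - 2 / t) (at t)"
    using t p by (auto intro!: derivative_eq_intros)
  have "((\<lambda>t. 2 * t / (t\<^sup>2 + y\<^sup>2) - 2 / t) has_real_derivative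
      (2 * (t\<^sup>2 + y\<^sup>2) - 2 * t * (2 * t)) / ((t\<^sup>2 + y\<^sup>2)\<^sup>2) + 2 / t\<^sup>2) (at t)"
    using t p by (auto intro!: derivative_eq_intros simp: power2_eq_square)
  moreover have "(2 * (t\<^sup>2 + y\<^sup>2) - 2 * t * (2 * t)) / ((t\<^sup>2 + y\<^sup>2)\<^sup>2) + 2 / t\<^sup>2
     = (6 * t\<^sup>2 * y\<^sup>2 + 2 * y^4) / ((t\<^sup>2 + y\<^sup>2)\<^sup>2 * t\<^sup>2)"
    using t p by (simp add: divide_simps) (simp add: algebra_simps power2_eq_square power4_eq_xxxx)
  ultimately show "((\<lambda>t. 2 * t / (t\<^sup>2 + y\<^sup>2) - 2 / t) has_real_derivative
      (6 * t\<^sup>2 * y\<^sup>2 + 2 * y^4) / ((t\<^sup>2 + y\<^sup>2)\<^sup>2 * t\<^sup>2)) (at t)" by simp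
  show "0 \<le> (6 * t\<^sup>2 * y\<^sup>2 + 2 * y^4) / ((t\<^sup>2 + y\<^sup>2)\<^sup>2 * t\<^sup>2)" by simp
qed

text \<open>By Gauss' product \<open>|\<Gamma>(x+iy)|/\<Gamma>(x)\<close> is log-concave in \<open>x\<close>, so it lies below its chords
  outside the interval of the chord.\<close>
lemma norm_Gamma_extrapolate:
  fixes \<sigma> s y :: real
  assumes s: "\<sigma> > 1" "s \<ge> 0"
  shows "cmod (Gamma (Complex (\<sigma> + s) y)) \<le>
     Gamma (\<sigma> + s) * (cmod (Gamma (Complex \<sigma> y)) / Gamma \<sigma>) *
       (cmod (Complex (\<sigma> - 1) y) / (\<sigma> - 1)) powr s"
proof -
  \<comment> \<open>Logarithm of |x+k+iy| / (x+k), the reciprocal of the k-th factor in Gauss'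
    product for |\<Gamma>(x+iy)| / \<Gamma>(x). Factor by factor, log-concavity is a statement about
    elementary functions.\<close>
  define c where "c k x = (ln ((x + real k)\<^sup>2 + y\<^sup>2) - 2 * ln (x + real k)) / 2" for k x
  define G where "G n x = (\<Sum>k\<le>n. c k x)" for n x
  have pos: "(x + real k)\<^sup>2 + y\<^sup>2 > 0" if "x > 0" for x k
    using that by (intro add_pos_nonneg) (auto intro!: zero_less_power add_pos_nonneg)
  have cc: "cmod (Complex x y + of_nat k) = (x + real k) * exp (c k x)" if "x > 0" for x k
  proof -
    have "exp (c k x) = sqrt ((x + real k)\<^sup>2 + y\<^sup>2) / (x + real k)"
      using that pos[OF that, of k]
      by (simp add: c_def diff_divide_distrib exp_diff ln_sqrt[symmetric] add_pos_nonneg)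
    moreover have "cmod (Complex x y + of_nat k) = sqrt ((x + real k)\<^sup>2 + y\<^sup>2)"
      by (simp add: cmod_def)
    ultimately show ?thesis using that by (simp add: add_pos_nonneg field_simps)
  qed
  have ser: "cmod (Gamma_series (Complex x y) n) = Gamma_series x n * exp (- G n x)" if "x > 0" for x n
  proof -
    have "cmod (pochhammer (Complex x y) (n+1)) = pochhammer x (n+1) * exp (G n x)"
    proof -
      have 1: "pochhammer (Complex x y) (n+1) = (\<Prod>k\<le>n. Complex x y + of_nat k)"
        by (rule pochhammer_prod[THEN trans], intro prod.cong) auto
      have 2: "pochhammer x (n+1) = (\<Prod>k\<le>n. x + real k)"
        by (rule pochhammer_prod[THEN trans], intro prod.cong) auto
      show ?thesis unfolding 1 2 G_def
        by (simp add: prod_norm[symmetric] cc[OF that] exp_sum prod.distrib)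
    qed
    then show ?thesis
      by (simp add: Gamma_series_def norm_mult norm_divide exp_minus field_simps)
  qed
  \<comment> \<open>\<sigma> is the convex combination of \<sigma> + s and \<sigma> - 1 with weights
    1/(s+1) and s/(s+1). The left end lies exactly one below \<sigma>, because there the functional
    equation makes the slope of the chord explicit; \<sigma> > 1 keeps it in the domain of
    convexity.\<close>
  have conv: "c k \<sigma> \<le> (1 / (s+1)) * c k (\<sigma> + s) + (s/(s+1)) * c k (\<sigma> - 1)" for k
  proof -
    have "convex_on {0<..} (\<lambda>x::real. ln (x\<^sup>2 + y\<^sup>2) - 2 * ln x)"
      by (rule ln_one_plus_inverse_square_convex)
    then have "(\<lambda>x::real. ln (x\<^sup>2 + y\<^sup>2) - 2 * ln x) ((1 - s/(s+1)) *\<^sub>R (\<sigma> + s + real k) + (s/(s+1)) *\<^sub>R (\<sigma> - 1 + real k))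
       \<le> (1 - s/(s+1)) * (\<lambda>x::real. ln (x\<^sup>2 + y\<^sup>2) - 2 * ln x) (\<sigma> + s + real k)
          + (s/(s+1)) * (\<lambda>x::real. ln (x\<^sup>2 + y\<^sup>2) - 2 * ln x) (\<sigma> - 1 + real k)"
      using s by (intro convex_onD) (auto simp: field_simps add_pos_nonneg)
    moreover have "(1 - s/(s+1)) *\<^sub>R (\<sigma> + s + real k) + (s/(s+1)) *\<^sub>R (\<sigma> - 1 + real k) = \<sigma> + real k"
      using s by (simp add: divide_simps) (simp add: algebra_simps)
    moreover have "1 - s/(s+1) = 1/(s+1)" using s by (simp add: field_simps)
    ultimately have "(\<lambda>x::real. ln (x\<^sup>2 + y\<^sup>2) - 2 * ln x) (\<sigma> + real k)
       \<le> 1/(s+1) * (\<lambda>x::real. ln (x\<^sup>2 + y\<^sup>2) - 2 * ln x) (\<sigma> + s + real k)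
          + s/(s+1) * (\<lambda>x::real. ln (x\<^sup>2 + y\<^sup>2) - 2 * ln x) (\<sigma> - 1 + real k)"
      by metis
    moreover have "X / 2 \<le> u * (Y / 2) + v * (Z / 2)" if "X \<le> u * Y + v * Z" for X Y Z u v :: real
      using that by (simp add: field_simps)
    ultimately show ?thesis unfolding c_def by blast
  qed
  have conv': "- G n (\<sigma> + s) \<le> - G n \<sigma> + s * (G n (\<sigma> - 1) - G n \<sigma>)" for n
  proof -
    have "- c k (\<sigma> + s) \<le> - c k \<sigma> + s * (c k (\<sigma> - 1) - c k \<sigma>)" for k
    proof -
      have "c k \<sigma> \<le> (c k (\<sigma> + s) + s * c k (\<sigma> - 1)) / (s + 1)"
        using conv[of k] by (simp add: add_divide_distrib)
      then show ?thesis using s by (simp add: pos_le_divide_eq algebra_simps)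
    qed
    then have "(\<Sum>k\<le>n. - c k (\<sigma> + s)) \<le> (\<Sum>k\<le>n. - c k \<sigma> + s * (c k (\<sigma> - 1) - c k \<sigma>))"
      by (intro sum_mono)
    then show ?thesis
      by (simp add: G_def sum.distrib sum_negf sum_distrib_left[symmetric] sum_subtractf)
  qed
  have lim: "(\<lambda>n. exp (- G n x)) \<longlonglongrightarrow> cmod (Gamma (Complex x y)) / Gamma x" if "x > 0" for x
  proof -
    have "(\<lambda>n. cmod (Gamma_series (Complex x y) n) / Gamma_series x n) \<longlonglongrightarrow> cmod (Gamma (Complex x y)) / Gamma x"
      using less_imp_neq[OF Gamma_real_pos[OF that]] by (intro tendsto_intros Gamma_series_LIMSEQ) auto
    moreover have "\<forall>\<^sub>F n in sequentially. cmod (Gamma_series (Complex x y) n) / Gamma_series x n = exp (- G n x)"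
    proof (rule eventually_mono[OF eventually_gt_at_top[of 0]])
      fix n :: nat assume "n > 0"
      have "Gamma_series x n \<noteq> 0"
        using \<open>x > 0\<close> \<open>n > 0\<close> pochhammer_pos[of x "n+1"] by (simp add: Gamma_series_def)
      then show "cmod (Gamma_series (Complex x y) n) / Gamma_series x n = exp (- G n x)"
        by (simp add: ser[OF that])
    qed
    ultimately show ?thesis by (rule Lim_transform_eventually)
  qed
  have nz: "Complex (\<sigma> - 1) y \<notin> \<int>\<^sub>\<le>\<^sub>0"
    using s by (auto elim!: nonpos_Ints_cases simp: complex_eq_iff)
  have nzs: "Complex \<sigma> y \<notin> \<int>\<^sub>\<le>\<^sub>0"
    using s by (auto elim!: nonpos_Ints_cases simp: complex_eq_iff)
  have nzr: "\<sigma> - 1 \<notin> \<int>\<^sub>\<le>\<^sub>0" using s by (auto elim!: nonpos_Ints_cases)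
  have q: "(cmod (Gamma (Complex \<sigma> y)) / Gamma \<sigma>) / (cmod (Gamma (Complex (\<sigma>-1) y)) / Gamma (\<sigma>-1))
     = cmod (Complex (\<sigma> - 1) y) / (\<sigma> - 1)"
  proof -
    have "Complex \<sigma> y = Complex (\<sigma> - 1) y + 1" by (simp add: complex_eq_iff)
    then have 1: "Gamma (Complex \<sigma> y) = Complex (\<sigma> - 1) y * Gamma (Complex (\<sigma>-1) y)"
      using Gamma_plus1[OF nz] by simp
    have 2: "Gamma \<sigma> = (\<sigma> - 1) * Gamma (\<sigma> - 1)" using Gamma_plus1[OF nzr] by simp
    show ?thesis using Gamma_nonzero[OF nz] Gamma_nonzero[OF nzr] s
      by (simp add: 1 2 norm_mult field_simps)
  qed
  have "(\<lambda>n. exp (- G n \<sigma>) * (exp (- G n \<sigma>) / exp (- G n (\<sigma> - 1))) powr s) \<longlonglongrightarrow>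
      (cmod (Gamma (Complex \<sigma> y)) / Gamma \<sigma>) * ((cmod (Gamma (Complex \<sigma> y)) / Gamma \<sigma>) / (cmod (Gamma (Complex (\<sigma>-1) y)) / Gamma (\<sigma>-1))) powr s"
    using s Gamma_nonzero[OF nz] Gamma_nonzero[OF nzs] Gamma_nonzero[OF nzr] less_imp_neq[OF Gamma_real_pos[of \<sigma>]]
    by (intro tendsto_intros lim) (auto simp: q)
  moreover have "exp (- G n (\<sigma> + s)) \<le> exp (- G n \<sigma>) * (exp (- G n \<sigma>) / exp (- G n (\<sigma> - 1))) powr s" for n
    using conv'[of n] by (simp add: powr_def exp_add[symmetric] exp_diff[symmetric])
  ultimately have "cmod (Gamma (Complex (\<sigma> + s) y)) / Gamma (\<sigma> + s) \<le>
      (cmod (Gamma (Complex \<sigma> y)) / Gamma \<sigma>) * (cmod (Complex (\<sigma> - 1) y) / (\<sigma> - 1)) powr s"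
    using lim[of "\<sigma> + s"] s unfolding q by (intro LIMSEQ_le[of "\<lambda>n. exp (- G n (\<sigma> + s))"]) auto
  then show ?thesis using Gamma_real_pos[of "\<sigma>+s"] s by (simp add: field_simps)
qed

text \<open>On the line Re z = 1/2 the map z to 1 - z is complex conjugation, so the reflection
  formula evaluates the squared modulus exactly.\<close>

lemma norm_Gamma_half: "(cmod (Gamma (Complex (1/2) y)))\<^sup>2 = pi / cosh (pi * y)"
proof -
  have "Gamma (Complex (1/2) y) * Gamma (1 - Complex (1/2) y) = of_real pi / sin (of_real pi * Complex (1/2) y)"
    by (rule Gamma_reflection_complex)
  moreover have "1 - Complex (1/2) y = cnj (Complex (1/2) y)" by (simp add: complex_eq_iff)
  ultimately have "Gamma (Complex (1/2) y) * cnj (Gamma (Complex (1/2) y)) = of_real pi / sin (of_real pi * Complex (1/2) y)"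
    by (simp add: cnj_Gamma)
  moreover have "sin (of_real pi * Complex (1/2) y) = of_real (cosh (pi * y))"
  proof -
    have "of_real pi * Complex (1/2) y = Complex (pi/2) (pi * y)" by (simp add: complex_eq_iff)
    then show ?thesis by (simp add: complex_eq_iff Re_sin Im_sin cosh_def)
  qed
  ultimately have "complex_of_real ((cmod (Gamma (Complex (1/2) y)))\<^sup>2) = of_real (pi / cosh (pi * y))"
    by (simp only: complex_norm_square of_real_divide)
  then show ?thesis by (simp only: of_real_eq_iff)
qed

text \<open>Reflection again: \<Gamma>(1 - iy) is -iy times the conjugate of \<Gamma>(iy), by the
  functional equation.\<close>

lemma norm_Gamma_imaginary:
  assumes "y > 0"
  shows "(cmod (Gamma (\<i> * of_real y)))\<^sup>2 = pi / (y * sinh (pi * y))"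
proof -
  have nz: "- (\<i> * of_real y) \<notin> \<int>\<^sub>\<le>\<^sub>0"
    using assms by (auto elim!: nonpos_Ints_cases simp: complex_eq_iff)
  have "Gamma (\<i> * of_real y) * Gamma (1 - \<i> * of_real y) = of_real pi / sin (of_real pi * (\<i> * of_real y))"
    by (rule Gamma_reflection_complex)
  moreover have "Gamma (1 - \<i> * of_real y) = - (\<i> * of_real y) * cnj (Gamma (\<i> * of_real y))"
    using Gamma_plus1[OF nz] by (simp add: cnj_Gamma)
  moreover have "sin (of_real pi * (\<i> * of_real y)) = \<i> * of_real (sinh (pi * y))"
    by (simp add: complex_eq_iff Re_sin Im_sin sinh_def)
  ultimately have "- (\<i> * of_real y) * (Gamma (\<i> * of_real y) * cnj (Gamma (\<i> * of_real y))) = of_real pi / (\<i> * of_real (sinh (pi * y)))"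
    by (simp add: algebra_simps)
  then have "Gamma (\<i> * of_real y) * cnj (Gamma (\<i> * of_real y)) = of_real pi / (of_real y * of_real (sinh (pi * y)))"
    using assms by (simp add: field_simps)
  then have "complex_of_real ((cmod (Gamma (\<i> * of_real y)))\<^sup>2) = of_real (pi / (y * sinh (pi * y)))"
    by (simp only: complex_norm_square of_real_divide of_real_mult)
  then show ?thesis by (simp only: of_real_eq_iff)
qed

text \<open>The upper half of Stirling's estimate on vertical lines. The exact value on Re z = 1/2
  is carried to 3/2 by the functional equation, from there to the right by extrapolation, and back
  to x by the functional equation.\<close>

lemma norm_Gamma_bound:
  fixes x :: real
  assumes x: "x > 0"
  shows "\<exists>C>0. \<forall>y. (cmod (Gamma (Complex x y)))\<^sup>2 \<le> C * (1 + y\<^sup>2) powr (x - 1/2) / cosh (pi * y)"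
proof -
  \<comment> \<open>Extrapolation starts at 3/2 and ends at 3/2 + s = x + 2. Overshooting by 2
    covers also those x > 0 that lie to the left of 3/2; each of the two factors picked up on the
    way back is at least c times the square root of 1 + y^2.\<close>
  define s where "s = x + 1/2"
  define c where "c = min (1/2) x"
  have c: "c > 0" "c \<le> x" "c \<le> 1/2" using x by (auto simp: c_def)
  define C1 where "C1 = Gamma (x + 2) / Gamma (3/2) * 2 powr s"
  have C1: "C1 > 0" unfolding C1_def using x by (intro mult_pos_pos divide_pos_pos) auto
  define C where "C = C1\<^sup>2 * pi / c^4"
  have main: "(cmod (Gamma (Complex x y)))\<^sup>2 \<le> C * (1 + y\<^sup>2) powr (x - 1/2) / cosh (pi * y)" for y
  proof -
    define N where "N = 1 + y\<^sup>2"
    have N: "N \<ge> 1" by (simp add: N_def)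
    have nzh: "Complex (1/2) y \<notin> \<int>\<^sub>\<le>\<^sub>0" by (auto elim!: nonpos_Ints_cases simp: complex_eq_iff)
    have nz0: "Complex x y \<notin> \<int>\<^sub>\<le>\<^sub>0" using x by (auto elim!: nonpos_Ints_cases simp: complex_eq_iff)
    have nz1: "Complex (x+1) y \<notin> \<int>\<^sub>\<le>\<^sub>0" using x by (auto elim!: nonpos_Ints_cases simp: complex_eq_iff)
    have m1: "(cmod (Complex (1/2) y))\<^sup>2 \<le> N" by (simp add: cmod_power2 N_def power_divide)
    have m2: "c\<^sup>2 * N \<le> (cmod (Complex x y))\<^sup>2"
    proof -
      have "c\<^sup>2 \<le> x\<^sup>2" "c\<^sup>2 \<le> 1" using c by (auto simp: power_mono power_le_one)
      then have "c\<^sup>2 * y\<^sup>2 \<le> y\<^sup>2" by (simp add: mult_left_le_one_le)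
      then show ?thesis using \<open>c\<^sup>2 \<le> x\<^sup>2\<close> by (simp add: cmod_power2 N_def algebra_simps)
    qed
    have m3: "c\<^sup>2 * N \<le> (cmod (Complex (x+1) y))\<^sup>2"
    proof -
      have "x\<^sup>2 \<le> (x+1)\<^sup>2" using x by (intro power_mono) auto
      then show ?thesis using m2 by (simp add: cmod_power2)
    qed
    have e1: "Gamma (Complex (x+2) y) = Complex (x+1) y * (Complex x y * Gamma (Complex x y))"
    proof -
      have "Complex (x+2) y = Complex (x+1) y + 1" "Complex (x+1) y = Complex x y + 1"
        by (auto simp: complex_eq_iff)
      then show ?thesis using Gamma_plus1[OF nz0] Gamma_plus1[OF nz1] by simp
    qed
    have e2: "Gamma (Complex (3/2) y) = Complex (1/2) y * Gamma (Complex (1/2) y)"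
    proof -
      have "Complex (3/2) y = Complex (1/2) y + 1" by (auto simp: complex_eq_iff)
      then show ?thesis using Gamma_plus1[OF nzh] by simp
    qed
    have "cmod (Gamma (Complex (3/2 + s) y)) \<le> Gamma (3/2 + s) * (cmod (Gamma (Complex (3/2) y)) / Gamma (3/2)) *
        (cmod (Complex (3/2 - 1) y) / (3/2 - 1)) powr s"
      using x by (intro norm_Gamma_extrapolate) (auto simp: s_def)
    also have "3/2 + s = x + 2" by (simp add: s_def)
    also have "Gamma (x+2) * (cmod (Gamma (Complex (3/2) y)) / Gamma (3/2)) * (cmod (Complex (3/2 - 1) y) / (3/2 - 1)) powr s
       = C1 * cmod (Gamma (Complex (1/2) y)) * (cmod (Complex (1/2) y) powr (s + 1))"
      by (simp add: C1_def e2 norm_mult powr_mult powr_add)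
    finally have "(cmod (Gamma (Complex (x+2) y)))\<^sup>2 \<le> (C1 * cmod (Gamma (Complex (1/2) y)) * (cmod (Complex (1/2) y) powr (s + 1)))\<^sup>2"
      by (intro power_mono) auto
    also have "\<dots> = C1\<^sup>2 * (pi / cosh (pi * y)) * ((cmod (Complex (1/2) y))\<^sup>2) powr (s + 1)"
      by (simp add: power_mult_distrib norm_Gamma_half) (simp add: power2_eq_square powr_mult)
    also have "\<dots> \<le> C1\<^sup>2 * (pi / cosh (pi * y)) * N powr (s + 1)"
      using m1 x by (intro mult_left_mono powr_mono2) (auto simp: s_def)
    finally have 1: "(cmod (Gamma (Complex (x+2) y)))\<^sup>2 \<le> C1\<^sup>2 * (pi / cosh (pi * y)) * N powr (s + 1)" .
    have "(c\<^sup>2 * N) * (c\<^sup>2 * N) * (cmod (Gamma (Complex x y)))\<^sup>2 \<le> (cmod (Complex (x+1) y))\<^sup>2 * (cmod (Complex x y))\<^sup>2 * (cmod (Gamma (Complex x y)))\<^sup>2"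
      using m2 m3 N by (intro mult_right_mono mult_mono) auto
    also have "\<dots> = (cmod (Gamma (Complex (x+2) y)))\<^sup>2" by (simp add: e1 norm_mult power_mult_distrib)
    finally have "(c^4 * N\<^sup>2) * (cmod (Gamma (Complex x y)))\<^sup>2 \<le> C1\<^sup>2 * (pi / cosh (pi * y)) * N powr (s + 1)"
      using 1 by (simp add: power2_eq_square power4_eq_xxxx mult_ac)
    also have "N powr (s + 1) = N powr (x - 1/2) * N\<^sup>2"
      using N powr_add[of N "x - 1/2" 2] by (simp add: s_def)
    finally have "(cmod (Gamma (Complex x y)))\<^sup>2 * (c^4 * N\<^sup>2) \<le> (C1\<^sup>2 * pi * N powr (x - 1/2) / cosh (pi * y)) * N\<^sup>2"
      by (simp add: mult_ac)
    then have "(cmod (Gamma (Complex x y)))\<^sup>2 \<le> (C1\<^sup>2 * pi * N powr (x - 1/2) / cosh (pi * y)) / c^4"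
      using N c by (simp add: pos_le_divide_eq mult_ac)
    then show ?thesis by (simp add: C_def N_def mult_ac)
  qed
  have "C > 0" using C1 c by (simp add: C_def)
  then show ?thesis using main by blast
qed

lemma sinh_le_mult_cosh:
  fixes x :: real assumes "x \<ge> 0" shows "sinh x \<le> x * cosh x"
proof -
  have "(\<lambda>x. x * cosh x - sinh x) 0 \<le> (\<lambda>x. x * cosh x - sinh x) x"
    by (rule DERIV_nonneg_imp_nondecreasing[OF assms])
       (auto intro!: derivative_eq_intros exI mult_nonneg_nonneg)
  then show ?thesis by simp
qed

lemma tanh_le_self: "(x::real) \<ge> 0 \<Longrightarrow> tanh x \<le> x"
  using sinh_le_mult_cosh[of x] by (simp add: tanh_def field_simps)

text \<open>The leading orders of the Plancherel density: l^2 at 0, where \<Gamma>(il) in the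
  c-function has its pole, and l^(2a+1) at infinity.\<close>

definition jac_weight :: "real \<Rightarrow> real \<Rightarrow> real" where
  "jac_weight a l = (if l \<le> 1 then l\<^sup>2 else l powr (2 * a + 1))"

lemma jac_weight_pos: "l > 0 \<Longrightarrow> jac_weight a l > 0"
  by (simp add: jac_weight_def)

lemma jac_weight_measurable [measurable]: "jac_weight a \<in> borel_measurable borel"
  unfolding jac_weight_def by measurable

text \<open>The exponential factors cancel. The two Gamma functions in the denominator of c
  contribute 1 / cosh^2 (\<pi>l/2), and 1 / |\<Gamma>(il)|^2 contributes l sinh (\<pi>l) / \<pi>, so
  only l tanh (\<pi>l/2) and a power of 1 + l^2/4 with exponent \<open>x1 + x2 - 1 = a\<close>
  survive.\<close>

lemma jac_planch_le_weight:
  assumes ab: "b \<le> a" "-1/2 \<le> b" "a \<noteq> -1/2"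
  shows "\<exists>C>0. \<forall>l>0. jac_planch a b l \<le> C * jac_weight a l"
proof -
  define x1 where "x1 = jac_rho a b / 2"
  define x2 where "x2 = (a - b + 1) / 2"
  have x: "x1 > 0" "x2 > 0" "x1 + x2 - 1 = a" using ab by (auto simp: x1_def x2_def jac_rho_def field_simps)
  obtain C1 where C1: "C1 > 0" "\<And>y. (cmod (Gamma (Complex x1 y)))\<^sup>2 \<le> C1 * (1 + y\<^sup>2) powr (x1 - 1/2) / cosh (pi * y)"
    using norm_Gamma_bound[OF x(1)] by auto
  obtain C2 where C2: "C2 > 0" "\<And>y. (cmod (Gamma (Complex x2 y)))\<^sup>2 \<le> C2 * (1 + y\<^sup>2) powr (x2 - 1/2) / cosh (pi * y)"
    using norm_Gamma_bound[OF x(2)] by auto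
  define K where "K = (2 powr jac_rho a b * Gamma (a + 1))\<^sup>2"
  have "Gamma (a + 1) > 0" using ab by (intro Gamma_real_pos) auto
  then have K: "K > 0" by (simp add: K_def)
  define C where "C = C1 * C2 / K * (2 / pi) * (4 powr \<bar>a\<bar>) * (pi / 2)"
  have "C > 0" using C1 C2 K by (simp add: C_def)
  moreover have "jac_planch a b l \<le> C * jac_weight a l" if l: "l > 0" for l
  proof -
    define N where "N = 1 + (l/2)\<^sup>2"
    have N: "N \<ge> 1" by (simp add: N_def)
    have g1: "(\<i> * complex_of_real l + complex_of_real (jac_rho a b)) / 2 = Complex x1 (l/2)"
      by (simp add: complex_eq_iff x1_def)
    have g2: "(\<i> * complex_of_real l + complex_of_real (a - b + 1)) / 2 = Complex x2 (l/2)"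
      by (simp add: complex_eq_iff x2_def)
    have n2: "cmod (2 powr (complex_of_real (jac_rho a b) - \<i> * complex_of_real l)) = 2 powr jac_rho a b"
      using norm_powr_real_powr[of 2 "complex_of_real (jac_rho a b) - \<i> * complex_of_real l"] by simp
    have "cmod (Gamma (complex_of_real (a+1))) = Gamma (a + 1)"
      using \<open>Gamma (a + 1) > 0\<close> by (simp only: Gamma_complex_of_real norm_of_real)
    then have "(cmod (jac_c a b l))\<^sup>2 = K * (cmod (Gamma (\<i> * of_real l)))\<^sup>2 / ((cmod (Gamma (Complex x1 (l/2))))\<^sup>2 * (cmod (Gamma (Complex x2 (l/2))))\<^sup>2)"
      unfolding jac_c_def g1 g2 K_def
      by (simp add: norm_mult norm_divide n2 power_mult_distrib power_divide del: of_real_add)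
    then have "jac_planch a b l = (cmod (Gamma (Complex x1 (l/2))))\<^sup>2 * (cmod (Gamma (Complex x2 (l/2))))\<^sup>2 / (K * (pi / (l * sinh (pi * l))))"
      using norm_Gamma_imaginary[OF l] by (simp add: jac_planch_def)
    also have "\<dots> \<le> (C1 * N powr (x1 - 1/2) / cosh (pi * (l/2))) * (C2 * N powr (x2 - 1/2) / cosh (pi * (l/2))) / (K * (pi / (l * sinh (pi * l))))"
      unfolding N_def using l K C1 C2 sinh_real_pos_iff[of "pi * l"] by (intro divide_right_mono mult_mono C1(2) C2(2)) auto
    also have "\<dots> = C1 * C2 / K * N powr a * l * sinh (pi * l) / (pi * (cosh (pi * (l/2)))\<^sup>2)"
    proof -
      have "N powr a = N powr (x1 - 1/2) * N powr (x2 - 1/2)"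
        using x(3) by (simp add: powr_add[symmetric])
      then show ?thesis using K l by (simp add: field_simps power2_eq_square)
    qed
    also have "sinh (pi * l) = 2 * sinh (pi * (l/2)) * cosh (pi * (l/2))"
      using sinh_double[of "pi * (l/2)"] by simp
    also have "C1 * C2 / K * N powr a * l * (2 * sinh (pi * (l/2)) * cosh (pi * (l/2))) / (pi * (cosh (pi * (l/2)))\<^sup>2)
      = C1 * C2 / K * (2 / pi) * (N powr a * (l * tanh (pi * (l/2))))"
      by (simp add: tanh_def field_simps power2_eq_square)
    finally have 1: "jac_planch a b l \<le> C1 * C2 / K * (2 / pi) * (N powr a * (l * tanh (pi * (l/2))))" .
    \<comment> \<open>For l \<le> 1, N \<le> 2 and tanh t \<le> t give the order l^2. For l > 1,
      tanh is below 1 and N lies between l^2/4 and 4 l^2; the factor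
      \<open>4 powr \<bar>a\<bar>\<close> serves both signs of a.\<close>
    have 2: "N powr a * (l * tanh (pi * (l/2))) \<le> 4 powr \<bar>a\<bar> * (pi / 2) * jac_weight a l"
    proof (cases "l \<le> 1")
      case True
      have "l\<^sup>2 \<le> 1" using True l by (simp add: power_le_one)
      then have "N \<le> 2" by (simp add: N_def power_divide)
      have "N powr a \<le> N powr \<bar>a\<bar>" using N by (intro powr_mono) auto
      also have "\<dots> \<le> 4 powr \<bar>a\<bar>" using N \<open>N \<le> 2\<close> by (intro powr_mono2) auto
      finally have Na: "N powr a \<le> 4 powr \<bar>a\<bar>" .
      have "tanh (pi * (l/2)) \<le> pi * (l/2)" using l by (intro tanh_le_self) auto
      then have lt: "l * tanh (pi * (l/2)) \<le> pi / 2 * l\<^sup>2" using l by (simp add: power2_eq_square)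
      have "N powr a * (l * tanh (pi * (l/2))) \<le> 4 powr \<bar>a\<bar> * (pi / 2 * l\<^sup>2)"
        using l by (intro mult_mono[OF Na lt]) auto
      then show ?thesis using True by (simp add: jac_weight_def)
    next
      case False
      then have l1: "l > 1" by simp
      then have l2: "l\<^sup>2 \<ge> 1" by simp
      have N1: "N \<le> 4 * l\<^sup>2" "N \<ge> l\<^sup>2 / 4" using l2 by (auto simp: N_def power_divide)
      have l2p: "(l\<^sup>2) powr a = l powr (2 * a)" using powr_powr[of l 2 a] l by simp
      have Na: "N powr a \<le> 4 powr \<bar>a\<bar> * l powr (2 * a)"
      proof (cases "a \<ge> 0")
        case True
        then have "N powr a \<le> (4 * l\<^sup>2) powr a" using N N1 by (intro powr_mono2) auto
        then show ?thesis using True l1 by (simp add: powr_mult l2p)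
      next
        case False
        then have "N powr a \<le> (l\<^sup>2 / 4) powr a" using N N1 l by (intro powr_mono2') auto
        also have "\<dots> = 4 powr \<bar>a\<bar> * l powr (2 * a)"
        proof -
          have "(l\<^sup>2 / 4) powr a = l powr (2 * a) / 4 powr a" by (simp add: powr_divide l2p)
          moreover have "4 powr \<bar>a\<bar> = inverse (4 powr a)" using False powr_minus[of 4 a] by simp
          ultimately show ?thesis by (simp only: divide_inverse mult.commute)
        qed
        finally show ?thesis .
      qed
      have lt: "l * tanh (pi * (l/2)) \<le> l * (pi / 2)"
        using l tanh_real_lt_1[of "pi * (l/2)"] pi_ge_two by (intro mult_left_mono) auto
      have "N powr a * (l * tanh (pi * (l/2))) \<le> (4 powr \<bar>a\<bar> * l powr (2 * a)) * (l * (pi / 2))"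
        using l by (intro mult_mono[OF Na lt]) auto
      then show ?thesis using False l by (simp add: jac_weight_def powr_add mult_ac)
    qed
    have "jac_planch a b l \<le> C1 * C2 / K * (2 / pi) * (4 powr \<bar>a\<bar> * (pi / 2) * jac_weight a l)"
      using 1 mult_left_mono[OF 2, of "C1 * C2 / K * (2 / pi)"] C1 C2 K by simp
    then show ?thesis by (simp add: C_def mult_ac)
  qed
  ultimately show ?thesis by blast
qed

subsection \<open>The Jacobi functions\<close>

definition hyp_coeff :: "complex \<Rightarrow> complex \<Rightarrow> complex \<Rightarrow> nat \<Rightarrow> complex" where
  "hyp_coeff a b c n = pochhammer a n * pochhammer b n / (pochhammer c n * fact n)"

lemma hyp2F1_altdef: "hyp2F1 a b c z = (\<Sum>n. hyp_coeff a b c n * z ^ n)"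
  by (simp add: hyp2F1_def hyp_coeff_def)

lemma hyp_coeff_0 [simp]: "hyp_coeff a b c 0 = 1"
  by (simp add: hyp_coeff_def)

lemma hyp_coeff_Suc:
  assumes "c \<notin> \<int>\<^sub>\<le>\<^sub>0"
  shows "hyp_coeff a b c (Suc n) * ((c + of_nat n) * of_nat (Suc n)) = hyp_coeff a b c n * ((a + of_nat n) * (b + of_nat n))"
proof -
  have "c + of_nat n \<noteq> 0"
    using assms by (metis add.commute add_eq_0_iff minus_of_nat_in_nonpos_Ints)
  moreover have "pochhammer c n \<noteq> 0" using assms by (meson pochhammer_eq_0_imp_nonpos_Int)
  moreover have "of_nat (Suc n) \<noteq> (0::complex)" by (simp only: of_nat_eq_0_iff)
  ultimately show ?thesis
    by (simp add: hyp_coeff_def pochhammer_Suc fact_Suc divide_simps del: of_nat_Suc)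
qed

lemma hyp_coeff_summable:
  fixes z :: complex
  assumes c: "c \<notin> \<int>\<^sub>\<le>\<^sub>0" and z: "norm z < 1"
  shows "summable (\<lambda>n. hyp_coeff a b c n * z ^ n)"
proof -
  define q where "q n = (a + of_nat n) * (b + of_nat n) / ((c + of_nat n) * of_nat (Suc n))" for n
  have nz: "c + of_nat n \<noteq> 0" for n
    using c by (metis add.commute add_eq_0_iff minus_of_nat_in_nonpos_Ints)
  have lim: "(\<lambda>n. (d + of_nat n) / of_nat n) \<longlonglongrightarrow> 1" for d :: complex
  proof -
    have "(\<lambda>n. d / of_nat n + 1) \<longlonglongrightarrow> 0 + 1"
      by (intro tendsto_intros lim_const_over_n)
    moreover have "\<forall>\<^sub>F n in sequentially. d / of_nat n + 1 = (d + of_nat n) / of_nat n"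
      using eventually_gt_at_top[of 0] by eventually_elim (simp add: add_divide_distrib)
    ultimately show ?thesis using Lim_transform_eventually[of "\<lambda>n. d / of_nat n + 1" "0+1"] by simp
  qed
  have "(\<lambda>n. ((a + of_nat n) / of_nat n) * ((b + of_nat n) / of_nat n) / (((c + of_nat n) / of_nat n) * ((1 + of_nat n) / of_nat n))) \<longlonglongrightarrow> 1 * 1 / (1 * 1)"
    by (intro tendsto_intros lim) auto
  moreover have "\<forall>\<^sub>F n in sequentially. ((a + of_nat n) / of_nat n) * ((b + of_nat n) / of_nat n) / (((c + of_nat n) / of_nat n) * ((1 + of_nat n) / of_nat n)) = q n"
    using eventually_gt_at_top[of 0] by eventually_elim (simp add: q_def)
  ultimately have "q \<longlonglongrightarrow> 1"
    using Lim_transform_eventually by fastforce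
  then have "(\<lambda>n. norm (q n) * norm z) \<longlonglongrightarrow> norm (1::complex) * norm z"
    by (intro tendsto_intros)
  then have "\<forall>\<^sub>F n in sequentially. norm (q n) * norm z < (1 + norm z) / 2"
    using z by (intro order_tendstoD(2)[of _ "norm z"]) auto
  then obtain N where N: "\<And>n. n \<ge> N \<Longrightarrow> norm (q n) * norm z < (1 + norm z) / 2"
    by (auto simp: eventually_sequentially)
  have st: "hyp_coeff a b c (Suc n) = hyp_coeff a b c n * q n" for n
  proof -
    have "of_nat (Suc n) \<noteq> (0::complex)" by (simp only: of_nat_eq_0_iff)
    then show ?thesis using hyp_coeff_Suc[OF c, of a b n] nz[of n] by (simp add: q_def divide_simps del: of_nat_Suc)
  qed
  show ?thesis
  proof (rule summable_ratio_test[of "(1 + norm z) / 2" N])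
    show "(1 + norm z) / 2 < 1" using z by simp
    fix n assume "n \<ge> N"
    have "norm (hyp_coeff a b c (Suc n) * z ^ Suc n) = norm (q n) * norm z * norm (hyp_coeff a b c n * z ^ n)"
      by (simp add: st norm_mult)
    also have "\<dots> \<le> (1 + norm z) / 2 * norm (hyp_coeff a b c n * z ^ n)"
      using N[OF \<open>n \<ge> N\<close>] by (intro mult_right_mono) auto
    finally show "norm (hyp_coeff a b c (Suc n) * z ^ Suc n) \<le> (1 + norm z) / 2 * norm (hyp_coeff a b c n * z ^ n)" .
  qed
qed

definition hyp2F1' :: "complex \<Rightarrow> complex \<Rightarrow> complex \<Rightarrow> complex \<Rightarrow> complex" where
  "hyp2F1' a b c z = (\<Sum>n. diffs (hyp_coeff a b c) n * z ^ n)"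

definition hyp2F1'' :: "complex \<Rightarrow> complex \<Rightarrow> complex \<Rightarrow> complex \<Rightarrow> complex" where
  "hyp2F1'' a b c z = (\<Sum>n. diffs (diffs (hyp_coeff a b c)) n * z ^ n)"

lemma hyp2F1_deriv:
  assumes "c \<notin> \<int>\<^sub>\<le>\<^sub>0" "norm z < 1"
  shows "(hyp2F1 a b c has_field_derivative hyp2F1' a b c z) (at z)"
  using termdiffs_strong'[of 1 "hyp_coeff a b c" z] hyp_coeff_summable[OF assms(1)] assms(2)
  by (simp add: hyp2F1_altdef[abs_def] hyp2F1'_def)

lemma hyp2F1'_deriv:
  assumes "c \<notin> \<int>\<^sub>\<le>\<^sub>0" "norm z < 1"
  shows "(hyp2F1' a b c has_field_derivative hyp2F1'' a b c z) (at z)"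
  using termdiffs_strong'[of 1 "diffs (hyp_coeff a b c)" z] hyp_coeff_summable[OF assms(1)] assms(2)
    termdiff_converges[of _ 1 "hyp_coeff a b c"]
  by (simp add: hyp2F1'_def[abs_def] hyp2F1''_def)

text \<open>The recurrence \<open>hyp_coeff_Suc\<close> is this equation read off at z^n, since z
  d/dz multiplies the n-th coefficient by n.\<close>

lemma hyp2F1_ode:
  assumes c: "c \<notin> \<int>\<^sub>\<le>\<^sub>0" and z: "norm z < 1"
  shows "z * (1 - z) * hyp2F1'' a b c z = a * b * hyp2F1 a b c z - (c - (a + b + 1) * z) * hyp2F1' a b c z"
proof -
  define f where "f = hyp_coeff a b c"
  have sm: "norm x < 1 \<Longrightarrow> summable (\<lambda>n. f n * x ^ n)" for x
    unfolding f_def by (rule hyp_coeff_summable[OF c])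
  have sm1: "norm x < 1 \<Longrightarrow> summable (\<lambda>n. diffs f n * x ^ n)" for x
    by (rule termdiff_converges[OF _ sm]) auto
  have sm2: "norm x < 1 \<Longrightarrow> summable (\<lambda>n. diffs (diffs f) n * x ^ n)" for x
    by (rule termdiff_converges[OF _ sm1]) auto
  have F: "(\<lambda>n. f n * z ^ n) sums hyp2F1 a b c z"
    using summable_sums[OF sm[OF z]] by (simp add: hyp2F1_altdef f_def)
  have F1: "(\<lambda>n. diffs f n * z ^ n) sums hyp2F1' a b c z"
    using summable_sums[OF sm1[OF z]] by (simp add: hyp2F1'_def f_def)
  have F2: "(\<lambda>n. diffs (diffs f) n * z ^ n) sums hyp2F1'' a b c z"
    using summable_sums[OF sm2[OF z]] by (simp add: hyp2F1''_def f_def)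
  have zF1: "(\<lambda>n. of_nat n * f n * z ^ n) sums (z * hyp2F1' a b c z)"
  proof -
    have "(\<lambda>n. of_nat (Suc n) * f (Suc n) * z ^ Suc n) sums (z * hyp2F1' a b c z)"
      using sums_mult[OF F1, of z] by (simp add: diffs_def algebra_simps)
    then show ?thesis using sums_Suc[of "\<lambda>n. of_nat n * f n * z ^ n"] by simp
  qed
  have zF2: "(\<lambda>n. of_nat n * diffs f n * z ^ n) sums (z * hyp2F1'' a b c z)"
  proof -
    have "(\<lambda>n. of_nat (Suc n) * diffs f (Suc n) * z ^ Suc n) sums (z * hyp2F1'' a b c z)"
      using sums_mult[OF F2, of z] by (simp add: diffs_def[of "diffs f"] algebra_simps)
    then show ?thesis using sums_Suc[of "\<lambda>n. of_nat n * diffs f n * z ^ n"] by simp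
  qed
  have zzF2: "(\<lambda>n. of_nat n * (of_nat n - 1) * f n * z ^ n) sums (z * (z * hyp2F1'' a b c z))"
  proof -
    have "(\<lambda>n. of_nat (Suc n) * (of_nat (Suc n) - 1) * f (Suc n) * z ^ Suc n) sums (z * (z * hyp2F1'' a b c z))"
      using sums_mult[OF zF2, of z] by (simp add: diffs_def algebra_simps)
    then show ?thesis using sums_Suc[of "\<lambda>n. of_nat n * (of_nat n - 1) * f n * z ^ n"] by simp
  qed
  have "(\<lambda>n. (of_nat n * diffs f n * z ^ n - of_nat n * (of_nat n - 1) * f n * z ^ n)
        + (c * (diffs f n * z ^ n) - (a + b + 1) * (of_nat n * f n * z ^ n)) - a * b * (f n * z ^ n))
      sums ((z * hyp2F1'' a b c z - z * (z * hyp2F1'' a b c z)) + (c * hyp2F1' a b c z - (a + b + 1) * (z * hyp2F1' a b c z)) - a * b * hyp2F1 a b c z)"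
    by (intro sums_add sums_diff sums_mult zF2 zzF2 zF1 F1 F)
  moreover have "(of_nat n * diffs f n * z ^ n - of_nat n * (of_nat n - 1) * f n * z ^ n)
        + (c * (diffs f n * z ^ n) - (a + b + 1) * (of_nat n * f n * z ^ n)) - a * b * (f n * z ^ n) = 0" for n
  proof -
    have "(of_nat n * diffs f n * z ^ n - of_nat n * (of_nat n - 1) * f n * z ^ n)
        + (c * (diffs f n * z ^ n) - (a + b + 1) * (of_nat n * f n * z ^ n)) - a * b * (f n * z ^ n)
      = (f (Suc n) * ((c + of_nat n) * of_nat (Suc n)) - f n * ((a + of_nat n) * (b + of_nat n))) * z ^ n"
      by (simp add: diffs_def algebra_simps)
    then show ?thesis using hyp_coeff_Suc[OF c, of a b n] by (simp add: f_def)
  qed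
  ultimately have "(z * hyp2F1'' a b c z - z * (z * hyp2F1'' a b c z)) + (c * hyp2F1' a b c z - (a + b + 1) * (z * hyp2F1' a b c z)) - a * b * hyp2F1 a b c z = 0"
    using sums_unique2 sums_zero by fastforce
  then show ?thesis by (simp add: algebra_simps)
qed

lemma hyp2F1_0 [simp]: "hyp2F1 a b c 0 = 1"
  by (simp add: hyp2F1_altdef powser_zero)

lemma hyp2F1_terminating:
  "hyp2F1 (- of_nat n) b c z = (\<Sum>k\<le>n. hyp_coeff (- of_nat n) b c k * z ^ k)"
  unfolding hyp2F1_altdef
  by (rule suminf_finite) (auto simp: hyp_coeff_def pochhammer_of_nat_eq_0_iff)

section \<open>The Jacobi functions as solutions of the Jacobi differential equation\<close>

locale jacobi =
  fixes a b :: real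
  assumes b_le_a: "b \<le> a" and b_ge: "-1/2 \<le> b" and a_ne: "a \<noteq> -1/2"
begin

definition "\<rho> = jac_rho a b"
definition "A x = jac_A a b x"
text \<open>B is the logarithmic derivative A'/A, so the Jacobi operator is d^2/dx^2 + B d/dx;
  \<open>phi l\<close> is an eigenfunction with eigenvalue \<open>- eig l\<close>.\<close>

definition "B x = (2 * a + 1) / tanh x + (2 * b + 1) * tanh x"
definition "phi l x = jacobi_phi a b l x"
definition "eig l = l\<^sup>2 + (of_real \<rho>)\<^sup>2" for l :: complex

lemma a_gt: "2 * a + 1 > 0" using b_le_a b_ge a_ne by linarith
lemma b_ge': "2 * b + 1 \<ge> 0" using b_ge by linarith
lemma rho_eq: "\<rho> = a + b + 1" by (simp add: \<rho>_def jac_rho_def)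
lemma rho_pos: "\<rho> > 0" using b_le_a b_ge a_ne by (auto simp: rho_eq)

lemma A_def': "A x = 2 powr (2 * \<rho>) * sinh x powr (2 * a + 1) * cosh x powr (2 * b + 1)"
  by (simp add: A_def jac_A_def \<rho>_def)

lemma A_0 [simp]: "A 0 = 0" by (simp add: A_def')

lemma A_pos: "x > 0 \<Longrightarrow> A x > 0" by (simp add: A_def')

lemma A_nonneg: "A x \<ge> 0" by (simp add: A_def')

lemma A_measurable [measurable]: "A \<in> borel_measurable borel"
proof -
  have [measurable]: "(sinh :: real \<Rightarrow> real) \<in> borel_measurable borel" "(cosh :: real \<Rightarrow> real) \<in> borel_measurable borel"
    by (auto intro!: borel_measurable_continuous_onI continuous_intros)
  show ?thesis unfolding A_def'[abs_def] by measurable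
qed

lemma A_continuous: "continuous_on {0..} A"
  unfolding A_def'[abs_def] using a_gt b_ge'
  by (intro continuous_intros continuous_on_powr') auto

lemma A_deriv: "x > 0 \<Longrightarrow> (A has_real_derivative A x * B x) (at x)"
proof -
  assume x: "x > 0"
  have "(A has_real_derivative
     2 powr (2 * \<rho>) * ((2*a+1) * sinh x powr (2*a+1-1) * cosh x) * cosh x powr (2*b+1)
     + 2 powr (2 * \<rho>) * sinh x powr (2*a+1) * ((2*b+1) * cosh x powr (2*b+1-1) * sinh x)) (at x)"
  proof -
    have "((\<lambda>x. sinh x powr (2*a+1)) has_real_derivative (2*a+1) * sinh x powr (2*a+1-1) * cosh x) (at x)"
      using DERIV_fun_powr[of sinh "cosh x" x "2*a+1"] x by (auto intro!: derivative_eq_intros)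
    moreover have "((\<lambda>x. cosh x powr (2*b+1)) has_real_derivative (2*b+1) * cosh x powr (2*b+1-1) * sinh x) (at x)"
      using DERIV_fun_powr[of cosh "sinh x" x "2*b+1"] by (auto intro!: derivative_eq_intros)
    ultimately show ?thesis unfolding A_def'[abs_def]
      by (rule DERIV_cong[OF DERIV_mult[OF DERIV_cmult]]) (simp add: algebra_simps)
  qed
  moreover have "2 powr (2 * \<rho>) * ((2*a+1) * sinh x powr (2*a+1-1) * cosh x) * cosh x powr (2*b+1)
     + 2 powr (2 * \<rho>) * sinh x powr (2*a+1) * ((2*b+1) * cosh x powr (2*b+1-1) * sinh x) = A x * B x"
  proof -
    have "sinh x powr (2*a+1-1) = sinh x powr (2*a+1) / sinh x" "cosh x powr (2*b+1-1) = cosh x powr (2*b+1) / cosh x"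
      using x powr_diff[of "sinh x" "2*a+1" 1] powr_diff[of "cosh x" "2*b+1" 1] by auto
    then show ?thesis using x
      by (simp only: A_def' B_def tanh_def) (simp add: divide_simps algebra_simps)
  qed
  ultimately show ?thesis by simp
qed

lemma B_pos: "x > 0 \<Longrightarrow> B x > 0"
  using a_gt b_ge' by (auto simp: B_def intro!: add_pos_nonneg)

lemma B_deriv:
  assumes x: "x > 0"
  shows "(B has_real_derivative - ((2*a+1) / (sinh x)\<^sup>2) + (2*b+1) / (cosh x)\<^sup>2) (at x)"
proof -
  have "(B has_real_derivative - ((2*a+1) * (1 - (tanh x)\<^sup>2) / (tanh x)\<^sup>2) + (2*b+1) * (1 - (tanh x)\<^sup>2)) (at x)"
    unfolding B_def[abs_def] using x by (auto intro!: derivative_eq_intros simp: power2_eq_square)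
  moreover have "1 - (tanh x)\<^sup>2 = 1 / (cosh x)\<^sup>2"
  proof -
    have "1 - (tanh x)\<^sup>2 = ((cosh x)\<^sup>2 - (sinh x)\<^sup>2) / (cosh x)\<^sup>2"
      by (simp add: tanh_def power_divide diff_divide_distrib)
    then show ?thesis by (simp only: hyperbolic_pythagoras)
  qed
  ultimately show ?thesis by (simp add: tanh_def power_divide)
qed

text \<open>Rests on \<open>b \<le> a\<close> and sinh < cosh. This monotonicity supplies the sign
  of one boundary term in Green's identity, and with it the positivity of translation.\<close>

lemma B_antimono:
  assumes "0 < x" "x \<le> y" shows "B y \<le> B x"
proof (rule DERIV_nonpos_imp_nonincreasing[OF assms(2)])
  fix t assume "x \<le> t" "t \<le> y"
  then have t: "t > 0" using assms by simp
  have "(2*b+1) / (cosh t)\<^sup>2 \<le> (2*a+1) / (sinh t)\<^sup>2"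
    using t a_gt b_ge' b_le_a sinh_le_cosh_real[of t] by (intro frac_le power_mono) (auto intro!: zero_less_power)
  then show "\<exists>y. (B has_real_derivative y) (at t) \<and> y \<le> 0"
    using B_deriv[OF t] by (intro exI) (auto simp: )
qed

lemma A_mono: assumes "0 \<le> x" "x \<le> y" shows "A x \<le> A y"
  unfolding A_def' using assms a_gt b_ge' rho_pos
  by (intro mult_mono powr_mono2) (auto simp: cosh_real_nonneg_le_iff)

text \<open>The exponent m of cosh x in the Pfaff form. Both numerator parameters are affine in m,
  namely -m/2 and -b - m/2, so m carries the whole dependence on l; the series terminates when m is
  an even natural number.\<close>

definition "mexp l = \<i> * l - of_real \<rho>" for l :: complex
definition "phiF l = hyp2F1 (- mexp l / 2) (- of_real b - mexp l / 2) (of_real (a + 1))"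
definition "phiF' l = hyp2F1' (- mexp l / 2) (- of_real b - mexp l / 2) (of_real (a + 1))"
definition "phiF'' l = hyp2F1'' (- mexp l / 2) (- of_real b - mexp l / 2) (of_real (a + 1))"

definition "dphi l x = exp (mexp l * of_real (ln (cosh x))) * (mexp l * of_real (tanh x) * phiF l (of_real ((tanh x)\<^sup>2))
    + 2 * of_real (tanh x * (1 - (tanh x)\<^sup>2)) * phiF' l (of_real ((tanh x)\<^sup>2)))"

lemma phi_altdef: "phi l x = exp (mexp l * of_real (ln (cosh x))) * phiF l (of_real ((tanh x)\<^sup>2))"
proof -
  have "complex_of_real (cosh x) \<noteq> 0" by simp
  then have "complex_of_real (cosh x) powr (\<i> * l - complex_of_real (jac_rho a b)) = exp (mexp l * of_real (ln (cosh x)))"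
    by (simp add: powr_def mexp_def \<rho>_def Ln_of_real)
  moreover have "(complex_of_real (jac_rho a b) - \<i> * l) / 2 = - mexp l / 2"
    by (simp add: mexp_def \<rho>_def)
  moreover have "(complex_of_real (a - b + 1) - \<i> * l) / 2 = - of_real b - mexp l / 2"
    by (simp add: mexp_def \<rho>_def jac_rho_def field_simps)
  ultimately show ?thesis by (simp only: phi_def jacobi_phi_def phiF_def)
qed

lemma phi_0 [simp]: "phi l 0 = 1" by (simp add: phi_altdef phiF_def)
lemma dphi_0 [simp]: "dphi l 0 = 0" by (simp add: dphi_def)

lemma a1_not_nonpos: "complex_of_real (a + 1) \<notin> \<int>\<^sub>\<le>\<^sub>0"
proof
  assume "complex_of_real (a + 1) \<in> \<int>\<^sub>\<le>\<^sub>0"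
  then obtain n where "complex_of_real (a + 1) = - of_nat n" by (auto elim: nonpos_Ints_cases')
  then have "Re (complex_of_real (a + 1)) = Re (- of_nat n)" by metis
  then show False using a_gt by simp
qed

lemma tanh_sq_lt: "norm (complex_of_real ((tanh x)\<^sup>2)) < 1"
proof -
  have "\<bar>tanh x\<bar> < 1" using tanh_real_bounds[of x] by auto
  then show ?thesis by (simp add: norm_power abs_square_less_1)
qed

lemma tanh_sq_deriv:
  "((\<lambda>x. complex_of_real ((tanh x)\<^sup>2)) has_vector_derivative of_real (2 * tanh x * (1 - (tanh x)\<^sup>2))) (at x)"
  by (intro has_vector_derivative_of_real) (auto intro!: derivative_eq_intros simp: field_simps)

lemma phiF_deriv:
  "((\<lambda>x. phiF l (of_real ((tanh x)\<^sup>2))) has_vector_derivative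
     of_real (2 * tanh x * (1 - (tanh x)\<^sup>2)) * phiF' l (of_real ((tanh x)\<^sup>2))) (at x)"
  using field_vector_diff_chain_at[OF tanh_sq_deriv[of x], of "phiF l"]
    hyp2F1_deriv[OF a1_not_nonpos tanh_sq_lt] by (simp add: phiF_def phiF'_def o_def)

lemma phiF'_deriv:
  "((\<lambda>x. phiF' l (of_real ((tanh x)\<^sup>2))) has_vector_derivative
     of_real (2 * tanh x * (1 - (tanh x)\<^sup>2)) * phiF'' l (of_real ((tanh x)\<^sup>2))) (at x)"
  using field_vector_diff_chain_at[OF tanh_sq_deriv[of x], of "phiF' l"]
    hyp2F1'_deriv[OF a1_not_nonpos tanh_sq_lt] by (simp add: phiF'_def phiF''_def o_def)

lemma exp_cosh_deriv:
  "((\<lambda>x. exp (m * complex_of_real (ln (cosh x)))) has_vector_derivative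
      m * of_real (tanh x) * exp (m * of_real (ln (cosh x)))) (at x)"
proof -
  have "((\<lambda>x. ln (cosh x)) has_real_derivative tanh x) (at x)"
    by (auto intro!: derivative_eq_intros simp: tanh_def)
  then have "((\<lambda>x. m * of_real (ln (cosh x))) has_vector_derivative m * of_real (tanh x)) (at x)"
    by (intro has_vector_derivative_mult_right has_vector_derivative_of_real)
  then show ?thesis
    using field_vector_diff_chain_at[of _ _ x exp "exp (m * of_real (ln (cosh x)))"] by (auto simp: o_def)
qed

lemma phi_deriv: "(phi l has_vector_derivative dphi l x) (at x)"
proof -
  have "((\<lambda>x. exp (mexp l * of_real (ln (cosh x))) * phiF l (of_real ((tanh x)\<^sup>2))) has_vector_derivative
     exp (mexp l * of_real (ln (cosh x))) * (of_real (2 * tanh x * (1 - (tanh x)\<^sup>2)) * phiF' l (of_real ((tanh x)\<^sup>2)))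
     + mexp l * of_real (tanh x) * exp (mexp l * of_real (ln (cosh x))) * phiF l (of_real ((tanh x)\<^sup>2))) (at x)"
    by (intro has_vector_derivative_mult exp_cosh_deriv phiF_deriv)
  then show ?thesis unfolding phi_altdef[abs_def] dphi_def by (simp add: algebra_simps)
qed

text \<open>The Jacobi equation, for x > 0 since B is singular at 0. In the variable T^2 with T =
  tanh x, the second derivative of the series occurs as T^2 (1 - T^2) F'', which is what the
  hypergeometric equation evaluates.\<close>

lemma dphi_deriv:
  assumes x: "x > 0"
  shows "(dphi l has_vector_derivative - (eig l * phi l x) - of_real (B x) * dphi l x) (at x)"
proof -
  define E where "E = exp (mexp l * of_real (ln (cosh x)))"
  define T where "T = complex_of_real (tanh x)"
  define F where "F = phiF l (of_real ((tanh x)\<^sup>2))"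
  define F1 where "F1 = phiF' l (of_real ((tanh x)\<^sup>2))"
  define F2 where "F2 = phiF'' l (of_real ((tanh x)\<^sup>2))"
  define m where "m = mexp l"
  define D where "D = E * (m * T * (of_real (2 * tanh x * (1 - (tanh x)\<^sup>2)) * F1) + m * (1 - T\<^sup>2) * F
     + (2 * T * (1 - T\<^sup>2) * (of_real (2 * tanh x * (1 - (tanh x)\<^sup>2)) * F2)
     + 2 * ((1 - T\<^sup>2)\<^sup>2 - 2 * T\<^sup>2 * (1 - T\<^sup>2)) * F1 - 2 * 0)) 
     + m * T * E * (m * T * F + 2 * T * (1 - T\<^sup>2) * F1)"
  have t1: "((\<lambda>x. mexp l * complex_of_real (tanh x)) has_vector_derivative m * (1 - T\<^sup>2)) (at x)"
    unfolding m_def T_def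
    by (rule has_vector_derivative_mult_right, rule has_vector_derivative_of_real[THEN has_vector_derivative_eq_rhs])
       (auto intro!: derivative_eq_intros)
  have t2: "((\<lambda>x. 2 * complex_of_real (tanh x * (1 - (tanh x)\<^sup>2))) has_vector_derivative 2 * ((1 - T\<^sup>2)\<^sup>2 - 2 * T\<^sup>2 * (1 - T\<^sup>2))) (at x)"
  proof -
    have "((\<lambda>x. tanh x * (1 - (tanh x)\<^sup>2)) has_real_derivative
        tanh x * (- (2 * tanh x * (1 - (tanh x)\<^sup>2))) + (1 - (tanh x)\<^sup>2) * (1 - (tanh x)\<^sup>2)) (at x)"
      by (auto intro!: derivative_eq_intros)
    from has_vector_derivative_mult_right[OF has_vector_derivative_of_real[OF this], of 2]
    show ?thesis unfolding T_def
      by (rule has_vector_derivative_eq_rhs) (simp add: algebra_simps power2_eq_square)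
  qed
  have "(dphi l has_vector_derivative D) (at x)"
    unfolding dphi_def[abs_def]
    by (rule has_vector_derivative_eq_rhs,
        rule has_vector_derivative_mult[OF exp_cosh_deriv has_vector_derivative_add[OF
           has_vector_derivative_mult[OF t1 phiF_deriv] has_vector_derivative_mult[OF t2 phiF'_deriv]]])
       (simp add: D_def E_def F_def F1_def F2_def T_def m_def algebra_simps)
  moreover have "D = - (eig l * phi l x) - of_real (B x) * dphi l x"
  proof -
    have ode: "T\<^sup>2 * (1 - T\<^sup>2) * F2 = (- m / 2) * (- of_real b - m / 2) * F
       - (of_real (a + 1) - (- m / 2 + (- of_real b - m / 2) + 1) * T\<^sup>2) * F1"
      using hyp2F1_ode[OF a1_not_nonpos tanh_sq_lt, of x "- m / 2" "- of_real b - m / 2"]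
      by (simp add: F_def F1_def F2_def phiF_def phiF'_def phiF''_def T_def m_def)
    \<comment> \<open>The factor 4 clears the halves in the parameters -m/2 and -b - m/2.\<close>
    have ode: "4 * (T\<^sup>2 * (1 - T\<^sup>2) * F2) = m * (2 * of_real b + m) * F
       - (4 * of_real (a + 1) - 4 * (1 - m - of_real b) * T\<^sup>2) * F1"
      unfolding ode by (simp add: field_simps)
    have eig: "eig l = - m * (m + 2 * of_real \<rho>)"
      by (simp add: eig_def m_def mexp_def algebra_simps power2_eq_square)
    have Bx: "complex_of_real (B x) * T = of_real (2 * a + 1) + of_real (2 * b + 1) * T\<^sup>2"
      using x by (simp add: B_def T_def field_simps power2_eq_square)
    have ph: "phi l x = E * F" by (simp add: phi_altdef E_def F_def)
    have dph: "dphi l x = E * (T * (m * F + 2 * (1 - T\<^sup>2) * F1))"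
      by (simp add: dphi_def E_def F_def F1_def T_def m_def algebra_simps)
    have D1: "D = E * ((1 - T\<^sup>2) * (4 * (T\<^sup>2 * (1 - T\<^sup>2) * F2)) + 4 * m * T\<^sup>2 * (1 - T\<^sup>2) * F1 + m * (1 - T\<^sup>2) * F + 2 * ((1 - T\<^sup>2)\<^sup>2 - 2 * T\<^sup>2 * (1 - T\<^sup>2)) * F1 + m\<^sup>2 * T\<^sup>2 * F)"
      by (simp add: D_def T_def[symmetric]) (simp add: algebra_simps power2_eq_square)
    have "of_real (B x) * dphi l x = E * ((of_real (B x) * T) * (m * F + 2 * (1 - T\<^sup>2) * F1))"
      by (simp add: dph algebra_simps)
    then show ?thesis unfolding D1 ode Bx eig ph
      by (simp add: rho_eq) (simp add: algebra_simps power2_eq_square)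
  qed
  ultimately show ?thesis by simp
qed

lemma phi_continuous [continuous_intros]: "continuous_on S (phi l)"
  by (rule continuous_at_imp_continuous_on) (use phi_deriv has_vector_derivative_continuous in blast)

lemma dphi_continuous [continuous_intros]: "continuous_on S (dphi l)"
proof -
  have 1: "continuous_on UNIV (\<lambda>x. phiF l (of_real ((tanh x)\<^sup>2)))" "continuous_on UNIV (\<lambda>x. phiF' l (of_real ((tanh x)\<^sup>2)))"
    using phiF_deriv phiF'_deriv has_vector_derivative_continuous
    by (intro continuous_at_imp_continuous_on ballI; blast)+
  have "continuous_on UNIV (dphi l)"
    unfolding dphi_def[abs_def] by (intro continuous_intros 1) auto
  then show ?thesis by (rule continuous_on_subset) auto
qed

text \<open>The self-adjoint form (A phi')' = - eig A phi. It has no singular coefficient at 0,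
  where A phi' vanishes.\<close>

lemma A_dphi_deriv:
  assumes "x > 0"
  shows "((\<lambda>x. of_real (A x) * dphi l x) has_vector_derivative - (eig l * (of_real (A x) * phi l x))) (at x)"
  using has_vector_derivative_mult[OF has_vector_derivative_of_real[OF A_deriv[OF assms]] dphi_deriv[OF assms]]
  by (simp add: algebra_simps)

text \<open>Unfolded to the series, with the Pochhammer symbols as finite products, the function is
  a limit of jointly measurable terms. This gives measurability of transforms in l.\<close>

lemma phi_measurable_pair [measurable]:
  "(\<lambda>(l, x). phi (complex_of_real l) x) \<in> borel_measurable (borel \<Otimes>\<^sub>M borel)"
proof -
  have [measurable]: "(tanh :: real \<Rightarrow> real) \<in> borel_measurable borel" "(cosh :: real \<Rightarrow> real) \<in> borel_measurable borel"
    by (auto intro!: borel_measurable_continuous_onI continuous_intros)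
  show ?thesis
    unfolding phi_altdef phiF_def hyp2F1_def pochhammer_prod mexp_def split_beta by measurable
qed

text \<open>Here m = 0 and the series stops at its first term. That the constant 1 is a Jacobi
  function makes constants available in the span and later yields invariance of A dx.\<close>

lemma phi_one: "phi (- \<i> * of_real \<rho>) x = 1"
proof -
  have "mexp (- \<i> * of_real \<rho>) = 0" by (simp add: mexp_def)
  then have "phi (- \<i> * of_real \<rho>) x = hyp2F1 (- of_nat 0) (- of_real b) (of_real (a + 1)) (of_real ((tanh x)\<^sup>2))"
    by (simp add: phi_altdef phiF_def)
  then show ?thesis unfolding hyp2F1_terminating by simp
qed

text \<open>Here m = 2n and the series stops at n; up to normalisation these are the Jacobi
  polynomials. The exact degree n matters, as it lets them generate all polynomials in sinh^2; no
  cancellation occurs in the top coefficient because all coefficients \<open>c k\<close> are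
  positive.\<close>

lemma phi_poly:
  "\<exists>p :: real poly. degree p = n \<and> (\<forall>x. phi (- \<i> * of_real (\<rho> + 2 * real n)) x = of_real (poly p ((sinh x)\<^sup>2)))"
proof -
  define l where "l = - \<i> * complex_of_real (\<rho> + 2 * real n)"
  have m: "mexp l = of_nat (2 * n)" by (simp add: mexp_def l_def algebra_simps)
  define c where "c k = pochhammer (- real n) k * pochhammer (- b - real n) k / (pochhammer (a + 1) k * fact k)" for k
  have cc: "hyp_coeff (- of_nat n) (- of_real b - of_nat n) (of_real (a + 1)) k = of_real (c k)" for k
    unfolding hyp_coeff_def c_def
    by (simp only: of_real_divide of_real_mult pochhammer_of_real[symmetric] of_real_fact of_real_minus of_real_diff of_real_of_nat_eq)
  \<comment> \<open>Each of the two Pochhammer symbols of negative numbers carries the sign (-1)^k;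
    the signs cancel. The factor b + n - i is at least b + 1 > 0 for i < n.\<close>
  have cpos: "c k > 0" if "k \<le> n" for k
  proof -
    have 1: "pochhammer (- real n) k = (-1)^k * (\<Prod>i=0..<k. real n - real i)"
      by (induction k) (auto simp: pochhammer_Suc algebra_simps)
    have 2: "pochhammer (- b - real n) k = (-1)^k * (\<Prod>i=0..<k. b + real n - real i)"
      by (induction k) (auto simp: pochhammer_Suc algebra_simps)
    have 3: "(\<Prod>i=0..<k. real n - real i) > 0" using that by (intro prod_pos) auto
    have 4: "(\<Prod>i=0..<k. b + real n - real i) > 0"
    proof (intro prod_pos ballI)
      fix i assume "i \<in> {0..<k}"
      then have "real i + 1 \<le> real n" using that by auto
      then show "b + real n - real i > 0" using b_ge by linarith
    qed
    have 5: "pochhammer (a + 1) k > 0" using a_gt by (intro pochhammer_pos) auto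
    have "c k = ((-1)^k * (-1)^k) * ((\<Prod>i=0..<k. real n - real i) * (\<Prod>i=0..<k. b + real n - real i)) / (pochhammer (a + 1) k * fact k)"
      by (simp add: c_def 1 2)
    then show ?thesis using 3 4 5 by (simp add: power_mult_distrib[symmetric])
  qed
  \<comment> \<open>With s = sinh^2 x, the product cosh^(2n) x tanh^(2k) x equals s^k
    (1+s)^(n-k).\<close>
  define p where "p = (\<Sum>k\<le>n. smult (c k) ([:0,1:] ^ k * [:1,1:] ^ (n - k)))"
  have px: "poly p s = (\<Sum>k\<le>n. c k * (s ^ k * (1 + s) ^ (n - k)))" for s
    by (simp add: p_def poly_sum)
  have deg_le: "degree p \<le> n"
    unfolding p_def
  proof (rule degree_sum_le)
    fix k assume "k \<in> {..n}"
    have "degree ([:0,1:] ^ k * [:1,1:] ^ (n - k) :: real poly) \<le> degree ([:0,1:] ^ k :: real poly) + degree ([:1,1:] ^ (n - k) :: real poly)"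
      by (rule degree_mult_le)
    also have "\<dots> \<le> n" using \<open>k \<in> {..n}\<close> by (simp add: degree_power_eq)
    finally show "degree (smult (c k) ([:0,1:] ^ k * [:1,1:] ^ (n - k))) \<le> n"
      using degree_smult_le order_trans by blast
  qed simp
  have "coeff p n > 0"
  proof -
    have "coeff ([:0,1:] ^ k * [:1,1:] ^ (n - k) :: real poly) n = 1" if "k \<le> n" for k
    proof -
      have d: "degree ([:0,1:] ^ k * [:1,1:] ^ (n - k) :: real poly) = n"
        using that by (subst degree_mult_eq) (auto simp: degree_power_eq)
      have "lead_coeff ([:0,1:] ^ k * [:1,1:] ^ (n - k) :: real poly) = 1"
        by (simp add: lead_coeff_mult lead_coeff_power)
      then show ?thesis using d by simp
    qed
    then have "coeff p n = (\<Sum>k\<le>n. c k)" by (simp add: p_def coeff_sum)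
    then show ?thesis using cpos by (auto intro!: sum_pos)
  qed
  then have "degree p = n" using deg_le le_degree[of p n] by simp
  moreover have "phi l x = of_real (poly p ((sinh x)\<^sup>2))" for x
  proof -
    have e: "exp (mexp l * of_real (ln (cosh x))) = of_real ((cosh x) ^ (2 * n))"
      by (simp only: m exp_of_nat_mult exp_of_real of_real_power) simp
    have F: "phiF l (of_real ((tanh x)\<^sup>2)) = of_real (\<Sum>k\<le>n. c k * ((tanh x)\<^sup>2) ^ k)"
    proof -
      have "phiF l (of_real ((tanh x)\<^sup>2)) = hyp2F1 (- of_nat n) (- of_real b - of_nat n) (of_real (a + 1)) (of_real ((tanh x)\<^sup>2))"
        unfolding phiF_def m by simp
      also have "\<dots> = (\<Sum>k\<le>n. of_real (c k) * (of_real ((tanh x)\<^sup>2)) ^ k)"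
        unfolding hyp2F1_terminating cc ..
      finally show ?thesis by simp
    qed
    have "phi l x = of_real ((cosh x) ^ (2 * n) * (\<Sum>k\<le>n. c k * ((tanh x)\<^sup>2) ^ k))"
      by (simp only: phi_altdef e F of_real_mult)
    moreover have "(cosh x) ^ (2 * n) * (\<Sum>k\<le>n. c k * ((tanh x)\<^sup>2) ^ k) = poly p ((sinh x)\<^sup>2)"
      unfolding px sum_distrib_left
    proof (intro sum.cong refl)
      fix k assume "k \<in> {..n}"
      then have n: "n = k + (n - k)" by simp
      have c1: "(cosh x) ^ (2 * n) = ((cosh x)\<^sup>2) ^ k * ((cosh x)\<^sup>2) ^ (n - k)"
        by (subst n) (simp only: power_mult power_add)
      have c2: "((cosh x)\<^sup>2) ^ k * ((tanh x)\<^sup>2) ^ k = ((sinh x)\<^sup>2) ^ k"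
        by (simp add: power_mult_distrib[symmetric] tanh_def)
      have c3: "(cosh x)\<^sup>2 = 1 + (sinh x)\<^sup>2" by (simp add: cosh_square_eq)
      have "cosh x ^ (2 * n) * (c k * (tanh x)\<^sup>2 ^ k) = c k * ((((cosh x)\<^sup>2) ^ k * ((tanh x)\<^sup>2) ^ k) * ((cosh x)\<^sup>2) ^ (n - k))"
        unfolding c1 by (simp only: mult_ac)
      then show "cosh x ^ (2 * n) * (c k * (tanh x)\<^sup>2 ^ k) = c k * ((sinh x)\<^sup>2 ^ k * (1 + (sinh x)\<^sup>2) ^ (n - k))"
        by (simp only: c2 c3[symmetric])
    qed
    ultimately show ?thesis by simp
  qed
  ultimately show ?thesis unfolding l_def by blast
qed

end

subsection \<open>Bounds and asymptotics of the Jacobi functions\<close>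

text \<open>f exp(-g) is nonincreasing. Derivatives are asked for in the open interval only, since
  the lemma is also applied from 0, where B is singular.\<close>

lemma gronwall:
  fixes f g f' g' :: "real \<Rightarrow> real"
  assumes st: "s \<le> t" and cf: "continuous_on {s..t} f" and cg: "continuous_on {s..t} g"
    and df: "\<And>x. s < x \<Longrightarrow> x < t \<Longrightarrow> (f has_real_derivative f' x) (at x)"
    and dg: "\<And>x. s < x \<Longrightarrow> x < t \<Longrightarrow> (g has_real_derivative g' x) (at x)"
    and le: "\<And>x. s < x \<Longrightarrow> x < t \<Longrightarrow> f' x \<le> g' x * f x"
  shows "f t \<le> f s * exp (g t - g s)"
proof -
  have "(\<lambda>x. f x * exp (- g x)) t \<le> (\<lambda>x. f x * exp (- g x)) s"
  proof (rule DERIV_nonpos_imp_decreasing_open[OF st])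
    fix x assume x: "s < x" "x < t"
    have "((\<lambda>x. f x * exp (- g x)) has_real_derivative f' x * exp (- g x) + exp (- g x) * (- g' x) * f x) (at x)"
      by (intro DERIV_mult df[OF x] DERIV_fun_exp DERIV_minus dg[OF x])
    moreover have "f' x * exp (- g x) + exp (- g x) * (- g' x) * f x = exp (- g x) * (f' x - g' x * f x)"
      by (simp add: algebra_simps)
    moreover have "\<dots> \<le> 0" using le[OF x] by (intro mult_nonneg_nonpos) auto
    ultimately show "\<exists>y. ((\<lambda>x. f x * exp (- g x)) has_real_derivative y) (at x) \<and> y \<le> 0" by metis
  qed (intro continuous_intros cf cg)
  then show ?thesis by (simp add: exp_minus exp_diff field_simps)
qed

lemma norm_sq_deriv:
  fixes f :: "real \<Rightarrow> complex"
  assumes "(f has_vector_derivative f') (at x)"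
  shows "((\<lambda>x. (cmod (f x))\<^sup>2) has_real_derivative 2 * (f x \<bullet> f')) (at x)"
  using bounded_bilinear.has_vector_derivative[OF bounded_bilinear_inner assms assms]
  by (simp add: has_real_derivative_iff_has_vector_derivative power2_norm_eq_inner inner_commute)

text \<open>Serves to extract the amplitudes of the solutions at infinity together with the rate of
  convergence.\<close>

lemma cauchy_inverse_limit:
  fixes f :: "real \<Rightarrow> complex"
  assumes x0: "x0 > 0" and K: "K \<ge> 0"
    and le: "\<And>x y. x0 \<le> x \<Longrightarrow> x \<le> y \<Longrightarrow> cmod (f y - f x) \<le> K * (1 / x - 1 / y)"
  obtains L where "\<And>x. x0 \<le> x \<Longrightarrow> cmod (f x - L) \<le> K / x"
proof -
  have le': "cmod (f y - f x) \<le> K / x" if "x0 \<le> x" "x \<le> y" for x y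
  proof -
    have "K * (1 / x - 1 / y) \<le> K * (1 / x)" using that x0 K by (intro mult_left_mono) auto
    then show ?thesis using le[OF that] by simp
  qed
  have lim0: "((\<lambda>x. K / x) \<longlongrightarrow> 0) at_top" by real_asymp
  have "Cauchy (\<lambda>n. f (real n))"
  proof (rule CauchyI')
    fix e :: real assume "e > 0"
    have "\<forall>\<^sub>F x in at_top. K / x < e" by (rule order_tendstoD(2)[OF lim0 \<open>e > 0\<close>])
    then have "\<forall>\<^sub>F n in sequentially. K / real n < e"
      by (rule eventually_compose_filterlim[OF _ filterlim_real_sequentially])
    then obtain M where M: "\<And>n. n \<ge> M \<Longrightarrow> K / real n < e" by (auto simp: eventually_sequentially)
    obtain M' where M': "x0 \<le> real M'" by (meson real_arch_simple)
    show "\<exists>M. \<forall>m\<ge>M. \<forall>n>m. dist (f (real m)) (f (real n)) < e"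
    proof (intro exI allI impI)
      fix m n assume "max M M' \<le> m" "m < n"
      then have m: "x0 \<le> real m" "real m \<le> real n" "M \<le> m" using M' by auto
      show "dist (f (real m)) (f (real n)) < e"
        using le'[OF m(1,2)] M[OF m(3)] by (simp add: dist_norm norm_minus_commute)
    qed
  qed
  then obtain L where L: "(\<lambda>n. f (real n)) \<longlonglongrightarrow> L" using Cauchy_convergent_iff convergent_def by blast
  show ?thesis
  proof (rule that[of L])
    fix x assume x: "x0 \<le> x"
    have "(\<lambda>n. cmod (f (real n) - f x)) \<longlonglongrightarrow> cmod (L - f x)" by (intro tendsto_intros L)
    moreover have "\<forall>\<^sub>F n in sequentially. cmod (f (real n) - f x) \<le> K / x"
    proof -
      obtain N where "x \<le> real N" by (meson real_arch_simple)
      then show ?thesis by (intro eventually_sequentiallyI[of N] le'[OF x]) auto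
    qed
    ultimately have "cmod (L - f x) \<le> K / x" by (rule tendsto_upperbound) simp
    then show "cmod (f x - L) \<le> K / x" by (simp add: norm_minus_commute)
  qed
qed

section \<open>Energy of the Jacobi equation and bounds for \<open>phi\<close> at real spectral
  parameters\<close>

context jacobi begin

definition "k2 l = l\<^sup>2 + \<rho>\<^sup>2" for l :: real

lemma k2_pos: "k2 l > 0" using rho_pos by (simp add: k2_def add_nonneg_pos)

lemma eig_real: "eig (of_real l) = of_real (k2 l)" by (simp add: eig_def k2_def)

text \<open>The energy of phi'' + B phi' + k2 phi = 0. As B > 0 acts as friction, it decreases from
  its initial value \<open>k2 l\<close>, which yields |phi| \<le> 1 and |phi'| \<le> sqrt k2 at
  once.\<close>

definition "en l x = k2 l * (cmod (phi (of_real l) x))\<^sup>2 + (cmod (dphi (of_real l) x))\<^sup>2"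

lemma en_continuous: "continuous_on S (en l)"
  unfolding en_def[abs_def] by (intro continuous_intros)

lemma en_deriv:
  assumes "x > 0"
  shows "(en l has_real_derivative - (2 * B x * (cmod (dphi (of_real l) x))\<^sup>2)) (at x)"
proof -
  have "(en l has_real_derivative k2 l * (2 * (phi (of_real l) x \<bullet> dphi (of_real l) x))
      + 2 * (dphi (of_real l) x \<bullet> (- (eig (of_real l) * phi (of_real l) x) - of_real (B x) * dphi (of_real l) x))) (at x)"
    unfolding en_def[abs_def] by (intro DERIV_add DERIV_cmult norm_sq_deriv phi_deriv dphi_deriv assms)
  moreover have "of_real r * z = r *\<^sub>R z" for r and z :: complex by (simp add: scaleR_conv_of_real)
  ultimately show ?thesis
    by (simp add: eig_real inner_diff_right inner_commute power2_norm_eq_inner algebra_simps)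
qed

lemma en_antimono:
  assumes "0 \<le> s" "s \<le> t" shows "en l t \<le> en l s"
proof (rule DERIV_nonpos_imp_decreasing_open[OF assms(2)])
  fix x assume "s < x" "x < t"
  then have x: "x > 0" using assms by simp
  show "\<exists>y. (en l has_real_derivative y) (at x) \<and> y \<le> 0"
    using en_deriv[OF x, of l] B_pos[OF x] by (intro exI conjI) auto
qed (rule en_continuous)

lemma en_0: "en l 0 = k2 l" by (simp add: en_def)

lemma phi_le_1: assumes "x \<ge> 0" shows "cmod (phi (of_real l) x) \<le> 1"
proof -
  have "k2 l * (cmod (phi (of_real l) x))\<^sup>2 \<le> k2 l * 1"
    using en_antimono[of 0 x l, OF _ assms] zero_le_power2[of "cmod (dphi (of_real l) x)"]
    unfolding en_0 unfolding en_def by linarith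
  then have "(cmod (phi (of_real l) x))\<^sup>2 \<le> 1\<^sup>2" using k2_pos[of l] by simp
  then show ?thesis by (rule power2_le_imp_le) simp
qed

lemma dphi_le: assumes "x \<ge> 0" shows "cmod (dphi (of_real l) x) \<le> sqrt (k2 l)"
proof -
  have "(cmod (dphi (of_real l) x))\<^sup>2 \<le> k2 l"
    using en_antimono[of 0 x l, OF _ assms] mult_nonneg_nonneg[OF less_imp_le[OF k2_pos[of l]] zero_le_power2[of "cmod (phi (of_real l) x)"]]
    unfolding en_0 unfolding en_def by linarith
  then show ?thesis by (rule real_le_rsqrt)
qed

text \<open>A behaves like a power of sinh near 0, and on a bounded range sinh t is comparable with
  sinh (t/2).\<close>

lemma A_half:
  assumes "X > 0"
  shows "\<exists>c>0. \<forall>t. 0 < t \<and> t \<le> X \<longrightarrow> c * A t \<le> A (t / 2)"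
proof -
  define c where "c = (1 / (2 * cosh X)) powr (2 * a + 1) * (1 / cosh X) powr (2 * b + 1)"
  have "c > 0" by (simp add: c_def)
  moreover have "c * A t \<le> A (t / 2)" if t: "0 < t" "t \<le> X" for t
  proof -
    have ch: "cosh t \<le> cosh X" using t by (simp add: cosh_real_nonneg_le_iff)
    have "sinh t \<le> t * cosh X"
      using sinh_le_mult_cosh[of t] t ch by (meson less_imp_le mult_left_mono order_trans)
    also have "\<dots> \<le> (2 * sinh (t/2)) * cosh X"
      using real_le_x_sinh[of "t/2"] t by (intro mult_right_mono) (auto simp: sinh_field_def exp_minus)
    finally have 1: "1 / (2 * cosh X) * sinh t \<le> sinh (t / 2)" by (simp add: field_simps)
    have 2: "1 / cosh X * cosh t \<le> cosh (t / 2)"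
    proof -
      have "1 / cosh X * cosh t \<le> 1" using ch by simp
      then show ?thesis using cosh_real_ge_1[of "t/2"] by linarith
    qed
    have "c * A t = 2 powr (2 * \<rho>) * (1 / (2 * cosh X) * sinh t) powr (2 * a + 1) * (1 / cosh X * cosh t) powr (2 * b + 1)"
      using t unfolding c_def A_def' by (subst (1 2) powr_mult) (auto simp: mult_ac)
    also have "\<dots> \<le> 2 powr (2 * \<rho>) * sinh (t/2) powr (2 * a + 1) * cosh (t/2) powr (2 * b + 1)"
      using 1 2 t a_gt b_ge' by (intro mult_mono order_refl powr_mono2) auto
    finally show ?thesis by (simp add: A_def')
  qed
  ultimately show ?thesis by blast
qed

lemma B_ge: assumes "t > 0" shows "(2 * a + 1) / t \<le> B t"
proof -
  have "(2 * a + 1) / t \<le> (2 * a + 1) / tanh t"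
    using tanh_le_self[of t] assms a_gt by (intro divide_left_mono) auto
  then show ?thesis using b_ge' assms by (simp add: B_def add_increasing2)
qed

text \<open>Friction made quantitative and uniform in l: up to the time \<tau> = 1/(2 sqrt k2) the
  real part of phi stays above 1/2, so |phi'| grows at least linearly and a fixed fraction of the
  energy is lost by then. The hypothesis \<open>sqrt (k2 l) * x \<ge> 1/2\<close> says x \<ge>
  \<tau>, and the loss persists because the energy decreases.\<close>

lemma phi_away_from_one:
  "\<exists>\<eta><1. \<eta> \<ge> 0 \<and> (\<forall>l x. x > 0 \<longrightarrow> sqrt (k2 l) * x \<ge> 1/2 \<longrightarrow> cmod (phi (of_real l) x) \<le> \<eta>)"
proof -
  define X where "X = 1 / (2 * \<rho>)"
  have X: "X > 0" using rho_pos by (simp add: X_def)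
  obtain c1 where c1: "c1 > 0" "\<And>t. 0 < t \<Longrightarrow> t \<le> X \<Longrightarrow> c1 * A t \<le> A (t / 2)"
    using A_half[OF X] by auto
  define c2 where "c2 = (2 * a + 1) * c1\<^sup>2 / 8"
  have c2: "c2 > 0" using a_gt c1 by (simp add: c2_def)
  define \<eta> where "\<eta> = sqrt (max 0 (1 - c2 / 8))"
  have "cmod (phi (of_real l) x) \<le> \<eta>" if x: "x > 0" "sqrt (k2 l) * x \<ge> 1/2" for l x
  proof -
    define \<kappa> where "\<kappa> = sqrt (k2 l)"
    have k: "\<kappa> > 0" "\<kappa>\<^sup>2 = k2 l" using k2_pos[of l] by (auto simp: \<kappa>_def)
    have "\<rho>\<^sup>2 \<le> k2 l" by (simp add: k2_def)
    then have k\<rho>: "\<rho> \<le> \<kappa>" by (auto simp: \<kappa>_def intro: real_le_rsqrt)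
    \<comment> \<open>As \<kappa> \<ge> \<rho>, the time \<tau> never exceeds X = 1/(2\<rho>), the
      range on which \<open>A_half\<close> provided one constant for all l.\<close>
    define \<tau> where "\<tau> = 1 / (2 * \<kappa>)"
    have \<tau>: "\<tau> > 0" "\<tau> \<le> X" using k k\<rho> rho_pos by (auto simp: \<tau>_def X_def frac_le)
    have re: "Re (phi (of_real l) s) \<ge> 1/2" if "0 \<le> s" "s \<le> \<tau>" for s
    proof (cases "s = 0")
      case False
      then have s: "0 < s" using that by simp
      have "cmod (phi (of_real l) s - phi (of_real l) 0) \<le> \<kappa> * s - \<kappa> * 0"
      proof (rule differentiable_bound_general[where f' = "dphi (of_real l)" and \<phi>' = "\<lambda>_. \<kappa>", OF s])
        show "\<And>x. ((*) \<kappa> has_vector_derivative \<kappa>) (at x)"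
          unfolding has_real_derivative_iff_has_vector_derivative[symmetric]
          by (auto intro!: derivative_eq_intros)
        show "\<And>x. 0 < x \<Longrightarrow> x < s \<Longrightarrow> cmod (dphi (of_real l) x) \<le> \<kappa>"
          unfolding \<kappa>_def by (rule dphi_le) simp
      qed (auto intro!: continuous_intros phi_deriv)
      also have "\<dots> \<le> 1/2" using that k by (simp add: \<tau>_def field_simps)
      finally have "cmod (phi (of_real l) s - 1) \<le> 1/2" by simp
      then show ?thesis using abs_Re_le_cmod[of "phi (of_real l) s - 1"] by simp
    qed simp
    have dl: "cmod (dphi (of_real l) t) \<ge> k2 l * c1 * t / 4" if t: "0 < t" "t \<le> \<tau>" for t
    proof -
      define G where "G s = - Re (of_real (A s) * dphi (of_real l) s)" for s
      have cG: "continuous_on {0..t} G"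
        unfolding G_def[abs_def]
        by (intro continuous_intros continuous_on_subset[OF A_continuous]) auto
      have dG: "(G has_real_derivative k2 l * A s * Re (phi (of_real l) s)) (at s)" if "s > 0" for s
      proof -
        have "((\<lambda>s. - Re (of_real (A s) * dphi (of_real l) s)) has_vector_derivative
            - Re (- (eig (of_real l) * (of_real (A s) * phi (of_real l) s)))) (at s)"
          by (intro has_vector_derivative_minus bounded_linear.has_vector_derivative[OF bounded_linear_Re] A_dphi_deriv that)
        then show ?thesis
          by (simp add: G_def[abs_def] has_real_derivative_iff_has_vector_derivative eig_real mult.assoc)
      qed
      \<comment> \<open>On the lower half of [0,t] only monotonicity of G is used. The upper half
        gives the growth: there A is at least A(t/2), which is comparable with A t, and Re phi is at
        least 1/2.\<close>
      have 1: "G 0 \<le> G (t/2)"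
      proof (rule DERIV_nonneg_imp_increasing_open[where f = G])
        fix s assume s: "0 < s" "s < t/2"
        show "\<exists>y. (G has_real_derivative y) (at s) \<and> 0 \<le> y"
          using re[of s] s t k2_pos[of l] A_nonneg[of s]
          by (intro exI[of _ "k2 l * A s * Re (phi (of_real l) s)"] conjI dG mult_nonneg_nonneg) auto
      qed (use t in \<open>auto intro: continuous_on_subset[OF cG]\<close>)
      have 2: "G (t/2) - (k2 l * A (t/2) / 2) * (t/2) \<le> G t - (k2 l * A (t/2) / 2) * t"
      proof (rule DERIV_nonneg_imp_increasing_open[where f = "\<lambda>s. G s - (k2 l * A (t/2) / 2) * s"])
        fix s assume s: "t/2 < s" "s < t"
        have "A (t/2) \<le> A s" using s t by (intro A_mono) auto
        then have "A (t/2) * (1/2) \<le> A s * Re (phi (of_real l) s)"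
          using re[of s] s t A_nonneg by (intro mult_mono) auto
        then have "k2 l * (A (t/2) * (1/2)) \<le> k2 l * (A s * Re (phi (of_real l) s))"
          using k2_pos[of l] by (intro mult_left_mono) auto
        moreover have "((\<lambda>s. G s - (k2 l * A (t/2) / 2) * s) has_real_derivative k2 l * A s * Re (phi (of_real l) s) - (k2 l * A (t/2) / 2) * 1) (at s)"
          using s t by (intro DERIV_diff dG DERIV_cmult DERIV_ident) auto
        ultimately show "\<exists>y. ((\<lambda>s. G s - (k2 l * A (t/2) / 2) * s) has_real_derivative y) (at s) \<and> 0 \<le> y"
          by (intro exI conjI) (auto simp: mult.assoc)
      qed (use t in \<open>auto intro!: continuous_intros continuous_on_subset[OF cG]\<close>)
      have "G 0 = 0" by (simp add: G_def)
      then have "k2 l * A (t/2) * t / 4 \<le> G t" using 1 2 by (simp add: field_simps)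
      also have "\<dots> \<le> A t * cmod (dphi (of_real l) t)"
        using abs_Re_le_cmod[of "of_real (A t) * dphi (of_real l) t"] A_nonneg[of t]
        by (simp add: G_def norm_mult)
      finally have "k2 l * A (t/2) * t / 4 \<le> A t * cmod (dphi (of_real l) t)" .
      moreover have "k2 l * (c1 * A t) * t / 4 \<le> k2 l * A (t/2) * t / 4"
        using c1(2)[of t] t \<tau> k2_pos[of l] by (intro divide_right_mono mult_right_mono mult_left_mono) auto
      ultimately have "A t * (k2 l * c1 * t / 4) \<le> A t * cmod (dphi (of_real l) t)" by (simp add: mult_ac)
      then show ?thesis using A_pos[of t] t by (simp only: mult_le_cancel_left_pos)
    qed
    \<comment> \<open>The energy is lost at rate 2 B |phi'|^2, which is at least c2 k2^2 t by B t
      \<ge> 2a+1 and the lower bound on |phi'|. Integrated up to \<tau>, where k2^2 \<tau>^2 = k2/4,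
      this is the fraction c2/8.\<close>
    have "en l \<tau> + c2 * (k2 l)\<^sup>2 * \<tau>\<^sup>2 / 2 \<le> en l 0 + c2 * (k2 l)\<^sup>2 * 0\<^sup>2 / 2"
    proof (rule DERIV_nonpos_imp_decreasing_open[where f = "\<lambda>t. en l t + c2 * (k2 l)\<^sup>2 * t\<^sup>2 / 2"])
      show "0 \<le> \<tau>" using \<tau> by simp
      fix t assume t: "0 < t" "t < \<tau>"
      have "(k2 l * c1 * t / 4)\<^sup>2 \<le> (cmod (dphi (of_real l) t))\<^sup>2"
        using dl[of t] t c1 k2_pos[of l] by (intro power_mono) auto
      then have "(2 * ((2 * a + 1) / t)) * (k2 l * c1 * t / 4)\<^sup>2 \<le> (2 * B t) * (cmod (dphi (of_real l) t))\<^sup>2"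
        using B_ge[OF t(1)] a_gt t B_pos[OF t(1)] by (intro mult_mono) auto
      moreover have "(2 * ((2 * a + 1) / t)) * (k2 l * c1 * t / 4)\<^sup>2 = c2 * (k2 l)\<^sup>2 * t"
        using t by (simp add: c2_def power2_eq_square field_simps)
      ultimately have "- (2 * B t * (cmod (dphi (of_real l) t))\<^sup>2) + c2 * (k2 l)\<^sup>2 * t \<le> 0" by simp
      moreover have "((\<lambda>t. en l t + c2 * (k2 l)\<^sup>2 * t\<^sup>2 / 2) has_real_derivative - (2 * B t * (cmod (dphi (of_real l) t))\<^sup>2) + c2 * (k2 l)\<^sup>2 * t) (at t)"
        using t by (auto intro!: derivative_eq_intros en_deriv)
      ultimately show "\<exists>y. ((\<lambda>t. en l t + c2 * (k2 l)\<^sup>2 * t\<^sup>2 / 2) has_real_derivative y) (at t) \<and> y \<le> 0"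
        by blast
    qed (intro continuous_intros en_continuous, auto)
    then have "en l \<tau> \<le> k2 l - c2 * (k2 l)\<^sup>2 * \<tau>\<^sup>2 / 2" by (simp add: en_0)
    also have "(k2 l)\<^sup>2 * \<tau>\<^sup>2 = k2 l / 4"
      using k by (simp add: \<tau>_def k(2)[symmetric] power2_eq_square field_simps)
    then have "k2 l - c2 * (k2 l)\<^sup>2 * \<tau>\<^sup>2 / 2 = k2 l * (1 - c2 / 8)" by (simp add: mult.assoc algebra_simps)
    finally have 3: "en l \<tau> \<le> k2 l * (1 - c2 / 8)" .
    have "\<tau> \<le> x" using x k by (simp add: \<tau>_def \<kappa>_def[symmetric] field_simps)
    then have "en l x \<le> en l \<tau>" using \<tau> by (intro en_antimono) auto
    then have "k2 l * (cmod (phi (of_real l) x))\<^sup>2 \<le> k2 l * (1 - c2 / 8)"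
      using 3 by (simp add: en_def) (smt (verit) zero_le_power2)
    then have "(cmod (phi (of_real l) x))\<^sup>2 \<le> 1 - c2 / 8" using k2_pos[of l] by simp
    then show ?thesis unfolding \<eta>_def by (intro real_le_rsqrt) auto
  qed
  moreover have "\<eta> < 1" using c2 unfolding \<eta>_def by (simp add: max_def)
  moreover have "\<eta> \<ge> 0" by (simp add: \<eta>_def)
  ultimately show ?thesis by blast
qed

section \<open>Liouville normal form: \<open>psi\<close> = sqrt A phi solves psi'' = (Q - l^2)
  psi\<close>

definition "psi l x = of_real (sqrt (A x)) * phi (of_real l) x"
definition "dpsi l x = of_real (sqrt (A x)) * (dphi (of_real l) x + of_real (B x / 2) * phi (of_real l) x)"
definition "Q x = (a\<^sup>2 - 1/4) / (sinh x)\<^sup>2 - (b\<^sup>2 - 1/4) / (cosh x)\<^sup>2"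

lemma sqrt_A_deriv:
  assumes "x > 0"
  shows "((\<lambda>x. sqrt (A x)) has_real_derivative sqrt (A x) * (B x / 2)) (at x)"
proof -
  have "((\<lambda>x. sqrt (A x)) has_real_derivative (inverse (sqrt (A x)) / 2) * (A x * B x)) (at x)"
    by (rule DERIV_chain2[OF DERIV_real_sqrt A_deriv]) (use A_pos[OF assms] assms in auto)
  moreover have "(inverse (sqrt (A x)) / 2) * (A x * B x) = sqrt (A x) * (B x / 2)"
    using A_pos[OF assms] by (simp add: field_simps)
  ultimately show ?thesis by (simp only:)
qed

lemma psi_deriv: "x > 0 \<Longrightarrow> (psi l has_vector_derivative dpsi l x) (at x)"
  using has_vector_derivative_mult[OF has_vector_derivative_of_real[OF sqrt_A_deriv] phi_deriv, of x "of_real l"]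
  by (simp add: psi_def[abs_def] dpsi_def algebra_simps)

text \<open>Removing the first-order term leaves the potential B^2/4 + B'/2, whose constant part is
  \<rho>^2 and cancels the shift in \<open>k2 l\<close>; what remains is Q.\<close>

lemma dpsi_deriv:
  assumes x: "x > 0"
  shows "(dpsi l has_vector_derivative of_real (Q x - l\<^sup>2) * psi l x) (at x)"
proof -
  define B' where "B' = - ((2*a+1) / (sinh x)\<^sup>2) + (2*b+1) / (cosh x)\<^sup>2"
  have B': "((\<lambda>x. B x / 2) has_real_derivative B' / 2) (at x)"
    unfolding B'_def by (rule DERIV_cdivide[OF B_deriv[OF x]])
  have Q: "(B x)\<^sup>2 / 4 + B' / 2 - \<rho>\<^sup>2 = Q x"
  proof -
    have s0: "sinh x \<noteq> 0" using x by simp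
    have 1: "1 / tanh x = cosh x / sinh x" "tanh x = sinh x / cosh x" by (auto simp: tanh_def)
    have 2: "(cosh x / sinh x)\<^sup>2 = 1 + 1 / (sinh x)\<^sup>2" "(sinh x / cosh x)\<^sup>2 = 1 - 1 / (cosh x)\<^sup>2"
      using s0 by (auto simp: power_divide cosh_square_eq add_divide_distrib)
        (simp add: sinh_square_eq diff_divide_distrib)
    have "(B x)\<^sup>2 = ((2*a+1) * (cosh x / sinh x) + (2*b+1) * (sinh x / cosh x))\<^sup>2"
      by (simp add: B_def tanh_def)
    also have "\<dots> = (2*a+1)\<^sup>2 * (cosh x / sinh x)\<^sup>2 + 2 * (2*a+1) * (2*b+1) + (2*b+1)\<^sup>2 * (sinh x / cosh x)\<^sup>2"
    proof -
      define U V where "U = cosh x / sinh x" and "V = sinh x / cosh x"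
      have "U * V = 1" using s0 by (simp add: U_def V_def)
      moreover have "(p * u + q * v)\<^sup>2 = p\<^sup>2 * u\<^sup>2 + 2 * p * q * (u * v) + q\<^sup>2 * v\<^sup>2" for p q u v :: real
        by (simp add: power2_eq_square algebra_simps)
      ultimately show ?thesis unfolding U_def[symmetric] V_def[symmetric] by simp
    qed
    also have "\<dots> = (2*a+1)\<^sup>2 * (1 + 1 / (sinh x)\<^sup>2) + 2 * (2*a+1) * (2*b+1) + (2*b+1)\<^sup>2 * (1 - 1 / (cosh x)\<^sup>2)"
      unfolding 2 ..
    finally have 3: "(B x)\<^sup>2 = (2*a+1)\<^sup>2 * (1 + 1 / (sinh x)\<^sup>2) + 2 * (2*a+1) * (2*b+1) + (2*b+1)\<^sup>2 * (1 - 1 / (cosh x)\<^sup>2)" .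
    define u where "u = 1 / (sinh x)\<^sup>2"
    define v where "v = 1 / (cosh x)\<^sup>2"
    have "B' = - ((2*a+1) * u) + (2*b+1) * v" by (simp add: B'_def u_def v_def)
    moreover have "Q x = (a\<^sup>2 - 1/4) * u - (b\<^sup>2 - 1/4) * v" by (simp add: Q_def u_def v_def)
    moreover have "(B x)\<^sup>2 = (2*a+1)\<^sup>2 * (1 + u) + 2 * (2*a+1) * (2*b+1) + (2*b+1)\<^sup>2 * (1 - v)"
      unfolding 3 u_def v_def ..
    ultimately show ?thesis by (simp add: rho_eq power2_eq_square field_simps)
  qed
  have "(dpsi l has_vector_derivative
     of_real (sqrt (A x)) * ((- (eig (of_real l) * phi (of_real l) x) - of_real (B x) * dphi (of_real l) x)
        + (of_real (B x / 2) * dphi (of_real l) x + of_real (B' / 2) * phi (of_real l) x))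
     + of_real (sqrt (A x) * (B x / 2)) * (dphi (of_real l) x + of_real (B x / 2) * phi (of_real l) x)) (at x)"
    unfolding dpsi_def[abs_def]
    by (intro has_vector_derivative_mult has_vector_derivative_add has_vector_derivative_of_real sqrt_A_deriv dphi_deriv phi_deriv B' x)
  moreover have "of_real (sqrt (A x)) * ((- (eig (of_real l) * phi (of_real l) x) - of_real (B x) * dphi (of_real l) x)
        + (of_real (B x / 2) * dphi (of_real l) x + of_real (B' / 2) * phi (of_real l) x))
     + of_real (sqrt (A x) * (B x / 2)) * (dphi (of_real l) x + of_real (B x / 2) * phi (of_real l) x)
     = of_real ((B x)\<^sup>2 / 4 + B' / 2 - k2 l) * psi l x"
    by (simp add: psi_def eig_real power2_eq_square field_simps)
  moreover have "(B x)\<^sup>2 / 4 + B' / 2 - k2 l = Q x - l\<^sup>2" using Q by (simp add: k2_def)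
  ultimately show ?thesis by simp
qed

definition "CQ = \<bar>a\<^sup>2 - 1/4\<bar> + \<bar>b\<^sup>2 - 1/4\<bar>"

lemma CQ_nonneg: "CQ \<ge> 0" by (simp add: CQ_def)

lemma Q_le_sinh: assumes "x > 0" shows "\<bar>Q x\<bar> \<le> CQ / (sinh x)\<^sup>2"
proof -
  have "\<bar>Q x\<bar> \<le> \<bar>(a\<^sup>2 - 1/4) / (sinh x)\<^sup>2\<bar> + \<bar>(b\<^sup>2 - 1/4) / (cosh x)\<^sup>2\<bar>"
    unfolding Q_def by (rule abs_triangle_ineq4)
  also have "\<dots> \<le> \<bar>a\<^sup>2 - 1/4\<bar> / (sinh x)\<^sup>2 + \<bar>b\<^sup>2 - 1/4\<bar> / (sinh x)\<^sup>2"
    using assms sinh_le_cosh_real[of x]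
    by (simp add: abs_divide) (intro divide_left_mono power_mono, auto)
  finally show ?thesis by (simp add: CQ_def add_divide_distrib)
qed

lemma sinh_ge_self: "(x::real) \<ge> 0 \<Longrightarrow> x \<le> sinh x"
  using real_le_x_sinh[of x] by (simp add: sinh_field_def exp_minus)

lemma Q_le: assumes "x > 0" shows "\<bar>Q x\<bar> \<le> CQ / x\<^sup>2"
proof -
  have "CQ / (sinh x)\<^sup>2 \<le> CQ / x\<^sup>2"
    using assms sinh_ge_self[of x] CQ_nonneg by (intro divide_left_mono power_mono) auto
  then show ?thesis using Q_le_sinh[OF assms] by simp
qed

text \<open>The inverse cube makes y |Q y| integrable at infinity, as the comparison with the free
  solutions 1 and x demands. It follows from sinh x = 2 sinh (x/2) cosh (x/2) \<ge> x^2/2.\<close>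

lemma Q_le': assumes "x \<ge> 1" shows "\<bar>Q x\<bar> \<le> 4 * CQ / x ^ 3"
proof -
  have "x * (x/2) \<le> (2 * sinh (x/2)) * cosh (x/2)"
    using assms sinh_ge_self[of "x/2"] sinh_le_cosh_real[of "x/2"] by (intro mult_mono) auto
  then have "x * (x/2) \<le> sinh x" using sinh_double[of "x/2"] by simp
  then have "(x * (x/2))\<^sup>2 \<le> (sinh x)\<^sup>2" using assms by (intro power_mono) auto
  moreover have "x ^ 3 / 4 \<le> (x * (x/2))\<^sup>2"
  proof -
    have "x ^ 3 * 1 \<le> x ^ 3 * x" using assms by (intro mult_left_mono) auto
    then show ?thesis by (simp add: power2_eq_square power3_eq_cube field_simps)
  qed
  ultimately have "x ^ 3 / 4 \<le> (sinh x)\<^sup>2" by linarith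
  then have "CQ / (sinh x)\<^sup>2 \<le> CQ / (x ^ 3 / 4)"
    using assms CQ_nonneg by (intro divide_left_mono) auto
  then show ?thesis using Q_le_sinh[of x] assms by (simp add: mult.commute)
qed

text \<open>Energy of the free equation psi'' = - l^2 psi, divided by l^2; it would be constant if Q
  were 0.\<close>

definition "E l x = (cmod (psi l x))\<^sup>2 + (cmod (dpsi l x))\<^sup>2 / l\<^sup>2"

lemma psi_cont: "S \<subseteq> {0<..} \<Longrightarrow> continuous_on S (psi l)"
  by (rule continuous_at_imp_continuous_on) (use psi_deriv has_vector_derivative_continuous in blast)

lemma dpsi_cont: "S \<subseteq> {0<..} \<Longrightarrow> continuous_on S (dpsi l)"
  by (rule continuous_at_imp_continuous_on) (use dpsi_deriv has_vector_derivative_continuous in blast)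

text \<open>In the derivative of E the terms with l^2 cancel, and Q contributes at most a rate CQ/(l
  y^2). Its integral from 1/l to infinity is CQ for every l, whence a growth factor independent of
  l.\<close>

lemma E_growth:
  assumes l: "l > 0" and x: "x \<ge> 1 / l"
  shows "E l x \<le> E l (1 / l) * exp CQ"
proof -
  have p: "y > 0" if "1 / l \<le> y" for y using that l by (meson less_le_trans zero_less_divide_1_iff)
  have "E l x \<le> E l (1 / l) * exp (- CQ / (l * x) - (- CQ / (l * (1 / l))))"
  proof (rule gronwall[OF x, where f' = "\<lambda>x. 2 * (psi l x \<bullet> dpsi l x) + 2 * (dpsi l x \<bullet> (of_real (Q x - l\<^sup>2) * psi l x)) / l\<^sup>2" and g' = "\<lambda>x. CQ / (l * x\<^sup>2)"])
    show "continuous_on {1 / l..x} (E l)"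
      unfolding E_def[abs_def] using l by (intro continuous_intros psi_cont dpsi_cont) (auto dest: p)
    show "continuous_on {1 / l..x} (\<lambda>x. - CQ / (l * x))"
      using l by (intro continuous_intros) (auto dest: p)
    fix y assume y: "1 / l < y" "y < x"
    then have y0: "y > 0" using p[of y] by simp
    show "(E l has_real_derivative 2 * (psi l y \<bullet> dpsi l y) + 2 * (dpsi l y \<bullet> (of_real (Q y - l\<^sup>2) * psi l y)) / l\<^sup>2) (at y)"
      unfolding E_def[abs_def] by (intro DERIV_add DERIV_cdivide norm_sq_deriv psi_deriv dpsi_deriv y0)
    show "((\<lambda>x. - CQ / (l * x)) has_real_derivative CQ / (l * y\<^sup>2)) (at y)"
      using l y0 by (auto intro!: derivative_eq_intros simp: power2_eq_square field_simps)
    have "2 * (psi l y \<bullet> dpsi l y) + 2 * (dpsi l y \<bullet> (of_real (Q y - l\<^sup>2) * psi l y)) / l\<^sup>2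
       = 2 * Q y * (psi l y \<bullet> dpsi l y) / l\<^sup>2"
    proof -
      have 0: "of_real (Q y - l\<^sup>2) * psi l y = (Q y - l\<^sup>2) *\<^sub>R psi l y" by (simp add: scaleR_conv_of_real)
      show ?thesis unfolding 0 inner_scaleR_right using l by (simp add: inner_commute field_simps)
    qed
    also have "\<dots> \<le> 2 * (CQ / y\<^sup>2) * (cmod (psi l y) * cmod (dpsi l y)) / l\<^sup>2"
    proof (rule divide_right_mono)
      have "2 * Q y * (psi l y \<bullet> dpsi l y) \<le> \<bar>2 * Q y * (psi l y \<bullet> dpsi l y)\<bar>" by simp
      also have "\<dots> = 2 * \<bar>Q y\<bar> * \<bar>psi l y \<bullet> dpsi l y\<bar>" by (simp add: abs_mult)
      also have "\<dots> \<le> 2 * (CQ / y\<^sup>2) * (cmod (psi l y) * cmod (dpsi l y))"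
        using Q_le[OF y0] Cauchy_Schwarz_ineq2[of "psi l y" "dpsi l y"] CQ_nonneg
        by (intro mult_mono) auto
      finally show "2 * Q y * (psi l y \<bullet> dpsi l y) \<le> 2 * (CQ / y\<^sup>2) * (cmod (psi l y) * cmod (dpsi l y))" .
    qed simp
    also have "\<dots> = CQ / (l * y\<^sup>2) * (2 * cmod (psi l y) * (cmod (dpsi l y) / l))"
      using l by (simp add: power2_eq_square field_simps)
    also have "\<dots> \<le> CQ / (l * y\<^sup>2) * E l y"
    proof (rule mult_left_mono)
      show "2 * cmod (psi l y) * (cmod (dpsi l y) / l) \<le> E l y"
        using sum_squares_bound[of "cmod (psi l y)" "cmod (dpsi l y) / l"] by (simp add: E_def power_divide)
      show "0 \<le> CQ / (l * y\<^sup>2)" using CQ_nonneg l by simp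
    qed
    finally show "2 * (psi l y \<bullet> dpsi l y) + 2 * (dpsi l y \<bullet> (of_real (Q y - l\<^sup>2) * psi l y)) / l\<^sup>2 \<le> CQ / (l * y\<^sup>2) * E l y" .
  qed
  also have "\<dots> \<le> E l (1 / l) * exp CQ"
  proof (rule mult_left_mono)
    have "CQ / (l * x) \<ge> 0" using l p[OF x] CQ_nonneg by simp
    then show "exp (- CQ / (l * x) - (- CQ / (l * (1 / l)))) \<le> exp CQ" using l by simp
    show "0 \<le> E l (1 / l)" by (simp add: E_def)
  qed
  finally show ?thesis .
qed

lemma psi_le: "x \<ge> 0 \<Longrightarrow> cmod (psi l x) \<le> sqrt (A x)"
  using phi_le_1[of x l] A_nonneg[of x] by (simp add: psi_def norm_mult mult_left_le)

lemma sqrt_k2_le: "l \<ge> 0 \<Longrightarrow> sqrt (k2 l) \<le> l + \<rho>"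
  using rho_pos by (intro real_le_lsqrt) (auto simp: k2_def power2_eq_square algebra_simps)

lemma dpsi_le: assumes "x > 0" "l \<ge> 0" shows "cmod (dpsi l x) \<le> sqrt (A x) * (l + \<rho> + B x / 2)"
proof -
  have "cmod (dphi (of_real l) x + of_real (B x / 2) * phi (of_real l) x) \<le> cmod (dphi (of_real l) x) + (B x / 2) * cmod (phi (of_real l) x)"
    using norm_triangle_ineq[of "dphi (of_real l) x" "of_real (B x / 2) * phi (of_real l) x"] B_pos[OF assms(1)] by (simp add: norm_mult)
  also have "\<dots> \<le> (l + \<rho>) + (B x / 2) * 1"
    using dphi_le[of x l] phi_le_1[of x l] sqrt_k2_le[of l] B_pos[OF assms(1)] assms by (intro add_mono mult_left_mono) auto
  finally have "sqrt (A x) * cmod (dphi (of_real l) x + of_real (B x / 2) * phi (of_real l) x) \<le> sqrt (A x) * (l + \<rho> + B x / 2)"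
    using A_nonneg[of x] by (intro mult_left_mono) auto
  then show ?thesis using A_nonneg[of x] by (simp add: dpsi_def norm_mult)
qed

lemma A_le_near_0:
  assumes "0 < x" "x \<le> 1"
  shows "A x \<le> 2 powr (2 * \<rho>) * cosh 1 powr (2*a+1) * cosh 1 powr (2*b+1) * x powr (2*a+1)"
proof -
  have ch: "cosh x \<le> cosh 1" using assms by (simp add: cosh_real_nonneg_le_iff)
  have "sinh x \<le> cosh 1 * x"
    using sinh_le_mult_cosh[of x] assms ch by (smt (verit) mult.commute mult_left_mono)
  then have "A x \<le> 2 powr (2 * \<rho>) * (cosh 1 * x) powr (2*a+1) * cosh 1 powr (2*b+1)"
    unfolding A_def' using assms ch a_gt b_ge' by (intro mult_mono order_refl powr_mono2) auto
  then show ?thesis using assms by (simp add: powr_mult mult_ac)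
qed

lemma B_le_near_0:
  assumes "0 < x" "x \<le> 1"
  shows "B x \<le> ((2*a+1) * cosh 1 + (2*b+1)) / x"
proof -
  have ch: "cosh x \<le> cosh 1" using assms by (simp add: cosh_real_nonneg_le_iff)
  have "x * cosh x \<le> sinh x * cosh 1"
    using sinh_ge_self[of x] ch assms by (intro mult_mono) auto
  then have "1 / tanh x \<le> cosh 1 / x" using assms by (simp add: tanh_def field_simps)
  then have "(2*a+1) * (1 / tanh x) \<le> (2*a+1) * (cosh 1 / x)" using a_gt by (intro mult_left_mono) auto
  moreover have "(2*b+1) * tanh x \<le> (2*b+1) * (1 / x)"
    using b_ge' tanh_real_lt_1[of x] assms by (intro mult_left_mono) (auto intro: order_trans[of _ 1])
  ultimately show ?thesis by (simp add: B_def add_divide_distrib)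
qed

text \<open>At x = 1/l \<le> 1 the density A has order l^(-(2a+1)), the reciprocal of the weight,
  while B(1/l) has order l, so that |psi'|/l is again of the size of sqrt A.\<close>

lemma E_init_large:
  "\<exists>C>0. \<forall>l\<ge>1. E l (1 / l) \<le> C / jac_weight a l \<and> A (1 / l) \<le> C / jac_weight a l"
proof -
  define KA where "KA = 2 powr (2 * \<rho>) * cosh 1 powr (2*a+1) * cosh 1 powr (2*b+1)"
  define KB where "KB = (2*a+1) * cosh 1 + (2*b+1)"
  define C where "C = KA * (1 + (1 + \<rho> + KB)\<^sup>2)"
  have KA: "KA > 0" by (simp add: KA_def)
  have KB: "KB > 0" unfolding KB_def using a_gt b_ge' by (intro add_pos_nonneg) auto
  have C: "C \<ge> KA" using KA by (simp add: C_def algebra_simps)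
  have "E l (1 / l) \<le> C / jac_weight a l \<and> A (1 / l) \<le> C / jac_weight a l" if l: "l \<ge> 1" for l
  proof -
    have x: "0 < 1 / l" "1 / l \<le> 1" using l by auto
    have w: "jac_weight a l = l powr (2*a+1)" using l by (auto simp: jac_weight_def)
    have A1: "A (1/l) \<le> KA / jac_weight a l"
      using A_le_near_0[OF x] l by (simp add: KA_def w powr_divide)
    have "B (1/l) \<le> KB * l" using B_le_near_0[OF x] by (simp add: KB_def)
    moreover have "\<rho> \<le> \<rho> * l" using l rho_pos by simp
    moreover have "0 \<le> KB * l" using KB l by simp
    ultimately have "l + \<rho> + B (1/l) / 2 \<le> (1 + \<rho> + KB) * l" by (simp add: algebra_simps)
    then have "sqrt (A (1/l)) * (l + \<rho> + B (1/l) / 2) \<le> sqrt (A (1/l)) * ((1 + \<rho> + KB) * l)"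
      using A_nonneg[of "1/l"] by (intro mult_left_mono) auto
    then have "cmod (dpsi l (1/l)) \<le> sqrt (A (1/l)) * ((1 + \<rho> + KB) * l)"
      using dpsi_le[of "1/l" l] x l by linarith
    then have "(cmod (dpsi l (1/l)))\<^sup>2 \<le> (sqrt (A (1/l)) * ((1 + \<rho> + KB) * l))\<^sup>2"
      by (intro power_mono) auto
    also have "\<dots> = A (1/l) * (1 + \<rho> + KB)\<^sup>2 * l\<^sup>2" using A_nonneg[of "1/l"] by (simp add: power_mult_distrib)
    finally have "(cmod (dpsi l (1/l)))\<^sup>2 / l\<^sup>2 \<le> A (1/l) * (1 + \<rho> + KB)\<^sup>2"
      using l by (simp add: divide_le_eq)
    moreover have "(cmod (psi l (1/l)))\<^sup>2 \<le> (sqrt (A (1/l)))\<^sup>2"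
      using x by (intro power_mono psi_le) auto
    then have "(cmod (psi l (1/l)))\<^sup>2 \<le> A (1/l)" using A_nonneg[of "1/l"] by simp
    ultimately have "E l (1/l) \<le> A (1/l) * (1 + (1 + \<rho> + KB)\<^sup>2)" by (simp add: E_def algebra_simps)
    also have "\<dots> \<le> KA / jac_weight a l * (1 + (1 + \<rho> + KB)\<^sup>2)"
      using A1 by (intro mult_right_mono) auto
    finally have "E l (1/l) \<le> C / jac_weight a l" by (simp add: C_def)
    moreover have "KA / jac_weight a l \<le> C / jac_weight a l"
      using C jac_weight_pos[of l a] l by (intro divide_right_mono) auto
    ultimately show ?thesis using A1 by linarith
  qed
  moreover have "C > 0" using KA C by linarith
  ultimately show ?thesis by blast
qed

text \<open>For \<open>l < 1\<close> the solutions \<open>1, x\<close> of the free equation \<open>u'' = 0\<close> are the comparison system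
  on \<open>[1, 1/l]\<close>: \<open>psi = (psi - x psi') + x psi'\<close>.\<close>
lemma psi_init_small:
  "\<exists>C>0. \<forall>l x. 0 < l \<longrightarrow> l < 1 \<longrightarrow> 1 \<le> x \<longrightarrow> x \<le> 1 / l \<longrightarrow>
      (cmod (psi l x))\<^sup>2 \<le> C * x\<^sup>2 \<and> (cmod (dpsi l x))\<^sup>2 \<le> C"
proof -
  define M where "M = sqrt (A 1) * (1 + \<rho> + B 1)"
  have M: "M \<ge> 0" unfolding M_def using rho_pos B_pos[of 1] A_nonneg[of 1] by (intro mult_nonneg_nonneg) auto
  define K where "K = (4 * M\<^sup>2 + M\<^sup>2) * exp (16 * CQ + 2)"
  define C where "C = 2 * K + 1"
  have K0: "K \<ge> 0" by (simp add: K_def)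
  have "(cmod (psi l x))\<^sup>2 \<le> C * x\<^sup>2 \<and> (cmod (dpsi l x))\<^sup>2 \<le> C"
    if l: "0 < l" "l < 1" and x: "1 \<le> x" "x \<le> 1 / l" for l x
  proof -
    \<comment> \<open>\<open>al\<close> and \<open>dpsi\<close> are the coefficients of psi in the
      system 1, x. In N the first is divided by y, which puts both on the same scale.\<close>
    define al where "al y = psi l y - of_real y * dpsi l y" for y
    define N where "N y = (cmod (al y))\<^sup>2 / y\<^sup>2 + (cmod (dpsi l y))\<^sup>2" for y
    define q where "q y = Q y - l\<^sup>2" for y
    have al_deriv: "(al has_vector_derivative - (of_real (y * q y) * psi l y)) (at y)" if "y > 0" for y
    proof -
      have "(al has_vector_derivative dpsi l y - (of_real y * (of_real (Q y - l\<^sup>2) * psi l y) + of_real 1 * dpsi l y)) (at y)"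
        unfolding al_def[abs_def]
        by (intro has_vector_derivative_diff has_vector_derivative_mult has_vector_derivative_of_real psi_deriv dpsi_deriv that DERIV_ident)
      then show ?thesis by (simp add: q_def mult.assoc)
    qed
    define N' where "N' y = (2 * (al y \<bullet> (- (of_real (y * q y) * psi l y))) * y\<^sup>2 - (cmod (al y))\<^sup>2 * (2 * y)) / (y\<^sup>2 * y\<^sup>2) + 2 * (dpsi l y \<bullet> (of_real (q y) * psi l y))" for y
    have N_deriv: "(N has_real_derivative N' y) (at y)" if "y > 0" for y
      unfolding N_def[abs_def] N'_def q_def
      using that by (intro DERIV_add DERIV_divide norm_sq_deriv dpsi_deriv al_deriv[unfolded q_def])
        (auto intro!: derivative_eq_intros)
    have N'_le: "N' y \<le> 4 * (4 * CQ / y\<^sup>2 + l\<^sup>2 * y) * N y" if y: "y \<ge> 1" for y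
    proof -
      have y0: "y > 0" using y by simp
      define u where "u = cmod (al y) / y"
      define v where "v = cmod (dpsi l y)"
      have uv: "u \<ge> 0" "v \<ge> 0" using y0 by (auto simp: u_def v_def)
      have ps: "cmod (psi l y) \<le> y * (u + v)"
      proof -
        have "psi l y = al y + of_real y * dpsi l y" by (simp add: al_def)
        then have "cmod (psi l y) \<le> cmod (al y) + y * cmod (dpsi l y)"
          using norm_triangle_ineq[of "al y" "of_real y * dpsi l y"] y0 by (simp add: norm_mult)
        then show ?thesis using y0 by (simp add: u_def v_def distrib_left)
      qed
      have t1: "(2 * (al y \<bullet> (- (of_real (y * q y) * psi l y))) * y\<^sup>2 - (cmod (al y))\<^sup>2 * (2 * y)) / (y\<^sup>2 * y\<^sup>2)
          \<le> 2 * u * (\<bar>q y\<bar> * (y * (u + v)))"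
      proof -
        have "(2 * (al y \<bullet> (- (of_real (y * q y) * psi l y))) * y\<^sup>2 - (cmod (al y))\<^sup>2 * (2 * y)) / (y\<^sup>2 * y\<^sup>2)
          \<le> (2 * (al y \<bullet> (- (of_real (y * q y) * psi l y))) * y\<^sup>2) / (y\<^sup>2 * y\<^sup>2)"
          using y0 by (intro divide_right_mono) auto
        also have "\<dots> = 2 * (al y \<bullet> (- (of_real (y * q y) * psi l y))) / y\<^sup>2"
          using y0 by (intro nonzero_mult_divide_mult_cancel_right) auto
        also have "\<dots> \<le> 2 * (cmod (al y) * cmod (of_real (y * q y) * psi l y)) / y\<^sup>2"
          using norm_cauchy_schwarz[of "al y" "- (of_real (y * q y) * psi l y)"] by (intro divide_right_mono) auto
        also have "\<dots> = 2 * u * (\<bar>q y\<bar> * cmod (psi l y))"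
          using y0 by (simp add: u_def norm_mult abs_mult power2_eq_square field_simps)
        also have "\<dots> \<le> 2 * u * (\<bar>q y\<bar> * (y * (u + v)))"
          using ps uv by (intro mult_left_mono) auto
        finally show ?thesis .
      qed
      have t2: "2 * (dpsi l y \<bullet> (of_real (q y) * psi l y)) \<le> 2 * v * (\<bar>q y\<bar> * (y * (u + v)))"
      proof -
        have "2 * (dpsi l y \<bullet> (of_real (q y) * psi l y)) \<le> 2 * (v * (\<bar>q y\<bar> * cmod (psi l y)))"
          using norm_cauchy_schwarz[of "dpsi l y" "of_real (q y) * psi l y"] by (simp add: v_def norm_mult)
        also have "\<dots> \<le> 2 * (v * (\<bar>q y\<bar> * (y * (u + v))))"
          using ps uv by (intro mult_left_mono) auto
        finally show ?thesis by simp
      qed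
      have "N' y \<le> 2 * (\<bar>q y\<bar> * y) * (u + v)\<^sup>2"
        using t1 t2 unfolding N'_def by (simp add: power2_eq_square algebra_simps)
      also have "\<dots> \<le> 2 * (4 * CQ / y\<^sup>2 + l\<^sup>2 * y) * (2 * N y)"
      proof (rule mult_mono)
        have "\<bar>q y\<bar> \<le> 4 * CQ / y ^ 3 + l\<^sup>2"
          using Q_le'[OF y] abs_triangle_ineq4[of "Q y" "l\<^sup>2"] by (simp add: q_def)
        then have "\<bar>q y\<bar> * y \<le> (4 * CQ / y ^ 3 + l\<^sup>2) * y" using y0 by (intro mult_right_mono) auto
        also have "\<dots> = 4 * CQ / y\<^sup>2 + l\<^sup>2 * y" using y0 by (simp add: power2_eq_square power3_eq_cube field_simps)
        finally show "2 * (\<bar>q y\<bar> * y) \<le> 2 * (4 * CQ / y\<^sup>2 + l\<^sup>2 * y)" by simp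
        have "(u + v)\<^sup>2 \<le> 2 * (u\<^sup>2 + v\<^sup>2)"
          using sum_squares_bound[of u v] by (simp add: power2_sum)
        then show "(u + v)\<^sup>2 \<le> 2 * N y" by (simp add: N_def u_def v_def power_divide)
        show "0 \<le> 2 * (4 * CQ / y\<^sup>2 + l\<^sup>2 * y)" using CQ_nonneg y0 by simp
      qed auto
      also have "2 * X * (2 * n) = 4 * X * n" for X n :: real by simp
      finally show ?thesis .
    qed
    \<comment> \<open>The rate 4 (4 CQ/y^2 + l^2 y) has integral at most 16 CQ + 2 over [1, 1/l],
      since l x \<le> 1 there.\<close>
    have "N x \<le> N 1 * exp (4 * (- 4 * CQ / x + l\<^sup>2 * x\<^sup>2 / 2) - 4 * (- 4 * CQ / 1 + l\<^sup>2 * 1\<^sup>2 / 2))"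
    proof (rule gronwall[OF x(1), where f' = N' and g' = "\<lambda>y. 4 * (4 * CQ / y\<^sup>2 + l\<^sup>2 * y)" and g = "\<lambda>x. 4 * (- 4 * CQ / x + l\<^sup>2 * x\<^sup>2 / 2)"])
      show "continuous_on {1..x} N"
        by (rule continuous_at_imp_continuous_on) (auto intro!: DERIV_isCont N_deriv)
      show "continuous_on {1..x} (\<lambda>x. 4 * (- 4 * CQ / x + l\<^sup>2 * x\<^sup>2 / 2))"
        by (intro continuous_intros) auto
      fix y assume y: "1 < y" "y < x"
      show "(N has_real_derivative N' y) (at y)" using y by (intro N_deriv) auto
      show "((\<lambda>x. 4 * (- 4 * CQ / x + l\<^sup>2 * x\<^sup>2 / 2)) has_real_derivative 4 * (4 * CQ / y\<^sup>2 + l\<^sup>2 * y)) (at y)"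
        using y by (auto intro!: derivative_eq_intros simp: power2_eq_square field_simps)
      show "N' y \<le> 4 * (4 * CQ / y\<^sup>2 + l\<^sup>2 * y) * N y" using y by (intro N'_le) auto
    qed
    also have "\<dots> \<le> N 1 * exp (16 * CQ + 2)"
    proof (intro mult_left_mono)
      have "l * x \<le> 1" using x l by (simp add: field_simps)
      then have "l\<^sup>2 * x\<^sup>2 \<le> 1" using l x by (simp add: power_mult_distrib[symmetric] power_le_one)
      moreover have "- 4 * CQ / x \<le> 0" using CQ_nonneg x by simp
      moreover have "4 * (z + s / 2) - 4 * (- 4 * CQ + r / 2) \<le> 16 * CQ + 2" if "s \<le> 1" "z \<le> 0" "r \<ge> 0" for z s r
        using that by simp
      ultimately show "exp (4 * (- 4 * CQ / x + l\<^sup>2 * x\<^sup>2 / 2) - 4 * (- 4 * CQ / 1 + l\<^sup>2 * 1\<^sup>2 / 2)) \<le> exp (16 * CQ + 2)"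
        unfolding exp_le_cancel_iff power_one mult_1_right div_by_1 using zero_le_power2 by blast
      show "0 \<le> N 1" by (simp add: N_def)
    qed
    also have "\<dots> \<le> K"
    proof -
      have d1: "cmod (dpsi l 1) \<le> M"
      proof -
        have "sqrt (A 1) * (l + \<rho> + B 1 / 2) \<le> M"
          unfolding M_def using l B_pos[of 1] A_nonneg[of 1] by (intro mult_left_mono) auto
        then show ?thesis using dpsi_le[of 1 l] l by simp
      qed
      have p1: "cmod (psi l 1) \<le> M"
      proof -
        have "sqrt (A 1) * 1 \<le> M"
          unfolding M_def using rho_pos B_pos[of 1] A_nonneg[of 1] by (intro mult_left_mono) auto
        then show ?thesis using psi_le[of 1 l] by simp
      qed
      have "cmod (al 1) \<le> 2 * M" using norm_triangle_ineq4[of "psi l 1" "dpsi l 1"] d1 p1 by (simp add: al_def)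
      then have "(cmod (al 1))\<^sup>2 \<le> (2 * M)\<^sup>2" by (intro power_mono) auto
      moreover have "(cmod (dpsi l 1))\<^sup>2 \<le> M\<^sup>2" using d1 by (intro power_mono) auto
      ultimately have "N 1 \<le> 4 * M\<^sup>2 + M\<^sup>2" by (simp add: N_def power_mult_distrib)
      then show ?thesis unfolding K_def by (intro mult_right_mono) auto
    qed
    finally have Nx: "N x \<le> K" .
    have x0: "x > 0" using x by simp
    have "(cmod (dpsi l x))\<^sup>2 \<le> N x" by (simp add: N_def)
    moreover have "(cmod (psi l x))\<^sup>2 \<le> 2 * K * x\<^sup>2"
    proof -
      have "psi l x = al x + of_real x * dpsi l x" by (simp add: al_def)
      then have "cmod (psi l x) \<le> cmod (al x) + x * cmod (dpsi l x)"
        using norm_triangle_ineq[of "al x" "of_real x * dpsi l x"] x0 by (simp add: norm_mult)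
      then have "(cmod (psi l x))\<^sup>2 \<le> (cmod (al x) + x * cmod (dpsi l x))\<^sup>2" by (intro power_mono) auto
      also have "\<dots> \<le> 2 * ((cmod (al x))\<^sup>2 + (x * cmod (dpsi l x))\<^sup>2)"
        using sum_squares_bound[of "cmod (al x)" "x * cmod (dpsi l x)"] by (simp add: power2_sum)
      also have "\<dots> = 2 * N x * x\<^sup>2" using x0 by (simp add: N_def power_mult_distrib field_simps)
      also have "\<dots> \<le> 2 * K * x\<^sup>2" using Nx by (intro mult_right_mono) auto
      finally show ?thesis .
    qed
    moreover have "2 * K * x\<^sup>2 \<le> C * x\<^sup>2" by (intro mult_right_mono) (auto simp: C_def)
    moreover have "K \<le> C" using K0 by (simp add: C_def)
    ultimately show ?thesis using Nx by linarith
  qed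
  moreover have "C > 0" using K0 by (simp add: C_def)
  ultimately show ?thesis by blast
qed

text \<open>The size of the solutions is w^(-1/2) uniformly in x, which is what the weighted L^2
  bound requires. Beyond 1/l the free energy controls psi; before 1/l it is sqrt A, or for l < 1 and
  x > 1 the comparison with 1 and x.\<close>

lemma psi_bounds:
  "\<exists>C>0. \<forall>l>0. (\<forall>x. 0 < x \<longrightarrow> (cmod (psi l x))\<^sup>2 \<le> C / jac_weight a l) \<and>
      (\<forall>x\<ge>1/l. E l x \<le> C / jac_weight a l)"
proof -
  obtain C1 where C1: "C1 > 0" "\<And>l. l \<ge> 1 \<Longrightarrow> E l (1 / l) \<le> C1 / jac_weight a l \<and> A (1 / l) \<le> C1 / jac_weight a l"
    using E_init_large by blast
  obtain C2 where C2: "C2 > 0" "\<And>l x. 0 < l \<Longrightarrow> l < 1 \<Longrightarrow> 1 \<le> x \<Longrightarrow> x \<le> 1 / l \<Longrightarrow>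
      (cmod (psi l x))\<^sup>2 \<le> C2 * x\<^sup>2 \<and> (cmod (dpsi l x))\<^sup>2 \<le> C2"
    using psi_init_small by blast
  define C0 where "C0 = C1 + 2 * C2 + A 1"
  define C where "C = C0 * exp CQ"
  have A1: "A 1 > 0" by (simp add: A_pos)
  have C0: "C0 > 0" using C1 C2 A1 by (simp add: C0_def)
  have CC: "C \<ge> C0" using C0 CQ_nonneg by (simp add: C_def)
  have main: "(\<forall>x. 0 < x \<longrightarrow> (cmod (psi l x))\<^sup>2 \<le> C / jac_weight a l) \<and> (\<forall>x\<ge>1/l. E l x \<le> C / jac_weight a l)"
    if l: "l > 0" for l
  proof -
    have w: "jac_weight a l > 0" using l by (rule jac_weight_pos)
    have init: "E l (1/l) \<le> C0 / jac_weight a l"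
    proof (cases "l \<ge> 1")
      case True
      have "C1 / jac_weight a l \<le> C0 / jac_weight a l"
        using w C2 A1 by (intro divide_right_mono) (auto simp: C0_def)
      then show ?thesis using C1(2)[OF True] by linarith
    next
      case False
      then have l1: "l < 1" by simp
      have "E l (1/l) \<le> C2 * (1/l)\<^sup>2 + C2 / l\<^sup>2"
        unfolding E_def using C2(2)[OF l l1, of "1/l"] l l1 by (intro add_mono divide_right_mono) auto
      also have "\<dots> = 2 * C2 / jac_weight a l" using l1 by (simp add: jac_weight_def power_divide)
      also have "\<dots> \<le> C0 / jac_weight a l"
        using w C1 A1 by (intro divide_right_mono) (auto simp: C0_def)
      finally show ?thesis .
    qed
    have E2: "E l x \<le> C / jac_weight a l" if x: "x \<ge> 1/l" for x
    proof -
      have "E l x \<le> E l (1/l) * exp CQ" by (rule E_growth[OF l x])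
      also have "\<dots> \<le> (C0 / jac_weight a l) * exp CQ" using init by (intro mult_right_mono) auto
      finally show ?thesis by (simp add: C_def)
    qed
    have "(cmod (psi l x))\<^sup>2 \<le> C / jac_weight a l" if x: "x > 0" for x
    proof (cases "x \<ge> 1/l")
      case True
      have "(cmod (psi l x))\<^sup>2 \<le> E l x" by (simp add: E_def)
      then show ?thesis using E2[OF True] by linarith
    next
      case False
      have sq: "(cmod (psi l x))\<^sup>2 \<le> A x"
      proof -
        have "(cmod (psi l x))\<^sup>2 \<le> (sqrt (A x))\<^sup>2" using x by (intro power_mono psi_le) auto
        then show ?thesis using A_nonneg[of x] by simp
      qed
      have "(cmod (psi l x))\<^sup>2 \<le> C0 / jac_weight a l"
      proof (cases "l \<ge> 1")
        case True
        have "A x \<le> A (1/l)" using False x by (intro A_mono) auto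
        moreover have "C1 / jac_weight a l \<le> C0 / jac_weight a l"
          using w C2 A1 by (intro divide_right_mono) (auto simp: C0_def)
        ultimately show ?thesis using sq C1(2)[OF True] by linarith
      next
        case l1: False
        show ?thesis
        proof (cases "x \<le> 1")
          case True
          have "A x \<le> A 1" using True x by (intro A_mono) auto
          also have "\<dots> \<le> A 1 / jac_weight a l"
            using l l1 A1 w by (simp add: jac_weight_def field_simps power_le_one)
          also have "\<dots> \<le> C0 / jac_weight a l"
            using w C1 C2 by (intro divide_right_mono) (auto simp: C0_def)
          finally show ?thesis using sq by linarith
        next
          case x1: False
          have "(cmod (psi l x))\<^sup>2 \<le> C2 * x\<^sup>2" using C2(2)[OF l, of x] l1 x1 False by auto
          also have "\<dots> \<le> C2 * (1/l)\<^sup>2" using C2 x False by (intro mult_left_mono power_mono) auto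
          also have "\<dots> = C2 / jac_weight a l" using l1 by (simp add: jac_weight_def power_divide)
          also have "\<dots> \<le> C0 / jac_weight a l"
            using w C1 C2 A1 by (intro divide_right_mono) (auto simp: C0_def)
          finally show ?thesis .
        qed
      qed
      moreover have "C0 / jac_weight a l \<le> C / jac_weight a l" using CC w by (intro divide_right_mono) auto
      ultimately show ?thesis by linarith
    qed
    then show ?thesis using E2 by blast
  qed
  have "C > 0" using C0 CC by linarith
  then show ?thesis using main by blast
qed

text \<open>Variation of constants: (psi' + i m psi) exp(-i m x) with m = l or m = -l has derivative
  Q psi exp(-i m x), which is integrable from 1/l on, so it converges at rate 1/x. The two limits
  are the amplitudes, and psi is a difference of the two expressions.\<close>

lemma psi_asymptotics:
  "\<exists>C>0. \<forall>l>0. \<exists>b1 b2. cmod b1 \<le> C \<and> cmod b2 \<le> C \<and>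
     (\<forall>x>0. cmod (of_real (sqrt (jac_weight a l)) * psi l x - b1 * cis (l * x) - b2 * cis (- (l * x)))
        \<le> C * min 1 (1 / (l * x)))"
proof -
  obtain C0 where C0: "C0 > 0" "\<And>l x. l > 0 \<Longrightarrow> x > 0 \<Longrightarrow> (cmod (psi l x))\<^sup>2 \<le> C0 / jac_weight a l"
    "\<And>l x. l > 0 \<Longrightarrow> x \<ge> 1/l \<Longrightarrow> E l x \<le> C0 / jac_weight a l"
    using psi_bounds by blast
  define c where "c = sqrt C0"
  have c: "c > 0" using C0 by (simp add: c_def)
  \<comment> \<open>One constant for the amplitudes, the error beyond 1/l and the region x < 1/l,
    where the triangle inequality alone gives 3c + c CQ.\<close>
  define C where "C = 5 * c + 2 * c * CQ"
  have C: "C > 0" using c CQ_nonneg by (simp add: C_def add_pos_nonneg)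
  have "\<exists>b1 b2. cmod b1 \<le> C \<and> cmod b2 \<le> C \<and>
     (\<forall>x>0. cmod (of_real (sqrt (jac_weight a l)) * psi l x - b1 * cis (l * x) - b2 * cis (- (l * x)))
        \<le> C * min 1 (1 / (l * x)))" if l: "l > 0" for l
  proof -
    define w where "w = sqrt (jac_weight a l)"
    have w: "w > 0" using jac_weight_pos[OF l, of a] by (simp add: w_def)
    have ps: "w * cmod (psi l x) \<le> c" if "x > 0" for x
    proof -
      have "(w * cmod (psi l x))\<^sup>2 \<le> C0"
        using C0(2)[OF l that] jac_weight_pos[OF l, of a]
        by (simp add: w_def power_mult_distrib pos_le_divide_eq mult.commute)
      then show ?thesis unfolding c_def by (rule real_le_rsqrt)
    qed
    have dps: "w * cmod (dpsi l x) \<le> c * l" if "x \<ge> 1/l" for x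
    proof -
      have "(cmod (dpsi l x))\<^sup>2 / l\<^sup>2 \<le> C0 / jac_weight a l"
        using C0(3)[OF l that] zero_le_power2[of "cmod (psi l x)"] unfolding E_def by linarith
      then have "(w * cmod (dpsi l x) / l)\<^sup>2 \<le> C0"
        using jac_weight_pos[OF l, of a]
        by (simp add: w_def power_mult_distrib power_divide pos_le_divide_eq mult.commute)
      then have "w * cmod (dpsi l x) / l \<le> c" unfolding c_def by (rule real_le_rsqrt)
      then show ?thesis using l by (simp add: field_simps)
    qed
    have lim: "\<exists>L. cmod L \<le> (2 * c + c * CQ) * l / w \<and> (\<forall>x\<ge>1/l. cmod ((dpsi l x + \<i> * of_real m * psi l x) * cis (- (m * x)) - L) \<le> (c * CQ / w) / x)"
      if m: "m = l \<or> m = - l" for m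
    proof -
      define f where "f x = (dpsi l x + \<i> * of_real m * psi l x) * cis (- (m * x))" for x
      have m2: "m * m = l\<^sup>2" using m by (auto simp: power2_eq_square)
      have fd: "(f has_vector_derivative of_real (Q x) * psi l x * cis (- (m * x))) (at x)" if x: "x > 0" for x
      proof -
        have cd: "((\<lambda>x. cis (- (m * x))) has_vector_derivative - m *\<^sub>R (\<i> * cis (- (m * x)))) (at x)"
          using exp_scaleR_has_vector_derivative_left[of "- (of_real m * \<i>)" x]
          by (simp add: cis_conv_exp scaleR_conv_of_real mult_ac)
        have "(f has_vector_derivative (dpsi l x + \<i> * of_real m * psi l x) * (- m *\<^sub>R (\<i> * cis (- (m * x)))) +
           (of_real (Q x - l\<^sup>2) * psi l x + \<i> * of_real m * dpsi l x) * cis (- (m * x))) (at x)"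
          unfolding f_def[abs_def]
          by (intro has_vector_derivative_mult has_vector_derivative_add has_vector_derivative_mult_right cd psi_deriv dpsi_deriv x)
        moreover have "(dpsi l x + \<i> * of_real m * psi l x) * (- m *\<^sub>R (\<i> * cis (- (m * x)))) +
           (of_real (Q x - l\<^sup>2) * psi l x + \<i> * of_real m * dpsi l x) * cis (- (m * x))
           = of_real (Q x) * psi l x * cis (- (m * x)) + (of_real (m * m) - of_real (l\<^sup>2)) * psi l x * cis (- (m * x))"
          by (simp add: scaleR_conv_of_real algebra_simps)
        ultimately show ?thesis by (simp add: m2)
      qed
      have bound: "cmod (f y - f x) \<le> (c * CQ / w) * (1 / x - 1 / y)" if xy: "1/l \<le> x" "x \<le> y" for x y
      proof (cases "x = y")
        case False
        then have xy': "x < y" using xy by simp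
        have x0: "x > 0" using xy(1) l by (meson less_le_trans zero_less_divide_1_iff)
        have "cmod (f y - f x) \<le> - (c * CQ / w) / y - (- (c * CQ / w) / x)"
        proof (rule differentiable_bound_general[OF xy', where f' = "\<lambda>x. of_real (Q x) * psi l x * cis (- (m * x))" and \<phi>' = "\<lambda>x. (c * CQ / w) / x\<^sup>2"])
          show "continuous_on {x..y} f"
            by (rule continuous_at_imp_continuous_on) (use x0 in \<open>auto intro!: has_vector_derivative_continuous[OF fd]\<close>)
          show "continuous_on {x..y} (\<lambda>x. - (c * CQ / w) / x)"
            using x0 by (intro continuous_intros) auto
          fix z assume z: "x < z" "z < y"
          then have z0: "z > 0" using x0 by simp
          show "(f has_vector_derivative of_real (Q z) * psi l z * cis (- (m * z))) (at z)" by (rule fd[OF z0])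
          show "((\<lambda>x. - (c * CQ / w) / x) has_vector_derivative (c * CQ / w) / z\<^sup>2) (at z)"
            unfolding has_real_derivative_iff_has_vector_derivative[symmetric]
            using z0 w by (auto intro!: derivative_eq_intros simp: power2_eq_square)
          have "cmod (of_real (Q z) * psi l z * cis (- (m * z))) = \<bar>Q z\<bar> * cmod (psi l z)" by (simp add: norm_mult)
          also have "\<dots> \<le> (CQ / z\<^sup>2) * (c / w)"
            using Q_le[OF z0] ps[OF z0] w c by (intro mult_mono) (auto simp: field_simps)
          finally show "cmod (of_real (Q z) * psi l z * cis (- (m * z))) \<le> (c * CQ / w) / z\<^sup>2" by (simp add: mult_ac)
        qed
        then show ?thesis by (simp add: right_diff_distrib)
      qed simp
      obtain L where L: "\<And>x. 1/l \<le> x \<Longrightarrow> cmod (f x - L) \<le> (c * CQ / w) / x"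
        using cauchy_inverse_limit[OF _ _ bound] l c w CQ_nonneg by (metis divide_nonneg_pos less_imp_le mult_nonneg_nonneg zero_less_divide_1_iff)
      have "cmod L \<le> cmod (f (1/l)) + (c * CQ / w) / (1/l)"
        using L[of "1/l"] norm_triangle_ineq3[of L "f (1/l)"] by (simp add: norm_minus_commute)
      also have "cmod (f (1/l)) \<le> cmod (dpsi l (1/l)) + l * cmod (psi l (1/l))"
        unfolding f_def using norm_triangle_ineq[of "dpsi l (1/l)" "\<i> * of_real m * psi l (1/l)"] m l
        by (auto simp: norm_mult)
      also have "\<dots> \<le> 2 * c * l / w"
      proof -
        have "cmod (dpsi l (1/l)) \<le> c * l / w" using dps[of "1/l"] w by (simp add: pos_le_divide_eq mult.commute)
        moreover have "cmod (psi l (1/l)) \<le> c / w" using ps[of "1/l"] w l by (simp add: pos_le_divide_eq mult.commute)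
        then have "l * cmod (psi l (1/l)) \<le> l * (c / w)" using l by (intro mult_left_mono) auto
        ultimately have "cmod (dpsi l (1/l)) + l * cmod (psi l (1/l)) \<le> c * l / w + l * (c / w)" by linarith
        also have "\<dots> = 2 * c * l / w" using w by (simp add: field_simps)
        finally show ?thesis .
      qed
      finally have "cmod L \<le> (2 * c + c * CQ) * l / w" by (simp add: add_divide_distrib distrib_right)
      then show ?thesis using L unfolding f_def by blast
    qed
    obtain L1 where L1: "cmod L1 \<le> (2 * c + c * CQ) * l / w"
      "\<And>x. x \<ge> 1/l \<Longrightarrow> cmod ((dpsi l x + \<i> * of_real l * psi l x) * cis (- (l * x)) - L1) \<le> (c * CQ / w) / x"
      using lim[of l] by auto
    obtain L2 where L2: "cmod L2 \<le> (2 * c + c * CQ) * l / w"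
      "\<And>x. x \<ge> 1/l \<Longrightarrow> cmod ((dpsi l x - \<i> * of_real l * psi l x) * cis (l * x) - L2) \<le> (c * CQ / w) / x"
      using lim[of "-l"] by auto
    define b1 where "b1 = of_real w * L1 / (2 * \<i> * of_real l)"
    define b2 where "b2 = - (of_real w * L2 / (2 * \<i> * of_real l))"
    have nb: "cmod b1 \<le> (2 * c + c * CQ) / 2" "cmod b2 \<le> (2 * c + c * CQ) / 2"
      using L1(1) L2(1) l w by (auto simp: b1_def b2_def norm_mult norm_divide field_simps)
    have le: "(2 * c + c * CQ) / 2 \<le> C" using c CQ_nonneg by (simp add: C_def)
    have "cmod (of_real w * psi l x - b1 * cis (l * x) - b2 * cis (- (l * x))) \<le> C * min 1 (1 / (l * x))" if x: "x > 0" for x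
    proof (cases "x \<ge> 1/l")
      case True
      define f1 where "f1 = (dpsi l x + \<i> * of_real l * psi l x) * cis (- (l * x))"
      define f2 where "f2 = (dpsi l x - \<i> * of_real l * psi l x) * cis (l * x)"
      have cc: "cis (l * x) * cis (- (l * x)) = 1" by (simp add: cis_mult)
      have "f1 * cis (l * x) - f2 * cis (- (l * x)) = 2 * \<i> * of_real l * psi l x"
      proof -
        have "f1 * cis (l * x) = (dpsi l x + \<i> * of_real l * psi l x) * (cis (l * x) * cis (- (l * x)))"
          by (simp only: f1_def mult_ac)
        moreover have "f2 * cis (- (l * x)) = (dpsi l x - \<i> * of_real l * psi l x) * (cis (l * x) * cis (- (l * x)))"
          by (simp only: f2_def mult_ac)
        ultimately show ?thesis by (simp only: cc) (simp add: algebra_simps)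
      qed
      then have psi: "psi l x = (f1 * cis (l * x) - f2 * cis (- (l * x))) / (2 * \<i> * of_real l)" using l by simp
      have "of_real w * psi l x - b1 * cis (l * x) - b2 * cis (- (l * x))
         = of_real w / (2 * \<i> * of_real l) * ((f1 - L1) * cis (l * x) - (f2 - L2) * cis (- (l * x)))"
        unfolding psi b1_def b2_def using l by (simp add: field_simps)
      also have "cmod \<dots> = w / (2 * l) * cmod ((f1 - L1) * cis (l * x) - (f2 - L2) * cis (- (l * x)))"
        using w l by (simp add: norm_mult norm_divide)
      also have "\<dots> \<le> w / (2 * l) * ((c * CQ / w) / x + (c * CQ / w) / x)"
      proof (intro mult_left_mono)
        have "cmod ((f1 - L1) * cis (l * x) - (f2 - L2) * cis (- (l * x))) \<le> cmod (f1 - L1) + cmod (f2 - L2)"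
          using norm_triangle_ineq4[of "(f1 - L1) * cis (l * x)" "(f2 - L2) * cis (- (l * x))"] by (simp add: norm_mult)
        then show "cmod ((f1 - L1) * cis (l * x) - (f2 - L2) * cis (- (l * x))) \<le> (c * CQ / w) / x + (c * CQ / w) / x"
          using L1(2)[OF True] L2(2)[OF True] unfolding f1_def f2_def by linarith
      qed (use w l in auto)
      also have "\<dots> = c * CQ * (1 / (l * x))" using w l x by (simp add: field_simps)
      also have "\<dots> \<le> C * (1 / (l * x))" using c CQ_nonneg l x by (intro mult_right_mono) (auto simp: C_def)
      finally have "cmod (of_real w * psi l x - b1 * cis (l * x) - b2 * cis (- (l * x))) \<le> C * (1 / (l * x))" .
      moreover have "min 1 (1 / (l * x)) = 1 / (l * x)" using True l x by (simp add: min_def field_simps)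
      ultimately show ?thesis by simp
    next
      case False
      have "cmod (of_real w * psi l x - b1 * cis (l * x) - b2 * cis (- (l * x))) \<le> cmod (of_real w * psi l x) + cmod (b1 * cis (l * x)) + cmod (b2 * cis (- (l * x)))"
        using norm_triangle_ineq4[of "of_real w * psi l x - b1 * cis (l * x)" "b2 * cis (- (l * x))"] norm_triangle_ineq4[of "of_real w * psi l x" "b1 * cis (l * x)"] by linarith
      also have "\<dots> \<le> c + (2 * c + c * CQ) / 2 + (2 * c + c * CQ) / 2"
        using ps[OF x] nb w by (intro add_mono) (auto simp: norm_mult)
      also have "\<dots> \<le> C" using c CQ_nonneg by (simp add: C_def)
      finally show ?thesis using False l x by (simp add: min_def field_simps)
    qed
    then show ?thesis using nb le unfolding w_def by (metis order_trans)
  qed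
  then show ?thesis using C by blast
qed

end

subsection \<open>Plancherel's inequality and Schur's test on the line\<close>

text \<open>Measurability suffices: the Bochner integral of a function that is not integrable is
  0.\<close>

lemma norm_integral_le_nn_integral:
  fixes f :: "'a \<Rightarrow> complex"
  assumes [measurable]: "f \<in> borel_measurable M"
  shows "ennreal (cmod (integral\<^sup>L M f)) \<le> (\<integral>\<^sup>+x. ennreal (cmod (f x)) \<partial>M)"
proof (cases "integrable M f")
  case True then show ?thesis by (rule integral_norm_bound_ennreal)
qed (simp add: not_integrable_integral_eq)

text \<open>The kernel min(1, 1/(lx)) depends on the product lx only, so Schur's test with the
  homogeneous test function x^(-1/2) applies on both sides. The constant 16 is the square of
  4.\<close>

lemma schur_test_min_kernel:
  fixes H :: "real \<Rightarrow> real"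
  assumes [measurable]: "H \<in> borel_measurable borel" and H: "\<And>x. H x \<ge> 0"
  shows "(\<integral>\<^sup>+l\<in>{0<..}. (\<integral>\<^sup>+x\<in>{0<..}. ennreal (H x * min 1 (1 / (l * x))) \<partial>lborel)\<^sup>2 \<partial>lborel)
     \<le> 16 * (\<integral>\<^sup>+x\<in>{0<..}. ennreal ((H x)\<^sup>2) \<partial>lborel)"
proof -
  define k where "k s = min 1 (1 / s)" for s :: real
  have [measurable]: "k \<in> borel_measurable borel" unfolding k_def by measurable
  have k0: "k s \<ge> 0" if "s > 0" for s using that by (simp add: k_def)
  \<comment> \<open>The constant 4 is 2 + 2: the kernel is 1 up to 1/l and 1/(lx) beyond, and each
    range contributes 2 l^(-1/2).\<close>
  have I: "(\<integral>\<^sup>+x\<in>{0<..}. ennreal (k (l * x) * x powr (-1/2)) \<partial>lborel) \<le> ennreal (4 * l powr (-1/2))" if l: "l > 0" for l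
  proof -
    have "(\<integral>\<^sup>+x\<in>{0<..}. ennreal (k (l * x) * x powr (-1/2)) \<partial>lborel)
        \<le> (\<integral>\<^sup>+x\<in>{0..1/l}. ennreal (x powr (-1/2)) \<partial>lborel) + (\<integral>\<^sup>+x\<in>{1/l..}. ennreal (x powr (-3/2) / l) \<partial>lborel)"
    proof (subst nn_integral_add[symmetric])
      show "(\<integral>\<^sup>+x\<in>{0<..}. ennreal (k (l * x) * x powr (-1/2)) \<partial>lborel)
        \<le> (\<integral>\<^sup>+x. ennreal (x powr (-1/2)) * indicator {0..1/l} x + ennreal (x powr (-3/2) / l) * indicator {1/l..} x \<partial>lborel)"
      proof (intro nn_integral_mono)
        fix x :: real
        show "ennreal (k (l * x) * x powr (-1/2)) * indicator {0<..} x \<le> ennreal (x powr (-1/2)) * indicator {0..1/l} x + ennreal (x powr (-3/2) / l) * indicator {1/l..} x"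
        proof (cases "x > 0")
          case x: True
          show ?thesis
          proof (cases "x \<le> 1/l")
            case True
            have "k (l * x) * x powr (-1/2) \<le> 1 * x powr (-1/2)" by (intro mult_right_mono) (auto simp: k_def)
            then have "ennreal (k (l * x) * x powr (-1/2)) \<le> ennreal (x powr (-1/2))" by (intro ennreal_leI) simp
            then show ?thesis using True x by (simp add: indicator_def add_increasing2)
          next
            case False
            have e1: "x powr (-1) = 1 / x" using x by (simp add: powr_minus_divide)
            have e3: "x powr (-3/2) = x powr (-1/2) * (1 / x)" using powr_add[of x "-1/2" "-1"] unfolding e1 by simp
            have "k (l * x) * x powr (-1/2) \<le> (1 / (l * x)) * x powr (-1/2)"
              by (intro mult_right_mono) (auto simp: k_def)
            also have "\<dots> = x powr (-3/2) / l" unfolding e3 by simp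
            finally have "k (l * x) * x powr (-1/2) \<le> x powr (-3/2) / l" .
            then have "ennreal (k (l * x) * x powr (-1/2)) \<le> ennreal (x powr (-3/2) / l)" by (intro ennreal_leI)
            then show ?thesis using False x by (simp add: indicator_def)
          qed
        qed simp
      qed
    qed auto
    also have "(\<integral>\<^sup>+x\<in>{0..1/l}. ennreal (x powr (-1/2)) \<partial>lborel) = ennreal (2 * l powr (-1/2))"
    proof -
      have "((\<lambda>x. x powr (-1/2)) has_integral (1/l) powr (-1/2 + 1) / (-1/2 + 1)) {0..1/l}"
        using l by (intro has_integral_powr_from_0) auto
      moreover have "(1/l) powr (-1/2 + 1) / (-1/2 + 1) = 2 * l powr (-1/2)"
        using l by (simp add: powr_divide powr_minus_divide)
      ultimately have "((\<lambda>x. x powr (-1/2)) has_integral (2 * l powr (-1/2))) {0..1/l}" by (simp only:)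
      then show ?thesis by (intro nn_integral_has_integral_lebesgue') (use l in \<open>auto intro!: divide_nonneg_pos\<close>)
    qed
    also have "(\<integral>\<^sup>+x\<in>{1/l..}. ennreal (x powr (-3/2) / l) \<partial>lborel) = ennreal (2 * l powr (-1/2))"
    proof -
      have "((\<lambda>x. x powr (-3/2)) has_integral -((1/l) powr (-3/2 + 1)) / (-3/2 + 1)) {1/l..}"
        using l by (intro has_integral_powr_to_inf) auto
      then have "((\<lambda>x. x powr (-3/2) / l) has_integral (-((1/l) powr (-3/2 + 1)) / (-3/2 + 1)) / l) {1/l..}"
        by (rule has_integral_divide)
      moreover have "(-((1/l) powr (-3/2 + 1)) / (-3/2 + 1)) / l = 2 * l powr (-1/2)"
      proof -
        have "(1/l) powr (-1/2) = l powr (1/2)" using l by (simp add: powr_divide powr_minus_divide)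
        then have "(-((1/l) powr (-3/2 + 1)) / (-3/2 + 1)) / l = 2 * (l powr (1/2) / l)" by simp
        also have "l powr (1/2) / l = l powr (-1/2)" using l powr_diff[of l "1/2" 1] by simp
        finally show ?thesis .
      qed
      ultimately have "((\<lambda>x. x powr (-3/2) / l) has_integral (2 * l powr (-1/2))) {1/l..}" by (simp only:)
      then show ?thesis by (intro nn_integral_has_integral_lebesgue') (use l in \<open>auto intro!: divide_nonneg_pos\<close>)
    qed
    also have "ennreal (2 * l powr (-1/2)) + ennreal (2 * l powr (-1/2)) = ennreal (4 * l powr (-1/2))"
      by (simp flip: ennreal_plus)
    finally show ?thesis .
  qed
  have step: "(\<integral>\<^sup>+x\<in>{0<..}. ennreal (H x * k (l * x)) \<partial>lborel)\<^sup>2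
     \<le> ennreal (4 * l powr (-1/2)) * (\<integral>\<^sup>+x\<in>{0<..}. ennreal ((H x)\<^sup>2 * (k (l * x) * x powr (1/2))) \<partial>lborel)" if l: "l > 0" for l
  proof -
    define f where "f x = ennreal (sqrt (k (l * x) * x powr (-1/2))) * indicator {0<..} x" for x
    define g where "g x = ennreal (H x * sqrt (k (l * x) * x powr (1/2))) * indicator {0<..} x" for x
    have [measurable]: "f \<in> borel_measurable borel" "g \<in> borel_measurable borel"
      unfolding f_def g_def by measurable
    have "(\<integral>\<^sup>+x. f x * g x \<partial>lborel)\<^sup>2 \<le> (\<integral>\<^sup>+x. f x ^ 2 \<partial>lborel) * (\<integral>\<^sup>+x. g x ^ 2 \<partial>lborel)"
      by (rule Cauchy_Schwarz_nn_integral) auto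
    moreover have "f x * g x = ennreal (H x * k (l * x)) * indicator {0<..} x" for x
    proof (cases "x > 0")
      case True
      have "sqrt (k (l * x) * x powr (-1/2)) * sqrt (k (l * x) * x powr (1/2)) = k (l * x)"
        using True k0[of "l * x"] l
        by (simp add: real_sqrt_mult[symmetric] powr_minus field_simps)
      then show ?thesis using True H[of x] k0[of "l*x"] l
        by (simp add: f_def g_def ennreal_mult'[symmetric] mult_ac)
    qed (simp add: f_def)
    moreover have "f x ^ 2 = ennreal (k (l * x) * x powr (-1/2)) * indicator {0<..} x" for x
      using k0[of "l*x"] l by (cases "x > 0") (auto simp: f_def ennreal_power)
    moreover have "g x ^ 2 = ennreal ((H x)\<^sup>2 * (k (l * x) * x powr (1/2))) * indicator {0<..} x" for x
      using k0[of "l*x"] l H[of x] by (cases "x > 0") (auto simp: g_def ennreal_power power_mult_distrib)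
    ultimately have "(\<integral>\<^sup>+x\<in>{0<..}. ennreal (H x * k (l * x)) \<partial>lborel)\<^sup>2
      \<le> (\<integral>\<^sup>+x\<in>{0<..}. ennreal (k (l * x) * x powr (-1/2)) \<partial>lborel) * (\<integral>\<^sup>+x\<in>{0<..}. ennreal ((H x)\<^sup>2 * (k (l * x) * x powr (1/2))) \<partial>lborel)"
      by simp
    also have "\<dots> \<le> ennreal (4 * l powr (-1/2)) * (\<integral>\<^sup>+x\<in>{0<..}. ennreal ((H x)\<^sup>2 * (k (l * x) * x powr (1/2))) \<partial>lborel)"
      by (intro mult_right_mono I[OF l]) auto
    finally show ?thesis .
  qed
  have "(\<integral>\<^sup>+l\<in>{0<..}. (\<integral>\<^sup>+x\<in>{0<..}. ennreal (H x * k (l * x)) \<partial>lborel)\<^sup>2 \<partial>lborel)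
     \<le> (\<integral>\<^sup>+l. (\<integral>\<^sup>+x. ennreal (4 * ((H x)\<^sup>2 * x powr (1/2))) * indicator {0<..} x * (ennreal (k (x * l) * l powr (-1/2)) * indicator {0<..} l) \<partial>lborel) \<partial>lborel)"
  proof (intro nn_integral_mono)
    fix l :: real
    show "(\<integral>\<^sup>+x\<in>{0<..}. ennreal (H x * k (l * x)) \<partial>lborel)\<^sup>2 * indicator {0<..} l
       \<le> (\<integral>\<^sup>+x. ennreal (4 * ((H x)\<^sup>2 * x powr (1/2))) * indicator {0<..} x * (ennreal (k (x * l) * l powr (-1/2)) * indicator {0<..} l) \<partial>lborel)"
    proof (cases "l > 0")
      case True
      have "ennreal (4 * l powr (-1/2)) * (\<integral>\<^sup>+x\<in>{0<..}. ennreal ((H x)\<^sup>2 * (k (l * x) * x powr (1/2))) \<partial>lborel)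
        = (\<integral>\<^sup>+x. ennreal (4 * l powr (-1/2)) * (ennreal ((H x)\<^sup>2 * (k (l * x) * x powr (1/2))) * indicator {0<..} x) \<partial>lborel)"
        by (rule nn_integral_cmult[symmetric]) auto
      also have "\<dots> = (\<integral>\<^sup>+x. ennreal (4 * ((H x)\<^sup>2 * x powr (1/2))) * indicator {0<..} x * (ennreal (k (x * l) * l powr (-1/2)) * indicator {0<..} l) \<partial>lborel)"
      proof (intro nn_integral_cong)
        fix x :: real
        show "ennreal (4 * l powr (-1/2)) * (ennreal ((H x)\<^sup>2 * (k (l * x) * x powr (1/2))) * indicator {0<..} x)
          = ennreal (4 * ((H x)\<^sup>2 * x powr (1/2))) * indicator {0<..} x * (ennreal (k (x * l) * l powr (-1/2)) * indicator {0<..} l)"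
          using True k0[of "l*x"] by (cases "x > 0") (auto simp: ennreal_mult'[symmetric] ennreal_mult''[symmetric] mult_ac)
      qed
      finally show ?thesis using step[OF True] True by simp
    qed simp
  qed
  also have "\<dots> = (\<integral>\<^sup>+x. (\<integral>\<^sup>+l. ennreal (4 * ((H x)\<^sup>2 * x powr (1/2))) * indicator {0<..} x * (ennreal (k (x * l) * l powr (-1/2)) * indicator {0<..} l) \<partial>lborel) \<partial>lborel)"
    by (rule lborel_pair.Fubini') measurable
  also have "\<dots> = (\<integral>\<^sup>+x. ennreal (4 * ((H x)\<^sup>2 * x powr (1/2))) * indicator {0<..} x * (\<integral>\<^sup>+l\<in>{0<..}. ennreal (k (x * l) * l powr (-1/2)) \<partial>lborel) \<partial>lborel)"
    by (intro nn_integral_cong nn_integral_cmult) measurable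
  also have "\<dots> \<le> (\<integral>\<^sup>+x. 16 * (ennreal ((H x)\<^sup>2) * indicator {0<..} x) \<partial>lborel)"
  proof (intro nn_integral_mono)
    fix x :: real
    show "ennreal (4 * ((H x)\<^sup>2 * x powr (1/2))) * indicator {0<..} x * (\<integral>\<^sup>+l\<in>{0<..}. ennreal (k (x * l) * l powr (-1/2)) \<partial>lborel) \<le> 16 * (ennreal ((H x)\<^sup>2) * indicator {0<..} x)"
    proof (cases "x > 0")
      case True
      have "ennreal (4 * ((H x)\<^sup>2 * x powr (1/2))) * (\<integral>\<^sup>+l\<in>{0<..}. ennreal (k (x * l) * l powr (-1/2)) \<partial>lborel)
        \<le> ennreal (4 * ((H x)\<^sup>2 * x powr (1/2))) * ennreal (4 * x powr (-1/2))"
        by (intro mult_left_mono I[OF True]) auto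
      also have "\<dots> = ennreal (16 * (H x)\<^sup>2)"
        using True by (simp add: ennreal_mult'[symmetric] powr_minus field_simps)
      also have "\<dots> = 16 * ennreal ((H x)\<^sup>2)" by (simp add: ennreal_mult')
      finally show ?thesis using True by simp
    qed simp
  qed
  also have "\<dots> = 16 * (\<integral>\<^sup>+x\<in>{0<..}. ennreal ((H x)\<^sup>2) \<partial>lborel)"
    by (rule nn_integral_cmult) auto
  finally show ?thesis by (simp add: k_def)
qed

text \<open>|F|^2 is integrated against a normal density of width \<sigma>. By Fubini this becomes a
  double integral of H(x) times the conjugate of H(y) against a Gaussian in x - y, whose mass
  compensates the normalisation; then \<sigma> tends to infinity by Fatou's lemma.\<close>

lemma plancherel_inequality:
  fixes H :: "real \<Rightarrow> complex"
  assumes H: "integrable lborel H"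
  shows "(\<integral>\<^sup>+l. ennreal ((cmod (LINT x|lborel. H x * cis (l * x)))\<^sup>2) \<partial>lborel)
     \<le> ennreal (2 * pi) * (\<integral>\<^sup>+x. ennreal ((cmod (H x))\<^sup>2) \<partial>lborel)"
proof -
  have [measurable]: "H \<in> borel_measurable borel" using H by auto
  have [measurable]: "cis \<in> borel_measurable borel" "cnj \<in> borel_measurable borel"
    by (intro borel_measurable_continuous_onI continuous_intros)+
  define F where "F l = (LINT x|lborel. H x * cis (l * x))" for l
  have [measurable]: "F \<in> borel_measurable borel" unfolding F_def by measurable
  define K where "K = (LINT x|lborel. cmod (H x))"
  have F_le: "cmod (F l) \<le> K" for l
    unfolding F_def K_def by (rule order_trans[OF integral_norm_bound]) (simp add: norm_mult)
  have K0: "K \<ge> 0" unfolding K_def by simp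
  define S where "S = std_normal_distribution"
  interpret S: real_distribution S unfolding S_def by (rule real_dist_normal_dist)
  interpret SL: pair_sigma_finite S lborel ..
  have sS [measurable_cong]: "sets S = sets borel" by simp
  define Ft where "Ft H = (\<integral>\<^sup>+x. ennreal ((cmod (H x))\<^sup>2) \<partial>lborel)" for H :: "real \<Rightarrow> complex"
  have main: "ennreal (\<sigma> * sqrt (2 * pi)) * (\<integral>\<^sup>+m. ennreal ((cmod (F (\<sigma> * m)))\<^sup>2) \<partial>S) \<le> ennreal (2 * pi) * Ft H" if \<sigma>: "\<sigma> > 0" for \<sigma> :: real
  proof -
    have Hint: "integrable lborel (\<lambda>x. H x * cis (t * x))" for t
      by (rule Bochner_Integration.integrable_bound[OF H]) (auto simp: norm_mult)
    have int1: "integrable (S \<Otimes>\<^sub>M lborel) (\<lambda>(m, x). H x * cis (\<sigma> * m * x) * cnj (F (\<sigma> * m)))"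
    proof (rule SL.Fubini_integrable)
      show "integrable S (\<lambda>m. LINT x|lborel. cmod (case (m, x) of (m, x) \<Rightarrow> H x * cis (\<sigma> * m * x) * cnj (F (\<sigma> * m))))"
      proof (rule S.integrable_const_bound[where B = "K * K"])
        show "AE m in S. norm (LINT x|lborel. cmod (case (m, x) of (m, x) \<Rightarrow> H x * cis (\<sigma> * m * x) * cnj (F (\<sigma> * m)))) \<le> K * K"
        proof (rule AE_I2)
          fix m
          have "(LINT x|lborel. cmod (case (m, x) of (m, x) \<Rightarrow> H x * cis (\<sigma> * m * x) * cnj (F (\<sigma> * m)))) = K * cmod (F (\<sigma> * m))"
            by (simp add: norm_mult K_def)
          then show "norm (LINT x|lborel. cmod (case (m, x) of (m, x) \<Rightarrow> H x * cis (\<sigma> * m * x) * cnj (F (\<sigma> * m)))) \<le> K * K"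
            using F_le[of "\<sigma> * m"] K0 by (simp add: abs_mult mult_left_mono)
        qed
      qed measurable
      show "AE m in S. integrable lborel (\<lambda>x. case (m, x) of (m, x) \<Rightarrow> H x * cis (\<sigma> * m * x) * cnj (F (\<sigma> * m)))"
        using Hint by (auto intro!: AE_I2)
    qed measurable
    have int2: "integrable (S \<Otimes>\<^sub>M lborel) (\<lambda>(m, y). cis (\<sigma> * (x - y) * m) * cnj (H y))" for x
    proof (rule SL.Fubini_integrable)
      show "integrable S (\<lambda>m. LINT y|lborel. cmod (case (m, y) of (m, y) \<Rightarrow> cis (\<sigma> * (x - y) * m) * cnj (H y)))"
        by (rule S.integrable_const_bound[where B = K]) (auto simp: norm_mult K_def intro!: AE_I2)
      show "AE m in S. integrable lborel (\<lambda>y. case (m, y) of (m, y) \<Rightarrow> cis (\<sigma> * (x - y) * m) * cnj (H y))"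
      proof (rule AE_I2)
        fix m show "integrable lborel (\<lambda>y. case (m, y) of (m, y) \<Rightarrow> cis (\<sigma> * (x - y) * m) * cnj (H y))"
          by (rule Bochner_Integration.integrable_bound[OF H]) (auto simp: norm_mult)
      qed
    qed measurable
    \<comment> \<open>The characteristic function of the normal law turns the average over m into
      the Gaussian kernel.\<close>
    have ch: "(LINT m|S. cis (t * m)) = of_real (exp (- (t\<^sup>2) / 2))" for t
      using char_std_normal_distribution unfolding char_def S_def cis_conv_exp by (metis of_real_mult)
    define J where "J x = (LINT y|lborel. of_real (exp (- ((\<sigma> * (x - y))\<^sup>2) / 2)) * cnj (H y))" for x
    have "(LINT m|S. F (\<sigma> * m) * cnj (F (\<sigma> * m))) = (LINT m|S. LINT x|lborel. H x * cis (\<sigma> * m * x) * cnj (F (\<sigma> * m)))"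
      by (simp add: F_def Hint)
    also have "\<dots> = (LINT x|lborel. LINT m|S. H x * cis (\<sigma> * m * x) * cnj (F (\<sigma> * m)))"
      using SL.Fubini_integral[OF int1] by simp
    also have "\<dots> = (LINT x|lborel. H x * J x)"
    proof (rule Bochner_Integration.integral_cong[OF refl])
      fix x
      have "(LINT m|S. H x * cis (\<sigma> * m * x) * cnj (F (\<sigma> * m))) = H x * (LINT m|S. cis (\<sigma> * m * x) * cnj (F (\<sigma> * m)))"
        by (subst integral_mult_right_zero[symmetric]) (simp only: mult.assoc)
      also have "(LINT m|S. cis (\<sigma> * m * x) * cnj (F (\<sigma> * m))) = (LINT m|S. LINT y|lborel. cis (\<sigma> * (x - y) * m) * cnj (H y))"
      proof (rule Bochner_Integration.integral_cong[OF refl])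
        fix m
        have "cis (\<sigma> * m * x) * cnj (F (\<sigma> * m)) = cis (\<sigma> * m * x) * (LINT y|lborel. cnj (H y * cis (\<sigma> * m * y)))"
          by (simp add: F_def del: complex_cnj_mult)
        also have "\<dots> = (LINT y|lborel. cis (\<sigma> * m * x) * cnj (H y * cis (\<sigma> * m * y)))" by simp
        also have "\<dots> = (LINT y|lborel. cis (\<sigma> * (x - y) * m) * cnj (H y))"
        proof (rule Bochner_Integration.integral_cong[OF refl])
          fix y
          have "cis (\<sigma> * (x - y) * m) = cis (\<sigma> * m * x) * cis (- (\<sigma> * m * y))" by (simp add: cis_mult algebra_simps)
          then show "cis (\<sigma> * m * x) * cnj (H y * cis (\<sigma> * m * y)) = cis (\<sigma> * (x - y) * m) * cnj (H y)"
            by (simp add: cis_cnj)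
        qed
        finally show "cis (\<sigma> * m * x) * cnj (F (\<sigma> * m)) = (LINT y|lborel. cis (\<sigma> * (x - y) * m) * cnj (H y))" .
      qed
      also have "\<dots> = (LINT y|lborel. LINT m|S. cis (\<sigma> * (x - y) * m) * cnj (H y))"
        using SL.Fubini_integral[OF int2] by simp
      also have "\<dots> = J x" by (simp add: ch J_def)
      finally show "(LINT m|S. H x * cis (\<sigma> * m * x) * cnj (F (\<sigma> * m))) = H x * J x" .
    qed
    finally have eq: "(LINT m|S. F (\<sigma> * m) * cnj (F (\<sigma> * m))) = (LINT x|lborel. H x * J x)" .
    have [measurable]: "J \<in> borel_measurable borel" unfolding J_def by measurable
    have intF: "integrable S (\<lambda>m. (cmod (F (\<sigma> * m)))\<^sup>2)"
      by (rule S.integrable_const_bound[where B = "K\<^sup>2"]) (auto intro!: AE_I2 power_mono F_le)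
    have "(\<integral>\<^sup>+m. ennreal ((cmod (F (\<sigma> * m)))\<^sup>2) \<partial>S) = ennreal (LINT m|S. (cmod (F (\<sigma> * m)))\<^sup>2)"
      by (rule nn_integral_eq_integral[OF intF]) simp
    also have "(LINT m|S. (cmod (F (\<sigma> * m)))\<^sup>2) = cmod (of_real (LINT m|S. (cmod (F (\<sigma> * m)))\<^sup>2))"
      by (simp add: norm_of_real)
    also have "of_real (LINT m|S. (cmod (F (\<sigma> * m)))\<^sup>2) = (LINT x|lborel. H x * J x)"
      unfolding eq[symmetric] integral_complex_of_real[symmetric] by (simp only: complex_norm_square)
    also have "ennreal (cmod (LINT x|lborel. H x * J x)) \<le> (\<integral>\<^sup>+x. ennreal (cmod (H x * J x)) \<partial>lborel)"
      by (rule norm_integral_le_nn_integral) measurable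
    also have "\<dots> \<le> (\<integral>\<^sup>+x. ennreal (cmod (H x)) * (\<integral>\<^sup>+y. ennreal (exp (- ((\<sigma> * (x - y))\<^sup>2) / 2) * cmod (H y)) \<partial>lborel) \<partial>lborel)"
    proof (intro nn_integral_mono)
      fix x
      have "ennreal (cmod (J x)) \<le> (\<integral>\<^sup>+y. ennreal (cmod (of_real (exp (- ((\<sigma> * (x - y))\<^sup>2) / 2)) * cnj (H y))) \<partial>lborel)"
        unfolding J_def by (rule norm_integral_le_nn_integral) measurable
      also have "\<dots> = (\<integral>\<^sup>+y. ennreal (exp (- ((\<sigma> * (x - y))\<^sup>2) / 2) * cmod (H y)) \<partial>lborel)"
        by (simp add: norm_mult)
      finally show "ennreal (cmod (H x * J x)) \<le> ennreal (cmod (H x)) * (\<integral>\<^sup>+y. ennreal (exp (- ((\<sigma> * (x - y))\<^sup>2) / 2) * cmod (H y)) \<partial>lborel)"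
        by (simp add: norm_mult ennreal_mult mult_left_mono)
    qed
    also have "\<dots> = (\<integral>\<^sup>+x. (\<integral>\<^sup>+y. ennreal (cmod (H x) * (exp (- ((\<sigma> * (x - y))\<^sup>2) / 2) * cmod (H y))) \<partial>lborel) \<partial>lborel)"
      by (subst nn_integral_cmult[symmetric]) (auto simp: ennreal_mult)
    \<comment> \<open>Bounding |H(x)| |H(y)| by half the sum of squares leaves, by symmetry of the
      kernel, its one-variable mass sqrt(2\<pi>)/\<sigma> times the L^2 norm squared.\<close>
    also have "\<dots> \<le> (\<integral>\<^sup>+x. (\<integral>\<^sup>+y. ennreal (exp (- ((\<sigma> * (x - y))\<^sup>2) / 2) * ((cmod (H x))\<^sup>2 / 2)) + ennreal (exp (- ((\<sigma> * (x - y))\<^sup>2) / 2) * ((cmod (H y))\<^sup>2 / 2)) \<partial>lborel) \<partial>lborel)"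
    proof (intro nn_integral_mono)
      fix x y
      have "cmod (H x) * cmod (H y) \<le> (cmod (H x))\<^sup>2 / 2 + (cmod (H y))\<^sup>2 / 2"
        using sum_squares_bound[of "cmod (H x)" "cmod (H y)"] by simp
      then have "exp (- ((\<sigma> * (x - y))\<^sup>2) / 2) * (cmod (H x) * cmod (H y)) \<le> exp (- ((\<sigma> * (x - y))\<^sup>2) / 2) * ((cmod (H x))\<^sup>2 / 2 + (cmod (H y))\<^sup>2 / 2)"
        by (intro mult_left_mono) auto
      then show "ennreal (cmod (H x) * (exp (- ((\<sigma> * (x - y))\<^sup>2) / 2) * cmod (H y))) \<le> ennreal (exp (- ((\<sigma> * (x - y))\<^sup>2) / 2) * ((cmod (H x))\<^sup>2 / 2)) + ennreal (exp (- ((\<sigma> * (x - y))\<^sup>2) / 2) * ((cmod (H y))\<^sup>2 / 2))"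
        by (subst ennreal_plus[symmetric]) (auto simp: distrib_left mult_ac simp del: ennreal_plus intro!: ennreal_leI)
    qed
    also have "\<dots> = (\<integral>\<^sup>+x. (\<integral>\<^sup>+y. ennreal (exp (- ((\<sigma> * (x - y))\<^sup>2) / 2) * ((cmod (H x))\<^sup>2 / 2)) \<partial>lborel) \<partial>lborel)
        + (\<integral>\<^sup>+x. (\<integral>\<^sup>+y. ennreal (exp (- ((\<sigma> * (x - y))\<^sup>2) / 2) * ((cmod (H y))\<^sup>2 / 2)) \<partial>lborel) \<partial>lborel)"
      by (simp add: nn_integral_add)
    also have "(\<integral>\<^sup>+x. (\<integral>\<^sup>+y. ennreal (exp (- ((\<sigma> * (x - y))\<^sup>2) / 2) * ((cmod (H y))\<^sup>2 / 2)) \<partial>lborel) \<partial>lborel)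
       = (\<integral>\<^sup>+x. (\<integral>\<^sup>+y. ennreal (exp (- ((\<sigma> * (x - y))\<^sup>2) / 2) * ((cmod (H x))\<^sup>2 / 2)) \<partial>lborel) \<partial>lborel)"
    proof -
      have "(\<integral>\<^sup>+x. (\<integral>\<^sup>+y. ennreal (exp (- ((\<sigma> * (x - y))\<^sup>2) / 2) * ((cmod (H y))\<^sup>2 / 2)) \<partial>lborel) \<partial>lborel)
        = (\<integral>\<^sup>+y. (\<integral>\<^sup>+x. ennreal (exp (- ((\<sigma> * (x - y))\<^sup>2) / 2) * ((cmod (H y))\<^sup>2 / 2)) \<partial>lborel) \<partial>lborel)"
        by (rule lborel_pair.Fubini') measurable
      also have "\<dots> = (\<integral>\<^sup>+x. (\<integral>\<^sup>+y. ennreal (exp (- ((\<sigma> * (x - y))\<^sup>2) / 2) * ((cmod (H x))\<^sup>2 / 2)) \<partial>lborel) \<partial>lborel)"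
        by (simp add: power_mult_distrib power2_commute)
      finally show ?thesis .
    qed
    also have "(\<integral>\<^sup>+x. (\<integral>\<^sup>+y. ennreal (exp (- ((\<sigma> * (x - y))\<^sup>2) / 2) * ((cmod (H x))\<^sup>2 / 2)) \<partial>lborel) \<partial>lborel)
        = (\<integral>\<^sup>+x. ennreal (sqrt (2 * pi) / \<sigma> / 2) * ennreal ((cmod (H x))\<^sup>2) \<partial>lborel)"
    proof (intro nn_integral_cong)
      fix x
      have "(\<integral>\<^sup>+y. ennreal (exp (- ((\<sigma> * (x - y))\<^sup>2) / 2)) \<partial>lborel)
         = \<bar>1/\<sigma>\<bar> * (\<integral>\<^sup>+y. ennreal (exp (- ((\<sigma> * (x - (x + (1/\<sigma>) * y)))\<^sup>2) / 2)) \<partial>lborel)"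
        using \<sigma> by (intro nn_integral_real_affine) auto
      also have "(\<integral>\<^sup>+y. ennreal (exp (- ((\<sigma> * (x - (x + (1/\<sigma>) * y)))\<^sup>2) / 2)) \<partial>lborel) = (\<integral>\<^sup>+y. ennreal (sqrt (2 * pi)) * ennreal (std_normal_density y) \<partial>lborel)"
        using \<sigma> by (intro nn_integral_cong) (simp add: normal_density_def ennreal_mult'[symmetric])
      also have "\<dots> = ennreal (sqrt (2 * pi)) * (\<integral>\<^sup>+y. ennreal (std_normal_density y) \<partial>lborel)"
        by (rule nn_integral_cmult) simp
      also have "(\<integral>\<^sup>+y. ennreal (std_normal_density y) \<partial>lborel) = 1"
        using prob_space.emeasure_space_1[OF prob_space_normal_density[of 1 0]] by (simp add: emeasure_density)
      finally have "(\<integral>\<^sup>+y. ennreal (exp (- ((\<sigma> * (x - y))\<^sup>2) / 2)) \<partial>lborel) = ennreal (sqrt (2 * pi) / \<sigma>)"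
        using \<sigma> by (simp add: ennreal_mult'[symmetric])
      then show "(\<integral>\<^sup>+y. ennreal (exp (- ((\<sigma> * (x - y))\<^sup>2) / 2) * ((cmod (H x))\<^sup>2 / 2)) \<partial>lborel) = ennreal (sqrt (2 * pi) / \<sigma> / 2) * ennreal ((cmod (H x))\<^sup>2)"
        using \<sigma> by (simp add: ennreal_mult nn_integral_multc del: times_divide_eq_right times_divide_eq_left) (simp add: ennreal_mult''[symmetric])
    qed
    also have "\<dots> = ennreal (sqrt (2 * pi) / \<sigma> / 2) * Ft H" unfolding Ft_def by (rule nn_integral_cmult) measurable
    also have "\<dots> + \<dots> = ennreal (sqrt (2 * pi) / \<sigma>) * Ft H"
      using \<sigma> by (simp add: distrib_right[symmetric] ennreal_plus[symmetric] del: ennreal_plus)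
    finally have "(\<integral>\<^sup>+m. ennreal ((cmod (F (\<sigma> * m)))\<^sup>2) \<partial>S) \<le> ennreal (sqrt (2 * pi) / \<sigma>) * Ft H" .
    then have "ennreal (\<sigma> * sqrt (2 * pi)) * (\<integral>\<^sup>+m. ennreal ((cmod (F (\<sigma> * m)))\<^sup>2) \<partial>S) \<le> ennreal (\<sigma> * sqrt (2 * pi)) * (ennreal (sqrt (2 * pi) / \<sigma>) * Ft H)"
      by (intro mult_left_mono) auto
    also have "\<dots> = ennreal (2 * pi) * Ft H"
      using \<sigma> by (simp add: mult.assoc[symmetric] ennreal_mult'[symmetric])
    finally show ?thesis .
  qed
  have reg: "(\<integral>\<^sup>+l. ennreal (exp (- ((l / real (Suc n))\<^sup>2) / 2) * (cmod (F l))\<^sup>2) \<partial>lborel) \<le> ennreal (2 * pi) * Ft H" for n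
  proof -
    define \<sigma> where "\<sigma> = real (Suc n)"
    have \<sigma>: "\<sigma> > 0" by (simp add: \<sigma>_def)
    have "(\<integral>\<^sup>+l. ennreal (exp (- ((l / \<sigma>)\<^sup>2) / 2) * (cmod (F l))\<^sup>2) \<partial>lborel)
      = \<bar>\<sigma>\<bar> * (\<integral>\<^sup>+l. ennreal (exp (- (((0 + \<sigma> * l) / \<sigma>)\<^sup>2) / 2) * (cmod (F (0 + \<sigma> * l)))\<^sup>2) \<partial>lborel)"
      using \<sigma> by (intro nn_integral_real_affine) auto
    also have "\<dots> = ennreal \<sigma> * (\<integral>\<^sup>+l. ennreal (sqrt (2 * pi)) * (ennreal (std_normal_density l) * ennreal ((cmod (F (\<sigma> * l)))\<^sup>2)) \<partial>lborel)"
      using \<sigma> by (intro arg_cong2[where f = "(*)"] nn_integral_cong)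
        (auto simp: normal_density_def ennreal_mult'[symmetric] ennreal_mult''[symmetric])
    also have "\<dots> = ennreal \<sigma> * (ennreal (sqrt (2 * pi)) * (\<integral>\<^sup>+l. ennreal (std_normal_density l) * ennreal ((cmod (F (\<sigma> * l)))\<^sup>2) \<partial>lborel))"
      by (subst nn_integral_cmult) auto
    also have "(\<integral>\<^sup>+l. ennreal (std_normal_density l) * ennreal ((cmod (F (\<sigma> * l)))\<^sup>2) \<partial>lborel) = (\<integral>\<^sup>+m. ennreal ((cmod (F (\<sigma> * m)))\<^sup>2) \<partial>S)"
      unfolding S_def by (subst nn_integral_density) auto
    also have "ennreal \<sigma> * (ennreal (sqrt (2 * pi)) * (\<integral>\<^sup>+m. ennreal ((cmod (F (\<sigma> * m)))\<^sup>2) \<partial>S)) \<le> ennreal (2 * pi) * Ft H"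
      using main[OF \<sigma>] \<sigma> by (simp add: ennreal_mult mult.assoc)
    finally show ?thesis by (simp add: \<sigma>_def)
  qed
  have "(\<integral>\<^sup>+l. ennreal ((cmod (F l))\<^sup>2) \<partial>lborel) = (\<integral>\<^sup>+l. liminf (\<lambda>n. ennreal (exp (- ((l / real (Suc n))\<^sup>2) / 2) * (cmod (F l))\<^sup>2)) \<partial>lborel)"
  proof (intro nn_integral_cong)
    fix l
    have l0: "(\<lambda>n. l / real (Suc n)) \<longlonglongrightarrow> 0" by (rule LIMSEQ_Suc[OF lim_const_over_n])
    have "(\<lambda>n. exp (- ((l / real (Suc n))\<^sup>2) / 2)) \<longlonglongrightarrow> exp (- (0\<^sup>2) / 2)"
      by (intro tendsto_intros l0) auto
    then have "(\<lambda>n. ennreal (exp (- ((l / real (Suc n))\<^sup>2) / 2) * (cmod (F l))\<^sup>2)) \<longlonglongrightarrow> ennreal (exp (- (0\<^sup>2) / 2) * (cmod (F l))\<^sup>2)"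
      by (intro tendsto_ennrealI tendsto_mult_right)
    then show "ennreal ((cmod (F l))\<^sup>2) = liminf (\<lambda>n. ennreal (exp (- ((l / real (Suc n))\<^sup>2) / 2) * (cmod (F l))\<^sup>2))"
      using lim_imp_Liminf[OF sequentially_bot] by fastforce
  qed
  also have "\<dots> \<le> liminf (\<lambda>n. \<integral>\<^sup>+l. ennreal (exp (- ((l / real (Suc n))\<^sup>2) / 2) * (cmod (F l))\<^sup>2) \<partial>lborel)"
    by (rule nn_integral_liminf) measurable
  also have "\<dots> \<le> ennreal (2 * pi) * Ft H"
    by (intro Liminf_le always_eventually allI reg sequentially_bot)
  finally show ?thesis by (simp add: F_def Ft_def)
qed

subsection \<open>The Hausdorff--Young inequality by real interpolation\<close>

text \<open>Hoelder's inequality against the constant 1, from Young's inequality applied pointwise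
  to f/c. The measure is bounded by V and need not be normalised; the degenerate cases G = 0 and V =
  0 are separate because of the division.\<close>

lemma nn_integral_holder_const:
  fixes f :: "'a \<Rightarrow> real"
  assumes [measurable]: "f \<in> borel_measurable M" and f: "\<And>x. f x \<ge> 0"
    and q: "q > 1" and pq: "p > 1" "1 / p + 1 / q = 1"
    and G: "(\<integral>\<^sup>+x. ennreal (f x powr q) \<partial>M) \<le> ennreal G" and V: "emeasure M (space M) \<le> ennreal V"
    and GV: "G \<ge> 0" "V \<ge> 0"
  shows "(\<integral>\<^sup>+x. ennreal (f x) \<partial>M) \<le> ennreal (G powr (1/q) * V powr (1/p))"
proof (cases "G = 0 \<or> V = 0")
  case True
  then have "AE x in M. f x = 0"
  proof
    assume "G = 0"
    then have "(\<integral>\<^sup>+x. ennreal (f x powr q) \<partial>M) = 0" using G by simp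
    then have "AE x in M. ennreal (f x powr q) = 0" by (subst (asm) nn_integral_0_iff_AE) auto
    then show ?thesis using f by (auto elim!: eventually_mono)
  next
    assume "V = 0"
    then have "emeasure M (space M) = 0" using V by simp
    then show ?thesis by (intro AE_I[where N = "space M"]) auto
  qed
  then have "(\<integral>\<^sup>+x. ennreal (f x) \<partial>M) = 0"
    by (subst nn_integral_0_iff_AE) (auto elim!: eventually_mono)
  then show ?thesis by simp
next
  case False
  then have G0: "G > 0" and V0: "V > 0" using GV by auto
  \<comment> \<open>The scale at which the two terms of Young's inequality become c V / q and c V /
    p, so that they add up to c V.\<close>
  define c where "c = (G / V) powr (1 / q)"
  have c: "c > 0" using G0 V0 by (simp add: c_def)
  have cq: "c powr q = G / V" using q G0 V0 by (simp add: c_def powr_powr)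
  have "f x \<le> c / (q * c powr q) * f x powr q + c / p" for x
  proof -
    have "1 * (f x / c) \<le> 1 powr p / p + (f x / c) powr q / q"
      using f[of x] c q pq by (intro Youngs_inequality) auto
    then have "c * (f x / c) \<le> c * (1 / p + (f x / c) powr q / q)" using c by (intro mult_left_mono) auto
    then show ?thesis using c f[of x] by (simp add: powr_divide distrib_left add_ac mult_ac)
  qed
  then have "(\<integral>\<^sup>+x. ennreal (f x) \<partial>M) \<le> (\<integral>\<^sup>+x. ennreal (c / (q * c powr q)) * ennreal (f x powr q) + ennreal (c / p) \<partial>M)"
    using c q pq by (intro nn_integral_mono)
      (simp add: ennreal_mult'[symmetric] ennreal_plus[symmetric] ennreal_leI del: ennreal_plus)
  also have "\<dots> = ennreal (c / (q * c powr q)) * (\<integral>\<^sup>+x. ennreal (f x powr q) \<partial>M) + ennreal (c / p) * emeasure M (space M)"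
    by (subst nn_integral_add) (auto simp: nn_integral_cmult)
  also have "\<dots> \<le> ennreal (c / (q * c powr q)) * ennreal G + ennreal (c / p) * ennreal V"
    by (intro add_mono mult_left_mono G V) auto
  also have "\<dots> = ennreal (c / (q * c powr q) * G + c / p * V)"
    using c q pq G0 V0 by (simp add: ennreal_mult'[symmetric] ennreal_plus[symmetric] del: ennreal_plus)
  also have "c / (q * c powr q) * G + c / p * V = c * V * (1 / p + 1 / q)"
    unfolding cq using G0 V0 q pq(1) by (simp add: field_simps)
  also have "\<dots> = c * V" using pq by simp
  also have "c * V = G powr (1/q) * V powr (1/p)"
  proof -
    have "1 / p = 1 - 1 / q" using pq by simp
    then have "V powr (1/p) = V / V powr (1/q)" using V0 powr_diff[of V 1 "1/q"] by simp
    then show ?thesis using G0 V0 by (simp add: c_def powr_divide)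
  qed
  finally show ?thesis .
qed

text \<open>Jensen's inequality for the p-th power, as Hoelder's inequality with total mass V = 1.
  It covers f that is not integrable, with integral 0.\<close>

lemma prob_power_mean:
  fixes f :: "'a \<Rightarrow> complex"
  assumes "prob_space M" and [measurable]: "f \<in> borel_measurable M" and p: "p > 1"
  shows "ennreal (cmod (integral\<^sup>L M f) powr p) \<le> (\<integral>\<^sup>+x. ennreal (cmod (f x) powr p) \<partial>M)"
proof (cases "(\<integral>\<^sup>+x. ennreal (cmod (f x) powr p) \<partial>M) = \<infinity>")
  case False
  interpret prob_space M by fact
  obtain G where G: "G \<ge> 0" "(\<integral>\<^sup>+x. ennreal (cmod (f x) powr p) \<partial>M) = ennreal G"
    using False by (cases "(\<integral>\<^sup>+x. ennreal (cmod (f x) powr p) \<partial>M)") auto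
  define q where "q = p / (p - 1)"
  have q: "q > 1" "1 / q + 1 / p = 1" using p by (auto simp: q_def field_simps)
  have i1: "(\<integral>\<^sup>+x. ennreal (cmod (f x)) \<partial>M) \<le> ennreal (G powr (1/p) * 1 powr (1/q))"
    by (rule nn_integral_holder_const[OF _ _ p q]) (use G emeasure_space_1 in auto)
  have i2: "ennreal (cmod (integral\<^sup>L M f)) \<le> (\<integral>\<^sup>+x. ennreal (cmod (f x)) \<partial>M)"
  proof (cases "integrable M f")
    case True then show ?thesis by (rule integral_norm_bound_ennreal)
  qed (simp add: not_integrable_integral_eq)
  have "ennreal (cmod (integral\<^sup>L M f)) \<le> ennreal (G powr (1/p))"
    using order_trans[OF i2 i1] by (simp only: powr_one_eq_one mult_1_right)
  then have "cmod (integral\<^sup>L M f) \<le> G powr (1/p)" by (subst (asm) ennreal_le_iff) auto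
  then have "cmod (integral\<^sup>L M f) powr p \<le> (G powr (1/p)) powr p" using p by (intro powr_mono2) auto
  also have "\<dots> = G" using p G by (simp add: powr_powr)
  finally show ?thesis using G by (simp add: ennreal_leI)
qed simp

text \<open>The Riesz-Fischer argument for a family indexed by R tending to infinity: a fast
  subsequence converges almost everywhere, and Fatou's lemma carries the Cauchy estimate over to its
  limit.\<close>

lemma Lq_complete_at_top:
  fixes F :: "real \<Rightarrow> 'a \<Rightarrow> complex"
  assumes [measurable]: "\<And>R. F R \<in> borel_measurable M" and q: "q > 0"
    and cauchy: "\<And>e. e > 0 \<Longrightarrow> \<exists>R0. \<forall>R\<ge>R0. \<forall>R'\<ge>R0. (\<integral>\<^sup>+x. ennreal (cmod (F R x - F R' x) powr q) \<partial>M) \<le> ennreal e"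
  obtains g where "g \<in> borel_measurable M" "((\<lambda>R. \<integral>\<^sup>+x. ennreal (cmod (F R x - g x) powr q) \<partial>M) \<longlongrightarrow> 0) at_top"
proof -
  \<comment> \<open>Chosen so that 2^(kq) \<delta> k = 2^(-k): the series of 2^(kq) |d k|^q then has
    finite integral, which forces |d k| to be at most a multiple of 2^(-k) at almost every
    point.\<close>
  define \<delta> where "\<delta> k = (1/2) ^ k * ((1/2) ^ k) powr q" for k :: nat
  have \<delta>: "\<delta> k > 0" for k by (simp add: \<delta>_def)
  obtain r where r: "\<And>k R R'. R \<ge> r k \<Longrightarrow> R' \<ge> r k \<Longrightarrow> (\<integral>\<^sup>+x. ennreal (cmod (F R x - F R' x) powr q) \<partial>M) \<le> ennreal (\<delta> k)"
    using cauchy[OF \<delta>] by metis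
  \<comment> \<open>The maximum places \<open>s k\<close> beyond all earlier thresholds
    \<open>r j\<close>, and the summand k makes it tend to infinity.\<close>
  define s where "s k = Max (r ` {..k}) + real k" for k
  have s_ge: "s k \<ge> r j" if "j \<le> k" for j k
  proof -
    have "r j \<le> Max (r ` {..k})" using that by (intro Max_ge) auto
    then show ?thesis by (simp add: s_def)
  qed
  define d where "d k x = cmod (F (s (Suc k)) x - F (s k) x)" for k x
  have [measurable]: "d k \<in> borel_measurable M" for k unfolding d_def by measurable
  have dk: "(\<integral>\<^sup>+x. ennreal (d k x powr q) \<partial>M) \<le> ennreal (\<delta> k)" for k
    unfolding d_def by (intro r s_ge) auto
  define c where "c k = ((2::real) ^ k) powr q" for k :: nat
  have c\<delta>: "c k * \<delta> k = (1/2) ^ k" for k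
  proof -
    have "((2::real) ^ k) powr q * ((1/2) ^ k) powr q = (2 ^ k * (1/2) ^ k) powr q" by (simp add: powr_mult)
    also have "(2::real) ^ k * (1/2) ^ k = 1" by (simp add: power_mult_distrib[symmetric])
    finally show ?thesis by (simp add: c_def \<delta>_def)
  qed
  have "(\<integral>\<^sup>+x. (\<Sum>k. ennreal (c k * d k x powr q)) \<partial>M) = (\<Sum>k. \<integral>\<^sup>+x. ennreal (c k * d k x powr q) \<partial>M)"
    by (rule nn_integral_suminf) measurable
  also have "\<dots> \<le> (\<Sum>k. ennreal ((1/2) ^ k))"
  proof (intro suminf_le)
    fix k
    have "(\<integral>\<^sup>+x. ennreal (c k * d k x powr q) \<partial>M) = ennreal (c k) * (\<integral>\<^sup>+x. ennreal (d k x powr q) \<partial>M)"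
      by (subst nn_integral_cmult[symmetric]) (auto simp: c_def ennreal_mult')
    also have "\<dots> \<le> ennreal (c k) * ennreal (\<delta> k)" by (intro mult_left_mono dk) auto
    also have "\<dots> = ennreal (c k * \<delta> k)" by (rule ennreal_mult'[symmetric]) (simp add: c_def)
    also have "\<dots> = ennreal ((1/2) ^ k)" by (simp only: c\<delta>)
    finally show "(\<integral>\<^sup>+x. ennreal (c k * d k x powr q) \<partial>M) \<le> ennreal ((1/2) ^ k)" .
  qed auto
  also have "\<dots> = ennreal (\<Sum>k. (1/2) ^ k)" by (rule suminf_ennreal2) (auto intro!: summable_geometric)
  finally have "(\<integral>\<^sup>+x. (\<Sum>k. ennreal (c k * d k x powr q)) \<partial>M) \<noteq> \<infinity>" by (auto simp: top_unique)
  then have "AE x in M. (\<Sum>k. ennreal (c k * d k x powr q)) \<noteq> \<infinity>"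
    by (intro nn_integral_PInf_AE) auto
  then have AEc: "AE x in M. convergent (\<lambda>k. F (s k) x)"
  proof (rule eventually_mono)
    fix x assume fin: "(\<Sum>k. ennreal (c k * d k x powr q)) \<noteq> \<infinity>"
    define Z where "Z = enn2real (\<Sum>k. ennreal (c k * d k x powr q))"
    have Z: "(\<Sum>k. ennreal (c k * d k x powr q)) = ennreal Z" "Z \<ge> 0"
      using fin by (auto simp: Z_def less_top[symmetric])
    have "d k x \<le> (Z powr (1/q)) * (1/2) ^ k" for k
    proof -
      have "ennreal (c k * d k x powr q) \<le> (\<Sum>k. ennreal (c k * d k x powr q))"
        using sum_le_suminf[of "\<lambda>k. ennreal (c k * d k x powr q)" "{k}"] by simp
      then have "c k * d k x powr q \<le> Z" using Z by (simp add: ennreal_le_iff)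
      then have "(2 ^ k * d k x) powr q \<le> Z" by (simp add: c_def d_def powr_mult)
      then have "((2 ^ k * d k x) powr q) powr (1/q) \<le> Z powr (1/q)" using q by (intro powr_mono2) auto
      then have "2 ^ k * d k x \<le> Z powr (1/q)" using q by (simp add: powr_powr d_def)
      then show ?thesis by (simp add: field_simps power_divide)
    qed
    then have dle: "norm (norm (F (s (Suc k)) x - F (s k) x)) \<le> (Z powr (1/q)) * (1/2) ^ k" for k
      by (simp only: d_def real_norm_def abs_norm_cancel)
    have "summable (\<lambda>k. (Z powr (1/q)) * (1/2) ^ k :: real)" by (intro summable_mult summable_geometric) auto
    then have "summable (\<lambda>k. norm (F (s (Suc k)) x - F (s k) x))"
      by (rule summable_comparison_test'[OF _ dle])
    then have "summable (\<lambda>k. F (s (Suc k)) x - F (s k) x)" by (rule summable_norm_cancel)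
    then have "convergent (\<lambda>n. \<Sum>k<n. F (s (Suc k)) x - F (s k) x)" by (simp add: summable_iff_convergent)
    then have "convergent (\<lambda>n. F (s n) x - F (s 0) x)" using sum_lessThan_telescope[of "\<lambda>k. F (s k) x"] by simp
    then have "convergent (\<lambda>n. (F (s n) x - F (s 0) x) + F (s 0) x)" by (intro convergent_add convergent_const)
    then show "convergent (\<lambda>k. F (s k) x)" by simp
  qed
  define g where "g x = lim (\<lambda>k. F (s k) x)" for x
  have [measurable]: "g \<in> borel_measurable M" unfolding g_def by measurable
  have lim: "AE x in M. (\<lambda>k. F (s k) x) \<longlonglongrightarrow> g x"
    using AEc by (auto simp: g_def convergent_LIMSEQ_iff elim!: eventually_mono)
  have fat: "(\<integral>\<^sup>+x. ennreal (cmod (F R x - g x) powr q) \<partial>M) \<le> ennreal e"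
    if e: "\<And>R'. R' \<ge> R0 \<Longrightarrow> (\<integral>\<^sup>+x. ennreal (cmod (F R x - F R' x) powr q) \<partial>M) \<le> ennreal e" for R R0 e
  proof -
    have "(\<integral>\<^sup>+x. ennreal (cmod (F R x - g x) powr q) \<partial>M) = (\<integral>\<^sup>+x. liminf (\<lambda>k. ennreal (cmod (F R x - F (s k) x) powr q)) \<partial>M)"
    proof (rule nn_integral_cong_AE, rule eventually_mono[OF lim])
      fix x assume "(\<lambda>k. F (s k) x) \<longlonglongrightarrow> g x"
      then have "(\<lambda>k. ennreal (cmod (F R x - F (s k) x) powr q)) \<longlonglongrightarrow> ennreal (cmod (F R x - g x) powr q)"
        using q by (intro tendsto_intros tendsto_powr') auto
      then show "ennreal (cmod (F R x - g x) powr q) = liminf (\<lambda>k. ennreal (cmod (F R x - F (s k) x) powr q))"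
        by (metis lim_imp_Liminf sequentially_bot)
    qed
    also have "\<dots> \<le> liminf (\<lambda>k. \<integral>\<^sup>+x. ennreal (cmod (F R x - F (s k) x) powr q) \<partial>M)"
      by (rule nn_integral_liminf) measurable
    also have "\<dots> \<le> ennreal e"
    proof -
      obtain N where N: "R0 - r 0 \<le> real N" by (meson real_arch_simple)
      have "\<forall>\<^sub>F k in sequentially. (\<integral>\<^sup>+x. ennreal (cmod (F R x - F (s k) x) powr q) \<partial>M) \<le> ennreal e"
      proof (rule eventually_sequentiallyI[of N])
        fix k assume "N \<le> k"
        have "r 0 \<le> Max (r ` {..k})" by (intro Max_ge) auto
        then have "R0 \<le> s k" using N \<open>N \<le> k\<close> unfolding s_def by linarith
        then show "(\<integral>\<^sup>+x. ennreal (cmod (F R x - F (s k) x) powr q) \<partial>M) \<le> ennreal e" by (rule e)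
      qed
      then show ?thesis by (intro Liminf_le) auto
    qed
    finally show ?thesis .
  qed
  show ?thesis
  proof (rule that[of g])
    show "((\<lambda>R. \<integral>\<^sup>+x. ennreal (cmod (F R x - g x) powr q) \<partial>M) \<longlongrightarrow> 0) at_top"
    proof (rule order_tendstoI)
      fix e :: ennreal assume "0 < e"
      then obtain e' where e': "e' > 0" "ennreal e' < e"
        by (metis dense ennreal_cases ennreal_less_zero_iff infinity_ennreal_def less_top order_less_imp_not_less top.not_eq_extremum ennreal_0)
      obtain R0 where R0: "\<And>R R'. R \<ge> R0 \<Longrightarrow> R' \<ge> R0 \<Longrightarrow> (\<integral>\<^sup>+x. ennreal (cmod (F R x - F R' x) powr q) \<partial>M) \<le> ennreal e'"
        using cauchy[OF e'(1)] by blast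
      have "(\<integral>\<^sup>+x. ennreal (cmod (F R x - g x) powr q) \<partial>M) < e" if "R \<ge> R0" for R
        using fat[of R0 R e'] R0[OF that] e'(2) by (meson le_less_trans)
      then show "\<forall>\<^sub>F R in at_top. (\<integral>\<^sup>+x. ennreal (cmod (F R x - g x) powr q) \<partial>M) < e"
        by (auto simp: eventually_at_top_linorder)
    qed simp
  qed measurable
qed

text \<open>For each level s, h is cut where |h| is so large that the L^1 norm of the upper part is
  at most s/2. The bound into L^\<infinity> then confines {|T h| > s} to {|T h1| \<ge> s/2} for the
  lower part h1, which Chebyshev's inequality and the L^2 bound estimate; the layer-cake formula
  sums over s. T is constrained on restrictions of the one function h only, because an integral
  operator is additive on integrable functions only.\<close>

lemma marcinkiewicz_hausdorff_young:
  fixes T :: "('a \<Rightarrow> complex) \<Rightarrow> 'b \<Rightarrow> complex" and h :: "'a \<Rightarrow> complex"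
  assumes M: "sigma_finite_measure M" and N: "sigma_finite_measure N"
    and [measurable]: "h \<in> borel_measurable M" and p: "1 < p" "p < 2" and q: "q = p / (p - 1)"
    and T0 [measurable]: "T h \<in> borel_measurable N"
    and T [measurable]: "\<And>E. E \<in> sets M \<Longrightarrow> T (\<lambda>x. indicator E x * h x) \<in> borel_measurable N"
    and splitE: "\<And>E y. E \<in> sets M \<Longrightarrow> T h y = T (\<lambda>x. indicator E x * h x) y + T (\<lambda>x. indicator (space M - E) x * h x) y"
    and Linf: "\<And>E y. E \<in> sets M \<Longrightarrow> ennreal (cmod (T (\<lambda>x. indicator E x * h x) y)) \<le> (\<integral>\<^sup>+x\<in>E. ennreal (cmod (h x)) \<partial>M)"
    and L2: "\<And>E. E \<in> sets M \<Longrightarrow> (\<integral>\<^sup>+y. ennreal ((cmod (T (\<lambda>x. indicator E x * h x) y))\<^sup>2) \<partial>N) \<le> ennreal C * (\<integral>\<^sup>+x\<in>E. ennreal ((cmod (h x))\<^sup>2) \<partial>M)"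
    and C: "C \<ge> 0" and m: "(\<integral>\<^sup>+x. ennreal (cmod (h x) powr p) \<partial>M) = ennreal m" "m > 0"
  shows "(\<integral>\<^sup>+y. ennreal (cmod (T h y) powr q) \<partial>N) \<le> ennreal (4 * C * q / (q - 2) * 2 powr (q - 2) * m powr (q - 1))"
proof -
  have qq: "q > 2" using p by (simp add: q field_simps)
  interpret M: sigma_finite_measure M by fact
  interpret N: sigma_finite_measure N by fact
  interpret NL: pair_sigma_finite N lborel ..
  interpret XL: pair_sigma_finite M lborel ..
  \<comment> \<open>The lower part. Off this set |h| \<le> s/(2m) |h|^p, so the integral of |h|
    there is at most s/2.\<close>
  define S where "S s = {x \<in> space M. s * cmod (h x) powr (p - 1) \<le> 2 * m}" for s
  have S [measurable]: "S s \<in> sets M" for s unfolding S_def by measurable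
  have layer: "ennreal (cmod z powr q) = (\<integral>\<^sup>+s. ennreal (q * s powr (q - 1)) * indicator {0..<cmod z} s \<partial>lborel)" for z
  proof -
    have "((\<lambda>s. s powr (q - 1)) has_integral cmod z powr (q - 1 + 1) / (q - 1 + 1)) {0..cmod z}"
      using qq by (intro has_integral_powr_from_0) auto
    then have "((\<lambda>s. q * s powr (q - 1)) has_integral q * (cmod z powr (q - 1 + 1) / (q - 1 + 1))) {0..cmod z}"
      by (rule has_integral_mult_right)
    then have "((\<lambda>s. q * s powr (q - 1)) has_integral cmod z powr q) {0..cmod z}" using qq by simp
    then have "(\<integral>\<^sup>+s. ennreal (q * s powr (q - 1)) * indicator {0..cmod z} s \<partial>lborel) = ennreal (cmod z powr q)"
      using qq by (intro nn_integral_has_integral_lebesgue') auto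
    moreover have "(\<integral>\<^sup>+s. ennreal (q * s powr (q - 1)) * indicator {0..cmod z} s \<partial>lborel) = (\<integral>\<^sup>+s. ennreal (q * s powr (q - 1)) * indicator {0..<cmod z} s \<partial>lborel)"
      by (intro nn_integral_cong_AE eventually_mono[OF AE_lborel_singleton[of "cmod z"]]) (auto simp: indicator_def)
    ultimately show ?thesis by simp
  qed
  have pt: "(\<integral>\<^sup>+y. indicator {0..<cmod (T h y)} s \<partial>N) \<le> ennreal (4 * C / s\<^sup>2) * (\<integral>\<^sup>+x\<in>S s. ennreal ((cmod (h x))\<^sup>2) \<partial>M)" if s: "s > 0" for s
  proof -
    define T1 where "T1 = T (\<lambda>x. indicator (S s) x * h x)"
    have [measurable]: "T1 \<in> borel_measurable N" unfolding T1_def by measurable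
    have b: "cmod (T (\<lambda>x. indicator (space M - S s) x * h x) y) \<le> s / 2" for y
    proof -
      have "ennreal (cmod (T (\<lambda>x. indicator (space M - S s) x * h x) y)) \<le> (\<integral>\<^sup>+x\<in>space M - S s. ennreal (cmod (h x)) \<partial>M)"
        by (rule Linf) measurable
      also have "\<dots> \<le> (\<integral>\<^sup>+x. ennreal (s / (2 * m)) * ennreal (cmod (h x) powr p) \<partial>M)"
      proof (intro nn_integral_mono)
        fix x assume x: "x \<in> space M"
        show "ennreal (cmod (h x)) * indicator (space M - S s) x \<le> ennreal (s / (2 * m)) * ennreal (cmod (h x) powr p)"
        proof (cases "x \<in> S s")
          case False
          then have "2 * m \<le> s * cmod (h x) powr (p - 1)" using x by (simp add: S_def)
          then have "cmod (h x) * (2 * m) \<le> cmod (h x) * (s * cmod (h x) powr (p - 1))" by (intro mult_left_mono) auto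
          also have "\<dots> = s * cmod (h x) powr p"
            by (cases "h x = 0") (auto simp: powr_diff mult_ac)
          finally have "cmod (h x) \<le> s / (2 * m) * cmod (h x) powr p" using m by (simp add: field_simps)
          then show ?thesis using False x s m by (simp add: ennreal_mult'[symmetric] ennreal_leI)
        qed simp
      qed
      also have "\<dots> = ennreal (s / (2 * m)) * ennreal m" by (subst nn_integral_cmult) (auto simp: m)
      also have "\<dots> = ennreal (s / 2)" using s m by (simp add: ennreal_mult'[symmetric])
      finally show ?thesis using s by (subst (asm) ennreal_le_iff) auto
    qed
    have "(\<integral>\<^sup>+y. indicator {0..<cmod (T h y)} s \<partial>N) \<le> (\<integral>\<^sup>+y. ennreal (4 / s\<^sup>2) * ennreal ((cmod (T1 y))\<^sup>2) \<partial>N)"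
    proof (intro nn_integral_mono)
      fix y
      show "indicator {0..<cmod (T h y)} s \<le> ennreal (4 / s\<^sup>2) * ennreal ((cmod (T1 y))\<^sup>2)"
      proof (cases "s < cmod (T h y)")
        case True
        have "cmod (T h y) \<le> cmod (T1 y) + cmod (T (\<lambda>x. indicator (space M - S s) x * h x) y)"
          unfolding T1_def splitE[OF S, of y s] by (rule norm_triangle_ineq)
        then have "s / 2 \<le> cmod (T1 y)" using True b[of y] by linarith
        then have "(s / 2)\<^sup>2 \<le> (cmod (T1 y))\<^sup>2" using s by (intro power_mono) auto
        then have "1 \<le> 4 / s\<^sup>2 * (cmod (T1 y))\<^sup>2" using s by (simp add: power_divide field_simps)
        then have "ennreal 1 \<le> ennreal (4 / s\<^sup>2 * (cmod (T1 y))\<^sup>2)" by (rule ennreal_leI)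
        also have "\<dots> = ennreal (4 / s\<^sup>2) * ennreal ((cmod (T1 y))\<^sup>2)" by (rule ennreal_mult) auto
        finally show ?thesis by (rule order_trans[rotated]) (simp add: indicator_def)
      qed (simp add: indicator_def)
    qed
    also have "\<dots> = ennreal (4 / s\<^sup>2) * (\<integral>\<^sup>+y. ennreal ((cmod (T1 y))\<^sup>2) \<partial>N)" by (rule nn_integral_cmult) measurable
    also have "\<dots> \<le> ennreal (4 / s\<^sup>2) * (ennreal C * (\<integral>\<^sup>+x\<in>S s. ennreal ((cmod (h x))\<^sup>2) \<partial>M))"
      unfolding T1_def by (intro mult_left_mono L2) auto
    also have "\<dots> = ennreal (4 * C / s\<^sup>2) * (\<integral>\<^sup>+x\<in>S s. ennreal ((cmod (h x))\<^sup>2) \<partial>M)"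
      using C s by (simp add: mult.assoc[symmetric] ennreal_mult'[symmetric])
    finally show ?thesis .
  qed
  have "(\<integral>\<^sup>+y. ennreal (cmod (T h y) powr q) \<partial>N) = (\<integral>\<^sup>+y. (\<integral>\<^sup>+s. ennreal (q * s powr (q - 1)) * indicator {0..<cmod (T h y)} s \<partial>lborel) \<partial>N)"
    by (intro nn_integral_cong layer)
  also have "\<dots> = (\<integral>\<^sup>+s. (\<integral>\<^sup>+y. ennreal (q * s powr (q - 1)) * indicator {0..<cmod (T h y)} s \<partial>N) \<partial>lborel)"
    unfolding atLeastLessThan_def atLeast_def lessThan_def by (rule NL.Fubini'[symmetric]) measurable
  also have "\<dots> \<le> (\<integral>\<^sup>+s. (\<integral>\<^sup>+x. ennreal (4 * C * q * s powr (q - 3)) * (ennreal ((cmod (h x))\<^sup>2) * indicator {s. 0 < s \<and> s * cmod (h x) powr (p - 1) \<le> 2 * m} s) \<partial>M) \<partial>lborel)"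
  proof (rule nn_integral_mono_AE, rule eventually_mono[OF AE_lborel_singleton[of 0]])
    fix s :: real assume s0: "s \<noteq> 0"
    show "(\<integral>\<^sup>+y. ennreal (q * s powr (q - 1)) * indicator {0..<cmod (T h y)} s \<partial>N)
      \<le> (\<integral>\<^sup>+x. ennreal (4 * C * q * s powr (q - 3)) * (ennreal ((cmod (h x))\<^sup>2) * indicator {s. 0 < s \<and> s * cmod (h x) powr (p - 1) \<le> 2 * m} s) \<partial>M)"
    proof (cases "s > 0")
      case s: True
      have mm: "(\<lambda>y. indicator {0..<cmod (T h y)} s :: ennreal) \<in> borel_measurable N"
        unfolding atLeastLessThan_def atLeast_def lessThan_def by measurable
      have "(\<integral>\<^sup>+y. ennreal (q * s powr (q - 1)) * indicator {0..<cmod (T h y)} s \<partial>N) = ennreal (q * s powr (q - 1)) * (\<integral>\<^sup>+y. indicator {0..<cmod (T h y)} s \<partial>N)"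
        by (rule nn_integral_cmult[OF mm])
      also have "\<dots> \<le> ennreal (q * s powr (q - 1)) * (ennreal (4 * C / s\<^sup>2) * (\<integral>\<^sup>+x\<in>S s. ennreal ((cmod (h x))\<^sup>2) \<partial>M))"
        by (intro mult_left_mono pt s) auto
      also have "\<dots> = ennreal (4 * C * q * s powr (q - 3)) * (\<integral>\<^sup>+x\<in>S s. ennreal ((cmod (h x))\<^sup>2) \<partial>M)"
      proof -
        have "s powr (q - 1) / s\<^sup>2 = s powr (q - 3)"
          using s powr_diff[of s "q - 1" 2] by simp
        then have "q * s powr (q - 1) * (4 * C / s\<^sup>2) = 4 * C * q * s powr (q - 3)" by (metis (no_types, opaque_lifting) mult.assoc mult.commute times_divide_eq_right)
        then show ?thesis using C qq by (simp add: mult.assoc[symmetric] ennreal_mult'[symmetric])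
      qed
      also have "\<dots> = (\<integral>\<^sup>+x. ennreal (4 * C * q * s powr (q - 3)) * (ennreal ((cmod (h x))\<^sup>2) * indicator (S s) x) \<partial>M)"
        by (rule nn_integral_cmult[symmetric]) measurable
      also have "\<dots> = (\<integral>\<^sup>+x. ennreal (4 * C * q * s powr (q - 3)) * (ennreal ((cmod (h x))\<^sup>2) * indicator {s. 0 < s \<and> s * cmod (h x) powr (p - 1) \<le> 2 * m} s) \<partial>M)"
        using s by (intro nn_integral_cong) (auto simp: S_def indicator_def)
      finally show ?thesis .
    qed (use s0 in simp)
  qed
  also have "\<dots> = (\<integral>\<^sup>+x. (\<integral>\<^sup>+s. ennreal (4 * C * q * s powr (q - 3)) * (ennreal ((cmod (h x))\<^sup>2) * indicator {s. 0 < s \<and> s * cmod (h x) powr (p - 1) \<le> 2 * m} s) \<partial>lborel) \<partial>M)"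
    by (rule XL.Fubini') measurable
  also have "\<dots> \<le> (\<integral>\<^sup>+x. ennreal (4 * C * q / (q - 2) * (2 * m) powr (q - 2)) * ennreal (cmod (h x) powr p) \<partial>M)"
  proof (intro nn_integral_mono)
    fix x
    show "(\<integral>\<^sup>+s. ennreal (4 * C * q * s powr (q - 3)) * (ennreal ((cmod (h x))\<^sup>2) * indicator {s. 0 < s \<and> s * cmod (h x) powr (p - 1) \<le> 2 * m} s) \<partial>lborel)
      \<le> ennreal (4 * C * q / (q - 2) * (2 * m) powr (q - 2)) * ennreal (cmod (h x) powr p)"
    proof (cases "h x = 0")
      case False
      define u where "u = cmod (h x)"
      have u: "u > 0" using False by (simp add: u_def)
      define L where "L = 2 * m * u powr (1 - p)"
      have L: "L > 0" using m u by (simp add: L_def)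
      have up: "u powr (p - 1) * u powr (1 - p) = 1" using u by (simp add: powr_add[symmetric])
      have "(\<integral>\<^sup>+s. ennreal (4 * C * q * s powr (q - 3)) * (ennreal (u\<^sup>2) * indicator {s. 0 < s \<and> s * u powr (p - 1) \<le> 2 * m} s) \<partial>lborel)
        \<le> (\<integral>\<^sup>+s. ennreal (4 * C * q * u\<^sup>2 * s powr (q - 3)) * indicator {0..L} s \<partial>lborel)"
      proof (intro nn_integral_mono)
        fix s :: real
        show "ennreal (4 * C * q * s powr (q - 3)) * (ennreal (u\<^sup>2) * indicator {s. 0 < s \<and> s * u powr (p - 1) \<le> 2 * m} s)
          \<le> ennreal (4 * C * q * u\<^sup>2 * s powr (q - 3)) * indicator {0..L} s"
        proof (cases "0 < s \<and> s * u powr (p - 1) \<le> 2 * m")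
          case True
          then have "(s * u powr (p - 1)) * u powr (1 - p) \<le> 2 * m * u powr (1 - p)" by (intro mult_right_mono) auto
          then have "s \<le> L" using up by (simp add: L_def mult.assoc)
          then show ?thesis using True C qq by (simp add: ennreal_mult'[symmetric] ennreal_mult''[symmetric] mult_ac)
        qed simp
      qed
      also have "\<dots> = ennreal (4 * C * q * u\<^sup>2 * (L powr (q - 2) / (q - 2)))"
      proof -
        have "((\<lambda>s. s powr (q - 3)) has_integral L powr (q - 3 + 1) / (q - 3 + 1)) {0..L}"
          using qq L by (intro has_integral_powr_from_0) auto
        then have "((\<lambda>s. 4 * C * q * u\<^sup>2 * s powr (q - 3)) has_integral 4 * C * q * u\<^sup>2 * (L powr (q - 3 + 1) / (q - 3 + 1))) {0..L}"
          by (rule has_integral_mult_right)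
        then have "(\<integral>\<^sup>+s. ennreal (4 * C * q * u\<^sup>2 * s powr (q - 3)) * indicator {0..L} s \<partial>lborel) = ennreal (4 * C * q * u\<^sup>2 * (L powr (q - 3 + 1) / (q - 3 + 1)))"
          using C qq by (intro nn_integral_has_integral_lebesgue') auto
        then show ?thesis by simp
      qed
      also have "4 * C * q * u\<^sup>2 * (L powr (q - 2) / (q - 2)) = 4 * C * q / (q - 2) * (2 * m) powr (q - 2) * u powr p"
      proof -
        \<comment> \<open>The conjugacy of p and q enters here: integrating s^(q-3) up to L,
          possible as q > 2, leaves exactly |h|^p.\<close>
        have "(1 - p) * (q - 2) = p - 2" using p by (simp add: q field_simps)
        then have "L powr (q - 2) = (2 * m) powr (q - 2) * u powr (p - 2)"
          using m u by (simp add: L_def powr_mult powr_powr)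
        moreover have "u\<^sup>2 * u powr (p - 2) = u powr p" using u powr_add[of u 2 "p - 2"] by simp
        ultimately show ?thesis by (simp add: mult_ac)
      qed
      also have "ennreal (4 * C * q / (q - 2) * (2 * m) powr (q - 2) * u powr p)
        = ennreal (4 * C * q / (q - 2) * (2 * m) powr (q - 2)) * ennreal (u powr p)"
        by (rule ennreal_mult'') simp
      finally show ?thesis unfolding u_def .
    qed simp
  qed
  also have "\<dots> = ennreal (4 * C * q / (q - 2) * (2 * m) powr (q - 2)) * ennreal m"
    by (subst nn_integral_cmult) (auto simp: m)
  also have "\<dots> = ennreal (4 * C * q / (q - 2) * 2 powr (q - 2) * m powr (q - 1))"
  proof -
    have "m powr (q - 1) = m powr (q - 2) * m" using m powr_add[of m "q - 2" 1] by simp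
    then show ?thesis using C qq m by (simp add: ennreal_mult''[symmetric] powr_mult mult_ac)
  qed
  finally show ?thesis .
qed

subsection \<open>The Hausdorff moment problem\<close>

text \<open>The Bernstein polynomial as an element of the type of polynomials, on which the
  functional acts.\<close>

definition bern_poly :: "nat \<Rightarrow> nat \<Rightarrow> real poly" where
  "bern_poly n k = smult (of_nat (n choose k)) ([:0, 1:] ^ k * [:1, -1:] ^ (n - k))"

lemma poly_bern_poly: "poly (bern_poly n k) x = Bernstein n k x"
  by (simp add: bern_poly_def Bernstein_def)

text \<open>The measure is a weak limit of the measures putting mass \<open>\<Lambda>(bern_poly n k)\<close> on \<open>k/n\<close>.\<close>
theorem hausdorff_moment:
  fixes \<Lambda> :: "real poly \<Rightarrow> real"
  assumes add: "\<And>p q. \<Lambda> (p + q) = \<Lambda> p + \<Lambda> q" and smult: "\<And>c p. \<Lambda> (smult c p) = c * \<Lambda> p"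
    and pos: "\<And>p. (\<And>x. 0 \<le> x \<Longrightarrow> x \<le> 1 \<Longrightarrow> poly p x \<ge> 0) \<Longrightarrow> \<Lambda> p \<ge> 0" and one: "\<Lambda> 1 = 1"
  obtains \<mu> :: "real measure" where "real_distribution \<mu>" "AE x in \<mu>. x \<in> {0..1}"
    "\<And>p. (LINT x|\<mu>. poly p x) = \<Lambda> p"
proof -
  have zero: "\<Lambda> 0 = 0" using smult[of 0 0] by simp
  have sum: "\<Lambda> (\<Sum>i\<in>I. f i) = (\<Sum>i\<in>I. \<Lambda> (f i))" if "finite I" for I :: "nat set" and f
    using that by (induction I rule: finite_induct) (auto simp: zero add)
  have mono: "\<Lambda> p \<le> \<Lambda> q" if "\<And>x. 0 \<le> x \<Longrightarrow> x \<le> 1 \<Longrightarrow> poly p x \<le> poly q x" for p q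
  proof -
    have "\<Lambda> (q + smult (-1) p) \<ge> 0" using that by (intro pos) simp
    then show ?thesis unfolding add smult by simp
  qed
  have const: "\<Lambda> [:c:] = c" for c using smult[of c 1] one by simp
  have bnd: "\<bar>\<Lambda> p - \<Lambda> q\<bar> \<le> e" if "\<And>x. 0 \<le> x \<Longrightarrow> x \<le> 1 \<Longrightarrow> \<bar>poly p x - poly q x\<bar> \<le> e" for p q e
  proof -
    have "poly p x \<le> poly (q + [:e:]) x" "poly q x \<le> poly (p + [:e:]) x" if "0 \<le> x" "x \<le> 1" for x
      using \<open>\<And>x. 0 \<le> x \<Longrightarrow> x \<le> 1 \<Longrightarrow> \<bar>poly p x - poly q x\<bar> \<le> e\<close>[OF that] by auto
    then have "\<Lambda> p \<le> \<Lambda> (q + [:e:])" "\<Lambda> q \<le> \<Lambda> (p + [:e:])" by (auto intro!: mono)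
    then show ?thesis unfolding add const by simp
  qed
  define wt where "wt n k = \<Lambda> (bern_poly n k)" for n k
  have wt0: "wt n k \<ge> 0" for n k
    unfolding wt_def by (intro pos) (simp add: poly_bern_poly Bernstein_nonneg)
  have wt1: "(\<Sum>k\<le>n. wt n k) = 1" for n
  proof -
    have "(\<Sum>k\<le>n. wt n k) = \<Lambda> (\<Sum>k\<le>n. bern_poly n k)" by (simp add: wt_def sum)
    also have "(\<Sum>k\<le>n. bern_poly n k) = 1"
      by (rule iffD1[OF poly_eq_poly_eq_iff]) (rule ext, simp add: poly_sum poly_bern_poly)
    finally show ?thesis by (simp add: one)
  qed
  define P where "P n = embed_pmf (\<lambda>k. if k \<le> n then wt n k else 0)" for n
  have pmfP: "pmf (P n) k = (if k \<le> n then wt n k else 0)" for n k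
    unfolding P_def
  proof (rule pmf_embed_pmf)
    show "0 \<le> (if k \<le> n then wt n k else 0)" for k by (simp add: wt0)
    have "(\<integral>\<^sup>+k. ennreal (if k \<le> n then wt n k else 0) \<partial>count_space UNIV) = (\<Sum>k\<le>n. ennreal (if k \<le> n then wt n k else 0))"
      by (rule nn_integral_count_space') auto
    also have "\<dots> = ennreal (\<Sum>k\<le>n. wt n k)" by (simp add: sum_ennreal wt0)
    finally show "(\<integral>\<^sup>+k. ennreal (if k \<le> n then wt n k else 0) \<partial>count_space UNIV) = 1" by (simp add: wt1)
  qed
  define \<mu> where "\<mu> n = distr (measure_pmf (P n)) borel (\<lambda>k. real k / real n)" for n
  have rd: "real_distribution (\<mu> n)" for n
    unfolding \<mu>_def by (intro prob_space.real_distribution_distr) (auto simp: prob_space_measure_pmf)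
  have setP: "set_pmf (P n) \<subseteq> {..n}" for n by (auto simp: set_pmf_eq pmfP split: if_splits)
  have int\<mu>: "(LINT x|\<mu> n. f x) = (\<Sum>k\<le>n. f (real k / real n) * wt n k)" if [measurable]: "f \<in> borel_measurable borel" for f :: "real \<Rightarrow> real" and n
  proof -
    have "(LINT x|\<mu> n. f x) = (LINT k|measure_pmf (P n). f (real k / real n))"
      unfolding \<mu>_def by (rule integral_distr) auto
    also have "\<dots> = (\<Sum>k\<le>n. f (real k / real n) * pmf (P n) k)"
      by (rule integral_measure_pmf_real) (use setP[of n] in \<open>auto simp: set_pmf_eq\<close>)
    finally show ?thesis by (simp add: pmfP)
  qed
  \<comment> \<open>Tightness is formulated with intervals open on the left, so the interval has to
    start below the node 0.\<close>
  have mass: "measure (\<mu> n) {-1<..2} = 1" for n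
  proof -
    have "measure (\<mu> n) {-1<..2} = measure (measure_pmf (P n)) ((\<lambda>k. real k / real n) -` {-1<..2})"
      unfolding \<mu>_def by (subst measure_distr) auto
    also have "\<dots> = 1"
    proof -
      have "AE k in measure_pmf (P n). k \<in> (\<lambda>k. real k / real n) -` {-1<..2}"
      proof (rule AE_pmfI)
        fix k assume "k \<in> set_pmf (P n)"
        then have "k \<le> n" using setP by auto
        then have "real k / real n \<le> 1" by (auto simp: divide_le_eq_1)
        moreover have "-1 < real k / real n" by (rule less_le_trans[of _ 0]) auto
        ultimately show "k \<in> (\<lambda>k. real k / real n) -` {-1<..2}" by auto
      qed
      then show ?thesis by (subst (asm) measure_pmf.prob_eq_1[symmetric]) auto
    qed
    finally show ?thesis .
  qed
  have "tight \<mu>"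
    unfolding tight_def
  proof (intro conjI allI impI)
    fix e :: real assume "e > 0"
    then have "(-1::real) < 2 \<and> (\<forall>n. 1 - e < measure (\<mu> n) {-1<..2})" using mass by simp
    then show "\<exists>a b. a < b \<and> (\<forall>n. 1 - e < measure (\<mu> n) {a<..b})" by blast
  qed (rule rd)
  then obtain r \<nu> where r: "strict_mono (r :: nat \<Rightarrow> nat)" "real_distribution \<nu>" "weak_conv_m (\<mu> \<circ> id \<circ> r) \<nu>"
    using tight_imp_convergent_subsubsequence[of \<mu> id] by (auto simp: strict_mono_def)
  have wc: "(\<lambda>n. LINT x|\<mu> (r n). f x) \<longlonglongrightarrow> (LINT x|\<nu>. f x)" if "\<And>x. isCont f x" "\<And>x. \<bar>f x\<bar> \<le> C" for f :: "real \<Rightarrow> real" and C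
    using weak_conv_imp_integral_bdd_continuous_conv[of "\<mu> \<circ> id \<circ> r" \<nu> f C] r rd that by simp
  interpret \<nu>: real_distribution \<nu> by fact
  \<comment> \<open>Weak convergence tests bounded continuous functions on the whole line only;
    clamping the argument to [0,1] makes polynomials such, without changing them at the
    nodes.\<close>
  define cl where "cl x = max 0 (min 1 x)" for x :: real
  have cl_cont: "isCont cl x" for x unfolding cl_def[abs_def] by (intro continuous_intros)
  have cl_id: "cl x = x" if "0 \<le> x" "x \<le> 1" for x using that by (simp add: cl_def)
  have cl_rng: "0 \<le> cl x" "cl x \<le> 1" for x by (auto simp: cl_def)
  \<comment> \<open>Holds for n = 0 too, where the single node is 0/0 = 0.\<close>
  have nodes: "0 \<le> real k / real n" "real k / real n \<le> 1" if "k \<le> n" for k n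
    using that by (auto simp: divide_le_eq_1)
  have AE: "AE x in \<nu>. x \<in> {0..1}"
  proof -
    define f where "f x = min 1 \<bar>x - cl x\<bar>" for x
    have fc: "isCont f x" for x unfolding f_def[abs_def] by (intro continuous_intros cl_cont)
    have [measurable]: "f \<in> borel_measurable borel"
      using fc by (intro borel_measurable_continuous_onI) (auto simp: continuous_on_eq_continuous_at)
    have f0: "0 \<le> f x" "f x \<le> 1" for x by (auto simp: f_def)
    have "(LINT x|\<mu> (r n). f x) = 0" for n
      by (subst int\<mu>) (auto simp: f_def cl_id nodes)
    moreover have "(\<lambda>n. LINT x|\<mu> (r n). f x) \<longlonglongrightarrow> (LINT x|\<nu>. f x)"
      using f0 by (intro wc[where C = 1] fc) (auto simp: abs_le_iff)
    ultimately have "(LINT x|\<nu>. f x) = 0" using LIMSEQ_unique tendsto_const by (metis (mono_tags, lifting) LIMSEQ_const_iff tendsto_cong always_eventually)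
    moreover have "integrable \<nu> f" using f0 by (intro \<nu>.integrable_const_bound[where B = 1]) (auto simp: abs_le_iff)
    ultimately have "AE x in \<nu>. f x = 0" by (subst (asm) integral_nonneg_eq_0_iff_AE) (auto simp: f0)
    then show ?thesis
    proof (rule eventually_mono)
      fix x assume "f x = 0"
      then have "x = cl x" by (auto simp: f_def min_def split: if_splits)
      then show "x \<in> {0..1}" using cl_rng[of x] by auto
    qed
  qed
  have "(LINT x|\<nu>. poly p x) = \<Lambda> p" for p
  proof -
    define f where "f x = poly p (cl x)" for x
    have fc: "isCont f x" for x unfolding f_def[abs_def] by (intro continuous_intros cl_cont)
    have [measurable]: "f \<in> borel_measurable borel"
      using fc by (intro borel_measurable_continuous_onI) (auto simp: continuous_on_eq_continuous_at)
    have pm: "poly p \<in> borel_measurable borel"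
      by (intro borel_measurable_continuous_onI continuous_intros)
    have "bounded (poly p ` {0..1})"
      by (intro compact_imp_bounded compact_continuous_image continuous_intros) auto
    then obtain C where C: "\<And>x. x \<in> {0..1} \<Longrightarrow> \<bar>poly p x\<bar> \<le> C" unfolding bounded_iff by (metis imageI real_norm_def)
    have lim: "(\<lambda>n. LINT x|\<mu> (r n). f x) \<longlonglongrightarrow> (LINT x|\<nu>. f x)"
      using cl_rng by (intro wc[where C = C] fc) (auto simp: f_def intro!: C)
    \<comment> \<open>Integrating p against the n-th discrete measure is the same as applying
      \<Lambda> to the n-th Bernstein approximation of p.\<close>
    have eq: "(LINT x|\<mu> n. f x) = \<Lambda> (\<Sum>k\<le>n. smult (poly p (real k / real n)) (bern_poly n k))" for n
      by (subst int\<mu>) (auto simp: sum smult wt_def f_def cl_id nodes intro!: sum.cong)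
    have "(\<lambda>n. LINT x|\<mu> n. f x) \<longlonglongrightarrow> \<Lambda> p"
    proof (rule LIMSEQ_I)
      fix e :: real assume e: "e > 0"
      obtain N where N: "\<And>n x. N \<le> n \<Longrightarrow> x \<in> {0..1} \<Longrightarrow> \<bar>poly p x - (\<Sum>k\<le>n. poly p (k/n) * Bernstein n k x)\<bar> < e / 2"
      proof -
        have "continuous_on {0..1} (poly p)" by (intro continuous_intros)
        from Bernstein_Weierstrass[OF this half_gt_zero[OF e]] show ?thesis using that by blast
      qed
      have "norm ((LINT x|\<mu> n. f x) - \<Lambda> p) < e" if "N \<le> n" for n
      proof -
        have "\<bar>\<Lambda> (\<Sum>k\<le>n. smult (poly p (real k / real n)) (bern_poly n k)) - \<Lambda> p\<bar> \<le> e / 2"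
        proof (rule bnd)
          fix x :: real assume "0 \<le> x" "x \<le> 1"
          then show "\<bar>poly (\<Sum>k\<le>n. smult (poly p (real k / real n)) (bern_poly n k)) x - poly p x\<bar> \<le> e / 2"
            using N[OF that, of x] by (simp add: poly_sum poly_bern_poly abs_minus_commute)
        qed
        then show ?thesis unfolding eq using e by simp
      qed
      then show "\<exists>no. \<forall>n\<ge>no. norm ((LINT x|\<mu> n. f x) - \<Lambda> p) < e" by blast
    qed
    then have "(\<lambda>n. LINT x|\<mu> (r n). f x) \<longlonglongrightarrow> \<Lambda> p"
      using LIMSEQ_subseq_LIMSEQ[OF _ r(1)] by (fastforce simp: o_def)
    then have "(LINT x|\<nu>. f x) = \<Lambda> p" using lim LIMSEQ_unique by blast
    moreover have "(LINT x|\<nu>. f x) = (LINT x|\<nu>. poly p x)"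
    proof (rule integral_cong_AE)
      show "AE x in \<nu>. f x = poly p x" by (rule eventually_mono[OF AE]) (simp add: f_def cl_id)
    qed (use pm in auto)
    ultimately show ?thesis by simp
  qed
  then show ?thesis using that r(2) AE by blast
qed

subsection \<open>Existence of the hypergroup convolution\<close>

context jacobi begin

text \<open>Pairs of a finite combination f of Jacobi functions and the solution u of the wave
  equation with u(x,0) = f(x), given by the same combination of products. A relation and not a map
  on functions, since f may have several representations; that u depends on f alone follows from
  \<open>jspan_bound\<close>.\<close>

inductive jspan :: "(real \<Rightarrow> complex) \<Rightarrow> (real \<Rightarrow> real \<Rightarrow> complex) \<Rightarrow> bool" where
  zero: "jspan (\<lambda>_. 0) (\<lambda>_ _. 0)"
| step: "jspan f u \<Longrightarrow> jspan (\<lambda>x. f x + c * phi l x) (\<lambda>x y. u x y + c * phi l x * phi l y)"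

lemma jspan_scale: "jspan f u \<Longrightarrow> jspan (\<lambda>x. k * f x) (\<lambda>x y. k * u x y)"
proof (induction rule: jspan.induct)
  case zero then show ?case using jspan.zero by simp
next
  case (step f u c l)
  from jspan.step[OF step.IH, of "k * c" l] show ?case by (simp add: algebra_simps)
qed

lemma jspan_add: "jspan g v \<Longrightarrow> jspan f u \<Longrightarrow> jspan (\<lambda>x. f x + g x) (\<lambda>x y. u x y + v x y)"
proof (induction rule: jspan.induct)
  case zero then show ?case by simp
next
  case (step g v c l)
  from jspan.step[OF step.IH[OF step.prems], of c l] show ?case by (simp add: add.assoc)
qed

lemma jspan_phi: "jspan (phi l) (\<lambda>x y. phi l x * phi l y)"
  using jspan.step[OF jspan.zero, of 1 l] by simp

lemma jspan_const: "jspan (\<lambda>_. k) (\<lambda>_ _. k)"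
  using jspan_scale[OF jspan_phi[of "- \<i> * of_real \<rho>"], of k] unfolding phi_one by simp

lemma jspan_at_0: "jspan f u \<Longrightarrow> u x 0 = f x"
  by (induction rule: jspan.induct) auto

lemma jspan_sym: "jspan f u \<Longrightarrow> u x y = u y x"
  by (induction rule: jspan.induct) auto

lemma jspan_cont: "jspan f u \<Longrightarrow> continuous_on UNIV (\<lambda>z. u (fst z) (snd z))"
  by (induction rule: jspan.induct)
     (auto intro!: continuous_intros continuous_on_compose2[OF phi_continuous])

lemma jspan_cont1: "jspan f u \<Longrightarrow> continuous_on S f"
  by (induction rule: jspan.induct) (auto intro!: continuous_intros)

text \<open>Where eig l differs from 0, an antiderivative of A phi is - A phi' / eig l. Defining it
  by the integral avoids the division, as eig l may vanish for complex l.\<close>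

lemma A_phi_antideriv:
  assumes X: "X > 0"
  obtains \<Psi> where "continuous_on {0..X} \<Psi>"
    "\<And>x. 0 < x \<Longrightarrow> x < X \<Longrightarrow> (\<Psi> has_vector_derivative of_real (A x) * phi l x) (at x)"
    "\<And>r s. 0 \<le> s \<Longrightarrow> s \<le> r \<Longrightarrow> r \<le> X \<Longrightarrow> - (eig l * (\<Psi> r - \<Psi> s)) = of_real (A r) * dphi l r - of_real (A s) * dphi l s"
proof -
  define \<Psi> where "\<Psi> x = integral {0..x} (\<lambda>t. of_real (A t) * phi l t)" for x
  have ci: "continuous_on {0..X} (\<lambda>t. of_real (A t) * phi l t)"
    by (intro continuous_intros continuous_on_subset[OF A_continuous]) auto
  have c: "continuous_on {0..X} \<Psi>"
    unfolding \<Psi>_def[abs_def] by (intro indefinite_integral_continuous_1 integrable_continuous_interval ci)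
  have d: "(\<Psi> has_vector_derivative of_real (A x) * phi l x) (at x)" if x: "0 < x" "x < X" for x
    using integral_has_vector_derivative[OF ci, of x] x at_within_Icc_at[of 0 x X] by (simp add: \<Psi>_def[abs_def])
  show ?thesis
  proof (rule that[OF c d])
    fix r s assume rs: "0 \<le> s" "s \<le> r" "r \<le> X"
    define D where "D x = of_real (A x) * dphi l x + eig l * \<Psi> x" for x
    have "D r = D s"
    proof (cases "s = r")
      case False
      then have sr: "s < r" using rs by simp
      have "cmod (D r - D s) \<le> 0 - 0"
      proof (rule differentiable_bound_general[OF sr, where f' = "\<lambda>_. 0" and \<phi> = "\<lambda>_. 0" and \<phi>' = "\<lambda>_. 0"])
        show "continuous_on {s..r} D"
          unfolding D_def[abs_def] using rs
          by (intro continuous_intros continuous_on_subset[OF A_continuous] continuous_on_subset[OF c]) auto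
        fix x assume x: "s < x" "x < r"
        have "(D has_vector_derivative - (eig l * (of_real (A x) * phi l x)) + eig l * (of_real (A x) * phi l x)) (at x)"
          unfolding D_def[abs_def] using x rs
          by (intro has_vector_derivative_add has_vector_derivative_mult_right A_dphi_deriv d) auto
        then show "(D has_vector_derivative 0) (at x)" by simp
      qed auto
      then show ?thesis by simp
    qed simp
    then show "- (eig l * (\<Psi> r - \<Psi> s)) = of_real (A r) * dphi l r - of_real (A s) * dphi l s"
      by (simp add: D_def algebra_simps)
  qed auto
qed

text \<open>Green's identity for \<open>u\<^sub>x\<^sub>x + B u\<^sub>x = u\<^sub>y\<^sub>y + B u\<^sub>y\<close> on the characteristic triangle with
  apex \<open>(x0, y0)\<close>, in differentiated form: \<open>J y\<close> is the flux through the horizontal line at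
  height \<open>y\<close> plus the boundary values of \<open>A(x) A(y) u\<close> on the two slanted sides.\<close>
lemma jspan_green:
  assumes xy: "0 < y0" "y0 \<le> x0"
  shows "jspan f u \<Longrightarrow> \<exists>J. continuous_on {0..y0} J \<and> J 0 = 0 \<and> J y0 = of_real (2 * A x0 * A y0) * u x0 y0 \<and>
    (\<forall>y. 0 < y \<and> y < y0 \<longrightarrow> (J has_vector_derivative
       of_real (A (x0 + y0 - y) * A y * (B y - B (x0 + y0 - y))) * u (x0 + y0 - y) y
       + of_real (A (x0 - y0 + y) * A y * (B (x0 - y0 + y) + B y)) * u (x0 - y0 + y) y) (at y))"
proof (induction rule: jspan.induct)
  case zero
  show ?case by (rule exI[of _ "\<lambda>_. 0"]) auto
next
  case (step f u c l)
  then obtain J where J: "continuous_on {0..y0} J" "J 0 = 0" "J y0 = of_real (2 * A x0 * A y0) * u x0 y0"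
    "\<And>y. 0 < y \<Longrightarrow> y < y0 \<Longrightarrow> (J has_vector_derivative
       of_real (A (x0 + y0 - y) * A y * (B y - B (x0 + y0 - y))) * u (x0 + y0 - y) y
       + of_real (A (x0 - y0 + y) * A y * (B (x0 - y0 + y) + B y)) * u (x0 - y0 + y) y) (at y)" by blast
  define X where "X = x0 + y0 + 1"
  obtain \<Psi> where \<Psi>: "continuous_on {0..X} \<Psi>"
    "\<And>x. 0 < x \<Longrightarrow> x < X \<Longrightarrow> (\<Psi> has_vector_derivative of_real (A x) * phi l x) (at x)"
    "\<And>r s. 0 \<le> s \<Longrightarrow> s \<le> r \<Longrightarrow> r \<le> X \<Longrightarrow> - (eig l * (\<Psi> r - \<Psi> s)) = of_real (A r) * dphi l r - of_real (A s) * dphi l s"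
    using A_phi_antideriv[of X] xy by (auto simp: X_def)
  \<comment> \<open>The abscissas of the two characteristics through the apex; both equal x0 at
    height y0.\<close>
  define r where "r y = x0 + y0 - y" for y
  define s where "s y = x0 - y0 + y" for y
  \<comment> \<open>For a single product the flux through height y is A(y) phi'(y) times the
    integral of A phi over [s y, r y]. On differentiating, eig l times that integral becomes a
    difference of boundary values of A phi', so eig l drops out.\<close>
  define K where "K y = (of_real (A y) * dphi l y) * (\<Psi> (r y) - \<Psi> (s y))
     + of_real (A (r y) * A y) * (phi l (r y) * phi l y) + of_real (A (s y) * A y) * (phi l (s y) * phi l y)" for y
  have cK: "continuous_on {0..y0} K"
  proof -
    have cr: "continuous_on {0..y0} r" "continuous_on {0..y0} s" unfolding r_def[abs_def] s_def[abs_def] by (intro continuous_intros)+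
    have i: "r ` {0..y0} \<subseteq> {0..}" "s ` {0..y0} \<subseteq> {0..}" "r ` {0..y0} \<subseteq> {0..X}" "s ` {0..y0} \<subseteq> {0..X}"
      using xy by (auto simp: r_def s_def X_def)
    have "continuous_on {0..y0} (\<lambda>y. \<Psi> (r y))" "continuous_on {0..y0} (\<lambda>y. \<Psi> (s y))"
      "continuous_on {0..y0} (\<lambda>y. A (r y))" "continuous_on {0..y0} (\<lambda>y. A (s y))" "continuous_on {0..y0} A"
      "continuous_on {0..y0} (\<lambda>y. phi l (r y))" "continuous_on {0..y0} (\<lambda>y. phi l (s y))"
      using continuous_on_compose2[OF \<Psi>(1) cr(1) i(3)] continuous_on_compose2[OF \<Psi>(1) cr(2) i(4)]
        continuous_on_compose2[OF A_continuous cr(1) i(1)] continuous_on_compose2[OF A_continuous cr(2) i(2)]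
        continuous_on_subset[OF A_continuous] continuous_on_compose2[OF phi_continuous[of UNIV] cr(1)]
        continuous_on_compose2[OF phi_continuous[of UNIV] cr(2)] by auto
    then show ?thesis unfolding K_def[abs_def] by (intro continuous_intros)
  qed
  have dK: "(K has_vector_derivative
       of_real (A (r y) * A y * (B y - B (r y))) * (phi l (r y) * phi l y)
       + of_real (A (s y) * A y * (B (s y) + B y)) * (phi l (s y) * phi l y)) (at y)" if y: "0 < y" "y < y0" for y
  proof -
    have p: "r y > 0" "s y > 0" "r y < X" "s y < X" "s y \<le> r y" using xy y by (auto simp: r_def s_def X_def)
    have dr: "(r has_vector_derivative -1) (at y)" "(s has_vector_derivative 1) (at y)"
      unfolding r_def[abs_def] s_def[abs_def] has_real_derivative_iff_has_vector_derivative[symmetric]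
      by (auto intro!: derivative_eq_intros)
    have dr': "(r has_real_derivative -1) (at y)" "(s has_real_derivative 1) (at y)"
      using dr by (auto simp: has_real_derivative_iff_has_vector_derivative)
    have d1: "((\<lambda>y. \<Psi> (r y)) has_vector_derivative - (of_real (A (r y)) * phi l (r y))) (at y)"
      "((\<lambda>y. \<Psi> (s y)) has_vector_derivative of_real (A (s y)) * phi l (s y)) (at y)"
      using vector_diff_chain_at[OF dr(1) \<Psi>(2)[of "r y"]] vector_diff_chain_at[OF dr(2) \<Psi>(2)[of "s y"]] p
      by (auto simp: o_def)
    have d2: "((\<lambda>y. phi l (r y)) has_vector_derivative - dphi l (r y)) (at y)"
      "((\<lambda>y. phi l (s y)) has_vector_derivative dphi l (s y)) (at y)"
      using vector_diff_chain_at[OF dr(1) phi_deriv] vector_diff_chain_at[OF dr(2) phi_deriv] by (auto simp: o_def)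
    have d3: "((\<lambda>y. A (r y) * A y) has_real_derivative A (r y) * (A y * B y) + - (A (r y) * B (r y)) * A y) (at y)"
      using DERIV_mult[OF DERIV_chain2[OF A_deriv[OF p(1)] dr'(1)] A_deriv[OF y(1)]] by (simp add: algebra_simps)
    have d4: "((\<lambda>y. A (s y) * A y) has_real_derivative A (s y) * (A y * B y) + (A (s y) * B (s y)) * A y) (at y)"
      using DERIV_mult[OF DERIV_chain2[OF A_deriv[OF p(2)] dr'(2)] A_deriv[OF y(1)]] by (simp add: algebra_simps)
    have K1: "(K has_vector_derivative
       ((of_real (A y) * dphi l y) * (- (of_real (A (r y)) * phi l (r y)) - of_real (A (s y)) * phi l (s y))
         + (- (eig l * (of_real (A y) * phi l y))) * (\<Psi> (r y) - \<Psi> (s y)))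
       + (of_real (A (r y) * A y) * (phi l (r y) * dphi l y + (- dphi l (r y)) * phi l y)
         + of_real (A (r y) * (A y * B y) + - (A (r y) * B (r y)) * A y) * (phi l (r y) * phi l y))
       + (of_real (A (s y) * A y) * (phi l (s y) * dphi l y + dphi l (s y) * phi l y)
         + of_real (A (s y) * (A y * B y) + (A (s y) * B (s y)) * A y) * (phi l (s y) * phi l y))) (at y)"
      unfolding K_def[abs_def]
      by (intro has_vector_derivative_add has_vector_derivative_mult has_vector_derivative_diff
          has_vector_derivative_of_real A_dphi_deriv d1 d2 d3 d4 phi_deriv y)
    have K2: "(- (eig l * (of_real (A y) * phi l y))) * (\<Psi> (r y) - \<Psi> (s y))
        = (of_real (A y) * phi l y) * (of_real (A (r y)) * dphi l (r y) - of_real (A (s y)) * dphi l (s y))"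
      unfolding \<Psi>(3)[OF less_imp_le[OF p(2)] p(5) less_imp_le[OF p(3)], symmetric] by (simp add: algebra_simps)
    from K1[unfolded K2] show ?thesis by (rule has_vector_derivative_eq_rhs) (simp add: algebra_simps)
  qed
  have K0: "K 0 = 0" by (simp add: K_def)
  have Ky0: "K y0 = of_real (2 * A x0 * A y0) * (phi l x0 * phi l y0)"
    by (simp add: K_def r_def s_def)
  show ?case
  proof (intro exI[of _ "\<lambda>y. J y + c * K y"] conjI allI impI)
    show "continuous_on {0..y0} (\<lambda>y. J y + c * K y)" by (intro continuous_intros J cK)
    show "J 0 + c * K 0 = 0" by (simp add: J K0)
    show "J y0 + c * K y0 = of_real (2 * A x0 * A y0) * (u x0 y0 + c * phi l x0 * phi l y0)"
      by (simp add: J Ky0 algebra_simps)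
    fix y assume y: "0 < y \<and> y < y0"
    have "((\<lambda>y. J y + c * K y) has_vector_derivative
       (of_real (A (x0 + y0 - y) * A y * (B y - B (x0 + y0 - y))) * u (x0 + y0 - y) y
       + of_real (A (x0 - y0 + y) * A y * (B (x0 - y0 + y) + B y)) * u (x0 - y0 + y) y)
       + c * (of_real (A (r y) * A y * (B y - B (r y))) * (phi l (r y) * phi l y)
       + of_real (A (s y) * A y * (B (s y) + B y)) * (phi l (s y) * phi l y))) (at y)"
      by (intro has_vector_derivative_add has_vector_derivative_mult_right J(4) dK) (use y in auto)
    then show "((\<lambda>y. J y + c * K y) has_vector_derivative
       of_real (A (x0 + y0 - y) * A y * (B y - B (x0 + y0 - y))) * (u (x0 + y0 - y) y + c * phi l (x0 + y0 - y) * phi l y)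
       + of_real (A (x0 - y0 + y) * A y * (B (x0 - y0 + y) + B y)) * (u (x0 - y0 + y) y + c * phi l (x0 - y0 + y) * phi l y)) (at y)"
      by (rule has_vector_derivative_eq_rhs) (simp add: r_def s_def algebra_simps)
  qed
qed

text \<open>J rises from 0 to 2 A(x0) A(y0) u(x0,y0). The weight on the right side is B y - B r
  \<ge> 0 because B decreases and y \<le> r; the weight on the left side is strictly
  positive.\<close>

lemma jspan_apex_pos:
  assumes u: "jspan f u" and xy: "0 < y0" "y0 \<le> x0"
    and pos: "\<And>y. 0 < y \<Longrightarrow> y < y0 \<Longrightarrow> Re (u (x0 + y0 - y) y) > 0 \<and> Re (u (x0 - y0 + y) y) > 0"
  shows "Re (u x0 y0) > 0"
proof -
  obtain J where J: "continuous_on {0..y0} J" "J 0 = 0" "J y0 = of_real (2 * A x0 * A y0) * u x0 y0"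
    "\<And>y. 0 < y \<Longrightarrow> y < y0 \<Longrightarrow> (J has_vector_derivative
       of_real (A (x0 + y0 - y) * A y * (B y - B (x0 + y0 - y))) * u (x0 + y0 - y) y
       + of_real (A (x0 - y0 + y) * A y * (B (x0 - y0 + y) + B y)) * u (x0 - y0 + y) y) (at y)"
    using jspan_green[OF xy u] by blast
  have "(\<lambda>y. Re (J y)) 0 < (\<lambda>y. Re (J y)) y0"
  proof (rule DERIV_pos_imp_increasing_open[OF xy(1)])
    show "continuous_on {0..y0} (\<lambda>y. Re (J y))" by (intro continuous_intros J)
    fix y assume y: "0 < y" "y < y0"
    define r where "r = x0 + y0 - y"
    define s where "s = x0 - y0 + y"
    have p: "r > 0" "s > 0" "y \<le> r" using xy y by (auto simp: r_def s_def)
    have "((\<lambda>y. Re (J y)) has_vector_derivative Re (of_real (A r * A y * (B y - B r)) * u r y + of_real (A s * A y * (B s + B y)) * u s y)) (at y)"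
      using bounded_linear.has_vector_derivative[OF bounded_linear_Re J(4)[OF y]] by (simp add: r_def s_def)
    then have "((\<lambda>y. Re (J y)) has_real_derivative A r * A y * (B y - B r) * Re (u r y) + A s * A y * (B s + B y) * Re (u s y)) (at y)"
      by (simp add: has_real_derivative_iff_has_vector_derivative)
    moreover have "A r * A y * (B y - B r) * Re (u r y) \<ge> 0"
      using pos[OF y] A_nonneg B_antimono[OF y(1) p(3)] by (intro mult_nonneg_nonneg) (auto simp: r_def)
    moreover have "A s * A y * (B s + B y) * Re (u s y) > 0"
      using pos[OF y] A_pos[OF p(2)] A_pos[OF y(1)] B_pos[OF p(2)] B_pos[OF y(1)] by (intro mult_pos_pos) (auto simp: s_def)
    ultimately show "\<exists>d. ((\<lambda>y. Re (J y)) has_real_derivative d) (at y) \<and> d > 0" using add_nonneg_pos by blast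
  qed
  then have "2 * A x0 * A y0 * Re (u x0 y0) > 0" by (simp add: J)
  moreover have "2 * A x0 * A y0 > 0" using A_pos[of x0] A_pos[of y0] xy by simp
  ultimately show ?thesis by (simp add: zero_less_mult_iff)
qed

text \<open>A maximum principle: among the points of the closed triangle where Re u \<le> 0, a
  lowest one exists by compactness. It is not on the base, and the sides of its own triangle lie
  below it, where Re u > 0; this contradicts \<open>jspan_apex_pos\<close>.\<close>

lemma jspan_pos_strict:
  assumes u: "jspan f u" and xy: "0 \<le> y0" "y0 \<le> x0"
    and pos: "\<And>z. x0 - y0 \<le> z \<Longrightarrow> z \<le> x0 + y0 \<Longrightarrow> Re (f z) > 0"
  shows "Re (u x0 y0) > 0"
proof (rule ccontr)
  assume neg: "\<not> ?thesis"
  define Tr where "Tr = {z :: real \<times> real. 0 \<le> snd z \<and> x0 - y0 + snd z \<le> fst z \<and> fst z \<le> x0 + y0 - snd z}"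
  define Z where "Z = Tr \<inter> {z. Re (u (fst z) (snd z)) \<le> 0}"
  have cl: "closed Z"
    unfolding Z_def Tr_def by (intro closed_Int closed_Collect_conj closed_Collect_le continuous_intros jspan_cont[OF u])
  have "Z \<subseteq> cbox (x0 - y0, 0) (x0 + y0, y0)"
    by (auto simp: Z_def Tr_def)
  then have "bounded Z" using bounded_cbox bounded_subset by blast
  then have cZ: "compact Z" using cl compact_eq_bounded_closed by blast
  have "(x0, y0) \<in> Z" using neg xy by (auto simp: Z_def Tr_def)
  then have ne: "Z \<noteq> {}" by blast
  obtain z where z: "z \<in> Z" "\<And>z'. z' \<in> Z \<Longrightarrow> snd z \<le> snd z'"
    using continuous_attains_inf[OF cZ ne continuous_on_snd[OF continuous_on_id]] by blast
  obtain x1 y1 where z1: "z = (x1, y1)" by (cases z)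
  have t: "0 \<le> y1" "x0 - y0 + y1 \<le> x1" "x1 \<le> x0 + y0 - y1" "Re (u x1 y1) \<le> 0"
    using z(1) by (auto simp: z1 Z_def Tr_def)
  have "y1 \<noteq> 0"
  proof
    assume "y1 = 0"
    then show False using t pos[of x1] jspan_at_0[OF u, of x1] by simp
  qed
  then have y1: "y1 > 0" "y1 \<le> x1" using t xy by auto
  have below: "Re (u x y) > 0" if "0 \<le> y" "y < y1" "x0 - y0 + y \<le> x" "x \<le> x0 + y0 - y" for x y
  proof (rule ccontr)
    assume "\<not> Re (u x y) > 0"
    then have "(x, y) \<in> Z" using that by (auto simp: Z_def Tr_def)
    then show False using z(2)[of "(x, y)"] that by (simp add: z1)
  qed
  have "Re (u x1 y1) > 0"
    by (rule jspan_apex_pos[OF u y1]) (use t in \<open>auto intro!: below\<close>)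
  then show False using t by simp
qed

text \<open>Strictness is removed by adding a small constant, constants being in the span; the
  symmetry of u reduces to y \<le> x.\<close>

lemma jspan_nonneg:
  assumes u: "jspan f u" and xy: "0 \<le> x" "0 \<le> y"
    and nn: "\<And>z. \<bar>x - y\<bar> \<le> z \<Longrightarrow> z \<le> x + y \<Longrightarrow> Re (f z) \<ge> 0"
  shows "Re (u x y) \<ge> 0"
proof -
  have main: "Re (u x y) \<ge> 0" if xy: "0 \<le> y" "y \<le> x" and nn: "\<And>z. x - y \<le> z \<Longrightarrow> z \<le> x + y \<Longrightarrow> Re (f z) \<ge> 0" for x y
  proof (rule field_le_epsilon)
    fix e :: real assume "e > 0"
    have "Re (u x y + of_real e) > 0"
      by (rule jspan_pos_strict[OF jspan_add[OF jspan_const u] xy]) (use nn \<open>e > 0\<close> in \<open>auto intro!: add_nonneg_pos\<close>)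
    then show "0 \<le> Re (u x y) + e" by simp
  qed
  show ?thesis
  proof (cases "y \<le> x")
    case True then show ?thesis using main[OF xy(2) True] nn by auto
  next
    case False
    then have "Re (u y x) \<ge> 0" using main[OF xy(1), of y] nn by (auto simp: add.commute)
    then show ?thesis using jspan_sym[OF u] by simp
  qed
qed

text \<open>Rotating u(x,y) onto the negative axis by \<theta> of modulus 1 and applying positivity
  to M + \<theta> f. With M = 0 it shows that the value at (x,y) is determined by f on
  [|x-y|, x+y].\<close>

lemma jspan_bound:
  assumes u: "jspan f u" and xy: "0 \<le> x" "0 \<le> y"
    and b: "\<And>z. \<bar>x - y\<bar> \<le> z \<Longrightarrow> z \<le> x + y \<Longrightarrow> cmod (f z) \<le> M"
  shows "cmod (u x y) \<le> M"
proof (cases "u x y = 0")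
  case True
  have "cmod (f (x + y)) \<le> M" using xy by (intro b) auto
  then show ?thesis using True by (simp add: order_trans[OF norm_ge_zero])
next
  case False
  define \<theta> where "\<theta> = - (cnj (u x y) / of_real (cmod (u x y)))"
  have \<theta>: "cmod \<theta> = 1" "\<theta> * u x y = - of_real (cmod (u x y))"
    using False by (auto simp: \<theta>_def norm_divide complex_norm_square[symmetric] mult.commute[of "cnj _"] power2_eq_square)
  have "Re (of_real M + \<theta> * u x y) \<ge> 0"
  proof (rule jspan_nonneg[OF jspan_add[OF jspan_scale[OF u] jspan_const] xy])
    fix z assume z: "\<bar>x - y\<bar> \<le> z" "z \<le> x + y"
    have "\<bar>Re (\<theta> * f z)\<bar> \<le> cmod (\<theta> * f z)" by (rule abs_Re_le_cmod)
    also have "\<dots> \<le> M" using b[OF z] \<theta> by (simp add: norm_mult)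
    finally show "Re (of_real M + \<theta> * f z) \<ge> 0" by simp
  qed
  then show ?thesis unfolding \<theta>(2) by simp
qed

lemma jspan_bound_diff:
  assumes "jspan f u" "jspan g v" "0 \<le> x" "0 \<le> y"
    and "\<And>z. \<bar>x - y\<bar> \<le> z \<Longrightarrow> z \<le> x + y \<Longrightarrow> cmod (f z - g z) \<le> M"
  shows "cmod (u x y - v x y) \<le> M"
  using jspan_bound[OF jspan_add[OF jspan_scale[OF assms(2), of "-1"] assms(1)] assms(3,4), of M] assms(5) by simp

text \<open>Induction on the degree: a multiple of the Jacobi function that is a polynomial of the
  same degree removes the leading coefficient. The solution stays real, as needed for a real moment
  functional.\<close>

lemma jspan_poly:
  "\<exists>u. jspan (\<lambda>z. of_real (poly p ((sinh z)\<^sup>2))) (\<lambda>x y. of_real (u x y))"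
proof (induction "degree p" arbitrary: p rule: less_induct)
  case less
  obtain q :: "real poly" where q: "degree q = degree p" "\<And>x. phi (- \<i> * of_real (\<rho> + 2 * real (degree p))) x = of_real (poly q ((sinh x)\<^sup>2))"
    using phi_poly[of "degree p"] by blast
  show ?case
  proof (cases "degree p = 0")
    case True
    then obtain k where "p = [:k:]" by (meson degree_eq_zeroE)
    then show ?thesis using jspan_const[of "of_real k"] by (intro exI[of _ "\<lambda>_ _. k"]) simp
  next
    case False
    define k where "k = lead_coeff p / lead_coeff q"
    have "lead_coeff q \<noteq> 0" using q(1) False by (metis degree_0 leading_coeff_0_iff)
    define p' where "p' = p - smult k q"
    have "degree p' < degree p"
    proof -
      have "degree p' \<le> degree p" unfolding p'_def using q(1) by (intro degree_diff_le) auto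
      moreover have "coeff p' (degree p) = 0" using q(1) \<open>lead_coeff q \<noteq> 0\<close> by (simp add: p'_def k_def)
      ultimately show ?thesis using False by (metis degree_0 leading_coeff_0_iff le_neq_implies_less gr0I)
    qed
    then obtain u where u: "jspan (\<lambda>z. of_real (poly p' ((sinh z)\<^sup>2))) (\<lambda>x y. of_real (u x y))" using less by blast
    have "jspan (\<lambda>z. of_real (poly p ((sinh z)\<^sup>2))) (\<lambda>x y. of_real (u x y + k * poly q ((sinh x)\<^sup>2) * poly q ((sinh y)\<^sup>2)))"
      using jspan.step[OF u, of "of_real k" "- \<i> * of_real (\<rho> + 2 * real (degree p))"]
      unfolding q(2) by (simp add: p'_def)
    then show ?thesis by (rule exI[of _ "\<lambda>x y. u x y + k * poly q ((sinh x)\<^sup>2) * poly q ((sinh y)\<^sup>2)"])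
  qed
qed

text \<open>Weierstrass approximation in the variable v = sinh^2 z / sinh^2 R, which maps [0,R]
  homeomorphically onto [0,1].\<close>

lemma poly_sinh_dense:
  fixes f :: "real \<Rightarrow> real"
  assumes R: "R > 0" and f: "continuous_on {0..R} f" and e: "e > 0"
  obtains p :: "real poly" where "\<And>z. 0 \<le> z \<Longrightarrow> z \<le> R \<Longrightarrow> \<bar>f z - poly p ((sinh z)\<^sup>2)\<bar> < e"
proof -
  define g where "g v = f (arsinh (sqrt v * sinh R))" for v
  have sR: "sinh R > 0" using R by simp
  have rng: "(\<lambda>v. arsinh (sqrt v * sinh R)) ` {0..1} \<subseteq> {0..R}"
  proof clarify
    fix v :: real assume v: "v \<in> {0..1}"
    then have 1: "sqrt v * sinh R \<le> 1 * sinh R" "0 \<le> sqrt v * sinh R" using sR by (intro mult_right_mono, auto)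
    have "sinh (arsinh (sqrt v * sinh R)) \<le> sinh R" "sinh 0 \<le> sinh (arsinh (sqrt v * sinh R))" using 1 by auto
    then show "arsinh (sqrt v * sinh R) \<in> {0..R}" unfolding sinh_real_le_iff by simp
  qed
  have "continuous_on {0..1} g"
    unfolding g_def[abs_def] by (rule continuous_on_compose2[OF f _ rng]) (intro continuous_intros)
  from Bernstein_Weierstrass[OF this e] obtain n where
    n: "\<And>x. x \<in> {0..1} \<Longrightarrow> \<bar>g x - (\<Sum>k\<le>n. g (k/n) * Bernstein n k x)\<bar> < e" by blast
  define q :: "real poly" where "q = (\<Sum>k\<le>n. smult (g (k/n)) (bern_poly n k))"
  define p where "p = pcompose q [:0, 1 / (sinh R)\<^sup>2:]"
  show ?thesis
  proof (rule that[of p])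
    fix z assume z: "0 \<le> z" "z \<le> R"
    define v where "v = (sinh z)\<^sup>2 / (sinh R)\<^sup>2"
    have sz: "0 \<le> sinh z" "sinh z \<le> sinh R" using z by auto
    have v: "v \<in> {0..1}" using sz sR by (auto simp: v_def power_mono divide_le_eq_1)
    have "sqrt v * sinh R = sinh z" using sz sR by (simp add: v_def real_sqrt_divide)
    then have gv: "g v = f z" by (simp add: g_def arsinh_sinh_real)
    have "poly p ((sinh z)\<^sup>2) = poly q v" by (simp add: p_def poly_pcompose v_def)
    also have "\<dots> = (\<Sum>k\<le>n. g (k/n) * Bernstein n k v)" by (simp add: q_def poly_sum poly_bern_poly)
    finally show "\<bar>f z - poly p ((sinh z)\<^sup>2)\<bar> < e" using n[OF v] gv by simp
  qed
qed

section \<open>The convolution measures: uniqueness and existence\<close>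

definition hconv :: "real \<Rightarrow> real \<Rightarrow> real measure \<Rightarrow> bool" where
  "hconv x y \<mu> \<longleftrightarrow> prob_space \<mu> \<and> sets \<mu> = sets borel \<and> emeasure \<mu> {\<bar>x - y\<bar>..x + y} = 1 \<and>
     (\<forall>l. (LINT t|\<mu>. phi l t) = phi l x * phi l y)"

lemma hconv_AE: assumes "hconv x y \<mu>" shows "AE z in \<mu>. \<bar>x - y\<bar> \<le> z \<and> z \<le> x + y"
proof -
  interpret prob_space \<mu> using assms by (simp add: hconv_def)
  have "prob {\<bar>x - y\<bar>..x + y} = 1" using assms by (simp add: hconv_def measure_def)
  then have "AE z in \<mu>. z \<in> {\<bar>x - y\<bar>..x + y}"
    using assms by (subst (asm) prob_eq_1) (auto simp: hconv_def)
  then show ?thesis by simp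
qed

lemma hconv_integrable:
  fixes f :: "real \<Rightarrow> 'b :: {banach, second_countable_topology}"
  assumes h: "hconv x y \<mu>" and f: "f \<in> borel_measurable borel"
    and b: "\<And>z. \<bar>x - y\<bar> \<le> z \<Longrightarrow> z \<le> x + y \<Longrightarrow> norm (f z) \<le> C"
  shows "integrable \<mu> f"
proof -
  interpret prob_space \<mu> using h by (simp add: hconv_def)
  have [measurable_cong]: "sets \<mu> = sets borel" using h by (simp add: hconv_def)
  show ?thesis
  proof (rule integrable_const_bound[where B = C])
    show "AE z in \<mu>. norm (f z) \<le> C" by (rule eventually_mono[OF hconv_AE[OF h]]) (use b in blast)
  qed (use f in measurable)
qed

lemma hconv_integrable_cont:
  fixes f :: "real \<Rightarrow> 'b :: {banach, second_countable_topology}"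
  assumes h: "hconv x y \<mu>" and f: "continuous_on UNIV f"
  shows "integrable \<mu> f"
proof -
  have "bounded (f ` {\<bar>x - y\<bar>..x + y})"
    by (intro compact_imp_bounded compact_continuous_image continuous_on_subset[OF f]) auto
  then obtain C where "\<And>z. z \<in> {\<bar>x - y\<bar>..x + y} \<Longrightarrow> norm (f z) \<le> C" unfolding bounded_iff by blast
  then show ?thesis by (intro hconv_integrable[OF h, of _ C] borel_measurable_continuous_onI f) auto
qed

lemma hconv_jspan:
  assumes h: "hconv x y \<mu>"
  shows "jspan f u \<Longrightarrow> (LINT t|\<mu>. f t) = u x y"
proof (induction rule: jspan.induct)
  case (step f u c l)
  have i: "integrable \<mu> f" "integrable \<mu> (phi l)"
    by (rule hconv_integrable_cont[OF h], rule jspan_cont1[OF step.hyps], rule hconv_integrable_cont[OF h], rule phi_continuous)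
  then show ?case using step.IH h by (simp add: hconv_def)
qed simp

lemma hconv_approx:
  fixes f g :: "real \<Rightarrow> complex"
  assumes h: "hconv x y \<mu>" and f: "integrable \<mu> f" and g: "integrable \<mu> g"
    and e: "\<And>z. \<bar>x - y\<bar> \<le> z \<Longrightarrow> z \<le> x + y \<Longrightarrow> cmod (f z - g z) \<le> e"
  shows "cmod ((LINT t|\<mu>. f t) - (LINT t|\<mu>. g t)) \<le> e"
proof -
  interpret prob_space \<mu> using h by (simp add: hconv_def)
  have "cmod ((LINT t|\<mu>. f t) - (LINT t|\<mu>. g t)) = cmod (LINT t|\<mu>. f t - g t)" using f g by simp
  also have "\<dots> \<le> (LINT t|\<mu>. cmod (f t - g t))" by simp
  also have "\<dots> \<le> (LINT t|\<mu>. e)"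
  proof (rule integral_mono_AE)
    show "AE t in \<mu>. cmod (f t - g t) \<le> e" by (rule eventually_mono[OF hconv_AE[OF h]]) (use e in blast)
  qed (use f g in auto)
  finally show ?thesis by (simp add: prob_space)
qed

text \<open>Complex-valued continuous functions are approximated by \<open>p1(sinh\<^sup>2) + i p2(sinh\<^sup>2)\<close>, for which
  the solution of the wave equation is known.\<close>
lemma jspan_dense:
  fixes f :: "real \<Rightarrow> complex"
  assumes R: "R > 0" and f: "continuous_on {0..R} f" and e: "e > 0"
  obtains g u where "jspan g u" "\<And>z. 0 \<le> z \<Longrightarrow> z \<le> R \<Longrightarrow> cmod (f z - g z) \<le> e"
    "\<exists>p1 p2. g = (\<lambda>z. of_real (poly p1 ((sinh z)\<^sup>2)) + \<i> * of_real (poly p2 ((sinh z)\<^sup>2)))"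
proof -
  have "continuous_on {0..R} (\<lambda>z. Re (f z))" "continuous_on {0..R} (\<lambda>z. Im (f z))" using f by (auto intro!: continuous_intros)
  then obtain p1 p2 :: "real poly" where p: "\<And>z. 0 \<le> z \<Longrightarrow> z \<le> R \<Longrightarrow> \<bar>Re (f z) - poly p1 ((sinh z)\<^sup>2)\<bar> < e/2"
    "\<And>z. 0 \<le> z \<Longrightarrow> z \<le> R \<Longrightarrow> \<bar>Im (f z) - poly p2 ((sinh z)\<^sup>2)\<bar> < e/2"
    using poly_sinh_dense[OF R _ half_gt_zero[OF e]] by metis
  obtain u1 u2 where u: "jspan (\<lambda>z. of_real (poly p1 ((sinh z)\<^sup>2))) (\<lambda>x y. of_real (u1 x y))"
    "jspan (\<lambda>z. of_real (poly p2 ((sinh z)\<^sup>2))) (\<lambda>x y. of_real (u2 x y))" using jspan_poly by blast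
  show ?thesis
  proof (rule that[OF jspan_add[OF jspan_scale[OF u(2), of \<i>] u(1)]])
    fix z assume z: "0 \<le> z" "z \<le> R"
    have "cmod (f z - (of_real (poly p1 ((sinh z)\<^sup>2)) + \<i> * of_real (poly p2 ((sinh z)\<^sup>2)))) \<le> \<bar>Re (f z) - poly p1 ((sinh z)\<^sup>2)\<bar> + \<bar>Im (f z) - poly p2 ((sinh z)\<^sup>2)\<bar>"
      by (rule order_trans[OF cmod_le]) simp
    also have "\<dots> \<le> e" using p[OF z] by simp
    finally show "cmod (f z - (of_real (poly p1 ((sinh z)\<^sup>2)) + \<i> * of_real (poly p2 ((sinh z)\<^sup>2)))) \<le> e" .
  qed blast
qed

text \<open>Both measures integrate every f in the span to the same u(x,y), and such f approximate
  exp(itz) uniformly on [0, x+y], which contains both supports. Hence the characteristic functions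
  agree.\<close>

lemma hconv_unique:
  assumes xy: "x > 0" "y > 0" and h: "hconv x y \<mu>" "hconv x y \<nu>"
  shows "\<mu> = \<nu>"
proof -
  have rd: "real_distribution \<mu>" "real_distribution \<nu>"
    using h by (auto simp: hconv_def real_distribution_def real_distribution_axioms_def)
  have "char \<mu> t = char \<nu> t" for t
  proof -
    have c: "continuous_on S (\<lambda>z. iexp (t * z))" for S by (intro continuous_intros)
    have "cmod (char \<mu> t - char \<nu> t) \<le> 0 + e" if e: "e > 0" for e
    proof -
      obtain g u where g: "jspan g u" "\<And>z. 0 \<le> z \<Longrightarrow> z \<le> x + y \<Longrightarrow> cmod (iexp (t * z) - g z) \<le> e / 2"
        by (rule jspan_dense[OF add_pos_pos[OF xy] c half_gt_zero[OF e]]) blast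
      have "cmod ((LINT z|\<mu>. iexp (t * z)) - (LINT z|\<mu>. g z)) \<le> e / 2"
        "cmod ((LINT z|\<nu>. iexp (t * z)) - (LINT z|\<nu>. g z)) \<le> e / 2"
        using hconv_approx[OF h(1) hconv_integrable_cont[OF h(1) c] hconv_integrable_cont[OF h(1) jspan_cont1[OF g(1)]], of "e/2"]
          hconv_approx[OF h(2) hconv_integrable_cont[OF h(2) c] hconv_integrable_cont[OF h(2) jspan_cont1[OF g(1)]], of "e/2"] g(2)
        by (meson abs_ge_zero order_trans)+
      moreover have "(LINT z|\<mu>. g z) = (LINT z|\<nu>. g z)" using hconv_jspan[OF h(1) g(1)] hconv_jspan[OF h(2) g(1)] by simp
      ultimately show ?thesis unfolding char_def
        using norm_triangle_ineq4[of "(LINT z|\<mu>. iexp (t * z)) - (LINT z|\<mu>. g z)" "(LINT z|\<nu>. iexp (t * z)) - (LINT z|\<nu>. g z)"] by simp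
    qed
    then have "cmod (char \<mu> t - char \<nu> t) \<le> 0" by (rule field_le_epsilon)
    then show ?thesis by simp
  qed
  then show ?thesis by (intro Levy_uniqueness rd ext)
qed

text \<open>The value at (x,y) of the solution with polynomial data is a positive normalised
  functional on polynomials in sinh^2 z. Rescaling sinh^2 affinely from [|x-y|, x+y] to [0,1] makes
  it a moment functional, and the representing measure is pushed back.\<close>

lemma hconv_exists:
  assumes xy: "x > 0" "y > 0"
  shows "\<exists>\<mu>. hconv x y \<mu>"
proof -
  define s where "s = \<bar>x - y\<bar>"
  define t where "t = x + y"
  have st: "0 \<le> s" "s < t" "t > 0" using xy by (auto simp: s_def t_def)
  define S where "S = (sinh s)\<^sup>2"
  define T where "T = (sinh t)\<^sup>2"
  have ST: "0 \<le> S" "S < T" using st by (auto simp: S_def T_def intro!: power_strict_mono)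
  \<comment> \<open>Composition with the affine map from [S,T] to [0,1]. Since x, y > 0 gives |x-y|
    < x+y, the interval is not degenerate.\<close>
  define P where "P p = pcompose p [:- S / (T - S), 1 / (T - S):]" for p :: "real poly"
  have polyP: "poly (P p) w = poly p ((w - S) / (T - S))" for p w
    by (simp add: P_def poly_pcompose diff_divide_distrib)
  \<comment> \<open>An arbitrary solution for each polynomial; \<open>eq\<close> shows that its
    value at (x,y) does not depend on the choice, which makes \<Lambda> linear.\<close>
  define U where "U p = (SOME u. jspan (\<lambda>z. of_real (poly p ((sinh z)\<^sup>2))) (\<lambda>x y. of_real (u x y)))" for p
  have U: "jspan (\<lambda>z. of_real (poly p ((sinh z)\<^sup>2))) (\<lambda>x y. of_real (U p x y))" for p
    unfolding U_def by (rule someI_ex[OF jspan_poly])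
  define \<Lambda> where "\<Lambda> p = U (P p) x y" for p
  have eq: "U p x y = v x y" if "jspan (\<lambda>z. of_real (poly p ((sinh z)\<^sup>2))) (\<lambda>x y. of_real (v x y))" for p v
  proof -
    have "cmod (of_real (U p x y) - of_real (v x y)) \<le> 0"
      by (rule jspan_bound_diff[OF U that]) (use xy in auto)
    then show ?thesis by simp
  qed
  obtain \<nu> where \<nu>: "real_distribution \<nu>" "AE v in \<nu>. v \<in> {0..1}" "\<And>p. (LINT v|\<nu>. poly p v) = \<Lambda> p"
  proof (rule hausdorff_moment[of \<Lambda>])
    show "\<Lambda> (p + q) = \<Lambda> p + \<Lambda> q" for p q
    proof -
      have "jspan (\<lambda>z. of_real (poly (P (p + q)) ((sinh z)\<^sup>2))) (\<lambda>x y. of_real (U (P p) x y + U (P q) x y))"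
        using jspan_add[OF U[of "P q"] U[of "P p"]] by (simp add: polyP)
      then show ?thesis unfolding \<Lambda>_def by (rule eq)
    qed
    show "\<Lambda> (smult c p) = c * \<Lambda> p" for c p
    proof -
      have "jspan (\<lambda>z. of_real (poly (P (smult c p)) ((sinh z)\<^sup>2))) (\<lambda>x y. of_real (c * U (P p) x y))"
        using jspan_scale[OF U[of "P p"], of "of_real c"] by (simp add: polyP)
      then show ?thesis unfolding \<Lambda>_def by (rule eq)
    qed
    show "\<Lambda> 1 = 1"
    proof -
      have "jspan (\<lambda>z. of_real (poly (P 1) ((sinh z)\<^sup>2))) (\<lambda>x y. of_real ((\<lambda>_ _. 1) x y))"
        using jspan_const[of 1] by (simp add: polyP)
      then show ?thesis unfolding \<Lambda>_def by (rule eq)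
    qed
    show "\<Lambda> p \<ge> 0" if nn: "\<And>v. 0 \<le> v \<Longrightarrow> v \<le> 1 \<Longrightarrow> poly p v \<ge> 0" for p
    proof -
      have "Re (of_real (U (P p) x y)) \<ge> 0"
      proof (rule jspan_nonneg[OF U])
        fix z assume "\<bar>x - y\<bar> \<le> z" "z \<le> x + y"
        then have z: "s \<le> z" "z \<le> t" by (auto simp: s_def t_def)
        have "S \<le> (sinh z)\<^sup>2" "(sinh z)\<^sup>2 \<le> T" using z st by (auto simp: S_def T_def intro!: power_mono)
        then show "Re (of_real (poly (P p) ((sinh z)\<^sup>2))) \<ge> 0" using ST by (auto simp: polyP intro!: nn)
      qed (use xy in auto)
      then show ?thesis by (simp add: \<Lambda>_def)
    qed
  qed (rule that)
  interpret \<nu>: real_distribution \<nu> by fact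
  \<comment> \<open>Inverse of the substitution v = (sinh^2 z - S)/(T - S).\<close>
  define Y where "Y v = arsinh (sqrt (S + (T - S) * v))" for v
  have Yc: "continuous_on UNIV Y" unfolding Y_def[abs_def] by (intro continuous_intros)
  have [measurable]: "Y \<in> borel_measurable borel" by (rule borel_measurable_continuous_onI[OF Yc])
  have Y1: "s \<le> Y v \<and> Y v \<le> t \<and> (sinh (Y v))\<^sup>2 = S + (T - S) * v" if v: "v \<in> {0..1}" for v
  proof -
    have 1: "S \<le> S + (T - S) * v" using v ST by simp
    have "(T - S) * v \<le> (T - S) * 1" using v ST by (intro mult_left_mono) auto
    then have 2: "S + (T - S) * v \<le> T" by simp
    have "sinh s = sqrt S" "sinh t = sqrt T" using st by (auto simp: S_def T_def)
    then have "sinh s \<le> sinh (Y v)" "sinh (Y v) \<le> sinh t" using 1 2 by (auto simp: Y_def)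
    then show ?thesis using 1 ST unfolding sinh_real_le_iff by (simp add: Y_def)
  qed
  define \<mu> where "\<mu> = distr \<nu> borel Y"
  have "real_distribution \<mu>" unfolding \<mu>_def by (rule \<nu>.real_distribution_distr) measurable
  then interpret \<mu>: real_distribution \<mu> .
  have supp: "AE z in \<mu>. z \<in> {s..t}"
    unfolding \<mu>_def by (subst AE_distr_iff) (use Y1 in \<open>auto intro!: eventually_mono[OF \<nu>(2)]\<close>)
  have int_cont: "integrable \<mu> f" if "continuous_on UNIV f" for f :: "real \<Rightarrow> complex"
  proof -
    have "bounded (f ` {s..t})"
      by (intro compact_imp_bounded compact_continuous_image continuous_on_subset[OF that]) auto
    then obtain C where C: "\<And>z. z \<in> {s..t} \<Longrightarrow> norm (f z) \<le> C" unfolding bounded_iff by blast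
    show ?thesis
      by (rule \<mu>.integrable_const_bound[where B = C])
         (use C borel_measurable_continuous_onI[OF that] in \<open>auto intro: eventually_mono[OF supp]\<close>)
  qed
  have mom: "(LINT z|\<mu>. complex_of_real (poly p ((sinh z)\<^sup>2))) = of_real (U p x y)" for p
  proof -
    define q where "q = pcompose p [:S, T - S:]"
    have Pq: "poly (P q) w = poly p w" for w
    proof -
      have "S + (w - S) / (T - S) * (T - S) = w" using ST by simp
      then show ?thesis by (simp only: polyP q_def poly_pcompose poly_pCons poly_0 mult_zero_right add_0_right)
    qed
    then have "P q = p" using poly_eq_poly_eq_iff by blast
    have cm: "(\<lambda>z. complex_of_real (poly p ((sinh z)\<^sup>2))) \<in> borel_measurable borel"
      by (intro borel_measurable_continuous_onI continuous_intros)
    have "(LINT z|\<mu>. complex_of_real (poly p ((sinh z)\<^sup>2))) = (LINT v|\<nu>. complex_of_real (poly p ((sinh (Y v))\<^sup>2)))"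
      unfolding \<mu>_def by (rule integral_distr) (use cm in auto)
    also have "\<dots> = (LINT v|\<nu>. complex_of_real (poly q v))"
    proof (rule integral_cong_AE)
      show "(\<lambda>v. complex_of_real (poly p ((sinh (Y v))\<^sup>2))) \<in> borel_measurable \<nu>"
        using measurable_compose[OF _ cm, of Y \<nu>] by simp
      show "(\<lambda>v. complex_of_real (poly q v)) \<in> borel_measurable \<nu>"
      proof -
        have "(\<lambda>v. complex_of_real (poly q v)) \<in> borel_measurable borel"
          by (intro borel_measurable_continuous_onI continuous_intros)
        then show ?thesis by simp
      qed
      show "AE v in \<nu>. complex_of_real (poly p ((sinh (Y v))\<^sup>2)) = complex_of_real (poly q v)"
        by (rule eventually_mono[OF \<nu>(2)]) (use Y1 in \<open>auto simp: q_def poly_pcompose mult.commute\<close>)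
    qed
    also have "\<dots> = of_real (\<Lambda> q)" by (simp add: \<nu>(3))
    also have "\<Lambda> q = U p x y" by (simp add: \<Lambda>_def \<open>P q = p\<close>)
    finally show ?thesis .
  qed
  \<comment> \<open>From polynomials in sinh^2 to an arbitrary complex l: phi l is approximated
    uniformly on [0,t], and \<open>jspan_bound_diff\<close> shows that the solutions at (x,y) are
    then equally close.\<close>
  have "(LINT z|\<mu>. phi l z) = phi l x * phi l y" for l
  proof -
    have "cmod ((LINT z|\<mu>. phi l z) - phi l x * phi l y) \<le> 0 + e" if e: "e > 0" for e
    proof -
      obtain g u where g: "jspan g u" "\<And>z. 0 \<le> z \<Longrightarrow> z \<le> t \<Longrightarrow> cmod (phi l z - g z) \<le> e / 2"
        "\<exists>p1 p2. g = (\<lambda>z. of_real (poly p1 ((sinh z)\<^sup>2)) + \<i> * of_real (poly p2 ((sinh z)\<^sup>2)))"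
        by (rule jspan_dense[OF st(3) phi_continuous[where l = l] half_gt_zero[OF e]]) blast
      obtain p1 p2 where gp: "g = (\<lambda>z. of_real (poly p1 ((sinh z)\<^sup>2)) + \<i> * of_real (poly p2 ((sinh z)\<^sup>2)))" using g(3) by blast
      have pc: "integrable \<mu> (\<lambda>z. complex_of_real (poly p ((sinh z)\<^sup>2)))" for p
        by (intro int_cont continuous_intros)
      have "(LINT z|\<mu>. g z) = of_real (U p1 x y) + \<i> * of_real (U p2 x y)"
        unfolding gp using pc by (simp add: mom del: integral_complex_of_real)
      also have "\<dots> = u x y"
      proof -
        have "cmod ((of_real (U p1 x y) + \<i> * of_real (U p2 x y)) - u x y) \<le> 0"
          by (rule jspan_bound_diff[OF jspan_add[OF jspan_scale[OF U[of p2], of \<i>] U[of p1]] g(1)]) (use xy in \<open>auto simp: gp\<close>)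
        then show ?thesis by simp
      qed
      finally have ig: "(LINT z|\<mu>. g z) = u x y" .
      have "cmod (phi l x * phi l y - u x y) \<le> e / 2"
        by (rule jspan_bound_diff[OF jspan_phi g(1)]) (use xy g(2) in \<open>auto simp: t_def\<close>)
      moreover have "cmod ((LINT z|\<mu>. phi l z) - (LINT z|\<mu>. g z)) \<le> e / 2"
      proof -
        have i: "integrable \<mu> (phi l)" "integrable \<mu> g" by (rule int_cont, rule phi_continuous, rule int_cont, rule jspan_cont1[OF g(1)])
        have "cmod ((LINT z|\<mu>. phi l z) - (LINT z|\<mu>. g z)) = cmod (LINT z|\<mu>. phi l z - g z)" using i by simp
        also have "\<dots> \<le> (LINT z|\<mu>. cmod (phi l z - g z))" by simp
        also have "\<dots> \<le> (LINT z|\<mu>. e / 2)"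
          by (rule integral_mono_AE) (use i st g(2) in \<open>auto intro!: eventually_mono[OF supp]\<close>)
        finally show ?thesis using \<mu>.prob_space by simp
      qed
      ultimately show ?thesis unfolding ig
        using norm_triangle_ineq4[of "(LINT z|\<mu>. phi l z) - u x y" "phi l x * phi l y - u x y"] by simp
    qed
    then have "cmod ((LINT z|\<mu>. phi l z) - phi l x * phi l y) \<le> 0" by (rule field_le_epsilon)
    then show ?thesis by simp
  qed
  moreover have "emeasure \<mu> {s..t} = 1"
    using supp by (subst \<mu>.emeasure_eq_1_AE) auto
  ultimately have "hconv x y \<mu>"
    using \<mu>.prob_space_axioms unfolding hconv_def s_def t_def by (simp add: \<mu>_def)
  then show ?thesis by blast
qed

text \<open>The definite description is resolved here, which takes existence and uniqueness
  together.\<close>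

lemma hconv_hyp_conv:
  assumes "x > 0" "y > 0" shows "hconv x y (hyp_conv a b x y)"
proof -
  have "hyp_conv a b x y = (THE \<mu>. hconv x y \<mu>)" by (simp add: hyp_conv_def hconv_def phi_def)
  moreover have "\<exists>!\<mu>. hconv x y \<mu>" using hconv_exists[OF assms] hconv_unique[OF assms] by blast
  ultimately show ?thesis by (metis theI')
qed

end

subsection \<open>Measurability of the convolution kernel\<close>

lemma sets_borel_lessThan: "sets (borel :: real measure) = sigma_sets UNIV (range lessThan)"
  by (simp add: borel_Iio)

lemma Int_stable_lessThan: "Int_stable (range (lessThan :: real \<Rightarrow> real set))"
proof (rule Int_stableI_image)
  fix i j :: real
  show "\<exists>k\<in>UNIV. {..<i} \<inter> {..<j} = {..<k}" by (intro bexI[of _ "min i j"]) auto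
qed

text \<open>Continuous functions increasing with n to the indicator of z < t. They carry statements
  about integrals of continuous functions over to half-lines, a generator of the Borel sets stable
  under intersection.\<close>

definition ramp :: "real \<Rightarrow> nat \<Rightarrow> real \<Rightarrow> real" where
  "ramp t n z = min 1 (max 0 (real n * (t - z)))"

lemma ramp_props: "0 \<le> ramp t n z" "ramp t n z \<le> 1" "z \<ge> t \<Longrightarrow> ramp t n z = 0"
  by (auto simp: ramp_def mult_nonneg_nonpos)

lemma ramp_cont: "continuous_on S (ramp t n)"
  unfolding ramp_def[abs_def] by (intro continuous_intros)

lemma ramp_measurable [measurable]: "ramp t n \<in> borel_measurable borel"
  by (rule borel_measurable_continuous_onI[OF ramp_cont])

lemma ramp_incseq: "incseq (\<lambda>n z. ennreal (ramp t n z))"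
proof (rule incseq_SucI, rule le_funI)
  fix n z
  have "max 0 (real n * (t - z)) \<le> max 0 (real (Suc n) * (t - z))"
  proof (cases "z \<le> t")
    case True
    then have "real n * (t - z) \<le> real (Suc n) * (t - z)" by (intro mult_right_mono) auto
    then show ?thesis by (simp add: max_def)
  next
    case False
    then have "real n * (t - z) \<le> 0" by (intro mult_nonneg_nonpos) auto
    then have "max 0 (real n * (t - z)) = 0" by (rule max_absorb1)
    then show ?thesis by simp
  qed
  then show "ennreal (ramp t n z) \<le> ennreal (ramp t (Suc n) z)"
    unfolding ramp_def by (intro ennreal_leI min.mono) auto
qed

lemma ramp_LIMSEQ: "(\<lambda>n. ennreal (ramp t n z)) \<longlonglongrightarrow> indicator {..<t} z"
proof (cases "z < t")
  case True
  obtain N where N: "1 / (t - z) \<le> real N" by (meson real_arch_simple)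
  have "\<forall>\<^sub>F n in sequentially. ennreal (ramp t n z) = 1"
  proof (rule eventually_sequentiallyI[of N])
    fix n assume "N \<le> n"
    then have "1 / (t - z) \<le> real n" using N by linarith
    then have "1 \<le> real n * (t - z)" using True by (simp add: field_simps)
    then show "ennreal (ramp t n z) = 1" by (simp add: ramp_def)
  qed
  then show ?thesis using True by (simp add: tendsto_eventually)
next
  case False
  then show ?thesis by (simp add: ramp_props)
qed

lemma emeasure_lessThan_ramp:
  assumes "sets \<mu> = sets borel"
  shows "(\<lambda>n. \<integral>\<^sup>+z. ennreal (ramp t n z) \<partial>\<mu>) \<longlonglongrightarrow> emeasure \<mu> {..<t}"
proof -
  have [measurable_cong]: "sets \<mu> = sets borel" by fact
  have "(\<lambda>n. \<integral>\<^sup>+z. ennreal (ramp t n z) \<partial>\<mu>) \<longlonglongrightarrow> (\<integral>\<^sup>+z. indicator {..<t} z \<partial>\<mu>)"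
    by (rule nn_integral_LIMSEQ[OF ramp_incseq _ ramp_LIMSEQ]) measurable
  then show ?thesis by simp
qed

section \<open>The translation kernel and the measure A dx\<close>

context jacobi begin

definition "MA = density lborel (\<lambda>y. ennreal (A y) * indicator {0<..} y)"

lemma sets_MA [measurable_cong, simp]: "sets MA = sets borel" by (simp add: MA_def)
lemma space_MA [simp]: "space MA = UNIV" by (simp add: MA_def)

lemma nn_integral_MA:
  assumes [measurable]: "f \<in> borel_measurable borel"
  shows "(\<integral>\<^sup>+y. f y \<partial>MA) = (\<integral>\<^sup>+y\<in>{0<..}. f y * ennreal (A y) \<partial>lborel)"
  unfolding MA_def by (subst nn_integral_density) (auto intro!: nn_integral_cong simp: mult_ac)

lemma AE_MA_pos: "AE y in MA. y > 0"
  unfolding MA_def by (subst AE_density) (auto simp: indicator_def)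

lemma A_bounded: "\<exists>C\<ge>0. \<forall>y. 0 \<le> y \<and> y \<le> R \<longrightarrow> A y \<le> C"
  by (rule exI[of _ "A (max 0 R)"]) (auto intro!: A_mono A_nonneg)

lemma emeasure_MA_finite: "emeasure MA {..<R} < \<infinity>" "emeasure MA {..R} < \<infinity>"
proof -
  obtain C where C: "C \<ge> 0" "\<And>y. 0 \<le> y \<Longrightarrow> y \<le> R \<Longrightarrow> A y \<le> C" using A_bounded[of R] by blast
  have "emeasure MA {..R} = (\<integral>\<^sup>+y. (ennreal (A y) * indicator {0<..} y) * indicator {..R} y \<partial>lborel)"
    unfolding MA_def by (subst emeasure_density) auto
  also have "\<dots> \<le> (\<integral>\<^sup>+y. ennreal C * indicator {0..R} y \<partial>lborel)"
    by (intro nn_integral_mono) (auto simp: indicator_def intro!: ennreal_leI C)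
  also have "\<dots> < \<infinity>" by (simp add: nn_integral_cmult ennreal_mult_less_top emeasure_lborel_Icc_eq)
  finally show 1: "emeasure MA {..R} < \<infinity>" .
  have "emeasure MA {..<R} \<le> emeasure MA {..R}" by (intro emeasure_mono) auto
  then show "emeasure MA {..<R} < \<infinity>" using 1 by (rule le_less_trans)
qed

lemma sigma_finite_MA: "sigma_finite_measure MA"
proof
  show "\<exists>S. countable S \<and> S \<subseteq> sets MA \<and> \<Union> S = space MA \<and> (\<forall>s\<in>S. emeasure MA s \<noteq> \<infinity>)"
  proof (intro exI conjI ballI)
    show "countable (range (\<lambda>n::nat. {..<real n}))" by auto
    show "\<Union> (range (\<lambda>n::nat. {..<real n})) = space MA" using reals_Archimedean2 by auto
    fix s assume "s \<in> range (\<lambda>n::nat. {..<real n})"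
    then show "emeasure MA s \<noteq> \<infinity>" using emeasure_MA_finite(1) by (auto simp: less_top)
  qed auto
qed

lemma integrable_MA_bounded:
  fixes f :: "real \<Rightarrow> complex"
  assumes f: "f \<in> borel_measurable borel" and b: "\<And>y. 0 < y \<Longrightarrow> y \<le> R \<Longrightarrow> cmod (f y) \<le> C" and z: "\<And>y. y > R \<Longrightarrow> f y = 0"
  shows "integrable MA f"
proof -
  note f [measurable]
  have "(\<integral>\<^sup>+y. ennreal (cmod (f y)) \<partial>MA) \<le> (\<integral>\<^sup>+y. ennreal (max 0 C) * indicator {..R} y \<partial>MA)"
  proof (rule nn_integral_mono_AE, rule eventually_mono[OF AE_MA_pos])
    fix y :: real assume "y > 0"
    then show "ennreal (cmod (f y)) \<le> ennreal (max 0 C) * indicator {..R} y"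
      using b[of y] z[of y] by (cases "y \<le> R") (auto intro!: ennreal_leI)
  qed
  also have "\<dots> = ennreal (max 0 C) * emeasure MA {..R}" by (subst nn_integral_cmult_indicator) auto
  also have "\<dots> < \<infinity>" using emeasure_MA_finite(2)[of R] by (simp add: ennreal_mult_less_top)
  finally show ?thesis by (intro integrableI_bounded) auto
qed

text \<open>The point mass for y \<le> 0 is a filler: it makes Kx x a probability kernel on the
  whole line and is not seen by \<open>MA\<close>.\<close>

definition "Kx x y = (if y > 0 then hyp_conv a b x y else return borel 0)"

lemma Kx_prob: "x > 0 \<Longrightarrow> prob_space (Kx x y)"
  using hconv_hyp_conv[of x y] by (auto simp: Kx_def hconv_def intro!: prob_space_return)

lemma Kx_sets: "x > 0 \<Longrightarrow> sets (Kx x y) = sets borel"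
  using hconv_hyp_conv[of x y] by (auto simp: Kx_def hconv_def)

lemma Kx_hconv: "x > 0 \<Longrightarrow> y > 0 \<Longrightarrow> hconv x y (Kx x y)"
  using hconv_hyp_conv[of x y] by (auto simp: Kx_def)

text \<open>The measure at y lives in [0, x+y], so approximating g on [0, n+x] by the span is
  accurate for y \<le> n. The integrals of the approximants are continuous in y.\<close>

lemma Kx_integral_measurable:
  fixes g :: "real \<Rightarrow> complex"
  assumes x: "x > 0" and g: "continuous_on UNIV g"
  shows "(\<lambda>y. LINT t|Kx x y. g t) \<in> borel_measurable borel"
proof -
  have "\<exists>f u. jspan f u \<and> (\<forall>z. 0 \<le> z \<and> z \<le> real n + x \<longrightarrow> cmod (g z - f z) \<le> 1 / real (Suc n))" for n
  proof -
    have R: "real n + x > 0" using x by simp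
    show ?thesis by (rule jspan_dense[OF R continuous_on_subset[OF g], of "1 / real (Suc n)"]) auto
  qed
  then obtain f u where fu: "\<And>n. jspan (f n) (u n)" "\<And>n z. 0 \<le> z \<Longrightarrow> z \<le> real n + x \<Longrightarrow> cmod (g z - f n z) \<le> 1 / real (Suc n)"
    by metis
  show ?thesis
  proof (rule borel_measurable_LIMSEQ_metric)
    fix n
    have "continuous_on UNIV (\<lambda>y. u n x y)"
      using continuous_on_compose2[OF jspan_cont[OF fu(1)[of n]], of UNIV "\<lambda>y. (x, y)",
        OF continuous_on_Pair[OF continuous_on_const continuous_on_id]] by simp
    then have [measurable]: "(\<lambda>y. u n x y) \<in> borel_measurable borel" by (rule borel_measurable_continuous_onI)
    show "(\<lambda>y. if y > 0 then u n x y else g 0) \<in> borel_measurable borel" by measurable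
  next
    fix y :: real
    show "(\<lambda>n. if y > 0 then u n x y else g 0) \<longlonglongrightarrow> (LINT t|Kx x y. g t)"
    proof (cases "y > 0")
      case True
      note h = Kx_hconv[OF x True]
      have "(\<lambda>n. u n x y - (LINT t|Kx x y. g t)) \<longlonglongrightarrow> 0"
      proof (rule Lim_null_comparison)
        obtain N where N: "y \<le> real N" by (meson real_arch_simple)
        show "\<forall>\<^sub>F n in sequentially. norm (u n x y - (LINT t|Kx x y. g t)) \<le> 1 / real (Suc n)"
        proof (rule eventually_sequentiallyI[of N])
          fix n assume "N \<le> n"
          have "cmod ((LINT t|Kx x y. g t) - (LINT t|Kx x y. f n t)) \<le> 1 / real (Suc n)"
            by (rule hconv_approx[OF h hconv_integrable_cont[OF h g] hconv_integrable_cont[OF h jspan_cont1[OF fu(1)]]])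
               (rule fu(2); use N \<open>N \<le> n\<close> in linarith)
          then show "norm (u n x y - (LINT t|Kx x y. g t)) \<le> 1 / real (Suc n)"
            using hconv_jspan[OF h fu(1)[of n]] by (simp add: norm_minus_commute)
        qed
        show "(\<lambda>n. 1 / real (Suc n)) \<longlonglongrightarrow> 0" by (rule LIMSEQ_Suc[OF lim_const_over_n])
      qed
      then show ?thesis using True by (simp add: LIM_zero_iff)
    next
      case False
      have "g \<in> borel_measurable borel" by (rule borel_measurable_continuous_onI[OF g])
      then show ?thesis using False by (simp add: Kx_def integral_return)
    qed
  qed
qed

lemma Kx_nn_ramp:
  assumes x: "x > 0"
  shows "(\<integral>\<^sup>+z. ennreal (ramp t n z) \<partial>Kx x y) = ennreal (Re (LINT z|Kx x y. complex_of_real (ramp t n z)))"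
proof -
  interpret prob_space "Kx x y" by (rule Kx_prob[OF x])
  have [measurable_cong]: "sets (Kx x y) = sets borel" by (rule Kx_sets[OF x])
  have "integrable (Kx x y) (ramp t n)"
    by (rule integrable_const_bound[where B = 1]) (auto simp: ramp_props abs_le_iff intro: order_trans[OF _ ramp_props(1)])
  then show ?thesis by (subst nn_integral_eq_integral) (auto simp: ramp_props)
qed

text \<open>It suffices to treat half-lines, whose masses are limits of integrals of ramps.\<close>

lemma Kx_measurable:
  assumes x: "x > 0"
  shows "Kx x \<in> borel \<rightarrow>\<^sub>M subprob_algebra borel"
proof (rule measurable_subprob_algebra_generated[OF sets_borel_lessThan Int_stable_lessThan])
  show "subprob_space (Kx x y)" for y using Kx_prob[OF x] prob_space_imp_subprob_space by blast
  show "sets (Kx x y) = sets borel" for y by (rule Kx_sets[OF x])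
  have "emeasure (Kx x y) UNIV = 1" for y
    using prob_space.emeasure_space_1[OF Kx_prob[OF x], of y] sets_eq_imp_space_eq[OF Kx_sets[OF x, of y]] by simp
  then show "(\<lambda>y. emeasure (Kx x y) UNIV) \<in> borel_measurable borel" by simp
  fix S assume "S \<in> range (lessThan :: real \<Rightarrow> _)"
  then obtain t where S: "S = {..<t}" by auto
  show "(\<lambda>y. emeasure (Kx x y) S) \<in> borel_measurable borel"
    unfolding S
  proof (rule borel_measurable_LIMSEQ_order)
    show "(\<lambda>n. \<integral>\<^sup>+z. ennreal (ramp t n z) \<partial>Kx x y) \<longlonglongrightarrow> emeasure (Kx x y) {..<t}" for y
      by (rule emeasure_lessThan_ramp[OF Kx_sets[OF x]])
    have "(\<lambda>y. LINT z|Kx x y. complex_of_real (ramp t n z)) \<in> borel_measurable borel" for n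
      by (rule Kx_integral_measurable[OF x]) (intro continuous_intros ramp_cont)
    then have "(\<lambda>y. ennreal (Re (LINT z|Kx x y. complex_of_real (ramp t n z)))) \<in> borel_measurable borel" for n by measurable
    then show "(\<lambda>y. \<integral>\<^sup>+z. ennreal (ramp t n z) \<partial>Kx x y) \<in> borel_measurable borel" for n
      by (simp only: Kx_nn_ramp[OF x])
  qed
qed auto

lemma Kx_lborel_measurable [measurable]:
  fixes f :: "real \<Rightarrow> complex"
  assumes x: "x > 0" and [measurable]: "f \<in> borel_measurable borel"
  shows "(\<lambda>y. LINT t|Kx x y. f t) \<in> borel_measurable borel"
  by (rule measurable_compose[OF Kx_measurable[OF x] integral_measurable_subprob_algebra]) fact

subsection \<open>The transform of a translate\<close>

text \<open>Lagrange's identity for two eigenfunctions, multiplied by the cut-off that is 1 on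
  [0,R1] and decreases linearly to 0 at R1 + 1. The right side is arranged to contain only values of
  phi i on [R1, R1+1] and no derivative, so that it can be estimated by uniform
  approximation.\<close>

lemma wronskian_identity:
  fixes l i :: complex
  assumes R1: "R1 > 0"
  defines "R2 \<equiv> R1 + 1"
  shows "(eig l - eig i) * ((LINT y:{0..R2}|lborel. phi i y * (of_real (min 1 (R2 - y)) * phi l y * of_real (A y))))
    = of_real (A R2) * phi i R2 * phi l R2 - of_real (A R1) * phi i R1 * phi l R1
      - (LINT y:{R1..R2}|lborel. phi i y * (2 * of_real (A y) * dphi l y + of_real (A y * B y) * phi l y))"
proof -
  define Wr where "Wr y = of_real (A y) * dphi i y * phi l y - phi i y * (of_real (A y) * dphi l y)" for y
  have dWr: "(Wr has_vector_derivative (eig l - eig i) * (of_real (A y) * phi i y * phi l y)) (at y)" if "y > 0" for y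
  proof -
    have "(Wr has_vector_derivative ((of_real (A y) * dphi i y) * dphi l y + (- (eig i * (of_real (A y) * phi i y))) * phi l y)
       - (phi i y * (- (eig l * (of_real (A y) * phi l y))) + dphi i y * (of_real (A y) * dphi l y))) (at y)"
      unfolding Wr_def[abs_def]
      by (intro has_vector_derivative_diff has_vector_derivative_mult A_dphi_deriv phi_deriv that)
    then show ?thesis by (rule has_vector_derivative_eq_rhs) (simp add: algebra_simps)
  qed
  have cA: "continuous_on {0..r} A" for r by (rule continuous_on_subset[OF A_continuous]) auto
  have cWr: "continuous_on {0..r} Wr" for r unfolding Wr_def[abs_def] by (intro continuous_intros cA)
  have Wr0: "Wr 0 = 0" by (simp add: Wr_def)
  have "((\<lambda>y. (eig l - eig i) * (of_real (A y) * phi i y * phi l y)) has_integral Wr R1 - Wr 0) {0..R1}"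
    by (rule fundamental_theorem_of_calculus_interior) (use R1 in \<open>auto intro!: cWr dWr\<close>)
  then have I1: "((\<lambda>y. (eig l - eig i) * (phi i y * (of_real (min 1 (R2 - y)) * phi l y * of_real (A y)))) has_integral Wr R1) {0..R1}"
    unfolding Wr0 by (rule has_integral_eq[rotated, THEN has_integral_eq_rhs]) (auto simp: R2_def min_def algebra_simps)
  \<comment> \<open>Differentiating the cut-off produces - Wr, which contains dphi i. The summand A
    phi i phi l trades that for terms with phi i alone.\<close>
  define Z where "Z y = of_real (R2 - y) * Wr y + of_real (A y) * (phi i y * phi l y)" for y
  define g where "g y = phi i y * (2 * of_real (A y) * dphi l y + of_real (A y * B y) * phi l y)" for y
  have dZ: "(Z has_vector_derivative of_real (R2 - y) * ((eig l - eig i) * (of_real (A y) * phi i y * phi l y)) + g y) (at y)" if y: "y > 0" for y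
  proof -
    have "((\<lambda>y. R2 - y) has_real_derivative -1) (at y)" by (auto intro!: derivative_eq_intros)
    then have "(Z has_vector_derivative (of_real (R2 - y) * ((eig l - eig i) * (of_real (A y) * phi i y * phi l y)) + of_real (-1) * Wr y)
       + (of_real (A y) * (phi i y * dphi l y + dphi i y * phi l y) + of_real (A y * B y) * (phi i y * phi l y))) (at y)"
      unfolding Z_def[abs_def]
      by (intro has_vector_derivative_add has_vector_derivative_mult has_vector_derivative_of_real dWr phi_deriv A_deriv y)
    then show ?thesis by (rule has_vector_derivative_eq_rhs) (simp add: Wr_def g_def algebra_simps)
  qed
  have cZ: "continuous_on {R1..R2} Z" unfolding Z_def[abs_def] using R1
    by (intro continuous_intros continuous_on_subset[OF cWr[of R2]] continuous_on_subset[OF A_continuous]) auto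
  have I2: "((\<lambda>y. of_real (R2 - y) * ((eig l - eig i) * (of_real (A y) * phi i y * phi l y)) + g y) has_integral Z R2 - Z R1) {R1..R2}"
  proof (rule fundamental_theorem_of_calculus_interior[OF _ cZ])
    show "R1 \<le> R2" by (simp add: R2_def)
    fix y assume "y \<in> {R1<..<R2}"
    then show "(Z has_vector_derivative of_real (R2 - y) * ((eig l - eig i) * (of_real (A y) * phi i y * phi l y)) + g y) (at y)"
      using R1 by (intro dZ) auto
  qed
  have cB: "continuous_on {R1..R2} B"
    by (rule continuous_at_imp_continuous_on) (use R1 in \<open>auto intro!: DERIV_isCont B_deriv\<close>)
  have cg: "continuous_on {R1..R2} g"
    unfolding g_def[abs_def] using R1 by (intro continuous_intros cB continuous_on_subset[OF A_continuous]) auto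
  have gi: "(g has_integral (LINT y:{R1..R2}|lborel. g y)) {R1..R2}"
    using set_borel_integral_eq_integral[OF borel_integrable_atLeastAtMost'[OF cg]] by (simp add: integrable_integral)
  from has_integral_diff[OF I2 gi]
  have I3: "((\<lambda>y. (eig l - eig i) * (phi i y * (of_real (min 1 (R2 - y)) * phi l y * of_real (A y)))) has_integral
      Z R2 - Z R1 - (LINT y:{R1..R2}|lborel. g y)) {R1..R2}"
    by (rule has_integral_eq[rotated]) (auto simp: R2_def min_def algebra_simps)
  have "((\<lambda>y. (eig l - eig i) * (phi i y * (of_real (min 1 (R2 - y)) * phi l y * of_real (A y)))) has_integral
      Wr R1 + (Z R2 - Z R1 - (LINT y:{R1..R2}|lborel. g y))) {0..R2}"
    by (rule has_integral_combine[OF _ _ I1 I3]) (use R1 in \<open>auto simp: R2_def\<close>)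
  moreover have cc: "continuous_on {0..R2} (\<lambda>y. phi i y * (of_real (min 1 (R2 - y)) * phi l y * of_real (A y)))"
    by (intro continuous_intros cA)
  have "((\<lambda>y. phi i y * (of_real (min 1 (R2 - y)) * phi l y * of_real (A y))) has_integral
      (LINT y:{0..R2}|lborel. phi i y * (of_real (min 1 (R2 - y)) * phi l y * of_real (A y)))) {0..R2}"
    using set_borel_integral_eq_integral[OF borel_integrable_atLeastAtMost'[OF cc]] by (simp add: integrable_integral)
  then have "((\<lambda>y. (eig l - eig i) * (phi i y * (of_real (min 1 (R2 - y)) * phi l y * of_real (A y)))) has_integral
      (eig l - eig i) * (LINT y:{0..R2}|lborel. phi i y * (of_real (min 1 (R2 - y)) * phi l y * of_real (A y)))) {0..R2}"
    by (rule has_integral_mult_right)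
  ultimately have "(eig l - eig i) * (LINT y:{0..R2}|lborel. phi i y * (of_real (min 1 (R2 - y)) * phi l y * of_real (A y)))
     = Wr R1 + (Z R2 - Z R1 - (LINT y:{R1..R2}|lborel. g y))"
    by (rule has_integral_unique[symmetric])
  also have "\<dots> = of_real (A R2) * phi i R2 * phi l R2 - of_real (A R1) * phi i R1 * phi l R1 - (LINT y:{R1..R2}|lborel. g y)"
    by (simp add: Z_def R2_def algebra_simps)
  finally show ?thesis by (simp add: g_def)
qed

text \<open>\<open>Av\<close> is the transform at l with linear cut-off, and \<open>Ebd\<close> the
  boundary term by which the Jacobi operator fails to be symmetric for it; for k = phi i they are
  linked by the preceding identity.\<close>

definition "awt l R1 y = of_real (min 1 (R1 + 1 - y)) * phi l y * of_real (A y)"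
definition "Av l R1 k = (LINT y:{0..R1 + 1}|lborel. k y * awt l R1 y)"
definition "bwt l y = 2 * of_real (A y) * dphi l y + of_real (A y * B y) * phi l y"
definition "Ebd l R1 k = of_real (A (R1 + 1)) * k (R1 + 1) * phi l (R1 + 1) - of_real (A R1) * k R1 * phi l R1
   - (LINT y:{R1..R1 + 1}|lborel. k y * bwt l y)"

lemma awt_cont: "continuous_on {0..r} (awt l R1)"
  unfolding awt_def[abs_def] by (intro continuous_intros continuous_on_subset[OF A_continuous]) auto

lemma bwt_cont: "R1 > 0 \<Longrightarrow> continuous_on {R1..r} (bwt l)"
  unfolding bwt_def[abs_def]
  by (intro continuous_intros continuous_on_subset[OF A_continuous] continuous_at_imp_continuous_on)
     (auto intro!: DERIV_isCont B_deriv)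

lemma Av_set_integrable:
  "continuous_on UNIV k \<Longrightarrow> set_integrable lborel {0..R1 + 1} (\<lambda>y. k y * awt l R1 y)"
  by (intro borel_integrable_atLeastAtMost' continuous_intros awt_cont) (auto intro: continuous_on_subset)

lemma Ebd_set_integrable:
  "R1 > 0 \<Longrightarrow> continuous_on UNIV k \<Longrightarrow> set_integrable lborel {R1..R1 + 1} (\<lambda>y. k y * bwt l y)"
  by (intro borel_integrable_atLeastAtMost' continuous_intros bwt_cont) (auto intro: continuous_on_subset)

lemma Av_linear:
  assumes "continuous_on UNIV f" "continuous_on UNIV g"
  shows "Av l R1 (\<lambda>y. f y + c * g y) = Av l R1 f + c * Av l R1 g"
proof -
  have "Av l R1 (\<lambda>y. f y + c * g y) = (LINT y:{0..R1 + 1}|lborel. f y * awt l R1 y + c * (g y * awt l R1 y))"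
    by (simp add: Av_def algebra_simps)
  also have "\<dots> = Av l R1 f + (LINT y:{0..R1 + 1}|lborel. c * (g y * awt l R1 y))"
    unfolding Av_def
    by (rule set_integral_add(2)[OF Av_set_integrable[OF assms(1)]])
       (intro set_integrable_mult_right Av_set_integrable assms)
  finally show ?thesis by (simp add: Av_def)
qed

lemma Ebd_linear:
  assumes "R1 > 0" "continuous_on UNIV f" "continuous_on UNIV g"
  shows "Ebd l R1 (\<lambda>y. f y + c * g y) = Ebd l R1 f + c * Ebd l R1 g"
proof -
  have "(LINT y:{R1..R1 + 1}|lborel. (f y + c * g y) * bwt l y) = (LINT y:{R1..R1 + 1}|lborel. f y * bwt l y + c * (g y * bwt l y))"
    by (simp add: algebra_simps)
  also have "\<dots> = (LINT y:{R1..R1 + 1}|lborel. f y * bwt l y) + (LINT y:{R1..R1 + 1}|lborel. c * (g y * bwt l y))"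
    by (rule set_integral_add(2)[OF Ebd_set_integrable[OF assms(1,2)]])
       (intro set_integrable_mult_right Ebd_set_integrable assms)
  finally show ?thesis by (simp add: Ebd_def algebra_simps)
qed

lemma Av_phi_eig: "R1 > 0 \<Longrightarrow> (eig l - eig i) * Av l R1 (phi i) = Ebd l R1 (phi i)"
  using wronskian_identity[of R1 l i] by (simp add: Av_def Ebd_def awt_def bwt_def)

lemma jspan_cont2: "jspan f u \<Longrightarrow> continuous_on UNIV (u s)"
  using continuous_on_compose2[OF jspan_cont, of f u UNIV "\<lambda>y. (s, y)",
      OF _ continuous_on_Pair[OF continuous_on_const continuous_on_id]] by simp

text \<open>The cut-off transform of u(s, .) as a function h of s. Each product contributes phi i s
  with eigenvalue eig i, and replacing eig i by eig l costs exactly \<open>Ebd\<close>. So h solves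
  the Jacobi equation for l up to a forcing term; without it h(s) would be phi l s times
  h(0).\<close>

lemma jspan_transform:
  assumes R1: "R1 > 0"
  shows "jspan f u \<Longrightarrow> \<exists>h dh. (\<forall>s. (h has_vector_derivative dh s) (at s)) \<and> continuous_on UNIV dh \<and> dh 0 = 0 \<and>
     (\<forall>s. h s = Av l R1 (u s)) \<and>
     (\<forall>s>0. (dh has_vector_derivative Ebd l R1 (u s) - eig l * h s - of_real (B s) * dh s) (at s))"
proof (induction rule: jspan.induct)
  case zero
  show ?case by (rule exI[of _ "\<lambda>_. 0"], rule exI[of _ "\<lambda>_. 0"]) (simp add: Av_def Ebd_def)
next
  case (step f u c i)
  then obtain h dh where h: "\<And>s. (h has_vector_derivative dh s) (at s)" "continuous_on UNIV dh" "dh 0 = 0"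
    "\<And>s. h s = Av l R1 (u s)"
    "\<And>s. s > 0 \<Longrightarrow> (dh has_vector_derivative Ebd l R1 (u s) - eig l * h s - of_real (B s) * dh s) (at s)" by blast
  define m where "m = c * Av l R1 (phi i)"
  have lin: "Av l R1 (\<lambda>y. u s y + c * phi i s * phi i y) = Av l R1 (u s) + (c * phi i s) * Av l R1 (phi i)"
    "Ebd l R1 (\<lambda>y. u s y + c * phi i s * phi i y) = Ebd l R1 (u s) + (c * phi i s) * Ebd l R1 (phi i)" for s
    using Av_linear[OF jspan_cont2[OF step.hyps] phi_continuous] Ebd_linear[OF R1 jspan_cont2[OF step.hyps] phi_continuous]
    by blast+
  show ?case
  proof (rule exI[of _ "\<lambda>s. h s + m * phi i s"], rule exI[of _ "\<lambda>s. dh s + m * dphi i s"], intro conjI allI impI)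
    show "((\<lambda>s. h s + m * phi i s) has_vector_derivative dh s + m * dphi i s) (at s)" for s
      by (intro has_vector_derivative_add has_vector_derivative_mult_right h phi_deriv)
    show "continuous_on UNIV (\<lambda>s. dh s + m * dphi i s)" by (intro continuous_intros h)
    show "dh 0 + m * dphi i 0 = 0" by (simp add: h)
    show "h s + m * phi i s = Av l R1 (\<lambda>y. u s y + c * phi i s * phi i y)" for s
      unfolding lin h(4) m_def by (simp add: mult_ac)
    fix s :: real assume s: "s > 0"
    have "((\<lambda>s. dh s + m * dphi i s) has_vector_derivative
      (Ebd l R1 (u s) - eig l * h s - of_real (B s) * dh s) + m * (- (eig i * phi i s) - of_real (B s) * dphi i s)) (at s)"
      by (intro has_vector_derivative_add has_vector_derivative_mult_right h dphi_deriv s)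
    then show "((\<lambda>s. dh s + m * dphi i s) has_vector_derivative
      Ebd l R1 (\<lambda>y. u s y + c * phi i s * phi i y) - eig l * (h s + m * phi i s) - of_real (B s) * (dh s + m * dphi i s)) (at s)"
      unfolding lin Av_phi_eig[OF R1, symmetric] m_def
      by (rule has_vector_derivative_eq_rhs) (simp add: algebra_simps)
  qed
qed

lemma Ebd_bound:
  assumes R1: "R1 > 0"
  shows "\<exists>C\<ge>0. \<forall>k e. continuous_on UNIV k \<longrightarrow> (\<forall>y. R1 \<le> y \<and> y \<le> R1 + 1 \<longrightarrow> cmod (k y) \<le> e) \<longrightarrow> cmod (Ebd l R1 k) \<le> C * e"
proof -
  define C1 where "C1 = cmod (of_real (A (R1 + 1)) * phi l (R1 + 1))"
  define C2 where "C2 = cmod (of_real (A R1) * phi l R1)"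
  define C3 where "C3 = (LINT y:{R1..R1 + 1}|lborel. cmod (bwt l y))"
  have ib: "set_integrable lborel {R1..R1 + 1} (\<lambda>y. cmod (bwt l y))"
    by (intro borel_integrable_atLeastAtMost' continuous_intros bwt_cont R1)
  have C3: "C3 \<ge> 0" unfolding C3_def set_lebesgue_integral_def by (intro integral_nonneg_AE) auto
  have "cmod (Ebd l R1 k) \<le> (C1 + C2 + C3) * e"
    if k: "continuous_on UNIV k" and e: "\<And>y. R1 \<le> y \<Longrightarrow> y \<le> R1 + 1 \<Longrightarrow> cmod (k y) \<le> e" for k e
  proof -
    have "cmod (LINT y:{R1..R1 + 1}|lborel. k y * bwt l y) \<le> (LINT y:{R1..R1 + 1}|lborel. cmod (k y * bwt l y))"
      by (rule set_integral_norm_bound[OF Ebd_set_integrable[OF R1 k]])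
    also have "\<dots> \<le> (LINT y:{R1..R1 + 1}|lborel. e * cmod (bwt l y))"
      by (rule set_integral_mono[OF set_integrable_norm[OF Ebd_set_integrable[OF R1 k]]])
         (use ib e in \<open>auto simp: norm_mult intro!: mult_right_mono\<close>)
    also have "\<dots> = C3 * e" by (simp add: C3_def)
    finally have 3: "cmod (LINT y:{R1..R1 + 1}|lborel. k y * bwt l y) \<le> C3 * e" .
    have 1: "cmod (of_real (A (R1 + 1)) * k (R1 + 1) * phi l (R1 + 1)) \<le> C1 * e"
      using mult_left_mono[OF e[of "R1 + 1"], of C1] by (simp add: C1_def norm_mult mult_ac)
    have 2: "cmod (of_real (A R1) * k R1 * phi l R1) \<le> C2 * e"
      using mult_left_mono[OF e[of R1], of C2] by (simp add: C2_def norm_mult mult_ac)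
    have "cmod (Ebd l R1 k) \<le> cmod (of_real (A (R1 + 1)) * k (R1 + 1) * phi l (R1 + 1)) + cmod (of_real (A R1) * k R1 * phi l R1) + cmod (LINT y:{R1..R1 + 1}|lborel. k y * bwt l y)"
      unfolding Ebd_def by (meson norm_triangle_ineq4 order_trans add_right_mono)
    then show ?thesis using 1 2 3 by (simp add: distrib_right)
  qed
  moreover have "C1 + C2 + C3 \<ge> 0" using C3 by (simp add: C1_def C2_def)
  ultimately show ?thesis by blast
qed

lemma Av_bound:
  assumes R1: "R1 > 0"
  shows "\<exists>C\<ge>0. \<forall>k k' e. set_integrable lborel {0..R1 + 1} (\<lambda>y. k y * awt l R1 y) \<longrightarrow> set_integrable lborel {0..R1 + 1} (\<lambda>y. k' y * awt l R1 y)
    \<longrightarrow> (\<forall>y. 0 < y \<and> y \<le> R1 + 1 \<longrightarrow> cmod (k y - k' y) \<le> e) \<longrightarrow> cmod (Av l R1 k - Av l R1 k') \<le> C * e"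
proof -
  define C where "C = (LINT y:{0..R1 + 1}|lborel. cmod (awt l R1 y))"
  have C: "C \<ge> 0" unfolding C_def set_lebesgue_integral_def by (intro integral_nonneg_AE) auto
  have ia: "set_integrable lborel {0..R1 + 1} (\<lambda>y. cmod (awt l R1 y))"
    by (intro borel_integrable_atLeastAtMost' continuous_intros awt_cont)
  have "cmod (Av l R1 k - Av l R1 k') \<le> C * e"
    if k: "set_integrable lborel {0..R1 + 1} (\<lambda>y. k y * awt l R1 y)" "set_integrable lborel {0..R1 + 1} (\<lambda>y. k' y * awt l R1 y)"
      and e: "\<And>y. 0 < y \<Longrightarrow> y \<le> R1 + 1 \<Longrightarrow> cmod (k y - k' y) \<le> e" for k k' e
  proof -
    have d: "set_integrable lborel {0..R1 + 1} (\<lambda>y. k y * awt l R1 y - k' y * awt l R1 y)"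
      by (rule set_integral_diff(1)[OF k])
    have "cmod (Av l R1 k - Av l R1 k') = cmod (LINT y:{0..R1 + 1}|lborel. k y * awt l R1 y - k' y * awt l R1 y)"
      unfolding Av_def set_integral_diff(2)[OF k] ..
    also have "\<dots> \<le> (LINT y:{0..R1 + 1}|lborel. cmod (k y * awt l R1 y - k' y * awt l R1 y))"
      by (rule set_integral_norm_bound[OF d])
    also have "\<dots> \<le> (LINT y:{0..R1 + 1}|lborel. e * cmod (awt l R1 y))"
    proof (rule set_integral_mono_AE)
      show "AE y\<in>{0..R1 + 1} in lborel. cmod (k y * awt l R1 y - k' y * awt l R1 y) \<le> e * cmod (awt l R1 y)"
        \<comment> \<open>The hypothesis on k - k' speaks of y > 0 only, as the kernel is meaningful
          there.\<close>
        using AE_lborel_singleton[of "0::real"]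
      proof (rule eventually_mono, intro impI)
        fix y :: real assume "y \<noteq> 0" "y \<in> {0..R1 + 1}"
        then have "cmod (k y - k' y) * cmod (awt l R1 y) \<le> e * cmod (awt l R1 y)" by (intro mult_right_mono e) auto
        then show "cmod (k y * awt l R1 y - k' y * awt l R1 y) \<le> e * cmod (awt l R1 y)"
          by (simp add: norm_mult[symmetric] left_diff_distrib)
      qed
    qed (use d ia in \<open>auto intro!: set_integrable_norm\<close>)
    finally show ?thesis by (simp add: C_def mult.commute)
  qed
  then show ?thesis using C by blast
qed

text \<open>Gronwall's inequality for the difference of h and h(0) phi l. The friction term is
  singular at 0 but has the favourable sign and is dropped.\<close>

lemma forced_ode_bound:
  assumes x: "x > 0" and e: "e \<ge> 0"
    and h: "\<And>s. (h has_vector_derivative dh s) (at s)" "continuous_on UNIV dh" "dh 0 = 0"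
    and dh: "\<And>s. s > 0 \<Longrightarrow> (dh has_vector_derivative r s - eig l * h s - of_real (B s) * dh s) (at s)"
    and r: "\<And>s. 0 < s \<Longrightarrow> s < x \<Longrightarrow> cmod (r s) \<le> e"
  shows "cmod (h x - phi l x * h 0) \<le> e * exp ((2 + cmod (eig l)) * x)"
proof -
  define d where "d s = h s - h 0 * phi l s" for s
  define d' where "d' s = dh s - h 0 * dphi l s" for s
  define c where "c = 2 + cmod (eig l)"
  have c: "c \<ge> 2" by (simp add: c_def)
  \<comment> \<open>Including e^2 makes the differential inequality homogeneous, so that the forcing
    needs no separate treatment.\<close>
  define N where "N s = (cmod (d s))\<^sup>2 + (cmod (d' s))\<^sup>2 + e\<^sup>2" for s
  have dd: "(d has_vector_derivative d' s) (at s)" for s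
    unfolding d_def[abs_def] d'_def by (intro has_vector_derivative_diff has_vector_derivative_mult_right h phi_deriv)
  have dd': "(d' has_vector_derivative r s - eig l * d s - of_real (B s) * d' s) (at s)" if "s > 0" for s
  proof -
    have "(d' has_vector_derivative (r s - eig l * h s - of_real (B s) * dh s) - h 0 * (- (eig l * phi l s) - of_real (B s) * dphi l s)) (at s)"
      unfolding d'_def[abs_def] by (intro has_vector_derivative_diff has_vector_derivative_mult_right dh dphi_deriv that)
    then show ?thesis by (rule has_vector_derivative_eq_rhs) (simp add: d_def d'_def algebra_simps)
  qed
  have hc: "continuous_on S h" for S
    by (rule continuous_at_imp_continuous_on) (use h(1) has_vector_derivative_continuous in blast)
  have "N x \<le> N 0 * exp (c * x - c * 0)"
  proof (rule gronwall[where f' = "\<lambda>s. 2 * (d s \<bullet> d' s) + 2 * (d' s \<bullet> (r s - eig l * d s - of_real (B s) * d' s)) + 0" and g' = "\<lambda>_. c"])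
    show "0 \<le> x" using x by simp
    show "continuous_on {0..x} N"
      unfolding N_def[abs_def] d_def[abs_def] d'_def[abs_def]
      by (intro continuous_intros hc continuous_on_subset[OF h(2)]) auto
    show "continuous_on {0..x} ((*) c)" by (intro continuous_intros)
    fix s assume s: "0 < s" "s < x"
    show "(N has_real_derivative 2 * (d s \<bullet> d' s) + 2 * (d' s \<bullet> (r s - eig l * d s - of_real (B s) * d' s)) + 0) (at s)"
      unfolding N_def[abs_def] by (intro DERIV_add norm_sq_deriv dd dd' s DERIV_const)
    show "((*) c has_real_derivative c) (at s)" by (auto intro!: derivative_eq_intros)
    define p where "p = cmod (d s)"
    define q where "q = cmod (d' s)"
    have pq: "2 * p * q \<le> p\<^sup>2 + q\<^sup>2" by (rule sum_squares_bound)
    have i1: "d s \<bullet> d' s \<le> p * q" unfolding p_def q_def by (rule norm_cauchy_schwarz)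
    have i2: "d' s \<bullet> (r s) \<le> q * e"
      using norm_cauchy_schwarz[of "d' s" "r s"] mult_left_mono[OF r[OF s], of q] by (simp add: q_def)
    have i3: "- (d' s \<bullet> (eig l * d s)) \<le> q * (cmod (eig l) * p)"
      using norm_cauchy_schwarz[of "d' s" "- (eig l * d s)"] by (simp add: p_def q_def norm_mult)
    have i4: "d' s \<bullet> (of_real (B s) * d' s) \<ge> 0"
    proof -
      have "of_real (B s) * d' s = B s *\<^sub>R d' s" by (simp add: scaleR_conv_of_real)
      then show ?thesis using B_pos[OF s(1)] by simp
    qed
    have "2 * (d s \<bullet> d' s) + 2 * (d' s \<bullet> (r s - eig l * d s - of_real (B s) * d' s)) + 0
      \<le> 2 * (p * q) + 2 * (q * e + q * (cmod (eig l) * p))"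
      using i1 i2 i3 i4 by (simp add: inner_diff_right)
    also have "\<dots> = 2 * p * q + 2 * q * e + cmod (eig l) * (2 * p * q)" by (simp add: algebra_simps)
    also have "\<dots> \<le> (p\<^sup>2 + q\<^sup>2) + (q\<^sup>2 + e\<^sup>2) + cmod (eig l) * (p\<^sup>2 + q\<^sup>2)"
      using pq sum_squares_bound[of q e] by (intro add_mono mult_left_mono) auto
    also have "\<dots> \<le> c * (p\<^sup>2 + q\<^sup>2 + e\<^sup>2)"
    proof -
      have "0 \<le> p\<^sup>2" "0 \<le> q\<^sup>2" "0 \<le> e\<^sup>2" "0 \<le> cmod (eig l) * e\<^sup>2" by auto
      then show ?thesis unfolding c_def distrib_right distrib_left by linarith
    qed
    finally show "2 * (d s \<bullet> d' s) + 2 * (d' s \<bullet> (r s - eig l * d s - of_real (B s) * d' s)) + 0 \<le> c * N s"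
      by (simp add: N_def p_def q_def)
  qed
  also have "N 0 = e\<^sup>2" by (simp add: N_def d_def d'_def h)
  finally have "N x \<le> e\<^sup>2 * exp (c * x)" by simp
  then have "(cmod (d x))\<^sup>2 \<le> e\<^sup>2 * exp (c * x)"
    unfolding N_def using zero_le_power2[of "cmod (d' x)"] zero_le_power2[of e] by linarith
  also have "\<dots> \<le> e\<^sup>2 * (exp (c * x))\<^sup>2"
    using c x by (intro mult_left_mono) (auto simp: power2_eq_square mult_exp_exp)
  finally have "(cmod (d x))\<^sup>2 \<le> (e * exp (c * x))\<^sup>2" by (simp add: power_mult_distrib)
  then have "cmod (d x) \<le> e * exp (c * x)" by (rule power2_le_imp_le) (use e in auto)
  then show ?thesis by (simp add: d_def c_def mult.commute)
qed

lemma MA_altdef: "MA = density lborel (\<lambda>y. ennreal (A y * indicator {0<..} y))"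
  unfolding MA_def by (intro density_cong) (auto simp: indicator_def)

text \<open>k vanishes wherever the cut-off differs from 1.\<close>

lemma Av_MA:
  fixes k :: "real \<Rightarrow> complex"
  assumes [measurable]: "k \<in> borel_measurable borel" and k: "\<And>y. y \<ge> R1 \<Longrightarrow> k y = 0"
  shows "Av l R1 k = (LINT y|MA. k y * phi l y)"
proof -
  have [measurable]: "phi l \<in> borel_measurable borel" by (intro borel_measurable_continuous_onI continuous_intros)
  have "(LINT y|MA. k y * phi l y) = (LINT y|lborel. (A y * indicator {0<..} y) *\<^sub>R (k y * phi l y))"
    unfolding MA_altdef by (rule integral_density) (auto simp: A_nonneg)
  also have "\<dots> = Av l R1 k"
    unfolding Av_def set_lebesgue_integral_def
  proof (rule integral_cong_AE)
    show "AE y in lborel. (A y * indicator {0<..} y) *\<^sub>R (k y * phi l y) = indicat_real {0..R1 + 1} y *\<^sub>R (k y * awt l R1 y)"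
      using AE_lborel_singleton[of "0::real"]
    proof (rule eventually_mono)
      fix y :: real assume "y \<noteq> 0"
      then show "(A y * indicator {0<..} y) *\<^sub>R (k y * phi l y) = indicat_real {0..R1 + 1} y *\<^sub>R (k y * awt l R1 y)"
        using k[of y] by (cases "y \<ge> R1") (auto simp: awt_def indicator_def scaleR_conv_of_real)
    qed
    have "(\<lambda>y. indicat_real {0..R1 + 1} y *\<^sub>R awt l R1 y) \<in> borel_measurable borel"
      unfolding awt_def by measurable
    then have "(\<lambda>y. k y * (indicat_real {0..R1 + 1} y *\<^sub>R awt l R1 y)) \<in> borel_measurable borel" by measurable
    then show "(\<lambda>y. indicat_real {0..R1 + 1} y *\<^sub>R (k y * awt l R1 y)) \<in> borel_measurable lborel" by simp
  qed auto
  finally show ?thesis by simp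
qed

text \<open>g is approximated by f in the span with solution u. Propagation of the support keeps u
  small on the cut-off region, so h(s) nearly solves the unforced equation, giving h(x) close to phi
  l x h(0). Complex l is allowed, which includes the case phi l = 1.\<close>

lemma translate_cont_transform:
  fixes g :: "real \<Rightarrow> complex"
  assumes x: "x > 0" and g: "continuous_on UNIV g" and R: "R > 0" "\<And>z. z \<ge> R \<Longrightarrow> g z = 0"
  shows "(LINT y|MA. (LINT t|Kx x y. g t) * phi l y) = phi l x * (LINT y|MA. g y * phi l y)"
proof -
  define R1 where "R1 = R + x"
  have R1: "R1 > 0" using R x by (simp add: R1_def)
  define tg where "tg y = (LINT t|Kx x y. g t)" for y
  have tgm [measurable]: "tg \<in> borel_measurable borel" unfolding tg_def by (rule Kx_integral_measurable[OF x g])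
  have [measurable]: "g \<in> borel_measurable borel" by (rule borel_measurable_continuous_onI[OF g])
  have tg0: "tg y = 0" if "y \<ge> R1" for y
  proof -
    have y: "y > 0" using that R1 by simp
    have "tg y = (LINT t|Kx x y. 0)" unfolding tg_def
    proof (rule integral_cong_AE)
      show "AE t in Kx x y. g t = 0"
        by (rule eventually_mono[OF hconv_AE[OF Kx_hconv[OF x y]]]) (use that in \<open>auto simp: R1_def intro!: R\<close>)
    qed (auto simp: measurable_cong_sets[OF Kx_sets[OF x] refl])
    then show ?thesis by simp
  qed
  obtain CE where CE: "CE \<ge> 0" "\<And>k e. continuous_on UNIV k \<Longrightarrow> (\<And>y. R1 \<le> y \<Longrightarrow> y \<le> R1 + 1 \<Longrightarrow> cmod (k y) \<le> e) \<Longrightarrow> cmod (Ebd l R1 k) \<le> CE * e"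
    using Ebd_bound[OF R1, of l] by blast
  obtain CA where CA: "CA \<ge> 0" "\<And>k k' e. set_integrable lborel {0..R1 + 1} (\<lambda>y. k y * awt l R1 y) \<Longrightarrow> set_integrable lborel {0..R1 + 1} (\<lambda>y. k' y * awt l R1 y)
    \<Longrightarrow> (\<And>y. 0 < y \<Longrightarrow> y \<le> R1 + 1 \<Longrightarrow> cmod (k y - k' y) \<le> e) \<Longrightarrow> cmod (Av l R1 k - Av l R1 k') \<le> CA * e"
    using Av_bound[OF R1, of l] by blast
  have tgi: "set_integrable lborel {0..R1 + 1} (\<lambda>y. tg y * awt l R1 y)"
  proof -
    obtain C where C: "\<And>z. z \<in> {0..R1 + 1 + x} \<Longrightarrow> cmod (g z) \<le> C"
    proof -
      have "bounded (g ` {0..R1 + 1 + x})"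
        by (intro compact_imp_bounded compact_continuous_image continuous_on_subset[OF g]) auto
      then show ?thesis using that unfolding bounded_iff by blast
    qed
    have tb: "cmod (tg y) \<le> C" if "0 < y" "y \<le> R1 + 1" for y
    proof -
      have "cmod ((LINT t|Kx x y. g t) - (LINT t|Kx x y. 0)) \<le> C"
        by (rule hconv_approx[OF Kx_hconv[OF x that(1)] hconv_integrable_cont[OF Kx_hconv[OF x that(1)] g]])
           (use that in \<open>auto intro!: C\<close>)
      then show ?thesis by (simp add: tg_def)
    qed
    have am: "(\<lambda>y. indicat_real {0..R1 + 1} y *\<^sub>R awt l R1 y) \<in> borel_measurable borel"
    proof -
      have [measurable]: "phi l \<in> borel_measurable borel" by (intro borel_measurable_continuous_onI continuous_intros)
      show ?thesis unfolding awt_def by measurable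
    qed
    have "integrable lborel (\<lambda>y. indicat_real {0..R1 + 1} y *\<^sub>R (C * cmod (awt l R1 y)))"
      using borel_integrable_atLeastAtMost'[of 0 "R1 + 1" "\<lambda>y. C * cmod (awt l R1 y)"]
      by (simp add: set_integrable_def continuous_intros awt_cont)
    then show ?thesis
      unfolding set_integrable_def
    proof (rule Bochner_Integration.integrable_bound)
      have "(\<lambda>y. tg y * (indicat_real {0..R1 + 1} y *\<^sub>R awt l R1 y)) \<in> borel_measurable borel"
        using am by measurable
      then show "(\<lambda>y. indicat_real {0..R1 + 1} y *\<^sub>R (tg y * awt l R1 y)) \<in> borel_measurable lborel" by simp
      show "AE y in lborel. norm (indicat_real {0..R1 + 1} y *\<^sub>R (tg y * awt l R1 y)) \<le> norm (indicat_real {0..R1 + 1} y *\<^sub>R (C * cmod (awt l R1 y)))"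
        using AE_lborel_singleton[of "0::real"]
      proof (rule eventually_mono)
        fix y :: real assume "y \<noteq> 0"
        then show "norm (indicat_real {0..R1 + 1} y *\<^sub>R (tg y * awt l R1 y)) \<le> norm (indicat_real {0..R1 + 1} y *\<^sub>R (C * cmod (awt l R1 y)))"
          using tb[of y] by (auto simp: indicator_def norm_mult abs_mult intro!: mult_right_mono)
      qed
    qed
  qed
  define K where "K = exp ((2 + cmod (eig l)) * x)"
  define D where "D = CA + CE * K + cmod (phi l x) * CA"
  have D: "D \<ge> 0" using CA CE by (simp add: D_def K_def)
  have main: "cmod (Av l R1 tg - phi l x * Av l R1 g) \<le> D * e" if e: "e > 0" for e
  proof -
    have R3: "R1 + 1 + x > 0" using R1 x by simp
    obtain f u where fu: "jspan f u" "\<And>z. 0 \<le> z \<Longrightarrow> z \<le> R1 + 1 + x \<Longrightarrow> cmod (g z - f z) \<le> e"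
      by (rule jspan_dense[OF R3 continuous_on_subset[OF g] e]) auto
    obtain h dh where h: "\<And>s. (h has_vector_derivative dh s) (at s)" "continuous_on UNIV dh" "dh 0 = 0"
      "\<And>s. h s = Av l R1 (u s)"
      "\<And>s. s > 0 \<Longrightarrow> (dh has_vector_derivative Ebd l R1 (u s) - eig l * h s - of_real (B s) * dh s) (at s)"
      using jspan_transform[OF R1 fu(1), of l] by blast
    have 1: "cmod (h x - phi l x * h 0) \<le> (CE * e) * K"
      unfolding K_def
    proof (rule forced_ode_bound[OF x _ h(1,2,3,5)])
      show "0 \<le> CE * e" using CE e by simp
      fix s assume s: "0 < s" "s < x"
      show "cmod (Ebd l R1 (u s)) \<le> CE * e"
      proof (rule CE(2)[OF jspan_cont2[OF fu(1)]])
        fix y assume y: "R1 \<le> y" "y \<le> R1 + 1"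
        \<comment> \<open>Finite speed of propagation: for s < x and y \<ge> R1 = R + x the interval
          [|s-y|, s+y] lies beyond R, where g = 0 and hence |f| \<le> e.\<close>
        show "cmod (u s y) \<le> e"
        proof (rule jspan_bound[OF fu(1)])
          fix z assume z: "\<bar>s - y\<bar> \<le> z" "z \<le> s + y"
          have zR: "z \<ge> R" "z \<le> R1 + 1 + x" using z y s R by (auto simp: R1_def)
          then have "cmod (g z - f z) \<le> e" using R by (intro fu(2)) auto
          then show "cmod (f z) \<le> e" using R(2)[OF zR(1)] by simp
        qed (use s y R1 in auto)
      qed
    qed
    have 2: "cmod (Av l R1 (u x) - Av l R1 tg) \<le> CA * e"
    proof (rule CA(2)[OF Av_set_integrable[OF jspan_cont2[OF fu(1)]] tgi])
      fix y assume y: "0 < y" "y \<le> R1 + 1"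
      note hc = Kx_hconv[OF x y(1)]
      have "cmod ((LINT t|Kx x y. f t) - (LINT t|Kx x y. g t)) \<le> e"
        by (rule hconv_approx[OF hc hconv_integrable_cont[OF hc jspan_cont1[OF fu(1)]] hconv_integrable_cont[OF hc g]],
            subst norm_minus_commute, rule fu(2)) (use y x in linarith)+
      then show "cmod (u x y - tg y) \<le> e" using hconv_jspan[OF hc fu(1)] by (simp add: tg_def)
    qed
    have 3: "cmod (Av l R1 (u 0) - Av l R1 g) \<le> CA * e"
    proof (rule CA(2)[OF Av_set_integrable[OF jspan_cont2[OF fu(1)]] Av_set_integrable[OF g]])
      fix y assume y: "0 < y" "y \<le> R1 + 1"
      have "u 0 y = f y" using jspan_sym[OF fu(1), of 0 y] jspan_at_0[OF fu(1)] by simp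
      then show "cmod (u 0 y - g y) \<le> e" using fu(2)[of y] y x by (simp add: norm_minus_commute)
    qed
    have "Av l R1 tg - phi l x * Av l R1 g = (h x - phi l x * h 0) - (Av l R1 (u x) - Av l R1 tg) + phi l x * (Av l R1 (u 0) - Av l R1 g)"
      by (simp add: h(4) algebra_simps)
    also have "cmod \<dots> \<le> cmod (h x - phi l x * h 0) + cmod (Av l R1 (u x) - Av l R1 tg) + cmod (phi l x * (Av l R1 (u 0) - Av l R1 g))"
      by (meson norm_triangle_ineq norm_triangle_ineq4 order_trans add_right_mono)
    also have "\<dots> \<le> (CE * e) * K + CA * e + cmod (phi l x) * (CA * e)"
      using 1 2 3 by (intro add_mono) (auto simp: norm_mult intro!: mult_left_mono)
    also have "\<dots> = D * e" by (simp add: D_def algebra_simps)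
    finally show ?thesis .
  qed
  have "cmod (Av l R1 tg - phi l x * Av l R1 g) \<le> 0 + e" if "e > 0" for e
  proof -
    have "cmod (Av l R1 tg - phi l x * Av l R1 g) \<le> D * (e / (D + 1))" using that D by (intro main) auto
    also have "\<dots> \<le> e" using that D by (simp add: divide_le_eq)
    finally show ?thesis by simp
  qed
  then have "cmod (Av l R1 tg - phi l x * Av l R1 g) \<le> 0" by (rule field_le_epsilon)
  moreover have "Av l R1 tg = (LINT y|MA. tg y * phi l y)" by (rule Av_MA[OF tgm tg0])
  moreover have "Av l R1 g = (LINT y|MA. g y * phi l y)"
    by (rule Av_MA) (use R x in \<open>auto simp: R1_def intro!: R(2)\<close>)
  ultimately show ?thesis by (simp add: tg_def)
qed

section \<open>Invariance of A dx and the transform of translates of integrable functions\<close>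

lemma phi_measurable [measurable]: "phi l \<in> borel_measurable borel"
  by (intro borel_measurable_continuous_onI continuous_intros)

lemma Kx_nn_measurable [measurable]:
  assumes x: "x > 0" and h: "h \<in> borel_measurable borel"
  shows "(\<lambda>y. \<integral>\<^sup>+z. h z \<partial>Kx x y) \<in> borel_measurable borel"
  by (rule measurable_compose[OF Kx_measurable[OF x] nn_integral_measurable_subprob_algebra[OF h]])

text \<open>The weights \<open>1 + Re (c \<phi>)\<close> make positive measures out of the complex density \<open>\<phi>\<close>; taking
  \<open>c = 0, 1, -i\<close> recovers it.\<close>
lemma kernel_measure_eq:
  assumes x: "x > 0" and c: "cmod c \<le> 1"
  shows "density MA (\<lambda>y. ennreal (1 + Re (c * phi (of_real l) y))) \<bind> Kx x
     = density MA (\<lambda>y. ennreal (1 + Re (c * (phi (of_real l) x * phi (of_real l) y))))"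
proof -
  define k1 where "k1 y = 1 + Re (c * phi (of_real l) y)" for y
  define k2 where "k2 y = 1 + Re (c * (phi (of_real l) x * phi (of_real l) y))" for y
  have [measurable]: "k1 \<in> borel_measurable borel" "k2 \<in> borel_measurable borel"
    unfolding k1_def k2_def by measurable
  have k: "0 \<le> k1 y" "k1 y \<le> 2" "0 \<le> k2 y" "k2 y \<le> 2" if "y > 0" for y
  proof -
    have p: "cmod (phi (of_real l) y) \<le> 1" "cmod (phi (of_real l) x) \<le> 1" using that x by (auto intro!: phi_le_1)
    have "cmod (c * phi (of_real l) y) \<le> 1 * 1" unfolding norm_mult using c p by (intro mult_mono) auto
    moreover have "cmod (c * (phi (of_real l) x * phi (of_real l) y)) \<le> 1 * (1 * 1)"
      unfolding norm_mult using c p by (intro mult_mono) auto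
    ultimately show "0 \<le> k1 y" "k1 y \<le> 2" "0 \<le> k2 y" "k2 y \<le> 2"
      using abs_Re_le_cmod[of "c * phi (of_real l) y"] abs_Re_le_cmod[of "c * (phi (of_real l) x * phi (of_real l) y)"]
      by (auto simp: k1_def k2_def)
  qed
  define M1 where "M1 = density MA (\<lambda>y. ennreal (k1 y))"
  define M2 where "M2 = density MA (\<lambda>y. ennreal (k2 y))"
  have s1 [measurable_cong]: "sets M1 = sets borel" "sets M2 = sets borel" by (auto simp: M1_def M2_def)
  have KM: "Kx x \<in> M1 \<rightarrow>\<^sub>M subprob_algebra borel"
    using Kx_measurable[OF x] by (simp add: measurable_cong_sets[OF s1(1) refl])
  have sb: "sets (M1 \<bind> Kx x) = sets borel"
    by (rule sets_bind) (auto simp: Kx_sets[OF x] M1_def)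
  have eqn: "(\<integral>\<^sup>+z. ennreal (ramp t n z) \<partial>(M1 \<bind> Kx x)) = (\<integral>\<^sup>+z. ennreal (ramp t n z) \<partial>M2)" for t n
  proof -
    define J where "J y = (LINT z|Kx x y. ramp t n z)" for y
    \<comment> \<open>t may be nonpositive, whereas \<open>translate_cont_transform\<close> takes a
      positive radius.\<close>
    define R where "R = max t 1"
    have R: "R > 0" "\<And>z. z \<ge> R \<Longrightarrow> ramp t n z = 0" by (auto simp: R_def ramp_props)
    have J: "0 \<le> J y" "J y \<le> 1" "(\<integral>\<^sup>+z. ennreal (ramp t n z) \<partial>Kx x y) = ennreal (J y)" for y
    proof -
      interpret prob_space "Kx x y" by (rule Kx_prob[OF x])
      have [measurable_cong]: "sets (Kx x y) = sets borel" by (rule Kx_sets[OF x])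
      have i: "integrable (Kx x y) (ramp t n)"
        by (rule integrable_const_bound[where B = 1]) (auto simp: ramp_props)
      show "0 \<le> J y" unfolding J_def by (intro integral_nonneg_AE) (simp add: ramp_props)
      show "J y \<le> 1" unfolding J_def by (rule integral_le_const[OF i]) (simp add: ramp_props)
      show "(\<integral>\<^sup>+z. ennreal (ramp t n z) \<partial>Kx x y) = ennreal (J y)"
        unfolding J_def by (rule nn_integral_eq_integral[OF i]) (simp add: ramp_props)
    qed
    have G: "(LINT z|Kx x y. complex_of_real (ramp t n z)) = of_real (J y)" for y by (simp add: J_def)
    have cr: "continuous_on UNIV (\<lambda>z. complex_of_real (ramp t n z))" by (intro continuous_intros ramp_cont)
    have [measurable]: "(\<lambda>y. complex_of_real (J y)) \<in> borel_measurable borel"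
      using Kx_integral_measurable[OF x cr] by (simp only: G)
    then have "(\<lambda>y. Re (complex_of_real (J y))) \<in> borel_measurable borel" by measurable
    then have [measurable]: "J \<in> borel_measurable borel" by simp
    have J0: "J y = 0" if "y > R + x" for y
    proof -
      have y: "y > 0" using that R x by simp
      have "J y = (LINT z|Kx x y. 0)" unfolding J_def
      proof (rule integral_cong_AE)
        show "AE z in Kx x y. ramp t n z = 0"
          by (rule eventually_mono[OF hconv_AE[OF Kx_hconv[OF x y]]]) (use that in \<open>auto intro!: R\<close>)
      qed (auto simp: measurable_cong_sets[OF Kx_sets[OF x] refl])
      then show ?thesis by simp
    qed
    have T: "(LINT y|MA. of_real (J y) * phi m y) = phi m x * (LINT y|MA. of_real (ramp t n y) * phi m y)" for m
      unfolding G[symmetric] by (rule translate_cont_transform[OF x cr R(1)]) (simp add: R(2))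
    \<comment> \<open>The spectral parameter at which phi is identically 1 shows that translation
      preserves the total integral.\<close>
    have T1: "(LINT y|MA. complex_of_real (J y)) = (LINT y|MA. complex_of_real (ramp t n y))"
      using T[of "- \<i> * of_real \<rho>"] unfolding phi_one by simp
    have iJ: "integrable MA (\<lambda>y. complex_of_real (J y))" "integrable MA (\<lambda>y. of_real (J y) * phi (of_real l) y)"
      using J J0 phi_le_1[of _ l]
      by (auto intro!: integrable_MA_bounded[where R = "R + x" and C = 1] simp: norm_mult mult_le_one)
    have ir: "integrable MA (\<lambda>y. complex_of_real (ramp t n y))" "integrable MA (\<lambda>y. of_real (ramp t n y) * phi (of_real l) y)"
      using ramp_props[where t = t and n = n] R phi_le_1[of _ l]
      by (auto intro!: integrable_MA_bounded[where R = R and C = 1] simp: norm_mult mult_le_one)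
    have e1: "(LINT y|MA. k1 y * J y) = Re ((LINT y|MA. complex_of_real (J y)) + c * (LINT y|MA. of_real (J y) * phi (of_real l) y))"
    proof -
      have "k1 y * J y = Re (complex_of_real (J y) + c * (of_real (J y) * phi (of_real l) y))" for y
        by (simp add: k1_def algebra_simps)
      then have "(LINT y|MA. k1 y * J y) = Re (LINT y|MA. complex_of_real (J y) + c * (of_real (J y) * phi (of_real l) y))"
        using iJ by (simp only:) (rule integral_Re, auto)
      then show ?thesis using iJ by (simp del: integral_complex_of_real)
    qed
    have e2: "(LINT y|MA. k2 y * ramp t n y) = Re ((LINT y|MA. complex_of_real (ramp t n y)) + c * (phi (of_real l) x * (LINT y|MA. of_real (ramp t n y) * phi (of_real l) y)))"
    proof -
      have "k2 y * ramp t n y = Re (complex_of_real (ramp t n y) + c * (phi (of_real l) x * (of_real (ramp t n y) * phi (of_real l) y)))" for y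
        by (simp add: k2_def algebra_simps)
      then have "(LINT y|MA. k2 y * ramp t n y) = Re (LINT y|MA. complex_of_real (ramp t n y) + c * (phi (of_real l) x * (of_real (ramp t n y) * phi (of_real l) y)))"
        using ir by (simp only:) (rule integral_Re, auto)
      then show ?thesis using ir by (simp del: integral_complex_of_real)
    qed
    have i1: "integrable MA (\<lambda>y. k1 y * J y)"
    proof -
      have "integrable MA (\<lambda>y. Re (complex_of_real (J y) + c * (of_real (J y) * phi (of_real l) y)))"
        by (intro integrable_Re Bochner_Integration.integrable_add integrable_mult_right iJ)
      moreover have "(\<lambda>y. Re (complex_of_real (J y) + c * (of_real (J y) * phi (of_real l) y))) = (\<lambda>y. k1 y * J y)"
        by (rule ext) (simp add: k1_def algebra_simps)
      ultimately show ?thesis by (simp only:)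
    qed
    have i2: "integrable MA (\<lambda>y. k2 y * ramp t n y)"
    proof -
      have "integrable MA (\<lambda>y. Re (complex_of_real (ramp t n y) + c * (phi (of_real l) x * (of_real (ramp t n y) * phi (of_real l) y))))"
        by (intro integrable_Re Bochner_Integration.integrable_add integrable_mult_right ir)
      moreover have "(\<lambda>y. Re (complex_of_real (ramp t n y) + c * (phi (of_real l) x * (of_real (ramp t n y) * phi (of_real l) y)))) = (\<lambda>y. k2 y * ramp t n y)"
        by (rule ext) (simp add: k2_def algebra_simps)
      ultimately show ?thesis by (simp only:)
    qed
    have "(\<integral>\<^sup>+z. ennreal (ramp t n z) \<partial>(M1 \<bind> Kx x)) = (\<integral>\<^sup>+y. ennreal (J y) \<partial>M1)"
      by (subst nn_integral_bind[OF _ KM]) (auto simp: J)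
    also have "\<dots> = (\<integral>\<^sup>+y. ennreal (k1 y) * ennreal (J y) \<partial>MA)"
      unfolding M1_def by (rule nn_integral_density) auto
    also have "\<dots> = (\<integral>\<^sup>+y. ennreal (k1 y * J y) \<partial>MA)"
      by (rule nn_integral_cong_AE, rule eventually_mono[OF AE_MA_pos]) (simp add: ennreal_mult' k)
    also have "\<dots> = ennreal (LINT y|MA. k1 y * J y)"
      by (rule nn_integral_eq_integral[OF i1], rule eventually_mono[OF AE_MA_pos]) (auto simp: k J)
    also have "\<dots> = ennreal (LINT y|MA. k2 y * ramp t n y)" unfolding e1 e2 T T1 ..
    also have "\<dots> = (\<integral>\<^sup>+y. ennreal (k2 y * ramp t n y) \<partial>MA)"
      by (rule nn_integral_eq_integral[OF i2, symmetric], rule eventually_mono[OF AE_MA_pos]) (auto simp: k ramp_props)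
    also have "\<dots> = (\<integral>\<^sup>+y. ennreal (k2 y) * ennreal (ramp t n y) \<partial>MA)"
      by (rule nn_integral_cong_AE, rule eventually_mono[OF AE_MA_pos]) (simp add: ennreal_mult' k)
    also have "\<dots> = (\<integral>\<^sup>+z. ennreal (ramp t n z) \<partial>M2)"
      unfolding M2_def by (rule nn_integral_density[symmetric]) auto
    finally show ?thesis .
  qed
  have eqt: "emeasure (M1 \<bind> Kx x) {..<t} = emeasure M2 {..<t}" for t
    using emeasure_lessThan_ramp[OF sb, of t] emeasure_lessThan_ramp[OF s1(2), of t]
    unfolding eqn by (rule LIMSEQ_unique)
  have "M1 \<bind> Kx x = M2"
  proof (rule measure_eqI_generator_eq[OF Int_stable_lessThan, where \<Omega> = UNIV and A = "\<lambda>n. {..<real n}"])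
    show "(\<Union>i. {..<real i}) = UNIV" using reals_Archimedean2 by auto
    show "emeasure (M1 \<bind> Kx x) {..<real i} \<noteq> \<infinity>" for i
    proof -
      have "emeasure M2 {..<real i} = (\<integral>\<^sup>+y. ennreal (k2 y) * indicator {..<real i} y \<partial>MA)"
        unfolding M2_def by (rule emeasure_density) auto
      also have "\<dots> \<le> (\<integral>\<^sup>+y. 2 * indicator {..<real i} y \<partial>MA)"
      proof (rule nn_integral_mono_AE, rule eventually_mono[OF AE_MA_pos])
        fix y :: real assume "y > 0"
        then have "ennreal (k2 y) \<le> ennreal 2" by (intro ennreal_leI k)
        then show "ennreal (k2 y) * indicator {..<real i} y \<le> 2 * indicator {..<real i} y" by (intro mult_right_mono) auto
      qed
      also have "\<dots> = 2 * emeasure MA {..<real i}" by (subst nn_integral_cmult_indicator) auto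
      also have "\<dots> < \<infinity>" using emeasure_MA_finite(1)[of "real i"] by (simp add: ennreal_mult_less_top)
      finally show ?thesis unfolding eqt by simp
    qed
  qed (auto simp: eqt sb s1 sets_borel_lessThan[symmetric])
  then show ?thesis by (simp add: M1_def M2_def k1_def k2_def)
qed

lemma kernel_nn_integral:
  assumes x: "x > 0" and c: "cmod c \<le> 1" and h [measurable]: "h \<in> borel_measurable borel"
  shows "(\<integral>\<^sup>+y. ennreal (1 + Re (c * phi (of_real l) y)) * (\<integral>\<^sup>+z. h z \<partial>Kx x y) \<partial>MA)
     = (\<integral>\<^sup>+y. ennreal (1 + Re (c * (phi (of_real l) x * phi (of_real l) y))) * h y \<partial>MA)"
proof -
  define M1 where "M1 = density MA (\<lambda>y. ennreal (1 + Re (c * phi (of_real l) y)))"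
  have s1: "sets M1 = sets borel" by (simp add: M1_def)
  have KM: "Kx x \<in> M1 \<rightarrow>\<^sub>M subprob_algebra borel"
    using Kx_measurable[OF x] by (simp add: measurable_cong_sets[OF s1 refl])
  have [measurable]: "(\<lambda>y. \<integral>\<^sup>+z. h z \<partial>Kx x y) \<in> borel_measurable borel" by (rule Kx_nn_measurable[OF x h])
  have "(\<integral>\<^sup>+y. ennreal (1 + Re (c * phi (of_real l) y)) * (\<integral>\<^sup>+z. h z \<partial>Kx x y) \<partial>MA) = (\<integral>\<^sup>+y. (\<integral>\<^sup>+z. h z \<partial>Kx x y) \<partial>M1)"
    unfolding M1_def by (rule nn_integral_density[symmetric]) auto
  also have "\<dots> = (\<integral>\<^sup>+y. h y \<partial>(M1 \<bind> Kx x))" by (rule nn_integral_bind[OF h KM, symmetric])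
  also have "\<dots> = (\<integral>\<^sup>+y. ennreal (1 + Re (c * (phi (of_real l) x * phi (of_real l) y))) * h y \<partial>MA)"
    unfolding M1_def kernel_measure_eq[OF x c] by (rule nn_integral_density) auto
  finally show ?thesis .
qed

text \<open>The case c = 0: A dx is the Haar measure of the hypergroup.\<close>

lemma kernel_invariant:
  assumes x: "x > 0" and h: "h \<in> borel_measurable borel"
  shows "(\<integral>\<^sup>+y. (\<integral>\<^sup>+z. h z \<partial>Kx x y) \<partial>MA) = (\<integral>\<^sup>+y. h y \<partial>MA)"
  using kernel_nn_integral[OF x _ h, of 0] by simp

lemma translate_integrable:
  fixes f :: "real \<Rightarrow> complex"
  assumes x: "x > 0" and f: "integrable MA f"
  shows "AE y in MA. integrable (Kx x y) f" "integrable MA (\<lambda>y. LINT t|Kx x y. f t)"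
    "integrable MA (\<lambda>y. LINT t|Kx x y. cmod (f t))"
proof -
  have fm [measurable]: "f \<in> borel_measurable borel" using borel_measurable_integrable[OF f] by simp
  have fin: "(\<integral>\<^sup>+y. (\<integral>\<^sup>+z. ennreal (cmod (f z)) \<partial>Kx x y) \<partial>MA) < \<infinity>"
    using f by (subst kernel_invariant[OF x]) (auto simp: integrable_iff_bounded)
  have km [measurable]: "(\<lambda>y. \<integral>\<^sup>+z. ennreal (cmod (f z)) \<partial>Kx x y) \<in> borel_measurable borel" by (rule Kx_nn_measurable[OF x]) measurable
  have mc: "f \<in> borel_measurable (Kx x y)" for y by (simp add: measurable_cong_sets[OF Kx_sets[OF x] refl])
  have "AE y in MA. (\<integral>\<^sup>+z. ennreal (cmod (f z)) \<partial>Kx x y) \<noteq> \<infinity>"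
    by (rule nn_integral_PInf_AE) (use fin in auto)
  then show "AE y in MA. integrable (Kx x y) f"
    by (rule eventually_mono) (auto intro!: integrableI_bounded mc simp: less_top)
  have m1: "(\<lambda>y. LINT t|Kx x y. f t) \<in> borel_measurable borel" by (rule Kx_lborel_measurable[OF x fm])
  have m2: "(\<lambda>y. LINT t|Kx x y. cmod (f t)) \<in> borel_measurable borel"
    by (rule measurable_compose[OF Kx_measurable[OF x] integral_measurable_subprob_algebra]) measurable
  have b1: "ennreal (cmod (LINT t|Kx x y. f t)) \<le> (\<integral>\<^sup>+z. ennreal (cmod (f z)) \<partial>Kx x y)" for y
  proof (cases "integrable (Kx x y) f")
    case True then show ?thesis by (rule integral_norm_bound_ennreal)
  qed (simp add: not_integrable_integral_eq)
  have b2: "ennreal (norm (LINT t|Kx x y. cmod (f t))) \<le> (\<integral>\<^sup>+z. ennreal (cmod (f z)) \<partial>Kx x y)" for y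
  proof (cases "integrable (Kx x y) (\<lambda>t. cmod (f t))")
    case True from integral_norm_bound_ennreal[OF True] show ?thesis by simp
  qed (simp add: not_integrable_integral_eq)
  show "integrable MA (\<lambda>y. LINT t|Kx x y. f t)"
    by (rule integrableI_bounded[OF _ le_less_trans[OF nn_integral_mono[OF b1] fin]]) (use m1 in simp)
  show "integrable MA (\<lambda>y. LINT t|Kx x y. cmod (f t))"
    by (rule integrableI_bounded[OF _ le_less_trans[OF nn_integral_mono[OF b2] fin]]) (use m2 in simp)
qed

lemma integrable_mult_phi:
  assumes f: "integrable MA f"
  shows "integrable MA (\<lambda>y. f y * phi (of_real l) y)"
proof (rule Bochner_Integration.integrable_bound[OF f])
  show "AE y in MA. norm (f y * phi (of_real l) y) \<le> norm (f y)"
    by (rule eventually_mono[OF AE_MA_pos]) (auto simp: norm_mult intro!: mult_left_le phi_le_1)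
qed (use borel_measurable_integrable[OF f] in auto)

text \<open>Finite mass makes all integrals finite, so the identity for nonnegative functions with
  weights 1 + Re (c phi) becomes one for complex integrals.\<close>

lemma translate_transform_set:
  assumes x: "x > 0" and S [measurable]: "S \<in> sets borel" and fin: "emeasure MA S < \<infinity>"
  shows "(LINT y|MA. of_real (measure (Kx x y) S) * phi (of_real l) y) = phi (of_real l) x * (LINT y|MA. of_real (indicator S y) * phi (of_real l) y)"
proof -
  define m where "m y = measure (Kx x y) S" for y
  have em: "emeasure (Kx x y) S = ennreal (m y)" for y
    using prob_space.finite_measure[OF Kx_prob[OF x]] finite_measure.emeasure_eq_measure by (metis m_def)
  have [measurable]: "(\<lambda>y. emeasure (Kx x y) S) \<in> borel_measurable borel"
    by (rule measurable_compose[OF Kx_measurable[OF x] measurable_emeasure_subprob_algebra[OF S]])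
  have [measurable]: "m \<in> borel_measurable borel"
    unfolding m_def measure_def by measurable
  have m0: "0 \<le> m y" for y by (simp add: m_def)
  have nm: "(\<integral>\<^sup>+z. indicator S z \<partial>Kx x y) = ennreal (m y)" for y
    using em[of y] Kx_sets[OF x, of y] by simp
  have inv: "(\<integral>\<^sup>+y. ennreal (m y) \<partial>MA) = emeasure MA S"
    using kernel_invariant[OF x, of "indicator S"] by (simp add: nm)
  have iF: "integrable MA (\<lambda>y. complex_of_real (m y))" 
    by (rule integrableI_bounded) (use inv fin m0 in auto)
  have iS: "integrable MA (\<lambda>y. complex_of_real (indicator S y))"
    by (rule integrableI_bounded) (use fin in \<open>auto simp: ennreal_indicator\<close>)
  note iF' = integrable_mult_phi[OF iF, of l] and iS' = integrable_mult_phi[OF iS, of l]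
  have main: "Re ((LINT y|MA. complex_of_real (m y)) + c * (LINT y|MA. of_real (m y) * phi (of_real l) y))
     = Re ((LINT y|MA. complex_of_real (indicator S y)) + c * (phi (of_real l) x * (LINT y|MA. of_real (indicator S y) * phi (of_real l) y)))"
    if c: "cmod c \<le> 1" for c
  proof -
    have k: "0 \<le> 1 + Re (c * phi (of_real l) y)" "0 \<le> 1 + Re (c * (phi (of_real l) x * phi (of_real l) y))" if "y > 0" for y
    proof -
      have p: "cmod (phi (of_real l) y) \<le> 1" "cmod (phi (of_real l) x) \<le> 1" using that x by (auto intro!: phi_le_1)
      have "cmod (c * phi (of_real l) y) \<le> 1 * 1" unfolding norm_mult using c p by (intro mult_mono) auto
      moreover have "cmod (c * (phi (of_real l) x * phi (of_real l) y)) \<le> 1 * (1 * 1)"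
        unfolding norm_mult using c p by (intro mult_mono) auto
      ultimately show "0 \<le> 1 + Re (c * phi (of_real l) y)" "0 \<le> 1 + Re (c * (phi (of_real l) x * phi (of_real l) y))"
        using abs_Re_le_cmod[of "c * phi (of_real l) y"] abs_Re_le_cmod[of "c * (phi (of_real l) x * phi (of_real l) y)"]
        by auto
    qed
    define F1 where "F1 y = complex_of_real (m y) + c * (of_real (m y) * phi (of_real l) y)" for y
    define F2 where "F2 y = complex_of_real (indicator S y) + c * (phi (of_real l) x * (of_real (indicator S y) * phi (of_real l) y))" for y
    have F1: "integrable MA F1" unfolding F1_def using iF iF' by auto
    have F2: "integrable MA F2" unfolding F2_def using iS iS' by auto
    have r1: "Re (F1 y) = (1 + Re (c * phi (of_real l) y)) * m y" for y by (simp add: F1_def algebra_simps)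
    have r2: "Re (F2 y) = (1 + Re (c * (phi (of_real l) x * phi (of_real l) y))) * indicator S y" for y by (simp add: F2_def algebra_simps)
    have n1: "AE y in MA. 0 \<le> Re (F1 y)"
      unfolding r1 by (rule eventually_mono[OF AE_MA_pos]) (intro mult_nonneg_nonneg k m0)
    have n2: "AE y in MA. 0 \<le> Re (F2 y)"
      unfolding r2 by (rule eventually_mono[OF AE_MA_pos]) (intro mult_nonneg_nonneg k, auto)
    have "(\<integral>\<^sup>+y. ennreal (Re (F1 y)) \<partial>MA) = (\<integral>\<^sup>+y. ennreal (1 + Re (c * phi (of_real l) y)) * (\<integral>\<^sup>+z. indicator S z \<partial>Kx x y) \<partial>MA)"
      unfolding nm r1 by (rule nn_integral_cong_AE, rule eventually_mono[OF AE_MA_pos]) (simp only: ennreal_mult' k)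
    also have "\<dots> = (\<integral>\<^sup>+y. ennreal (1 + Re (c * (phi (of_real l) x * phi (of_real l) y))) * indicator S y \<partial>MA)"
      by (rule kernel_nn_integral[OF x c]) measurable
    also have "\<dots> = (\<integral>\<^sup>+y. ennreal (Re (F2 y)) \<partial>MA)"
      unfolding r2 by (rule nn_integral_cong) (auto simp: indicator_def)
    finally have "ennreal (LINT y|MA. Re (F1 y)) = ennreal (LINT y|MA. Re (F2 y))"
      using nn_integral_eq_integral[OF integrable_Re[OF F1] n1] nn_integral_eq_integral[OF integrable_Re[OF F2] n2] by simp
    then have "(LINT y|MA. Re (F1 y)) = (LINT y|MA. Re (F2 y))"
      using integral_nonneg_AE[OF n1] integral_nonneg_AE[OF n2] by (simp add: ennreal_inj)
    then have "Re (LINT y|MA. F1 y) = Re (LINT y|MA. F2 y)" by (simp only: integral_Re[OF F1] integral_Re[OF F2])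
    moreover have "(LINT y|MA. F1 y) = (LINT y|MA. complex_of_real (m y)) + c * (LINT y|MA. of_real (m y) * phi (of_real l) y)"
      unfolding F1_def using iF iF' by (simp del: integral_complex_of_real)
    moreover have "(LINT y|MA. F2 y) = (LINT y|MA. complex_of_real (indicator S y)) + c * (phi (of_real l) x * (LINT y|MA. of_real (indicator S y) * phi (of_real l) y))"
      unfolding F2_def using iS iS' by (simp del: integral_complex_of_real)
    ultimately show ?thesis by simp
  qed
  define P where "P = (LINT y|MA. of_real (m y) * phi (of_real l) y)"
  define P' where "P' = phi (of_real l) x * (LINT y|MA. of_real (indicator S y) * phi (of_real l) y)"
  define Q0 where "Q0 = (LINT y|MA. complex_of_real (m y))"
  define Q1 where "Q1 = (LINT y|MA. complex_of_real (indicator S y))"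
  have mm: "cmod c \<le> 1 \<Longrightarrow> Re (Q0 + c * P) = Re (Q1 + c * P')" for c
    using main[of c] unfolding P_def P'_def Q0_def Q1_def .
  \<comment> \<open>c = 0 equates the parts without phi; subtracting them, c = 1 gives the real
    parts, and c = -i the imaginary ones, as Re (-i P) = Im P.\<close>
  have "Re P = Re P'" "Im P = Im P'" using mm[of 0] mm[of 1] mm[of "-\<i>"] by auto
  then show ?thesis unfolding P_def P'_def m_def by (rule complex_eqI)
qed

text \<open>Extension from indicators of sets of finite mass to L^1. In the limit step the translate
  of |f| dominates the translates of the approximants, and it is integrable by invariance.\<close>

lemma translate_transform:
  fixes f :: "real \<Rightarrow> complex"
  assumes x: "x > 0" and f: "integrable MA f"
  shows "(LINT y|MA. (LINT t|Kx x y. f t) * phi (of_real l) y) = phi (of_real l) x * (LINT y|MA. f y * phi (of_real l) y)"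
  using f
proof (induction rule: integrable_induct)
  case (base S c)
  then have S: "S \<in> sets borel" by simp
  have e: "(LINT t|Kx x y. indicator S t *\<^sub>R c) = of_real (measure (Kx x y) S) * c" for y
    using S by (simp add: Kx_sets[OF x] scaleR_conv_of_real)
  have "(LINT y|MA. (LINT t|Kx x y. indicator S t *\<^sub>R c) * phi (of_real l) y) = (LINT y|MA. c * (of_real (measure (Kx x y) S) * phi (of_real l) y))"
    unfolding e by (simp add: mult_ac)
  also have "\<dots> = c * (phi (of_real l) x * (LINT y|MA. of_real (indicator S y) * phi (of_real l) y))"
    using translate_transform_set[OF x S base(2), of l] by simp
  also have "\<dots> = phi (of_real l) x * (LINT y|MA. c * (of_real (indicator S y) * phi (of_real l) y))" by simp
  also have "(\<lambda>y. c * (of_real (indicator S y) * phi (of_real l) y)) = (\<lambda>y. indicator S y *\<^sub>R c * phi (of_real l) y)"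
    by (auto simp: scaleR_conv_of_real mult_ac)
  finally show ?case .
next
  case (add f g)
  have "(LINT y|MA. (LINT t|Kx x y. f t + g t) * phi (of_real l) y) = (LINT y|MA. (LINT t|Kx x y. f t) * phi (of_real l) y + (LINT t|Kx x y. g t) * phi (of_real l) y)"
  proof (rule integral_cong_AE)
    show "AE y in MA. (LINT t|Kx x y. f t + g t) * phi (of_real l) y = (LINT t|Kx x y. f t) * phi (of_real l) y + (LINT t|Kx x y. g t) * phi (of_real l) y"
      using translate_integrable(1)[OF x add.hyps(1)] translate_integrable(1)[OF x add.hyps(2)]
      by eventually_elim (simp add: distrib_right)
    have [measurable]: "f \<in> borel_measurable borel" "g \<in> borel_measurable borel"
      using borel_measurable_integrable[OF add.hyps(1)] borel_measurable_integrable[OF add.hyps(2)] by auto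
    have fg: "(\<lambda>t. f t + g t) \<in> borel_measurable borel" by measurable
    note [measurable] = Kx_lborel_measurable[OF x fg] Kx_lborel_measurable[OF x, of f] Kx_lborel_measurable[OF x, of g]
    show "(\<lambda>y. (LINT t|Kx x y. f t + g t) * phi (of_real l) y) \<in> borel_measurable MA"
      "(\<lambda>y. (LINT t|Kx x y. f t) * phi (of_real l) y + (LINT t|Kx x y. g t) * phi (of_real l) y) \<in> borel_measurable MA" by measurable
  qed
  also have "\<dots> = phi (of_real l) x * (LINT y|MA. f y * phi (of_real l) y) + phi (of_real l) x * (LINT y|MA. g y * phi (of_real l) y)"
    using integrable_mult_phi[OF translate_integrable(2)[OF x add.hyps(1)], of l] integrable_mult_phi[OF translate_integrable(2)[OF x add.hyps(2)], of l] add.IH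
    by simp
  also have "\<dots> = phi (of_real l) x * (LINT y|MA. (f y + g y) * phi (of_real l) y)"
    using integrable_mult_phi[OF add.hyps(1), of l] integrable_mult_phi[OF add.hyps(2), of l] by (simp add: distrib_left distrib_right)
  finally show ?case .
next
  case (lim f s)
  have fm [measurable]: "f \<in> borel_measurable borel" using borel_measurable_integrable[OF lim.hyps(4)] by simp
  have sm [measurable]: "s i \<in> borel_measurable borel" for i using borel_measurable_integrable[OF lim.hyps(1)] by simp
  have mk: "g \<in> borel_measurable borel \<Longrightarrow> g \<in> borel_measurable (Kx x y)" for g :: "real \<Rightarrow> complex" and y
    by (simp add: measurable_cong_sets[OF Kx_sets[OF x] refl])
  have sp: "space (Kx x y) = UNIV" for y using sets_eq_imp_space_eq[OF Kx_sets[OF x, of y]] by simp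
  have L1: "(\<lambda>i. LINT y|MA. (LINT t|Kx x y. s i t) * phi (of_real l) y) \<longlonglongrightarrow> (LINT y|MA. (LINT t|Kx x y. f t) * phi (of_real l) y)"
  proof (rule integral_dominated_convergence[where w = "\<lambda>y. 2 * (LINT t|Kx x y. cmod (f t))"])
    note [measurable] = Kx_lborel_measurable[OF x fm] Kx_lborel_measurable[OF x sm]
    show "(\<lambda>y. (LINT t|Kx x y. f t) * phi (of_real l) y) \<in> borel_measurable MA" by measurable
    show "(\<lambda>y. (LINT t|Kx x y. s i t) * phi (of_real l) y) \<in> borel_measurable MA" for i by measurable
    show "integrable MA (\<lambda>y. 2 * (LINT t|Kx x y. cmod (f t)))" using translate_integrable(3)[OF x lim.hyps(4)] by simp
    show "AE y in MA. (\<lambda>i. (LINT t|Kx x y. s i t) * phi (of_real l) y) \<longlonglongrightarrow> (LINT t|Kx x y. f t) * phi (of_real l) y"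
      using translate_integrable(1)[OF x lim.hyps(4)]
    proof (rule eventually_mono)
      fix y assume i: "integrable (Kx x y) f"
      have "(\<lambda>i. LINT t|Kx x y. s i t) \<longlonglongrightarrow> (LINT t|Kx x y. f t)"
        by (rule integral_dominated_convergence[where w = "\<lambda>t. 2 * cmod (f t)"])
           (use i lim.hyps mk fm sm in \<open>auto intro!: AE_I2\<close>)
      then show "(\<lambda>i. (LINT t|Kx x y. s i t) * phi (of_real l) y) \<longlonglongrightarrow> (LINT t|Kx x y. f t) * phi (of_real l) y"
        by (intro tendsto_intros)
    qed
    show "AE y in MA. norm ((LINT t|Kx x y. s i t) * phi (of_real l) y) \<le> 2 * (LINT t|Kx x y. cmod (f t))" for i
      using translate_integrable(1)[OF x lim.hyps(4)] AE_MA_pos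
    proof eventually_elim
      fix y :: real assume i: "integrable (Kx x y) f" and y: "y > 0"
      have "cmod (LINT t|Kx x y. s i t) \<le> (LINT t|Kx x y. 2 * cmod (f t))"
      proof (rule order_trans[OF integral_norm_bound integral_mono'])
        show "integrable (Kx x y) (\<lambda>t. 2 * cmod (f t))" using i by simp
      qed (use lim.hyps in auto)
      then have "cmod (LINT t|Kx x y. s i t) * cmod (phi (of_real l) y) \<le> (LINT t|Kx x y. 2 * cmod (f t)) * 1"
        using phi_le_1[of y l] y by (intro mult_mono) auto
      then show "norm ((LINT t|Kx x y. s i t) * phi (of_real l) y) \<le> 2 * (LINT t|Kx x y. cmod (f t))" by (simp add: norm_mult)
    qed
  qed
  have L2: "(\<lambda>i. phi (of_real l) x * (LINT y|MA. s i y * phi (of_real l) y)) \<longlonglongrightarrow> phi (of_real l) x * (LINT y|MA. f y * phi (of_real l) y)"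
  proof (intro tendsto_mult tendsto_const integral_dominated_convergence[where w = "\<lambda>y. 2 * cmod (f y)"])
    show "integrable MA (\<lambda>y. 2 * cmod (f y))" using lim.hyps(4) by simp
    show "AE y in MA. (\<lambda>i. s i y * phi (of_real l) y) \<longlonglongrightarrow> f y * phi (of_real l) y"
      using lim.hyps(2) by (auto intro!: AE_I2 tendsto_intros)
    show "AE y in MA. norm (s i y * phi (of_real l) y) \<le> 2 * cmod (f y)" for i
    proof (rule eventually_mono[OF AE_MA_pos])
      fix y :: real assume "y > 0"
      then have "cmod (s i y) * cmod (phi (of_real l) y) \<le> (2 * cmod (f y)) * 1"
        using lim.hyps(3)[of y i] phi_le_1[of y l] by (intro mult_mono) auto
      then show "norm (s i y * phi (of_real l) y) \<le> 2 * cmod (f y)" by (simp add: norm_mult)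
    qed
  qed measurable
  show ?case using L1 L2 unfolding lim.IH by (rule LIMSEQ_unique)
qed

end

subsection \<open>The Hausdorff--Young inequality for the Jacobi transform\<close>

lemma ennreal_square_sum3_le:
  fixes r s t :: ennreal
  shows "(r + s + t)\<^sup>2 \<le> 3 * (r\<^sup>2 + s\<^sup>2 + t\<^sup>2)"
proof (cases "r = top \<or> s = top \<or> t = top")
  case True
  then have "3 * (r\<^sup>2 + s\<^sup>2 + t\<^sup>2) = top" by (auto simp: ennreal_mult_top)
  then show ?thesis by (simp only: top_greatest)
next
  case False
  then obtain r' s' t' where *: "r = ennreal r'" "r' \<ge> 0" "s = ennreal s'" "s' \<ge> 0" "t = ennreal t'" "t' \<ge> 0"
    by (metis ennreal_cases)
  have "(r' + s' + t')\<^sup>2 \<le> 3 * (r'\<^sup>2 + s'\<^sup>2 + t'\<^sup>2)"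
    using sum_squares_bound[of r' s'] sum_squares_bound[of s' t'] sum_squares_bound[of r' t']
    by (simp add: power2_eq_square algebra_simps)
  then have "ennreal ((r' + s' + t')\<^sup>2) \<le> ennreal (3 * (r'\<^sup>2 + s'\<^sup>2 + t'\<^sup>2))" by (rule ennreal_leI)
  then show ?thesis using * by (simp add: ennreal_power[symmetric] ennreal_mult)
qed

context jacobi begin

definition "NW = density lborel (\<lambda>l. ennreal (jac_weight a l) * indicator {0<..} l)"

lemma sets_NW [measurable_cong, simp]: "sets NW = sets borel" by (simp add: NW_def)
lemma space_NW [simp]: "space NW = UNIV" by (simp add: NW_def)

lemma nn_integral_NW:
  assumes [measurable]: "f \<in> borel_measurable borel"
  shows "(\<integral>\<^sup>+l. f l \<partial>NW) = (\<integral>\<^sup>+l\<in>{0<..}. f l * ennreal (jac_weight a l) \<partial>lborel)"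
  unfolding NW_def by (subst nn_integral_density) (auto intro!: nn_integral_cong simp: mult_ac)

lemma sigma_finite_NW: "sigma_finite_measure NW"
proof
  define S where "S n = {l. l \<le> 0 \<or> (l \<le> real n \<and> jac_weight a l \<le> real n)}" for n
  show "\<exists>S. countable S \<and> S \<subseteq> sets NW \<and> \<Union> S = space NW \<and> (\<forall>s\<in>S. emeasure NW s \<noteq> \<infinity>)"
  proof (intro exI[of _ "range S"] conjI ballI)
    have [measurable]: "S n \<in> sets borel" for n unfolding S_def by measurable
    then show "range S \<subseteq> sets NW" by auto
    show "\<Union> (range S) = space NW"
    proof (safe, simp_all)
      fix l :: real
      obtain n where "max l (jac_weight a l) \<le> real n" by (meson real_arch_simple)
      then show "\<exists>n. l \<in> S n" by (auto simp: S_def)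
    qed
    fix s assume "s \<in> range S"
    then obtain n where s: "s = S n" by auto
    have "emeasure NW s = (\<integral>\<^sup>+l. (ennreal (jac_weight a l) * indicator {0<..} l) * indicator s l \<partial>lborel)"
      unfolding NW_def s by (rule emeasure_density) auto
    also have "\<dots> \<le> (\<integral>\<^sup>+l. ennreal (real n) * indicator {0..real n} l \<partial>lborel)"
      by (intro nn_integral_mono) (auto simp: s S_def indicator_def intro!: ennreal_leI)
    also have "\<dots> < \<infinity>" by (simp add: nn_integral_cmult ennreal_mult_less_top)
    finally show "emeasure NW s \<noteq> \<infinity>" by simp
  qed simp
qed

definition "jF h l = (LINT x|MA. h x * phi (of_real l) x)"

lemma jF_measurable [measurable]:
  assumes [measurable]: "h \<in> borel_measurable borel"
  shows "jF h \<in> borel_measurable borel"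
proof -
  interpret sigma_finite_measure MA by (rule sigma_finite_MA)
  have 1: "(\<lambda>z. phi (complex_of_real (fst z)) (snd z)) \<in> borel_measurable (borel \<Otimes>\<^sub>M borel)"
    using phi_measurable_pair by (simp add: split_beta)
  have "(\<lambda>(l, x). h x * phi (complex_of_real l) x) \<in> borel_measurable (borel \<Otimes>\<^sub>M borel)"
    using 1 by (simp add: split_beta)
  then have "(\<lambda>(l, x). h x * phi (complex_of_real l) x) \<in> borel_measurable (borel \<Otimes>\<^sub>M MA)"
    by (simp add: measurable_cong_sets[OF sets_pair_measure_cong[OF refl sets_MA] refl])
  then show ?thesis unfolding jF_def[abs_def] by (rule borel_measurable_lebesgue_integral)
qed

lemma jF_le_nn_integral:
  assumes [measurable]: "h \<in> borel_measurable borel"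
  shows "ennreal (cmod (jF h l)) \<le> (\<integral>\<^sup>+x. ennreal (cmod (h x)) \<partial>MA)"
proof -
  have "ennreal (cmod (jF h l)) \<le> (\<integral>\<^sup>+x. ennreal (cmod (h x * phi (of_real l) x)) \<partial>MA)"
    unfolding jF_def by (rule norm_integral_le_nn_integral) measurable
  also have "\<dots> \<le> (\<integral>\<^sup>+x. ennreal (cmod (h x)) \<partial>MA)"
    by (rule nn_integral_mono_AE, rule eventually_mono[OF AE_MA_pos])
       (auto simp: norm_mult intro!: ennreal_leI mult_left_le phi_le_1)
  finally show ?thesis .
qed

lemma compact_support_integrable:
  fixes h :: "real \<Rightarrow> complex"
  assumes [measurable]: "h \<in> borel_measurable borel" and R: "\<And>x. x > R \<Longrightarrow> h x = 0"
    and p: "p \<ge> 1" and fin: "(\<integral>\<^sup>+x. ennreal (cmod (h x) powr p) \<partial>MA) < \<infinity>"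
  shows "integrable MA h"
proof (rule integrableI_bounded)
  have "cmod z \<le> 1 + cmod z powr p" for z :: complex
  proof (cases "cmod z \<le> 1")
    case False
    then have "cmod z powr 1 \<le> cmod z powr p" using p by (intro powr_mono) auto
    then show ?thesis using False by simp
  qed (simp add: add_increasing2)
  then have "(\<integral>\<^sup>+x. ennreal (cmod (h x)) \<partial>MA) \<le> (\<integral>\<^sup>+x. indicator {..R} x + ennreal (cmod (h x) powr p) \<partial>MA)"
  proof (intro nn_integral_mono)
    fix x assume le: "\<And>z :: complex. cmod z \<le> 1 + cmod z powr p"
    show "ennreal (cmod (h x)) \<le> indicator {..R} x + ennreal (cmod (h x) powr p)"
    proof (cases "x \<le> R")
      case True
      have "ennreal (cmod (h x)) \<le> ennreal (1 + cmod (h x) powr p)" by (intro ennreal_leI le)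
      then show ?thesis using True by simp
    qed (simp add: R)
  qed
  also have "\<dots> = emeasure MA {..R} + (\<integral>\<^sup>+x. ennreal (cmod (h x) powr p) \<partial>MA)"
    by (subst nn_integral_add) auto
  also have "\<dots> < \<infinity>" using emeasure_MA_finite(2)[of R] fin by simp
  finally show "(\<integral>\<^sup>+x. ennreal (cmod (h x)) \<partial>MA) < \<infinity>" .
qed simp

text \<open>With H = sqrt A h the transform is the integral of H psi. Multiplied by sqrt w, it
  splits into the Fourier transforms of H at l and -l with bounded amplitudes, and an error
  dominated by the kernel min(1, 1/(lx)).\<close>

lemma jF_L2:
  "\<exists>C>0. \<forall>h R. h \<in> borel_measurable borel \<longrightarrow> (\<forall>x>R. h x = 0) \<longrightarrow>
     (\<integral>\<^sup>+l. ennreal ((cmod (jF h l))\<^sup>2) \<partial>NW) \<le> ennreal C * (\<integral>\<^sup>+x. ennreal ((cmod (h x))\<^sup>2) \<partial>MA)"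
proof -
  obtain C where C: "C > 0" "\<And>l. l > 0 \<Longrightarrow> \<exists>b1 b2. cmod b1 \<le> C \<and> cmod b2 \<le> C \<and>
     (\<forall>x>0. cmod (of_real (sqrt (jac_weight a l)) * psi l x - b1 * cis (l * x) - b2 * cis (- (l * x)))
        \<le> C * min 1 (1 / (l * x)))" using psi_asymptotics by blast
  \<comment> \<open>2\<pi> twice from Plancherel at l and -l, 16 from Schur's test, 3 from the
    square of a sum of three terms, and C^2 from the amplitudes and the error.\<close>
  define D where "D = C\<^sup>2 * (3 * (4 * pi + 16))"
  have D: "D > 0" using C by (simp add: D_def add_pos_pos)
  have "(\<integral>\<^sup>+l. ennreal ((cmod (jF h l))\<^sup>2) \<partial>NW) \<le> ennreal D * (\<integral>\<^sup>+x. ennreal ((cmod (h x))\<^sup>2) \<partial>MA)"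
    if hm [measurable]: "h \<in> borel_measurable borel" and R: "\<And>x. x > R \<Longrightarrow> h x = 0" for h R
  proof (cases "(\<integral>\<^sup>+x. ennreal ((cmod (h x))\<^sup>2) \<partial>MA) = \<infinity>")
    case True then show ?thesis using D by (simp add: ennreal_mult_top)
  next
    case False
    have [measurable]: "cis \<in> borel_measurable borel"
      by (intro borel_measurable_continuous_onI continuous_intros)
    define H where "H x = of_real (indicator {0<..} x * sqrt (A x)) * h x" for x
    have [measurable]: "H \<in> borel_measurable borel" unfolding H_def by measurable
    have H2: "(\<integral>\<^sup>+x. ennreal ((cmod (H x))\<^sup>2) \<partial>lborel) = (\<integral>\<^sup>+x. ennreal ((cmod (h x))\<^sup>2) \<partial>MA)"
      unfolding H_def by (subst nn_integral_MA)
        (auto intro!: nn_integral_cong simp: indicator_def norm_mult power_mult_distrib A_nonneg ennreal_mult mult.commute)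
    have Hint: "integrable lborel H"
    proof (rule integrableI_bounded)
      have "(\<integral>\<^sup>+x. ennreal (cmod (H x)) \<partial>lborel) \<le> (\<integral>\<^sup>+x. indicator {0..R} x + ennreal ((cmod (H x))\<^sup>2) \<partial>lborel)"
      proof (intro nn_integral_mono)
        fix x
        show "ennreal (cmod (H x)) \<le> indicator {0..R} x + ennreal ((cmod (H x))\<^sup>2)"
        proof (cases "x \<in> {0..R}")
          case True
          have "cmod (H x) \<le> 1 + (cmod (H x))\<^sup>2" using zero_le_power2[of "cmod (H x) - 1/2"] by (simp add: power2_eq_square algebra_simps)
          then have "ennreal (cmod (H x)) \<le> ennreal (1 + (cmod (H x))\<^sup>2)" by (rule ennreal_leI)
          then show ?thesis using True by simp
        next
          case False
          then have "H x = 0" using R[of x] by (auto simp: H_def indicator_def)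
          then show ?thesis by simp
        qed
      qed
      also have "\<dots> = emeasure lborel {0..R} + (\<integral>\<^sup>+x. ennreal ((cmod (H x))\<^sup>2) \<partial>lborel)"
        by (subst nn_integral_add) auto
      also have "\<dots> < \<infinity>" using False unfolding H2 by (simp add: emeasure_lborel_Icc_eq less_top)
      finally show "(\<integral>\<^sup>+x. ennreal (cmod (H x)) \<partial>lborel) < \<infinity>" .
    qed simp
    define F where "F l = (LINT x|lborel. H x * cis (l * x))" for l
    have [measurable]: "F \<in> borel_measurable borel" unfolding F_def by measurable
    define S where "S l = (\<integral>\<^sup>+x\<in>{0<..}. ennreal (cmod (H x) * min 1 (1 / (l * x))) \<partial>lborel)" for l
    have [measurable]: "S \<in> borel_measurable borel" unfolding S_def by measurable
    have Hc: "integrable lborel (\<lambda>x. H x * cis (t * x))" for t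
      by (rule Bochner_Integration.integrable_bound[OF Hint]) (auto simp: norm_mult)
    have pt: "ennreal ((cmod (jF h l))\<^sup>2) * ennreal (jac_weight a l)
       \<le> ennreal (C\<^sup>2) * (3 * (ennreal ((cmod (F l))\<^sup>2) + ennreal ((cmod (F (- l)))\<^sup>2) + (S l)\<^sup>2))" if l: "l > 0" for l
    proof -
      obtain b1 b2 where b: "cmod b1 \<le> C" "cmod b2 \<le> C"
        "\<And>x. x > 0 \<Longrightarrow> cmod (of_real (sqrt (jac_weight a l)) * psi l x - b1 * cis (l * x) - b2 * cis (- (l * x))) \<le> C * min 1 (1 / (l * x))"
        using C(2)[OF l] by blast
      define w where "w = sqrt (jac_weight a l)"
      have w: "w > 0" using jac_weight_pos[OF l, of a] by (simp add: w_def)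
      define er where "er x = of_real w * psi l x - b1 * cis (l * x) - b2 * cis (- (l * x))" for x
      have [measurable]: "psi l \<in> borel_measurable borel" unfolding psi_def by measurable
      have [measurable]: "er \<in> borel_measurable borel" unfolding er_def by measurable
      have He: "integrable lborel (\<lambda>x. H x * er x)"
      proof (rule Bochner_Integration.integrable_bound[of _ "\<lambda>x. C * cmod (H x)"])
        show "integrable lborel (\<lambda>x. C * cmod (H x))" using Hint by simp
        show "AE x in lborel. norm (H x * er x) \<le> norm (C * cmod (H x))"
        proof (rule AE_I2)
          fix x
          show "norm (H x * er x) \<le> norm (C * cmod (H x))"
          proof (cases "x > 0")
            case True
            have "cmod (er x) \<le> C * 1" using b(3)[OF True] C(1) unfolding er_def w_def
              by (meson min.cobounded1 mult_left_mono order_trans less_imp_le)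
            then have "cmod (H x) * cmod (er x) \<le> cmod (H x) * C" by (intro mult_left_mono) auto
            then show ?thesis using C(1) by (simp add: norm_mult mult.commute)
          qed (simp add: H_def)
        qed
      qed measurable
      have "of_real w * jF h l = (LINT x|lborel. H x * (of_real w * psi l x))"
      proof -
        have "jF h l = (LINT x|lborel. (A x * indicator {0<..} x) *\<^sub>R (h x * phi (of_real l) x))"
          unfolding jF_def MA_altdef by (rule integral_density) (auto simp: A_nonneg)
        also have "\<dots> = (LINT x|lborel. H x * psi l x)"
          by (rule Bochner_Integration.integral_cong) (auto simp: H_def psi_def indicator_def scaleR_conv_of_real A_nonneg simp flip: of_real_mult)
        finally have "of_real w * jF h l = (LINT x|lborel. of_real w * (H x * psi l x))" by simp
        then show ?thesis by (simp add: mult_ac)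
      qed
      also have "\<dots> = (LINT x|lborel. b1 * (H x * cis (l * x)) + b2 * (H x * cis (- l * x)) + H x * er x)"
        by (simp add: er_def algebra_simps)
      also have "\<dots> = b1 * F l + b2 * F (- l) + (LINT x|lborel. H x * er x)"
        unfolding F_def using Hc[of l] Hc[of "-l"] He by simp
      finally have dec: "of_real w * jF h l = b1 * F l + b2 * F (- l) + (LINT x|lborel. H x * er x)" .
      have e3: "ennreal (cmod (LINT x|lborel. H x * er x)) \<le> ennreal C * S l"
      proof -
        have "ennreal (cmod (LINT x|lborel. H x * er x)) \<le> (\<integral>\<^sup>+x. ennreal (cmod (H x * er x)) \<partial>lborel)"
          by (rule norm_integral_le_nn_integral) measurable
        also have "\<dots> \<le> (\<integral>\<^sup>+x. ennreal C * (ennreal (cmod (H x) * min 1 (1 / (l * x))) * indicator {0<..} x) \<partial>lborel)"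
        proof (intro nn_integral_mono)
          fix x :: real
          show "ennreal (cmod (H x * er x)) \<le> ennreal C * (ennreal (cmod (H x) * min 1 (1 / (l * x))) * indicator {0<..} x)"
          proof (cases "x > 0")
            case True
            have "cmod (H x) * cmod (er x) \<le> cmod (H x) * (C * min 1 (1 / (l * x)))"
              using b(3)[OF True] unfolding er_def w_def by (intro mult_left_mono) auto
            then have "ennreal (cmod (H x * er x)) \<le> ennreal (C * (cmod (H x) * min 1 (1 / (l * x))))"
              by (intro ennreal_leI) (simp add: norm_mult mult_ac)
            then show ?thesis using True C(1) by (simp add: ennreal_mult')
          qed (simp add: H_def)
        qed
        also have "\<dots> = ennreal C * S l" unfolding S_def by (rule nn_integral_cmult) measurable
        finally show ?thesis .
      qed
      have "ennreal (w * cmod (jF h l)) \<le> ennreal (cmod (b1 * F l) + cmod (b2 * F (- l)) + cmod (LINT x|lborel. H x * er x))"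
      proof (rule ennreal_leI)
        have "w * cmod (jF h l) = cmod (of_real w * jF h l)" using w by (simp add: norm_mult)
        also have "\<dots> \<le> cmod (b1 * F l) + cmod (b2 * F (- l)) + cmod (LINT x|lborel. H x * er x)"
          unfolding dec by (meson norm_triangle_ineq order_trans add_right_mono)
        finally show "w * cmod (jF h l) \<le> cmod (b1 * F l) + cmod (b2 * F (- l)) + cmod (LINT x|lborel. H x * er x)" .
      qed
      also have "\<dots> = ennreal (cmod (b1 * F l)) + ennreal (cmod (b2 * F (- l))) + ennreal (cmod (LINT x|lborel. H x * er x))" by simp
      also have "\<dots> \<le> ennreal C * ennreal (cmod (F l)) + ennreal C * ennreal (cmod (F (- l))) + ennreal C * S l"
        using b C(1) by (intro add_mono e3) (auto simp: norm_mult ennreal_mult'[symmetric] intro!: ennreal_leI mult_right_mono)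
      also have "\<dots> = ennreal C * (ennreal (cmod (F l)) + ennreal (cmod (F (- l))) + S l)" by (simp add: distrib_left)
      finally have "(ennreal (w * cmod (jF h l)))\<^sup>2 \<le> (ennreal C * (ennreal (cmod (F l)) + ennreal (cmod (F (- l))) + S l))\<^sup>2"
        by (intro power_mono) auto
      also have "\<dots> = ennreal (C\<^sup>2) * (ennreal (cmod (F l)) + ennreal (cmod (F (- l))) + S l)\<^sup>2"
        using C(1) by (simp add: power_mult_distrib ennreal_power)
      also have "\<dots> \<le> ennreal (C\<^sup>2) * (3 * ((ennreal (cmod (F l)))\<^sup>2 + (ennreal (cmod (F (- l))))\<^sup>2 + (S l)\<^sup>2))"
        by (intro mult_left_mono ennreal_square_sum3_le) auto
      also have "(ennreal (w * cmod (jF h l)))\<^sup>2 = ennreal ((cmod (jF h l))\<^sup>2) * ennreal (jac_weight a l)"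
      proof -
        have "(ennreal (w * cmod (jF h l)))\<^sup>2 = ennreal ((w * cmod (jF h l))\<^sup>2)"
          using w by (intro ennreal_power) auto
        also have "(w * cmod (jF h l))\<^sup>2 = (cmod (jF h l))\<^sup>2 * jac_weight a l"
          using jac_weight_pos[OF l, of a] by (simp add: w_def power_mult_distrib)
        also have "ennreal \<dots> = ennreal ((cmod (jF h l))\<^sup>2) * ennreal (jac_weight a l)" by (rule ennreal_mult') simp
        finally show ?thesis .
      qed
      finally show ?thesis by (simp add: ennreal_power)
    qed
    have "(\<integral>\<^sup>+l. ennreal ((cmod (jF h l))\<^sup>2) \<partial>NW) = (\<integral>\<^sup>+l\<in>{0<..}. ennreal ((cmod (jF h l))\<^sup>2) * ennreal (jac_weight a l) \<partial>lborel)"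
      by (rule nn_integral_NW) measurable
    also have "\<dots> \<le> (\<integral>\<^sup>+l. ennreal (C\<^sup>2) * (3 * (ennreal ((cmod (F l))\<^sup>2) + ennreal ((cmod (F (- l)))\<^sup>2) + (S l)\<^sup>2 * indicator {0<..} l)) \<partial>lborel)"
    proof (intro nn_integral_mono)
      fix l :: real
      show "ennreal ((cmod (jF h l))\<^sup>2) * ennreal (jac_weight a l) * indicator {0<..} l \<le> ennreal (C\<^sup>2) * (3 * (ennreal ((cmod (F l))\<^sup>2) + ennreal ((cmod (F (- l)))\<^sup>2) + (S l)\<^sup>2 * indicator {0<..} l))"
        using pt[of l] by (cases "l > 0") auto
    qed
    also have "\<dots> = ennreal (C\<^sup>2) * (3 * ((\<integral>\<^sup>+l. ennreal ((cmod (F l))\<^sup>2) \<partial>lborel) + (\<integral>\<^sup>+l. ennreal ((cmod (F (- l)))\<^sup>2) \<partial>lborel) + (\<integral>\<^sup>+l\<in>{0<..}. (S l)\<^sup>2 \<partial>lborel)))"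
      by (simp add: nn_integral_cmult nn_integral_add)
    also have "(\<integral>\<^sup>+l. ennreal ((cmod (F (- l)))\<^sup>2) \<partial>lborel) = (\<integral>\<^sup>+l. ennreal ((cmod (F l))\<^sup>2) \<partial>lborel)"
      using nn_integral_real_affine[of "\<lambda>l. ennreal ((cmod (F l))\<^sup>2)" "-1" 0] by simp
    also have "ennreal (C\<^sup>2) * (3 * ((\<integral>\<^sup>+l. ennreal ((cmod (F l))\<^sup>2) \<partial>lborel) + (\<integral>\<^sup>+l. ennreal ((cmod (F l))\<^sup>2) \<partial>lborel) + (\<integral>\<^sup>+l\<in>{0<..}. (S l)\<^sup>2 \<partial>lborel)))
       \<le> ennreal (C\<^sup>2) * (3 * (ennreal (2 * pi) * (\<integral>\<^sup>+x. ennreal ((cmod (H x))\<^sup>2) \<partial>lborel) + ennreal (2 * pi) * (\<integral>\<^sup>+x. ennreal ((cmod (H x))\<^sup>2) \<partial>lborel) + 16 * (\<integral>\<^sup>+x. ennreal ((cmod (H x))\<^sup>2) \<partial>lborel)))"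
    proof (intro mult_left_mono add_mono)
      show "(\<integral>\<^sup>+l. ennreal ((cmod (F l))\<^sup>2) \<partial>lborel) \<le> ennreal (2 * pi) * (\<integral>\<^sup>+x. ennreal ((cmod (H x))\<^sup>2) \<partial>lborel)"
        unfolding F_def by (rule plancherel_inequality[OF Hint])
      then show "(\<integral>\<^sup>+l. ennreal ((cmod (F l))\<^sup>2) \<partial>lborel) \<le> ennreal (2 * pi) * (\<integral>\<^sup>+x. ennreal ((cmod (H x))\<^sup>2) \<partial>lborel)" .
      have "(\<integral>\<^sup>+l\<in>{0<..}. (S l)\<^sup>2 \<partial>lborel) \<le> 16 * (\<integral>\<^sup>+x\<in>{0<..}. ennreal ((cmod (H x))\<^sup>2) \<partial>lborel)"
        unfolding S_def by (rule schur_test_min_kernel) auto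
      also have "\<dots> \<le> 16 * (\<integral>\<^sup>+x. ennreal ((cmod (H x))\<^sup>2) \<partial>lborel)"
        by (intro mult_left_mono nn_integral_mono) (auto simp: indicator_def)
      finally show "(\<integral>\<^sup>+l\<in>{0<..}. (S l)\<^sup>2 \<partial>lborel) \<le> 16 * (\<integral>\<^sup>+x. ennreal ((cmod (H x))\<^sup>2) \<partial>lborel)" .
    qed auto
    also have "\<dots> = ennreal D * (\<integral>\<^sup>+x. ennreal ((cmod (H x))\<^sup>2) \<partial>lborel)"
    proof -
      have "ennreal (2 * pi) * X + ennreal (2 * pi) * X + 16 * X = ennreal (4 * pi + 16) * X" for X
      proof -
        have "(16::ennreal) = ennreal 16" by simp
        then have "ennreal (2 * pi) * X + ennreal (2 * pi) * X + 16 * X = (ennreal (2 * pi) + ennreal (2 * pi) + ennreal 16) * X"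
          by (simp only: distrib_right)
        also have "ennreal (2 * pi) + ennreal (2 * pi) + ennreal 16 = ennreal (4 * pi + 16)"
        proof -
          have "4 * pi + 16 = (2 * pi + 2 * pi) + 16" by simp
          also have "ennreal \<dots> = ennreal (2 * pi + 2 * pi) + ennreal 16" by (rule ennreal_plus) auto
          also have "ennreal (2 * pi + 2 * pi) = ennreal (2 * pi) + ennreal (2 * pi)" by (rule ennreal_plus) auto
          finally show ?thesis by simp
        qed
        finally show ?thesis .
      qed
      moreover have "ennreal D = ennreal (C\<^sup>2) * (3 * ennreal (4 * pi + 16))"
        unfolding D_def using ennreal_mult'[of "C\<^sup>2" "3 * (4 * pi + 16)"] ennreal_mult'[of 3 "4 * pi + 16"] by (simp only: zero_le_power2 ennreal_numeral zero_le_numeral)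
      ultimately show ?thesis by (simp only: mult.assoc)
    qed
    finally show ?thesis unfolding H2 .
  qed
  then show ?thesis using D by blast
qed

text \<open>m is the p-th power of the norm of h, and q - 1 = q/p, so this is the q-th power of the
  usual inequality.\<close>

lemma hausdorff_young:
  assumes p: "1 < p" "p \<le> 2" and q: "q = p / (p - 1)"
  shows "\<exists>K\<ge>0. \<forall>h R m. h \<in> borel_measurable borel \<longrightarrow> (\<forall>x>R. h x = 0) \<longrightarrow> m \<ge> 0 \<longrightarrow>
     (\<integral>\<^sup>+x. ennreal (cmod (h x) powr p) \<partial>MA) = ennreal m \<longrightarrow>
     (\<integral>\<^sup>+l. ennreal (cmod (jF h l) powr q) \<partial>NW) \<le> ennreal (K * m powr (q - 1))"
proof -
  obtain C where C: "C > 0" "\<And>h R. h \<in> borel_measurable borel \<Longrightarrow> (\<And>x. x > R \<Longrightarrow> h x = 0) \<Longrightarrow>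
     (\<integral>\<^sup>+l. ennreal ((cmod (jF h l))\<^sup>2) \<partial>NW) \<le> ennreal C * (\<integral>\<^sup>+x. ennreal ((cmod (h x))\<^sup>2) \<partial>MA)"
    using jF_L2 by blast
  have p2: "cmod z powr 2 = (cmod z)\<^sup>2" for z :: complex by (cases "z = 0") auto
  \<comment> \<open>The interpolation constant has q - 2 in the denominator; at p = 2 the L^2 bound
    itself takes its place.\<close>
  define K where "K = (if p = 2 then C else 4 * C * q / (q - 2) * 2 powr (q - 2))"
  have K: "K \<ge> 0"
  proof (cases "p = 2")
    case False
    then have "q > 2" using p by (simp add: q field_simps)
    then show ?thesis using C by (simp add: K_def False)
  qed (use C in \<open>simp add: K_def\<close>)
  have "(\<integral>\<^sup>+l. ennreal (cmod (jF h l) powr q) \<partial>NW) \<le> ennreal (K * m powr (q - 1))"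
    if hm [measurable]: "h \<in> borel_measurable borel" and R: "\<And>x. x > R \<Longrightarrow> h x = 0" and m: "m \<ge> 0"
      "(\<integral>\<^sup>+x. ennreal (cmod (h x) powr p) \<partial>MA) = ennreal m" for h R m
  proof (cases "p = 2")
    case True
    then have q2: "q = 2" by (simp add: q)
    have "(\<integral>\<^sup>+l. ennreal ((cmod (jF h l))\<^sup>2) \<partial>NW) \<le> ennreal C * ennreal m"
      using C(2)[OF hm R] m(2) by (simp add: True p2)
    then show ?thesis using m C(1) by (simp add: q2 p2 K_def True ennreal_mult)
  next
    case False
    show ?thesis
    proof (cases "m = 0")
      case True
      then have "(\<integral>\<^sup>+x. ennreal (cmod (h x) powr p) \<partial>MA) = 0" using m(2) by simp
      then have "AE x in MA. ennreal (cmod (h x) powr p) = 0" by (subst (asm) nn_integral_0_iff_AE) auto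
      then have "AE x in MA. h x = 0" by (rule eventually_mono) simp
      then have "jF h l = (LINT x|MA. 0)" for l
        unfolding jF_def by (intro integral_cong_AE) (auto elim!: eventually_mono)
      then show ?thesis by simp
    next
      case m0: False
      have hi: "integrable MA h"
        by (rule compact_support_integrable[OF hm R, of R p]) (use p m in auto)
      have hE: "integrable MA (\<lambda>x. indicator E x * h x)" if "E \<in> sets borel" for E
        by (rule Bochner_Integration.integrable_bound[OF hi]) (use that in \<open>auto simp: indicator_def intro!: AE_I2\<close>)
      have "(\<integral>\<^sup>+l. ennreal (cmod (jF h l) powr q) \<partial>NW) \<le> ennreal (4 * C * q / (q - 2) * 2 powr (q - 2) * m powr (q - 1))"
      proof (rule marcinkiewicz_hausdorff_young[OF sigma_finite_MA sigma_finite_NW _ p(1) _ q, where T = jF])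
        show "h \<in> borel_measurable MA" by simp
        show "p < 2" using p False by simp
        show "jF h \<in> borel_measurable NW" by simp
        show "jF (\<lambda>x. indicator E x * h x) \<in> borel_measurable NW" if "E \<in> sets MA" for E
          using that by simp
        show "jF h l = jF (\<lambda>x. indicator E x * h x) l + jF (\<lambda>x. indicator (space MA - E) x * h x) l" if E: "E \<in> sets MA" for E l
        proof -
          have E': "E \<in> sets borel" "space MA - E \<in> sets borel" using E by auto
          have "jF (\<lambda>x. indicator E x * h x) l + jF (\<lambda>x. indicator (space MA - E) x * h x) l
            = (LINT x|MA. indicator E x * h x * phi (of_real l) x + indicator (space MA - E) x * h x * phi (of_real l) x)"
            unfolding jF_def using integrable_mult_phi[OF hE[OF E'(1)], of l] integrable_mult_phi[OF hE[OF E'(2)], of l] by simp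
          also have "\<dots> = jF h l"
            unfolding jF_def by (rule Bochner_Integration.integral_cong) (auto simp: indicator_def)
          finally show ?thesis by simp
        qed
        show "ennreal (cmod (jF (\<lambda>x. indicator E x * h x) l)) \<le> (\<integral>\<^sup>+x\<in>E. ennreal (cmod (h x)) \<partial>MA)" if E: "E \<in> sets MA" for E l
        proof -
          have "ennreal (cmod (jF (\<lambda>x. indicator E x * h x) l)) \<le> (\<integral>\<^sup>+x. ennreal (cmod (indicator E x * h x)) \<partial>MA)"
            by (rule jF_le_nn_integral) (use E in simp)
          also have "\<dots> = (\<integral>\<^sup>+x\<in>E. ennreal (cmod (h x)) \<partial>MA)" by (rule nn_integral_cong) (auto simp: indicator_def)
          finally show ?thesis .
        qed
        show "(\<integral>\<^sup>+l. ennreal ((cmod (jF (\<lambda>x. indicator E x * h x) l))\<^sup>2) \<partial>NW) \<le> ennreal C * (\<integral>\<^sup>+x\<in>E. ennreal ((cmod (h x))\<^sup>2) \<partial>MA)" if E: "E \<in> sets MA" for E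
        proof -
          have "(\<integral>\<^sup>+l. ennreal ((cmod (jF (\<lambda>x. indicator E x * h x) l))\<^sup>2) \<partial>NW) \<le> ennreal C * (\<integral>\<^sup>+x. ennreal ((cmod (indicator E x * h x))\<^sup>2) \<partial>MA)"
            by (rule C(2)[of _ R]) (use E R in auto)
          also have "(\<integral>\<^sup>+x. ennreal ((cmod (indicator E x * h x))\<^sup>2) \<partial>MA) = (\<integral>\<^sup>+x\<in>E. ennreal ((cmod (h x))\<^sup>2) \<partial>MA)"
            by (rule nn_integral_cong) (auto simp: indicator_def)
          finally show ?thesis .
        qed
      qed (use C m m0 in auto)
      then show ?thesis by (simp add: K_def False)
    qed
  qed
  then show ?thesis using K by blast
qed

end

subsection \<open>Translation as a contraction\<close>

lemma powr_add_le:
  fixes r s q :: real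
  assumes "r \<ge> 0" "s \<ge> 0" "q \<ge> 0"
  shows "(r + s) powr q \<le> 2 powr q * (r powr q + s powr q)"
proof -
  have "(r + s) powr q \<le> (2 * max r s) powr q" using assms by (intro powr_mono2) auto
  also have "\<dots> = 2 powr q * (max r s) powr q" using assms by (simp add: powr_mult)
  also have "(max r s) powr q \<le> r powr q + s powr q" by (auto simp: max_def)
  finally show ?thesis by simp
qed

lemma enn_powr_1: "enn_powr z 1 = z"
  by (cases z) (auto simp: enn_powr_def)

context jacobi begin

text \<open>Jensen's inequality for each probability measure of the kernel, then invariance of A
  dx.\<close>

lemma translate_contraction:
  assumes x: "x > 0" and f [measurable]: "f \<in> borel_measurable borel" and p: "p > 1"
  shows "(\<integral>\<^sup>+y. ennreal (cmod (LINT t|Kx x y. f t) powr p) \<partial>MA) \<le> (\<integral>\<^sup>+y. ennreal (cmod (f y) powr p) \<partial>MA)"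
proof -
  have "(\<integral>\<^sup>+y. ennreal (cmod (LINT t|Kx x y. f t) powr p) \<partial>MA) \<le> (\<integral>\<^sup>+y. (\<integral>\<^sup>+t. ennreal (cmod (f t) powr p) \<partial>Kx x y) \<partial>MA)"
  proof (intro nn_integral_mono)
    fix y
    have "f \<in> borel_measurable (Kx x y)" by (simp add: measurable_cong_sets[OF Kx_sets[OF x] refl])
    then show "ennreal (cmod (LINT t|Kx x y. f t) powr p) \<le> (\<integral>\<^sup>+t. ennreal (cmod (f t) powr p) \<partial>Kx x y)"
      by (rule prob_power_mean[OF Kx_prob[OF x] _ p])
  qed
  also have "\<dots> = (\<integral>\<^sup>+y. ennreal (cmod (f y) powr p) \<partial>MA)" by (rule kernel_invariant[OF x]) measurable
  finally show ?thesis .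
qed

lemma translate_Lp_AE_integrable:
  assumes x: "x > 0" and f [measurable]: "f \<in> borel_measurable borel" and p: "p \<ge> 1"
    and fin: "(\<integral>\<^sup>+y. ennreal (cmod (f y) powr p) \<partial>MA) < \<infinity>"
  shows "AE y in MA. integrable (Kx x y) f"
proof -
  have [measurable]: "(\<lambda>y. \<integral>\<^sup>+t. ennreal (cmod (f t) powr p) \<partial>Kx x y) \<in> borel_measurable borel"
    by (rule Kx_nn_measurable[OF x]) measurable
  have "AE y in MA. (\<integral>\<^sup>+t. ennreal (cmod (f t) powr p) \<partial>Kx x y) \<noteq> \<infinity>"
    by (rule nn_integral_PInf_AE) (use fin kernel_invariant[OF x, of "\<lambda>t. ennreal (cmod (f t) powr p)"] in auto)
  then show ?thesis
  proof (rule eventually_mono)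
    fix y assume fy: "(\<integral>\<^sup>+t. ennreal (cmod (f t) powr p) \<partial>Kx x y) \<noteq> \<infinity>"
    interpret prob_space "Kx x y" by (rule Kx_prob[OF x])
    have mc [measurable]: "f \<in> borel_measurable (Kx x y)" by (simp add: measurable_cong_sets[OF Kx_sets[OF x] refl])
    show "integrable (Kx x y) f"
    proof (rule integrableI_bounded[OF mc])
      have le: "cmod z \<le> 1 + cmod z powr p" for z :: complex
      proof (cases "cmod z \<le> 1")
        case False
        then have "cmod z powr 1 \<le> cmod z powr p" using p by (intro powr_mono) auto
        then show ?thesis using False by simp
      qed (simp add: add_increasing2)
      have "(\<integral>\<^sup>+t. ennreal (cmod (f t)) \<partial>Kx x y) \<le> (\<integral>\<^sup>+t. 1 + ennreal (cmod (f t) powr p) \<partial>Kx x y)"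
      proof (intro nn_integral_mono)
        fix t
        have "ennreal (cmod (f t)) \<le> ennreal (1 + cmod (f t) powr p)" by (intro ennreal_leI le)
        then show "ennreal (cmod (f t)) \<le> 1 + ennreal (cmod (f t) powr p)" by simp
      qed
      also have "\<dots> = 1 + (\<integral>\<^sup>+t. ennreal (cmod (f t) powr p) \<partial>Kx x y)"
        by (subst nn_integral_add) (auto simp: emeasure_space_1)
      also have "\<dots> < \<infinity>" using fy by (simp add: less_top)
      finally show "(\<integral>\<^sup>+t. ennreal (cmod (f t)) \<partial>Kx x y) < \<infinity>" .
    qed
  qed
qed

section \<open>The Plancherel measure of dyadic windows\<close>

lemma jac_planch_continuous: "continuous_on {0<..} (jac_planch a b)"
proof -
  have nz: "complex_of_real r + \<i> * of_real s \<notin> \<int>\<^sub>\<le>\<^sub>0" if "r > 0" for r s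
    using that by (auto elim!: nonpos_Ints_cases simp: complex_eq_iff)
  have g1: "(\<i> * complex_of_real l + complex_of_real (jac_rho a b)) / 2 \<notin> \<int>\<^sub>\<le>\<^sub>0" for l
  proof -
    have eq: "(\<i> * complex_of_real l + complex_of_real (jac_rho a b)) / 2 = complex_of_real (\<rho> / 2) + \<i> * of_real (l / 2)"
      by (simp add: \<rho>_def field_simps)
    show ?thesis unfolding eq by (rule nz) (use rho_pos in simp)
  qed
  have g2: "(\<i> * complex_of_real l + complex_of_real (a - b + 1)) / 2 \<notin> \<int>\<^sub>\<le>\<^sub>0" for l
  proof -
    have eq: "(\<i> * complex_of_real l + complex_of_real (a - b + 1)) / 2 = complex_of_real ((a - b + 1) / 2) + \<i> * of_real (l / 2)"
      by (simp add: field_simps)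
    show ?thesis unfolding eq by (rule nz) (use b_le_a in simp)
  qed
  have g3: "\<i> * complex_of_real l \<notin> \<int>\<^sub>\<le>\<^sub>0" if "l > 0" for l
    using that by (auto elim!: nonpos_Ints_cases simp: complex_eq_iff)
  have c0: "jac_c a b l \<noteq> 0" if "l > 0" for l
    using Gamma_nonzero[OF g1[of l]] Gamma_nonzero[OF g2[of l]] Gamma_nonzero[OF g3[OF that]] Gamma_nonzero[OF a1_not_nonpos]
    by (simp add: jac_c_def powr_def)
  have G: "continuous_on {0<..} (\<lambda>l. Gamma (u l))" if "continuous_on {0<..} u" "\<And>l. l > 0 \<Longrightarrow> u l \<notin> \<int>\<^sub>\<le>\<^sub>0" for u :: "real \<Rightarrow> complex"
    by (rule continuous_on_compose2[OF continuous_on_Gamma that(1), of "- \<int>\<^sub>\<le>\<^sub>0"]) (use that(2) in auto)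
  have "continuous_on {0<..} (jac_c a b)"
    unfolding jac_c_def[abs_def] powr_def
    using Gamma_nonzero[OF g1] Gamma_nonzero[OF g2]
    by (auto intro!: continuous_intros G g1 g2[simplified] g3)
  then show ?thesis unfolding jac_planch_def[abs_def] using c0
    by (intro continuous_intros) auto
qed

definition "plw l = indicator {0<..} l * jac_planch a b l"

lemma plw_measurable [measurable]: "plw \<in> borel_measurable borel"
  using borel_measurable_continuous_on_indicator[OF _ jac_planch_continuous] by (simp add: plw_def[abs_def])

lemma nn_integral_plw:
  "(\<integral>\<^sup>+l\<in>{0<..}. ennreal (u l * jac_planch a b l) \<partial>lborel) = (\<integral>\<^sup>+l. ennreal (u l * plw l) \<partial>lborel)"
  by (intro nn_integral_cong) (auto simp: plw_def indicator_def)

text \<open>The window has length 1/x, and the weight on it is at most of order x^(-(2a+1)) for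
  small x and x^(-2) for large x. The resulting powers, divided by p in Hoelder's inequality, are
  the two smoothness exponents of the theorem.\<close>

lemma weight_window:
  "\<exists>C>0. \<forall>x>0. (\<integral>\<^sup>+l\<in>{1/x..2/x}. ennreal (plw l) \<partial>lborel) \<le> ennreal (C * (if x \<le> 1 then x powr (- (2 * (a + 1))) else x powr (-3)))"
proof -
  obtain Cp where Cp: "Cp > 0" "\<And>l. l > 0 \<Longrightarrow> jac_planch a b l \<le> Cp * jac_weight a l"
    using jac_planch_le_weight[OF b_le_a b_ge a_ne] by blast
  define C where "C = Cp * (4 * 2 powr (2 * a + 1))"
  have p1: "2 powr (2 * a + 1) \<ge> 1" using a_gt ge_one_powr_ge_zero[of 2 "2 * a + 1"] by simp
  have bound: "(\<integral>\<^sup>+l\<in>{1/x..2/x}. ennreal (plw l) \<partial>lborel) \<le> ennreal (Cp * W / x)"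
    if x: "x > 0" and W: "W \<ge> 0" "\<And>l. 1/x \<le> l \<Longrightarrow> l \<le> 2/x \<Longrightarrow> jac_weight a l \<le> W" for x W
  proof -
    have "(\<integral>\<^sup>+l\<in>{1/x..2/x}. ennreal (plw l) \<partial>lborel) \<le> (\<integral>\<^sup>+l\<in>{1/x..2/x}. ennreal (Cp * W) \<partial>lborel)"
    proof (intro nn_integral_mono)
      fix l :: real
      show "ennreal (plw l) * indicator {1/x..2/x} l \<le> ennreal (Cp * W) * indicator {1/x..2/x} l"
      proof (cases "l \<in> {1/x..2/x}")
        case True
        then have l: "1/x \<le> l" "l \<le> 2/x" by auto
        then have l0: "l > 0" using x by (meson less_le_trans zero_less_divide_1_iff)
        have "plw l \<le> Cp * jac_weight a l" using Cp(2)[OF l0] l0 by (simp add: plw_def)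
        also have "\<dots> \<le> Cp * W" using W(2)[OF l] Cp(1) by (intro mult_left_mono) auto
        finally show ?thesis using True by (simp add: ennreal_leI)
      qed simp
    qed
    also have "\<dots> = ennreal (Cp * W) * ennreal (2/x - 1/x)"
      using x by (subst nn_integral_cmult_indicator) (auto simp: divide_right_mono)
    also have "\<dots> = ennreal (Cp * W / x)" using x W Cp(1) by (simp add: ennreal_mult'[symmetric] field_simps)
    finally show ?thesis .
  qed
  have "(\<integral>\<^sup>+l\<in>{1/x..2/x}. ennreal (plw l) \<partial>lborel) \<le> ennreal (C * (if x \<le> 1 then x powr (- (2 * (a + 1))) else x powr (-3)))" if x: "x > 0" for x
  proof (cases "x \<le> 1")
    case True
    have "(\<integral>\<^sup>+l\<in>{1/x..2/x}. ennreal (plw l) \<partial>lborel) \<le> ennreal (Cp * ((2/x) powr (2 * a + 1)) / x)"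
    proof (rule bound[OF x])
      fix l assume l: "1/x \<le> l" "l \<le> 2/x"
      have "1 \<le> 1/x" using True x by simp
      then have l1: "1 \<le> l" using l by linarith
      then have "jac_weight a l = l powr (2 * a + 1)" by (auto simp: jac_weight_def)
      also have "\<dots> \<le> (2/x) powr (2 * a + 1)" using l1 l a_gt by (intro powr_mono2) auto
      finally show "jac_weight a l \<le> (2/x) powr (2 * a + 1)" .
    qed simp
    also have "(2/x) powr (2 * a + 1) / x = 2 powr (2 * a + 1) * x powr (- (2 * (a + 1)))"
    proof -
      have "x powr (2 * a + 1) * x = x powr (2 * (a + 1))" using x powr_add[of x "2 * a + 1" 1] by (simp add: algebra_simps)
      then have "x powr (- (2 * (a + 1))) = 1 / (x powr (2 * a + 1) * x)" by (simp only: powr_minus_divide)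
      then show ?thesis using x by (simp add: powr_divide)
    qed
    then have "Cp * ((2/x) powr (2 * a + 1)) / x = Cp * 2 powr (2 * a + 1) * x powr (- (2 * (a + 1)))" by (metis mult.assoc times_divide_eq_right)
    also have "ennreal \<dots> \<le> ennreal (C * x powr (- (2 * (a + 1))))"
      unfolding C_def using Cp(1) by (intro ennreal_leI mult_right_mono) auto
    finally show ?thesis using True by simp
  next
    case False
    have "(\<integral>\<^sup>+l\<in>{1/x..2/x}. ennreal (plw l) \<partial>lborel) \<le> ennreal (Cp * (2 powr (2 * a + 1) * (2/x)\<^sup>2) / x)"
    proof (rule bound[OF x])
      fix l assume l: "1/x \<le> l" "l \<le> 2/x"
      then have l0: "l > 0" using x by (meson less_le_trans zero_less_divide_1_iff)
      \<comment> \<open>For x between 1 and 2 the window reaches beyond 1, where the weight changes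
        its form; the factor \<open>2 powr (2 * a + 1)\<close> compares both forms with l^2 up to l
        = 2.\<close>
      have "2 / x \<le> 2" using False x by (simp add: field_simps)
      then have l2: "l \<le> 2" using l by linarith
      have "jac_weight a l \<le> 2 powr (2 * a + 1) * l\<^sup>2"
      proof (cases "l \<le> 1")
        case True
        have "1 * l\<^sup>2 \<le> 2 powr (2 * a + 1) * l\<^sup>2" using p1 by (intro mult_right_mono) auto
        then show ?thesis using True by (simp add: jac_weight_def)
      next
        case False
        have "l powr (2 * a + 1) \<le> 2 powr (2 * a + 1)" using l0 l2 a_gt by (intro powr_mono2) auto
        also have "\<dots> \<le> 2 powr (2 * a + 1) * l\<^sup>2" using False by simp
        finally show ?thesis using False by (simp add: jac_weight_def)
      qed
      also have "\<dots> \<le> 2 powr (2 * a + 1) * (2/x)\<^sup>2" using l l0 by (intro mult_left_mono power_mono) auto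
      finally show "jac_weight a l \<le> 2 powr (2 * a + 1) * (2/x)\<^sup>2" .
    qed simp
    also have "Cp * (2 powr (2 * a + 1) * (2/x)\<^sup>2) / x = C * x powr (-3)"
    proof -
      have "x powr (-3) = 1 / x ^ 3" using x by (simp add: powr_minus_divide)
      then show ?thesis by (simp add: C_def power2_eq_square power3_eq_cube)
    qed
    finally show ?thesis using False by simp
  qed
  moreover have "C > 0" using Cp by (simp add: C_def)
  ultimately show ?thesis by blast
qed

end

subsection \<open>The transform as a limit of truncations\<close>

lemma nn_integral_tail_tendsto_0:
  fixes u :: "real \<Rightarrow> ennreal"
  assumes M: "sets M = sets borel" and u: "u \<in> borel_measurable borel" and fin: "(\<integral>\<^sup>+x. u x \<partial>M) < \<infinity>"
  shows "(\<lambda>n. \<integral>\<^sup>+x. u x * indicator {real n<..} x \<partial>M) \<longlonglongrightarrow> 0"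
proof -
  have um [measurable]: "u \<in> borel_measurable M" using u by (simp add: measurable_cong_sets[OF M refl])
  have s: "{real n<..} \<in> sets M" for n using M by simp
  have "(\<lambda>n. \<integral>\<^sup>+x. u x * indicator {real n<..} x \<partial>M) \<longlonglongrightarrow> (\<integral>\<^sup>+x. 0 \<partial>M)"
  proof (rule nn_integral_dominated_convergence[where w = u])
    show "(\<lambda>x. u x * indicator {real n<..} x) \<in> borel_measurable M" for n
      using um s[of n] by (intro borel_measurable_times_ennreal borel_measurable_indicator)
    show "AE x in M. (\<lambda>n. u x * indicator {real n<..} x) \<longlonglongrightarrow> 0"
    proof (intro AE_I2 tendsto_eventually)
      fix x
      obtain N where "x \<le> real N" by (meson real_arch_simple)
      then show "\<forall>\<^sub>F n in sequentially. u x * indicator {real n<..} x = 0"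
        by (intro eventually_sequentiallyI[of N]) (auto simp: indicator_def)
    qed
  qed (use fin in \<open>auto simp: indicator_def\<close>)
  then show ?thesis by simp
qed

context jacobi begin

definition "PL = density lborel (\<lambda>l. ennreal (plw l))"

lemma sets_PL [measurable_cong, simp]: "sets PL = sets borel" by (simp add: PL_def)
lemma space_PL [simp]: "space PL = UNIV" by (simp add: PL_def)

lemma nn_integral_PL:
  assumes [measurable]: "u \<in> borel_measurable borel"
  shows "(\<integral>\<^sup>+l. u l \<partial>PL) = (\<integral>\<^sup>+l. ennreal (plw l) * u l \<partial>lborel)"
  unfolding PL_def by (rule nn_integral_density) measurable

lemma nn_integral_PL_planch:
  assumes [measurable]: "u \<in> borel_measurable borel" and "\<And>l. u l \<ge> 0"
  shows "(\<integral>\<^sup>+l. ennreal (u l) \<partial>PL) = (\<integral>\<^sup>+l\<in>{0<..}. ennreal (u l * jac_planch a b l) \<partial>lborel)"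
proof -
  have "(\<integral>\<^sup>+l. ennreal (u l) \<partial>PL) = (\<integral>\<^sup>+l. ennreal (plw l) * ennreal (u l) \<partial>lborel)"
    by (rule nn_integral_PL) measurable
  also have "\<dots> = (\<integral>\<^sup>+l. ennreal (u l * plw l) \<partial>lborel)"
    by (rule nn_integral_cong) (metis ennreal_mult' assms(2) mult.commute)
  finally show ?thesis by (simp only: nn_integral_plw)
qed

lemma hausdorff_young_planch:
  assumes p: "1 < p" "p \<le> 2" and q: "q = p / (p - 1)"
  shows "\<exists>K\<ge>0. \<forall>h R m. h \<in> borel_measurable borel \<longrightarrow> (\<forall>x>R. h x = 0) \<longrightarrow> m \<ge> 0 \<longrightarrow>
     (\<integral>\<^sup>+x. ennreal (cmod (h x) powr p) \<partial>MA) \<le> ennreal m \<longrightarrow>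
     (\<integral>\<^sup>+l. ennreal (cmod (jF h l) powr q) \<partial>PL) \<le> ennreal (K * m powr (q - 1))"
proof -
  obtain K where K: "K \<ge> 0" "\<And>h R m. h \<in> borel_measurable borel \<Longrightarrow> (\<And>x. x > R \<Longrightarrow> h x = 0) \<Longrightarrow> m \<ge> 0 \<Longrightarrow>
     (\<integral>\<^sup>+x. ennreal (cmod (h x) powr p) \<partial>MA) = ennreal m \<Longrightarrow>
     (\<integral>\<^sup>+l. ennreal (cmod (jF h l) powr q) \<partial>NW) \<le> ennreal (K * m powr (q - 1))"
    using hausdorff_young[OF p q] by blast
  obtain Cp where Cp: "Cp > 0" "\<And>l. l > 0 \<Longrightarrow> jac_planch a b l \<le> Cp * jac_weight a l"
    using jac_planch_le_weight[OF b_le_a b_ge a_ne] by blast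
  have q1: "q \<ge> 1" using p by (simp add: q field_simps)
  have "(\<integral>\<^sup>+l. ennreal (cmod (jF h l) powr q) \<partial>PL) \<le> ennreal (Cp * K * m powr (q - 1))"
    if hm [measurable]: "h \<in> borel_measurable borel" and R: "\<And>x. x > R \<Longrightarrow> h x = 0" and m: "m \<ge> 0"
      "(\<integral>\<^sup>+x. ennreal (cmod (h x) powr p) \<partial>MA) \<le> ennreal m" for h R m
  proof -
    define m' where "m' = enn2real (\<integral>\<^sup>+x. ennreal (cmod (h x) powr p) \<partial>MA)"
    have "(\<integral>\<^sup>+x. ennreal (cmod (h x) powr p) \<partial>MA) < top" using m(2) by (rule le_less_trans) simp
    then have m': "m' \<ge> 0" "m' \<le> m" "(\<integral>\<^sup>+x. ennreal (cmod (h x) powr p) \<partial>MA) = ennreal m'"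
      using m by (simp_all add: m'_def enn2real_leI)
    have "(\<integral>\<^sup>+l. ennreal (cmod (jF h l) powr q) \<partial>PL) = (\<integral>\<^sup>+l. ennreal (plw l) * ennreal (cmod (jF h l) powr q) \<partial>lborel)"
      by (rule nn_integral_PL) measurable
    also have "\<dots> \<le> (\<integral>\<^sup>+l. ennreal Cp * (ennreal (cmod (jF h l) powr q) * ennreal (jac_weight a l) * indicator {0<..} l) \<partial>lborel)"
    proof (intro nn_integral_mono)
      fix l :: real
      show "ennreal (plw l) * ennreal (cmod (jF h l) powr q) \<le> ennreal Cp * (ennreal (cmod (jF h l) powr q) * ennreal (jac_weight a l) * indicator {0<..} l)"
      proof (cases "l > 0")
        case True
        have "plw l \<le> Cp * jac_weight a l" using Cp(2)[OF True] True by (simp add: plw_def)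
        then have "ennreal (plw l) \<le> ennreal Cp * ennreal (jac_weight a l)" using Cp(1) by (simp add: ennreal_mult'[symmetric] ennreal_leI)
        then have "ennreal (plw l) * ennreal (cmod (jF h l) powr q) \<le> ennreal Cp * ennreal (jac_weight a l) * ennreal (cmod (jF h l) powr q)"
          by (rule mult_right_mono) simp
        then show ?thesis using True by (simp add: mult_ac)
      qed (simp add: plw_def)
    qed
    also have "\<dots> = ennreal Cp * (\<integral>\<^sup>+l. ennreal (cmod (jF h l) powr q) \<partial>NW)"
      by (subst nn_integral_cmult) (simp_all add: nn_integral_NW)
    also have "\<dots> \<le> ennreal Cp * ennreal (K * m' powr (q - 1))"
      by (intro mult_left_mono K(2)[OF hm R m'(1,3)]) auto
    also have "\<dots> = ennreal (Cp * K * m' powr (q - 1))" using Cp(1) by (simp add: ennreal_mult'[symmetric] mult.assoc)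
    also have "\<dots> \<le> ennreal (Cp * K * m powr (q - 1))"
      using m' Cp(1) K(1) q1 by (intro ennreal_leI mult_left_mono powr_mono2) auto
    finally show ?thesis .
  qed
  moreover have "Cp * K \<ge> 0" using Cp(1) K(1) by simp
  ultimately show ?thesis by blast
qed

text \<open>The indicator also removes the values at x \<le> 0, so the truncation is Borel on the
  whole line even if f is so on the positive axis only.\<close>

definition ftr :: "(real \<Rightarrow> complex) \<Rightarrow> real \<Rightarrow> real \<Rightarrow> complex" where
  "ftr f R x = indicator {0<..R} x *\<^sub>R f x"

lemma ftr_measurable [measurable]:
  assumes "set_borel_measurable borel {0<..} f"
  shows "ftr f R \<in> borel_measurable borel"
proof -
  have [measurable]: "(\<lambda>x. indicator {0<..} x *\<^sub>R f x) \<in> borel_measurable borel"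
    using assms by (simp add: set_borel_measurable_def)
  have "(\<lambda>x. indicator {..R} x *\<^sub>R (indicator {0<..} x *\<^sub>R f x)) \<in> borel_measurable borel" by measurable
  also have "(\<lambda>x. indicator {..R} x *\<^sub>R (indicator {0<..} x *\<^sub>R f x)) = ftr f R"
    by (auto simp: ftr_def indicator_def)
  finally show ?thesis .
qed

lemma jac_FT_trunc_eq_jF:
  assumes f: "set_borel_measurable borel {0<..} f"
  shows "jac_FT_trunc a b f R l = jF (ftr f R) l"
proof -
  have [measurable]: "ftr f R \<in> borel_measurable borel" by (rule ftr_measurable[OF f])
  have "jF (ftr f R) l = (LINT x|lborel. (A x * indicator {0<..} x) *\<^sub>R (ftr f R x * phi (of_real l) x))"
    unfolding jF_def MA_altdef by (rule integral_density) (auto simp: A_nonneg)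
  also have "\<dots> = jac_FT_trunc a b f R l"
    unfolding jac_FT_trunc_def set_lebesgue_integral_def
    by (rule Bochner_Integration.integral_cong) (auto simp: ftr_def indicator_def A_def phi_def scaleR_conv_of_real)
  finally show ?thesis by simp
qed

lemma is_jac_FT_iff:
  assumes f: "set_borel_measurable borel {0<..} f"
  shows "is_jac_FT a b p f g \<longleftrightarrow> g \<in> borel_measurable borel \<and>
    ((\<lambda>R. \<integral>\<^sup>+l. ennreal (cmod (jF (ftr f R) l - g l) powr (p / (p - 1))) \<partial>PL) \<longlongrightarrow> 0) at_top"
proof -
  have "(\<integral>\<^sup>+l\<in>{0<..}. ennreal (cmod (jF (ftr f R) l - g l) powr (p / (p - 1)) * jac_planch a b l) \<partial>lborel)
      = (\<integral>\<^sup>+l. ennreal (cmod (jF (ftr f R) l - g l) powr (p / (p - 1))) \<partial>PL)"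
    if [measurable]: "g \<in> borel_measurable borel" for R
  proof (rule nn_integral_PL_planch[symmetric])
    have [measurable]: "ftr f R \<in> borel_measurable borel" by (rule ftr_measurable[OF f])
    show "(\<lambda>l. cmod (jF (ftr f R) l - g l) powr (p / (p - 1))) \<in> borel_measurable borel" by measurable
  qed simp
  then show ?thesis unfolding is_jac_FT_def jac_FT_trunc_eq_jF[OF f] by auto
qed

lemma jF_diff:
  assumes "integrable MA h" "integrable MA k"
  shows "jF h l - jF k l = jF (\<lambda>x. h x - k x) l"
  unfolding jF_def using integrable_mult_phi[OF assms(1), of l] integrable_mult_phi[OF assms(2), of l]
  by (subst Bochner_Integration.integral_diff[symmetric]) (simp_all only: left_diff_distrib)

lemma jac_Lp_MA:
  assumes "jac_Lp a b p f"
  shows "(\<integral>\<^sup>+x. ennreal (cmod (indicator {0<..} x *\<^sub>R f x) powr p) \<partial>MA)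
    = (\<integral>\<^sup>+x\<in>{0<..}. ennreal (cmod (f x) powr p * jac_A a b x) \<partial>lborel)"
proof -
  have [measurable]: "(\<lambda>x. indicator {0<..} x *\<^sub>R f x) \<in> borel_measurable borel"
    using assms by (simp add: set_borel_measurable_def jac_Lp_def)
  have "(\<integral>\<^sup>+x. ennreal (cmod (indicator {0<..} x *\<^sub>R f x) powr p) \<partial>MA)
    = (\<integral>\<^sup>+x\<in>{0<..}. ennreal (cmod (indicator {0<..} x *\<^sub>R f x) powr p) * ennreal (A x) \<partial>lborel)"
    by (rule nn_integral_MA) measurable
  also have "\<dots> = (\<integral>\<^sup>+x\<in>{0<..}. ennreal (cmod (f x) powr p * jac_A a b x) \<partial>lborel)"
    by (intro nn_integral_cong) (auto simp: indicator_def A_def ennreal_mult')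
  finally show ?thesis .
qed

lemma ftr_integrable:
  assumes f: "jac_Lp a b p f" and p: "p > 1"
  shows "integrable MA (ftr f R)"
proof (rule compact_support_integrable[where p = p and R = R])
  show [measurable]: "ftr f R \<in> borel_measurable borel" using f by (intro ftr_measurable) (simp add: jac_Lp_def)
  have "(\<integral>\<^sup>+x. ennreal (cmod (ftr f R x) powr p) \<partial>MA) \<le> (\<integral>\<^sup>+x. ennreal (cmod (indicator {0<..} x *\<^sub>R f x) powr p) \<partial>MA)"
    by (intro nn_integral_mono) (auto simp: ftr_def indicator_def)
  also have "\<dots> < \<infinity>" unfolding jac_Lp_MA[OF f] using f by (simp add: jac_Lp_def)
  finally show "(\<integral>\<^sup>+x. ennreal (cmod (ftr f R x) powr p) \<partial>MA) < \<infinity>" .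
qed (use p in \<open>auto simp: ftr_def\<close>)

text \<open>A difference of two truncations is supported in the tail of f, so Hausdorff-Young makes
  the transforms a Cauchy family.\<close>

lemma is_jac_FT_exists:
  assumes f: "jac_Lp a b p f" and p: "1 < p" "p \<le> 2"
  shows "\<exists>g. is_jac_FT a b p f g"
proof -
  define q where "q = p / (p - 1)"
  have q1: "q > 1" using p by (simp add: q_def field_simps)
  have fm: "set_borel_measurable borel {0<..} f" using f by (simp add: jac_Lp_def)
  have ftm [measurable]: "ftr f R \<in> borel_measurable borel" for R by (rule ftr_measurable[OF fm])
  define u where "u x = ennreal (cmod (indicator {0<..} x *\<^sub>R f x) powr p)" for x
  have [measurable]: "(\<lambda>x. indicator {0<..} x *\<^sub>R f x) \<in> borel_measurable borel"
    using fm by (simp add: set_borel_measurable_def)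
  have um [measurable]: "u \<in> borel_measurable borel" unfolding u_def by measurable
  have ufin: "(\<integral>\<^sup>+x. u x \<partial>MA) < \<infinity>" unfolding u_def jac_Lp_MA[OF f] using f by (simp add: jac_Lp_def)
  obtain K where K: "K \<ge> 0" "\<And>h R m. h \<in> borel_measurable borel \<Longrightarrow> (\<And>x. x > R \<Longrightarrow> h x = 0) \<Longrightarrow> m \<ge> 0 \<Longrightarrow>
     (\<integral>\<^sup>+x. ennreal (cmod (h x) powr p) \<partial>MA) \<le> ennreal m \<Longrightarrow>
     (\<integral>\<^sup>+l. ennreal (cmod (jF h l) powr q) \<partial>PL) \<le> ennreal (K * m powr (q - 1))"
    using hausdorff_young_planch[OF p q_def] by blast
  have cauchy: "\<exists>R0. \<forall>R\<ge>R0. \<forall>R'\<ge>R0. (\<integral>\<^sup>+l. ennreal (cmod (jF (ftr f R) l - jF (ftr f R') l) powr q) \<partial>PL) \<le> ennreal e"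
    if e: "e > 0" for e
  proof -
    \<comment> \<open>Solves (K + 1) \<delta>^(q-1) = e; the added 1 allows for K = 0.\<close>
    define \<delta> where "\<delta> = (e / (K + 1)) powr (1 / (q - 1))"
    have \<delta>: "\<delta> > 0" using e K(1) by (simp add: \<delta>_def)
    have "\<delta> powr (q - 1) = e / (K + 1)" using e K(1) q1 by (simp add: \<delta>_def powr_powr)
    then have "(K + 1) * \<delta> powr (q - 1) = e" using K(1) by simp
    moreover have "K * \<delta> powr (q - 1) \<le> (K + 1) * \<delta> powr (q - 1)" by (intro mult_right_mono) auto
    ultimately have K\<delta>: "K * \<delta> powr (q - 1) \<le> e" by simp
    have "\<forall>\<^sub>F n in sequentially. (\<integral>\<^sup>+x. u x * indicator {real n<..} x \<partial>MA) < ennreal \<delta>"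
      using nn_integral_tail_tendsto_0[OF sets_MA um ufin] \<delta> by (intro order_tendstoD) auto
    then obtain n where n: "(\<integral>\<^sup>+x. u x * indicator {real n<..} x \<partial>MA) < ennreal \<delta>"
      unfolding eventually_sequentially by blast
    show ?thesis
    proof (intro exI[of _ "real n"] allI impI)
      fix R R' assume R: "real n \<le> R" "real n \<le> R'"
      define h where "h x = ftr f R x - ftr f R' x" for x
      have hm: "h \<in> borel_measurable borel" unfolding h_def by measurable
      have "(\<integral>\<^sup>+x. ennreal (cmod (h x) powr p) \<partial>MA) \<le> (\<integral>\<^sup>+x. u x * indicator {real n<..} x \<partial>MA)"
        using R by (intro nn_integral_mono) (auto simp: h_def u_def ftr_def indicator_def)
      then have "(\<integral>\<^sup>+x. ennreal (cmod (h x) powr p) \<partial>MA) \<le> ennreal \<delta>" using n by simp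
      then have "(\<integral>\<^sup>+l. ennreal (cmod (jF h l) powr q) \<partial>PL) \<le> ennreal (K * \<delta> powr (q - 1))"
        using \<delta> by (intro K(2)[OF hm, of "max R R'"]) (auto simp: h_def ftr_def)
      also have "\<dots> \<le> ennreal e" by (intro ennreal_leI K\<delta>)
      finally show "(\<integral>\<^sup>+l. ennreal (cmod (jF (ftr f R) l - jF (ftr f R') l) powr q) \<partial>PL) \<le> ennreal e"
        unfolding jF_diff[OF ftr_integrable[OF f p(1)] ftr_integrable[OF f p(1)]] h_def .
    qed
  qed
  have jm: "jF (ftr f R) \<in> borel_measurable PL" for R by measurable
  obtain g where "g \<in> borel_measurable PL" "((\<lambda>R. \<integral>\<^sup>+l. ennreal (cmod (jF (ftr f R) l - g l) powr q) \<partial>PL) \<longlongrightarrow> 0) at_top"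
    by (rule Lq_complete_at_top[OF jm _ cauchy]) (use q1 in auto)
  then have "is_jac_FT a b p f g" unfolding is_jac_FT_iff[OF fm] q_def by simp
  then show ?thesis by blast
qed

lemma translate_vanishes:
  assumes x: "x > 0" and h [measurable]: "h \<in> borel_measurable borel" and R: "\<And>y. y > R \<Longrightarrow> h y = 0" and y: "y > R + x" "y > 0"
  shows "(LINT t|Kx x y. h t) = 0"
proof (rule integral_eq_zero_AE)
  show "AE t in Kx x y. h t = 0"
    by (rule eventually_mono[OF hconv_AE[OF Kx_hconv[OF x y(2)]]]) (use y R in auto)
qed

text \<open>Writing the truncation as f0 - r with tail r, the difference between its translate and
  itself is that of f0 plus r minus the translate of r. Contraction bounds the last two by the tail,
  uniformly in x.\<close>

lemma translate_difference_Lp: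
  assumes x: "x > 0" and f: "jac_Lp a b p f" and fb [measurable]: "f \<in> borel_measurable borel" and p: "1 < p"
    and w: "(\<integral>\<^sup>+y\<in>{0<..}. ennreal (cmod (jac_tau a b x f y - f y) powr p * jac_A a b y) \<partial>lborel) = ennreal w" "w \<ge> 0"
    and t: "(\<integral>\<^sup>+y. ennreal (cmod (indicator {0<..} y *\<^sub>R f y) powr p) * indicator {R<..} y \<partial>MA) = ennreal t" "t \<ge> 0"
  shows "(\<integral>\<^sup>+y. ennreal (cmod ((LINT z|Kx x y. ftr f R z) - ftr f R y) powr p) \<partial>MA) \<le> ennreal (2 powr p * (w + 2 powr p * (2 * t)))"
proof -
  define f0 where "f0 y = indicator {0<..} y *\<^sub>R f y" for y
  define r where "r y = indicator {R<..} y *\<^sub>R f0 y" for y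
  have f0m [measurable]: "f0 \<in> borel_measurable borel" unfolding f0_def by measurable
  have rm [measurable]: "r \<in> borel_measurable borel" unfolding r_def by measurable
  have dec: "ftr f R y = f0 y - r y" for y by (auto simp: ftr_def f0_def r_def indicator_def)
  have Tm [measurable]: "(\<lambda>y. LINT z|Kx x y. k z) \<in> borel_measurable borel" if "k \<in> borel_measurable borel" for k :: "real \<Rightarrow> complex"
    by (rule Kx_lborel_measurable[OF x that])
  define D0 where "D0 y = (LINT z|Kx x y. f0 z) - f0 y" for y
  have D0m [measurable]: "D0 \<in> borel_measurable borel" unfolding D0_def by measurable
  have f0fin: "(\<integral>\<^sup>+y. ennreal (cmod (f0 y) powr p) \<partial>MA) < \<infinity>"
    unfolding f0_def jac_Lp_MA[OF f] using f by (simp add: jac_Lp_def)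
  have rt: "(\<integral>\<^sup>+y. ennreal (cmod (r y) powr p) \<partial>MA) = ennreal t"
    unfolding t(1)[symmetric] by (intro nn_integral_cong) (auto simp: r_def f0_def indicator_def)
  have D0w: "(\<integral>\<^sup>+y. ennreal (cmod (D0 y) powr p) \<partial>MA) = ennreal w"
  proof -
    \<comment> \<open>For y different from x the support [|x-y|, x+y] lies in the open half-line,
      where f0 = f; at y = x it contains 0, where they may differ.\<close>
    have eq: "(LINT z|Kx x y. f0 z) = jac_tau a b x f y" if y: "y > 0" "y \<noteq> x" for y
    proof -
      have "(LINT z|Kx x y. f0 z) = (LINT z|Kx x y. f z)"
      proof (rule integral_cong_AE)
        show "f0 \<in> borel_measurable (Kx x y)" "f \<in> borel_measurable (Kx x y)"
          by (simp_all add: measurable_cong_sets[OF Kx_sets[OF x] refl])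
        show "AE z in Kx x y. f0 z = f z"
          by (rule eventually_mono[OF hconv_AE[OF Kx_hconv[OF x y(1)]]]) (use y in \<open>auto simp: f0_def indicator_def\<close>)
      qed
      then show ?thesis using y by (simp add: jac_tau_def Kx_def)
    qed
    have "(\<integral>\<^sup>+y. ennreal (cmod (D0 y) powr p) \<partial>MA) = (\<integral>\<^sup>+y\<in>{0<..}. ennreal (cmod (D0 y) powr p) * ennreal (A y) \<partial>lborel)"
      by (rule nn_integral_MA) measurable
    also have "\<dots> = (\<integral>\<^sup>+y\<in>{0<..}. ennreal (cmod (jac_tau a b x f y - f y) powr p * jac_A a b y) \<partial>lborel)"
    proof (rule nn_integral_cong_AE)
      show "AE y in lborel. ennreal (cmod (D0 y) powr p) * ennreal (A y) * indicator {0<..} y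
          = ennreal (cmod (jac_tau a b x f y - f y) powr p * jac_A a b y) * indicator {0<..} y"
      proof (rule eventually_mono[OF AE_lborel_singleton[of x]])
        fix y assume "y \<noteq> x"
        then have "y > 0 \<Longrightarrow> D0 y = jac_tau a b x f y - f y" using eq[of y] by (simp add: D0_def) (simp add: f0_def)
        then show "ennreal (cmod (D0 y) powr p) * ennreal (A y) * indicator {0<..} y
          = ennreal (cmod (jac_tau a b x f y - f y) powr p * jac_A a b y) * indicator {0<..} y"
          by (cases "y > 0") (simp_all add: A_def ennreal_mult')
      qed
    qed
    finally show ?thesis using w by simp
  qed
  have "AE y in MA. integrable (Kx x y) f0"
    by (rule translate_Lp_AE_integrable[OF x f0m _ f0fin]) (use p in simp)
  moreover have "AE y in MA. integrable (Kx x y) r"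
    by (rule translate_Lp_AE_integrable[OF x rm, of p]) (use p rt in auto)
  ultimately have AE: "AE y in MA. ennreal (cmod ((LINT z|Kx x y. ftr f R z) - ftr f R y) powr p)
     \<le> ennreal (2 powr p) * (ennreal (cmod (D0 y) powr p) + ennreal (2 powr p) * (ennreal (cmod (LINT z|Kx x y. r z) powr p) + ennreal (cmod (r y) powr p)))"
  proof eventually_elim
    case (elim y)
    define s where "s = (LINT z|Kx x y. r z)"
    have "(LINT z|Kx x y. ftr f R z) - ftr f R y = D0 y + (r y - s)"
      unfolding dec D0_def s_def using elim by simp
    then have "cmod ((LINT z|Kx x y. ftr f R z) - ftr f R y) \<le> cmod (D0 y) + (cmod s + cmod (r y))"
      using norm_triangle_ineq[of "D0 y" "r y - s"] norm_triangle_ineq4[of "r y" s] by simp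
    then have "cmod ((LINT z|Kx x y. ftr f R z) - ftr f R y) powr p \<le> (cmod (D0 y) + (cmod s + cmod (r y))) powr p"
      using p by (intro powr_mono2) auto
    also have "\<dots> \<le> 2 powr p * (cmod (D0 y) powr p + (cmod s + cmod (r y)) powr p)"
      using p by (intro powr_add_le) auto
    also have "\<dots> \<le> 2 powr p * (cmod (D0 y) powr p + 2 powr p * (cmod s powr p + cmod (r y) powr p))"
      using p by (intro mult_left_mono add_left_mono powr_add_le) auto
    finally show ?case unfolding s_def[symmetric]
      by (simp add: ennreal_mult'[symmetric] ennreal_plus[symmetric] ennreal_leI del: ennreal_plus)
  qed
  have "(\<integral>\<^sup>+y. ennreal (cmod ((LINT z|Kx x y. ftr f R z) - ftr f R y) powr p) \<partial>MA)
     \<le> (\<integral>\<^sup>+y. ennreal (2 powr p) * (ennreal (cmod (D0 y) powr p) + ennreal (2 powr p) * (ennreal (cmod (LINT z|Kx x y. r z) powr p) + ennreal (cmod (r y) powr p))) \<partial>MA)"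
    by (rule nn_integral_mono_AE[OF AE])
  also have "\<dots> = ennreal (2 powr p) * (ennreal w + ennreal (2 powr p) * ((\<integral>\<^sup>+y. ennreal (cmod (LINT z|Kx x y. r z) powr p) \<partial>MA) + ennreal t))"
    using Tm[OF rm] by (simp add: nn_integral_cmult nn_integral_add D0w rt)
  also have "\<dots> \<le> ennreal (2 powr p) * (ennreal w + ennreal (2 powr p) * (ennreal t + ennreal t))"
    using translate_contraction[OF x rm p] rt by (intro mult_left_mono add_left_mono add_right_mono) auto
  also have "\<dots> = ennreal (2 powr p * (w + 2 powr p * (2 * t)))"
    using w(2) t(2) by (simp add: ennreal_mult'[symmetric] ennreal_plus[symmetric] del: ennreal_plus)
  finally show ?thesis .
qed

text \<open>Such f is not integrable for any convolution measure, and the Bochner integral is then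
  0.\<close>

lemma jac_tau_not_measurable:
  assumes "x > 0" "y > 0" "f \<notin> borel_measurable borel"
  shows "jac_tau a b x f y = 0"
proof -
  have "sets (hyp_conv a b x y) = sets borel" using hconv_hyp_conv[OF assms(1,2)] by (simp add: hconv_def)
  then have "\<not> integrable (hyp_conv a b x y) f"
    using assms(3) borel_measurable_integrable[of "hyp_conv a b x y" f] measurable_cong_sets[of "hyp_conv a b x y" borel borel borel] by auto
  then show ?thesis by (simp add: jac_tau_def not_integrable_integral_eq)
qed

subsection \<open>Integrability of the transform\<close>

text \<open>The translate minus the truncation itself has transform (phi - 1) times the transform of
  the truncation; Hausdorff-Young bounds it by the modulus of f and the tail. Letting the truncation
  radius grow removes the tail and replaces the transform by g.\<close>

lemma modulus_controls_transform:
  assumes p: "1 < p" "p \<le> 2" and q: "q = p / (p - 1)" and f: "jac_Lp a b p f"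
  shows "\<exists>K\<ge>0. \<forall>g x w. is_jac_FT a b p f g \<longrightarrow> x > 0 \<longrightarrow> w \<ge> 0 \<longrightarrow>
     (\<integral>\<^sup>+y\<in>{0<..}. ennreal (cmod (jac_tau a b x f y - f y) powr p * jac_A a b y) \<partial>lborel) = ennreal w \<longrightarrow>
     (\<integral>\<^sup>+l. ennreal ((cmod (1 - phi (of_real l) x) * cmod (g l)) powr q) \<partial>PL) \<le> ennreal (K * w powr (q - 1))"
proof -
  have q1: "q > 1" using p by (simp add: q field_simps)
  have fm: "set_borel_measurable borel {0<..} f" using f by (simp add: jac_Lp_def)
  have ftm [measurable]: "ftr f R \<in> borel_measurable borel" for R by (rule ftr_measurable[OF fm])
  define u where "u x = ennreal (cmod (indicator {0<..} x *\<^sub>R f x) powr p)" for x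
  have [measurable]: "(\<lambda>x. indicator {0<..} x *\<^sub>R f x) \<in> borel_measurable borel"
    using fm by (simp add: set_borel_measurable_def)
  have um [measurable]: "u \<in> borel_measurable borel" unfolding u_def by measurable
  have ufin: "(\<integral>\<^sup>+x. u x \<partial>MA) < \<infinity>" unfolding u_def jac_Lp_MA[OF f] using f by (simp add: jac_Lp_def)
  define T where "T n = (\<integral>\<^sup>+x. u x * indicator {real n<..} x \<partial>MA)" for n
  define t where "t n = enn2real (T n)" for n
  have Tlim: "T \<longlonglongrightarrow> 0" unfolding T_def by (rule nn_integral_tail_tendsto_0[OF sets_MA um ufin])
  have "T n \<le> (\<integral>\<^sup>+x. u x \<partial>MA)" for n unfolding T_def by (intro nn_integral_mono) (auto simp: indicator_def)
  then have "T n < \<infinity>" for n using ufin by (rule le_less_trans)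
  then have Tt: "T n = ennreal (t n)" "t n \<ge> 0" for n by (simp_all add: t_def)
  have tlim: "t \<longlonglongrightarrow> 0" unfolding t_def[abs_def] using Tlim by (intro tendsto_enn2real) auto
  obtain K where K: "K \<ge> 0" "\<And>h R m. h \<in> borel_measurable borel \<Longrightarrow> (\<And>x. x > R \<Longrightarrow> h x = 0) \<Longrightarrow> m \<ge> 0 \<Longrightarrow>
     (\<integral>\<^sup>+x. ennreal (cmod (h x) powr p) \<partial>MA) \<le> ennreal m \<Longrightarrow>
     (\<integral>\<^sup>+l. ennreal (cmod (jF h l) powr q) \<partial>PL) \<le> ennreal (K * m powr (q - 1))"
    using hausdorff_young_planch[OF p q] by blast
  have phi1: "cmod (1 - phi (of_real l) x) \<le> 2" if "x > 0" for x l
    using phi_le_1[of x l] that norm_triangle_ineq4[of 1 "phi (of_real l) x"] by simp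
  have [measurable]: "(\<lambda>l. phi (complex_of_real l) x) \<in> borel_measurable borel" for x
  proof -
    have "(\<lambda>z. phi (complex_of_real (fst z)) (snd z)) \<in> borel_measurable (borel \<Otimes>\<^sub>M borel)"
      using phi_measurable_pair by (simp add: split_beta)
    moreover have "(\<lambda>l. (l, x)) \<in> borel \<rightarrow>\<^sub>M borel \<Otimes>\<^sub>M borel" by measurable
    ultimately show ?thesis using measurable_compose by fastforce
  qed
  define M where "M w n = 2 powr p * (w + 2 powr p * (2 * t n))" for w n
  have core: "(\<integral>\<^sup>+l. ennreal ((cmod (1 - phi (of_real l) x) * cmod (jF (ftr f (real n)) l)) powr q) \<partial>PL)
      \<le> ennreal (2 powr q * K * M w n powr (q - 1))"
    if x: "x > 0" and w: "w \<ge> 0" "(\<integral>\<^sup>+y\<in>{0<..}. ennreal (cmod (jac_tau a b x f y - f y) powr p * jac_A a b y) \<partial>lborel) = ennreal w" for x w n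
  proof (cases "f \<in> borel_measurable borel")
    case fb: True
    define R where "R = real n"
    define d where "d y = (if y > 0 then (LINT z|Kx x y. ftr f R z) - ftr f R y else 0)" for y
    have [measurable]: "(\<lambda>y. LINT z|Kx x y. ftr f R z) \<in> borel_measurable borel" by (rule Kx_lborel_measurable[OF x ftm])
    have dm: "d \<in> borel_measurable borel" unfolding d_def by measurable
    have supp: "ftr f R y = 0" if "y > R" for y using that by (simp add: ftr_def)
    have d0: "d y = 0" if "y > R + x" for y
      using translate_vanishes[OF x ftm supp that] supp[of y] that x by (simp add: d_def)
    have fi: "integrable MA (ftr f R)" by (rule ftr_integrable[OF f p(1)])
    have jd: "jF d l = (phi (of_real l) x - 1) * jF (ftr f R) l" for l
    proof -
      have "jF d l = (LINT y|MA. (LINT z|Kx x y. ftr f R z) * phi (of_real l) y - ftr f R y * phi (of_real l) y)"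
        unfolding jF_def
      proof (rule integral_cong_AE)
        show "AE y in MA. d y * phi (of_real l) y = (LINT z|Kx x y. ftr f R z) * phi (of_real l) y - ftr f R y * phi (of_real l) y"
          by (rule eventually_mono[OF AE_MA_pos]) (simp add: d_def left_diff_distrib)
      qed (use dm in measurable)
      also have "\<dots> = (LINT y|MA. (LINT z|Kx x y. ftr f R z) * phi (of_real l) y) - (LINT y|MA. ftr f R y * phi (of_real l) y)"
        by (intro Bochner_Integration.integral_diff integrable_mult_phi translate_integrable(2)[OF x fi] fi)
      also have "\<dots> = (phi (of_real l) x - 1) * jF (ftr f R) l"
        unfolding translate_transform[OF x fi] jF_def by (simp add: left_diff_distrib)
      finally show ?thesis .
    qed
    have "(\<integral>\<^sup>+y. ennreal (cmod (d y) powr p) \<partial>MA) = (\<integral>\<^sup>+y. ennreal (cmod ((LINT z|Kx x y. ftr f R z) - ftr f R y) powr p) \<partial>MA)"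
      by (rule nn_integral_cong_AE, rule eventually_mono[OF AE_MA_pos]) (simp add: d_def)
    also have "\<dots> \<le> ennreal (M w n)"
      unfolding M_def R_def by (rule translate_difference_Lp[OF x f fb p(1) w(2,1) _ Tt(2)])
        (simp only: Tt(1)[symmetric] T_def u_def)
    finally have "(\<integral>\<^sup>+l. ennreal (cmod (jF d l) powr q) \<partial>PL) \<le> ennreal (K * M w n powr (q - 1))"
      using w Tt(2)[of n] by (intro K(2)[OF dm d0]) (auto simp: M_def)
    also have "\<dots> \<le> ennreal (2 powr q * K * M w n powr (q - 1))"
    proof (intro ennreal_leI mult_right_mono)
      have "1 \<le> 2 powr q" using q1 by (intro ge_one_powr_ge_zero) auto
      then show "K \<le> 2 powr q * K" using mult_right_mono[of 1 "2 powr q" K] K(1) by simp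
    qed simp
    finally show ?thesis unfolding jd norm_mult R_def by (simp add: norm_minus_commute)
  next
    case False
    \<comment> \<open>f is not Borel on the whole line: its translates vanish and w is the p-th
      power of the norm of f. Hausdorff-Young for the truncations themselves, with |1 - phi| \<le>
      2, is then enough.\<close>
    have "ennreal w = (\<integral>\<^sup>+y\<in>{0<..}. ennreal (cmod (f y) powr p * jac_A a b y) \<partial>lborel)"
      unfolding w(2)[symmetric] by (intro nn_integral_cong) (auto simp: jac_tau_not_measurable[OF x _ False] indicator_def)
    also have "\<dots> = (\<integral>\<^sup>+x. u x \<partial>MA)" unfolding u_def jac_Lp_MA[OF f] ..
    finally have uw: "(\<integral>\<^sup>+x. u x \<partial>MA) = ennreal w" by simp
    have "(\<integral>\<^sup>+y. ennreal (cmod (ftr f (real n) y) powr p) \<partial>MA) \<le> (\<integral>\<^sup>+x. u x \<partial>MA)"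
      by (intro nn_integral_mono) (auto simp: u_def ftr_def indicator_def)
    also have "\<dots> \<le> ennreal (M w n)"
    proof -
      have "1 * w \<le> 2 powr p * (w + 2 powr p * (2 * t n))"
        using w(1) Tt(2)[of n] p ge_one_powr_ge_zero[of 2 p] by (intro mult_mono) auto
      then show ?thesis unfolding uw M_def by (intro ennreal_leI) simp
    qed
    finally have I: "(\<integral>\<^sup>+l. ennreal (cmod (jF (ftr f (real n)) l) powr q) \<partial>PL) \<le> ennreal (K * M w n powr (q - 1))"
      using w Tt(2)[of n] by (intro K(2)[OF ftm, of "real n"]) (auto simp: M_def ftr_def)
    have "(\<integral>\<^sup>+l. ennreal ((cmod (1 - phi (of_real l) x) * cmod (jF (ftr f (real n)) l)) powr q) \<partial>PL)
      \<le> (\<integral>\<^sup>+l. ennreal (2 powr q) * ennreal (cmod (jF (ftr f (real n)) l) powr q) \<partial>PL)"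
    proof (intro nn_integral_mono)
      fix l
      have "(cmod (1 - phi (of_real l) x) * cmod (jF (ftr f (real n)) l)) powr q \<le> (2 * cmod (jF (ftr f (real n)) l)) powr q"
        using phi1[OF x, of l] q1 by (intro powr_mono2 mult_right_mono) auto
      then show "ennreal ((cmod (1 - phi (of_real l) x) * cmod (jF (ftr f (real n)) l)) powr q) \<le> ennreal (2 powr q) * ennreal (cmod (jF (ftr f (real n)) l) powr q)"
        by (simp add: powr_mult ennreal_mult'[symmetric] ennreal_leI)
    qed
    also have "\<dots> = ennreal (2 powr q) * (\<integral>\<^sup>+l. ennreal (cmod (jF (ftr f (real n)) l) powr q) \<partial>PL)"
      by (rule nn_integral_cmult) measurable
    also have "\<dots> \<le> ennreal (2 powr q) * ennreal (K * M w n powr (q - 1))" by (intro mult_left_mono I) simp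
    also have "\<dots> = ennreal (2 powr q * K * M w n powr (q - 1))" by (simp add: ennreal_mult'[symmetric] mult.assoc)
    finally show ?thesis .
  qed
  define K' where "K' = 2 powr q * (2 powr q * K * (2 powr p) powr (q - 1))"
  have "(\<integral>\<^sup>+l. ennreal ((cmod (1 - phi (of_real l) x) * cmod (g l)) powr q) \<partial>PL) \<le> ennreal (K' * w powr (q - 1))"
    if g: "is_jac_FT a b p f g" and x: "x > 0" and w: "w \<ge> 0" "(\<integral>\<^sup>+y\<in>{0<..}. ennreal (cmod (jac_tau a b x f y - f y) powr p * jac_A a b y) \<partial>lborel) = ennreal w" for g x w
  proof -
    have gm [measurable]: "g \<in> borel_measurable borel" using g by (simp add: is_jac_FT_def)
    define E where "E n = (\<integral>\<^sup>+l. ennreal (cmod (jF (ftr f (real n)) l - g l) powr q) \<partial>PL)" for n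
    have Elim: "E \<longlonglongrightarrow> 0"
      unfolding E_def q using g[unfolded is_jac_FT_iff[OF fm]] filterlim_real_sequentially
      by (auto intro: filterlim_compose[of _ _ at_top])
    define I where "I = (\<integral>\<^sup>+l. ennreal ((cmod (1 - phi (of_real l) x) * cmod (g l)) powr q) \<partial>PL)"
    have bnd: "I \<le> ennreal (2 powr q) * (ennreal (2 powr q) * E n + ennreal (2 powr q * K * M w n powr (q - 1)))" for n
    proof -
      have "I \<le> (\<integral>\<^sup>+l. ennreal (2 powr q) * (ennreal (2 powr q) * ennreal (cmod (jF (ftr f (real n)) l - g l) powr q)
             + ennreal ((cmod (1 - phi (of_real l) x) * cmod (jF (ftr f (real n)) l)) powr q)) \<partial>PL)"
        unfolding I_def
      proof (intro nn_integral_mono)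
        fix l
        define c F where "c = cmod (1 - phi (of_real l) x)" and "F = jF (ftr f (real n)) l"
        have c: "0 \<le> c" "c \<le> 2" using phi1[OF x, of l] by (auto simp: c_def)
        have "cmod (g l) \<le> cmod (F - g l) + cmod F" using norm_triangle_ineq4[of F "F - g l"] by simp
        then have "c * cmod (g l) \<le> c * cmod (F - g l) + c * cmod F" using c by (simp add: mult_left_mono distrib_left[symmetric])
        also have "\<dots> \<le> 2 * cmod (F - g l) + c * cmod F" using c by (intro add_right_mono mult_right_mono) auto
        finally have "(c * cmod (g l)) powr q \<le> (2 * cmod (F - g l) + c * cmod F) powr q"
          using c q1 by (intro powr_mono2) auto
        also have "\<dots> \<le> 2 powr q * ((2 * cmod (F - g l)) powr q + (c * cmod F) powr q)"
          using c q1 by (intro powr_add_le) auto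
        finally have "(c * cmod (g l)) powr q \<le> 2 powr q * (2 powr q * cmod (F - g l) powr q + (c * cmod F) powr q)"
          by (simp add: powr_mult)
        then show "ennreal ((c * cmod (g l)) powr q) \<le> ennreal (2 powr q) * (ennreal (2 powr q) * ennreal (cmod (F - g l) powr q)
             + ennreal ((c * cmod F) powr q))"
          by (simp add: ennreal_mult'[symmetric] ennreal_plus[symmetric] ennreal_leI del: ennreal_plus)
      qed
      also have "\<dots> = ennreal (2 powr q) * (ennreal (2 powr q) * E n
             + (\<integral>\<^sup>+l. ennreal ((cmod (1 - phi (of_real l) x) * cmod (jF (ftr f (real n)) l)) powr q) \<partial>PL))"
        unfolding E_def by (simp add: nn_integral_cmult nn_integral_add)
      also have "\<dots> \<le> ennreal (2 powr q) * (ennreal (2 powr q) * E n + ennreal (2 powr q * K * M w n powr (q - 1)))"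
        by (intro mult_left_mono add_left_mono core[OF x w]) auto
      finally show ?thesis .
    qed
    \<comment> \<open>The tails tend to 0, so only w remains. As w may be 0, continuity of the power
      at base 0 is used, valid because q - 1 > 0.\<close>
    have Mlim: "(\<lambda>n. 2 powr q * K * M w n powr (q - 1)) \<longlonglongrightarrow> 2 powr q * K * (2 powr p * (w + 2 powr p * (2 * 0))) powr (q - 1)"
      unfolding M_def
    proof (intro tendsto_mult tendsto_const tendsto_powr' tendsto_add tlim disjI2 conjI)
      show "0 < q - 1" using q1 by simp
      show "\<forall>\<^sub>F n in sequentially. 0 \<le> 2 powr p * (w + 2 powr p * (2 * t n))"
        using w(1) Tt(2) by (intro always_eventually allI) simp
    qed
    have "(\<lambda>n. ennreal (2 powr q) * (ennreal (2 powr q) * E n + ennreal (2 powr q * K * M w n powr (q - 1))))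
        \<longlonglongrightarrow> ennreal (2 powr q) * (ennreal (2 powr q) * 0 + ennreal (2 powr q * K * (2 powr p * (w + 2 powr p * (2 * 0))) powr (q - 1)))"
      by (intro ennreal_tendsto_cmult tendsto_add tendsto_ennrealI Elim Mlim) auto
    then have "I \<le> ennreal (2 powr q) * (ennreal (2 powr q) * 0 + ennreal (2 powr q * K * (2 powr p * (w + 2 powr p * (2 * 0))) powr (q - 1)))"
      by (rule LIMSEQ_le_const) (use bnd in auto)
    also have "\<dots> = ennreal (K' * w powr (q - 1))"
      using w(1) by (simp add: K'_def powr_mult ennreal_mult'[symmetric] mult_ac)
    finally show ?thesis unfolding I_def .
  qed
  moreover have "K' \<ge> 0" using K(1) by (simp add: K'_def)
  ultimately show ?thesis by blast
qed

text \<open>On the window l x \<ge> 1, so |1 - phi| is bounded below and can be divided out; Hoelder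
  then pairs the L^q bound on g with the Plancherel mass of the window.\<close>

lemma transform_window_bound:
  assumes p: "1 < p" "p \<le> 2" and f: "jac_Lp a b p f"
  shows "\<exists>c>0. \<forall>g x. is_jac_FT a b p f g \<longrightarrow> x > 0 \<longrightarrow>
     ennreal c * (\<integral>\<^sup>+l\<in>{1/x..2/x}. ennreal (cmod (g l) * plw l) \<partial>lborel)
       \<le> jac_omega a b p f x * ennreal (x powr (- (if x \<le> 1 then 2 * (a + 1) / p else 3 / p)))"
proof -
  define q where "q = p / (p - 1)"
  have q1: "q > 1" using p by (simp add: q_def field_simps)
  have pq: "1 / p + 1 / q = 1" using p by (simp add: q_def field_simps)
  obtain K where K: "K \<ge> 0" "\<And>g x w. is_jac_FT a b p f g \<Longrightarrow> x > 0 \<Longrightarrow> w \<ge> 0 \<Longrightarrow>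
     (\<integral>\<^sup>+y\<in>{0<..}. ennreal (cmod (jac_tau a b x f y - f y) powr p * jac_A a b y) \<partial>lborel) = ennreal w \<Longrightarrow>
     (\<integral>\<^sup>+l. ennreal ((cmod (1 - phi (of_real l) x) * cmod (g l)) powr q) \<partial>PL) \<le> ennreal (K * w powr (q - 1))"
    using modulus_controls_transform[OF p q_def f] by blast
  obtain Cw where Cw: "Cw > 0" "\<And>x. x > 0 \<Longrightarrow> (\<integral>\<^sup>+l\<in>{1/x..2/x}. ennreal (plw l) \<partial>lborel) \<le> ennreal (Cw * (if x \<le> 1 then x powr (- (2 * (a + 1))) else x powr (-3)))"
    using weight_window by blast
  obtain \<eta> where \<eta>: "\<eta> < 1" "\<And>l x. x > 0 \<Longrightarrow> sqrt (k2 l) * x \<ge> 1/2 \<Longrightarrow> cmod (phi (of_real l) x) \<le> \<eta>"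
    using phi_away_from_one by blast
  define c0 where "c0 = 1 - \<eta>"
  have c0: "c0 > 0" using \<eta>(1) by (simp add: c0_def)
  \<comment> \<open>The added 1 keeps C positive when K = 0.\<close>
  define C where "C = (1 / c0) * K powr (1/q) * Cw powr (1/p) + 1"
  have C: "C > 0" using c0 by (simp add: C_def add_nonneg_pos)
  have "ennreal (1 / C) * (\<integral>\<^sup>+l\<in>{1/x..2/x}. ennreal (cmod (g l) * plw l) \<partial>lborel)
       \<le> jac_omega a b p f x * ennreal (x powr (- (if x \<le> 1 then 2 * (a + 1) / p else 3 / p)))"
    if g: "is_jac_FT a b p f g" and x: "x > 0" for g x
  proof (cases "(\<integral>\<^sup>+y\<in>{0<..}. ennreal (cmod (jac_tau a b x f y - f y) powr p * jac_A a b y) \<partial>lborel) = \<infinity>")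
    case True
    then have "jac_omega a b p f x = \<infinity>" by (simp add: jac_omega_def enn_powr_def)
    then show ?thesis using x by (simp add: ennreal_top_mult)
  next
    case False
    define w where "w = enn2real (\<integral>\<^sup>+y\<in>{0<..}. ennreal (cmod (jac_tau a b x f y - f y) powr p * jac_A a b y) \<partial>lborel)"
    have w: "w \<ge> 0" "(\<integral>\<^sup>+y\<in>{0<..}. ennreal (cmod (jac_tau a b x f y - f y) powr p * jac_A a b y) \<partial>lborel) = ennreal w"
      using False by (simp_all add: w_def less_top)
    have om: "jac_omega a b p f x = ennreal (w powr (1 / p))" unfolding jac_omega_def w(2) using w(1) by (simp add: enn_powr_def)
    have gm [measurable]: "g \<in> borel_measurable borel" using g by (simp add: is_jac_FT_def)
    define W where "W = {1/x..2/x}"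
    have Wm [measurable]: "W \<in> sets borel" by (simp add: W_def)
    define M where "M = density lborel (\<lambda>l. ennreal (plw l) * indicator W l)"
    define X where "X = (if x \<le> 1 then x powr (- (2 * (a + 1))) else x powr (-3))"
    define G where "G = (1 / c0) powr q * (K * w powr (q - 1))"
    have nM: "(\<integral>\<^sup>+l. v l \<partial>M) = (\<integral>\<^sup>+l. ennreal (plw l) * indicator W l * v l \<partial>lborel)" if "v \<in> borel_measurable borel" for v
      unfolding M_def by (rule nn_integral_density) (use that in measurable)
    have [measurable]: "(\<lambda>l. phi (complex_of_real l) x) \<in> borel_measurable borel"
    proof -
      have "(\<lambda>z. phi (complex_of_real (fst z)) (snd z)) \<in> borel_measurable (borel \<Otimes>\<^sub>M borel)"
        using phi_measurable_pair by (simp add: split_beta)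
      moreover have "(\<lambda>l. (l, x)) \<in> borel \<rightarrow>\<^sub>M borel \<Otimes>\<^sub>M borel" by measurable
      ultimately show ?thesis using measurable_compose by fastforce
    qed
    have Gb: "(\<integral>\<^sup>+l. ennreal (cmod (g l) powr q) \<partial>M) \<le> ennreal G"
    proof -
      have "(\<integral>\<^sup>+l. ennreal (cmod (g l) powr q) \<partial>M) = (\<integral>\<^sup>+l. ennreal (plw l) * indicator W l * ennreal (cmod (g l) powr q) \<partial>lborel)"
        by (rule nM) measurable
      also have "\<dots> \<le> (\<integral>\<^sup>+l. ennreal ((1 / c0) powr q) * (ennreal (plw l) * ennreal ((cmod (1 - phi (of_real l) x) * cmod (g l)) powr q)) \<partial>lborel)"
      proof (intro nn_integral_mono)
        fix l :: real
        show "ennreal (plw l) * indicator W l * ennreal (cmod (g l) powr q) \<le> ennreal ((1 / c0) powr q) * (ennreal (plw l) * ennreal ((cmod (1 - phi (of_real l) x) * cmod (g l)) powr q))"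
        proof (cases "l \<in> W")
          case True
          then have l: "1/x \<le> l" by (simp add: W_def)
          then have l1: "1 \<le> l * x" using x by (simp add: field_simps)
          have l0: "l > 0" using l x by (meson less_le_trans zero_less_divide_1_iff)
          have "l \<le> sqrt (k2 l)" by (rule real_le_rsqrt) (simp add: k2_def)
          then have "l * x \<le> sqrt (k2 l) * x" using x by (intro mult_right_mono) auto
          then have "cmod (phi (of_real l) x) \<le> \<eta>" using l1 by (intro \<eta>(2)[OF x]) linarith
          then have "c0 \<le> cmod (1 - phi (of_real l) x)"
            using norm_triangle_ineq2[of 1 "phi (of_real l) x"] by (simp add: c0_def)
          then have "c0 * cmod (g l) \<le> cmod (1 - phi (of_real l) x) * cmod (g l)" by (rule mult_right_mono) simp
          then have "(c0 * cmod (g l)) powr q \<le> (cmod (1 - phi (of_real l) x) * cmod (g l)) powr q"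
            using c0 q1 by (intro powr_mono2) auto
          then have "(1 / c0) powr q * (c0 * cmod (g l)) powr q \<le> (1 / c0) powr q * (cmod (1 - phi (of_real l) x) * cmod (g l)) powr q"
            by (rule mult_left_mono) simp
          moreover have "(1 / c0) powr q * (c0 * cmod (g l)) powr q = cmod (g l) powr q"
            using c0 by (subst powr_mult[symmetric]) auto
          ultimately have "ennreal (cmod (g l) powr q) \<le> ennreal ((1 / c0) powr q) * ennreal ((cmod (1 - phi (of_real l) x) * cmod (g l)) powr q)"
            by (simp add: ennreal_mult'[symmetric] ennreal_leI)
          then have "ennreal (plw l) * ennreal (cmod (g l) powr q) \<le> ennreal (plw l) * (ennreal ((1 / c0) powr q) * ennreal ((cmod (1 - phi (of_real l) x) * cmod (g l)) powr q))"
            by (rule mult_left_mono) simp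
          then show ?thesis using True by (simp add: mult_ac)
        qed simp
      qed
      also have "\<dots> = ennreal ((1 / c0) powr q) * (\<integral>\<^sup>+l. ennreal ((cmod (1 - phi (of_real l) x) * cmod (g l)) powr q) \<partial>PL)"
        by (subst nn_integral_cmult) (simp_all add: nn_integral_PL)
      also have "\<dots> \<le> ennreal ((1 / c0) powr q) * ennreal (K * w powr (q - 1))"
        by (intro mult_left_mono K(2)[OF g x w]) simp
      also have "\<dots> = ennreal G" by (simp add: G_def ennreal_mult'[symmetric])
      finally show ?thesis .
    qed
    have V: "emeasure M (space M) \<le> ennreal (Cw * X)"
    proof -
      have "emeasure M (space M) = (\<integral>\<^sup>+l\<in>{1/x..2/x}. ennreal (plw l) \<partial>lborel)"
        unfolding M_def by (subst emeasure_density) (auto simp: W_def intro!: nn_integral_cong)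
      then show ?thesis using Cw(2)[OF x] by (simp add: X_def)
    qed
    have "(\<integral>\<^sup>+l\<in>{1/x..2/x}. ennreal (cmod (g l) * plw l) \<partial>lborel) = (\<integral>\<^sup>+l. ennreal (plw l) * indicator W l * ennreal (cmod (g l)) \<partial>lborel)"
      by (rule nn_integral_cong) (simp add: W_def ennreal_mult' mult_ac)
    also have "\<dots> = (\<integral>\<^sup>+l. ennreal (cmod (g l)) \<partial>M)" by (rule nM[symmetric]) measurable
    also have "\<dots> \<le> ennreal (G powr (1/q) * (Cw * X) powr (1/p))"
      by (rule nn_integral_holder_const[OF _ _ q1 p(1) pq Gb V]) (use c0 K(1) Cw(1) in \<open>auto simp: G_def X_def M_def\<close>)
    also have "G powr (1/q) * (Cw * X) powr (1/p) = ((1 / c0) * K powr (1/q) * Cw powr (1/p)) * (w powr (1/p) * X powr (1/p))"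
    proof -
      have "(q - 1) * (1 / q) = 1 / p" using pq q1 by (simp add: field_simps)
      then have "G powr (1/q) = (1 / c0) * (K powr (1/q) * w powr (1/p))"
        unfolding G_def using c0 K(1) q1 by (simp add: powr_mult powr_powr del: divide_cancel_left)
      moreover have "(Cw * X) powr (1/p) = Cw powr (1/p) * X powr (1/p)" using Cw(1) by (intro powr_mult)
      ultimately show ?thesis by (simp only: mult_ac)
    qed
    also have "ennreal (((1 / c0) * K powr (1/q) * Cw powr (1/p)) * (w powr (1/p) * X powr (1/p))) \<le> ennreal (C * (w powr (1/p) * X powr (1/p)))"
      by (intro ennreal_leI mult_right_mono) (auto simp: C_def)
    finally have "ennreal (1 / C) * (\<integral>\<^sup>+l\<in>{1/x..2/x}. ennreal (cmod (g l) * plw l) \<partial>lborel) \<le> ennreal (1 / C) * ennreal (C * (w powr (1/p) * X powr (1/p)))"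
      by (intro mult_left_mono) auto
    also have "\<dots> = ennreal (w powr (1/p)) * ennreal (X powr (1/p))"
      using C by (simp add: ennreal_mult'[symmetric])
    also have "X powr (1/p) = x powr (- (if x \<le> 1 then 2 * (a + 1) / p else 3 / p))"
    proof -
      have "- (2 * (a + 1)) * (1 / p) = - (2 * (a + 1) / p)" "- 3 * (1 / p) = - (3 / p)" using p by (simp_all add: field_simps)
      then show ?thesis by (simp only: X_def powr_powr if_distrib[of "\<lambda>r. r powr (1 / p)"] if_distrib[of uminus] if_distrib[of "(powr) x"])
    qed
    finally show ?thesis by (simp add: om)
  qed
  moreover have "1 / C > 0" using C by simp
  ultimately show ?thesis by blast
qed

text \<open>Interchanging the integrals: for fixed l > 0 the x whose window contains l form
  [1/l, 2/l], of length 1/l, and there 1/x \<ge> l/2. So each l is counted with mass at least 1/2,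
  whence the factor 2.\<close>

lemma nn_integral_dyadic_average:
  assumes [measurable]: "v \<in> borel_measurable borel" and v0: "\<And>l. l \<le> 0 \<Longrightarrow> v l = 0"
  shows "(\<lambda>x. (\<integral>\<^sup>+l\<in>{1/x..2/x}. v l \<partial>lborel) * ennreal (1 / x) * indicator {0<..} x) \<in> borel_measurable borel" (is ?meas)
    and "(\<integral>\<^sup>+l. v l \<partial>lborel) \<le> 2 * (\<integral>\<^sup>+x\<in>{0<..}. (\<integral>\<^sup>+l\<in>{1/x..2/x}. v l \<partial>lborel) * ennreal (1 / x) \<partial>lborel)" (is ?le)
proof -
  define h where "h x l = (if 1/x \<le> l \<and> l \<le> 2/x \<and> x > 0 then v l * ennreal (1 / x) else 0)" for x l :: real
  have hm [measurable]: "case_prod h \<in> borel_measurable (lborel \<Otimes>\<^sub>M lborel)"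
    unfolding h_def by measurable
  have J: "(\<integral>\<^sup>+l. h x l \<partial>lborel) = (\<integral>\<^sup>+l\<in>{1/x..2/x}. v l \<partial>lborel) * ennreal (1 / x) * indicator {0<..} x" for x
  proof (cases "x > 0")
    case True
    have "(\<integral>\<^sup>+l. h x l \<partial>lborel) = (\<integral>\<^sup>+l. (v l * indicator {1/x..2/x} l) * ennreal (1 / x) \<partial>lborel)"
      by (rule nn_integral_cong) (use True in \<open>auto simp: h_def indicator_def\<close>)
    also have "\<dots> = (\<integral>\<^sup>+l\<in>{1/x..2/x}. v l \<partial>lborel) * ennreal (1 / x)" by (rule nn_integral_multc) measurable
    finally show ?thesis using True by simp
  qed (simp add: h_def)
  have "(\<lambda>x. \<integral>\<^sup>+l. h x l \<partial>lborel) \<in> borel_measurable lborel" by (rule lborel.borel_measurable_nn_integral[OF hm])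
  then show ?meas by (simp add: J)
  have low: "v l \<le> 2 * (\<integral>\<^sup>+x. h x l \<partial>lborel)" for l
  proof (cases "l > 0")
    case l: True
    have "v l * ennreal (l / 2) * ennreal (1 / l) = (\<integral>\<^sup>+x. (v l * ennreal (l / 2)) * indicator {1/l..2/l} x \<partial>lborel)"
      using l by (subst nn_integral_cmult_indicator) (auto simp: divide_right_mono diff_divide_distrib[symmetric])
    also have "\<dots> \<le> (\<integral>\<^sup>+x. h x l \<partial>lborel)"
    proof (intro nn_integral_mono)
      fix x :: real
      show "v l * ennreal (l / 2) * indicator {1/l..2/l} x \<le> h x l"
      proof (cases "x \<in> {1/l..2/l}")
        case True
        then have x: "1/l \<le> x" "x \<le> 2/l" by auto
        then have x0: "x > 0" using l by (meson less_le_trans zero_less_divide_1_iff)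
        have "1/x \<le> l" "l \<le> 2/x" "l / 2 \<le> 1 / x" using x x0 l by (auto simp: field_simps)
        then show ?thesis using True x0 by (auto simp: h_def intro!: mult_left_mono ennreal_leI)
      qed simp
    qed
    finally have "2 * (v l * ennreal (l / 2) * ennreal (1 / l)) \<le> 2 * (\<integral>\<^sup>+x. h x l \<partial>lborel)" by (rule mult_left_mono) simp
    moreover have "2 * (v l * ennreal (l / 2) * ennreal (1 / l)) = v l"
    proof -
      have "ennreal 2 * ennreal (l / 2) * ennreal (1 / l) = 1"
        using l by (simp only: ennreal_mult'[symmetric] ennreal_1) (simp add: ennreal_mult'[symmetric])
      then have "v l * (ennreal 2 * ennreal (l / 2) * ennreal (1 / l)) = v l" by simp
      then show ?thesis by (simp add: mult_ac)
    qed
    ultimately show ?thesis by simp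
  qed (simp add: v0)
  have "(\<integral>\<^sup>+l. v l \<partial>lborel) \<le> (\<integral>\<^sup>+l. 2 * (\<integral>\<^sup>+x. h x l \<partial>lborel) \<partial>lborel)" by (intro nn_integral_mono low)
  also have "\<dots> = 2 * (\<integral>\<^sup>+l. (\<integral>\<^sup>+x. h x l \<partial>lborel) \<partial>lborel)" by (rule nn_integral_cmult) measurable
  also have "(\<integral>\<^sup>+l. (\<integral>\<^sup>+x. h x l \<partial>lborel) \<partial>lborel) = (\<integral>\<^sup>+x. (\<integral>\<^sup>+l. h x l \<partial>lborel) \<partial>lborel)"
    by (rule lborel_pair.Fubini'[OF hm])
  finally show ?le by (simp add: J)
qed

lemma besov_transform_integrable:
  assumes p: "1 < p" "p \<le> 2" and b1: "jac_besov a b p 1 (2 * (a + 1) / p) f" and b2: "jac_besov a b p 1 (3 / p) f"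
    and g: "is_jac_FT a b p f g"
  shows "(\<integral>\<^sup>+t\<in>{0<..}. ennreal (cmod (g t) * jac_planch a b t) \<partial>lborel) < \<infinity>"
proof -
  have f: "jac_Lp a b p f" using b1 by (simp add: jac_besov_def)
  have gm [measurable]: "g \<in> borel_measurable borel" using g by (simp add: is_jac_FT_def)
  obtain c where c: "c > 0" "\<And>x. x > 0 \<Longrightarrow>
     ennreal c * (\<integral>\<^sup>+l\<in>{1/x..2/x}. ennreal (cmod (g l) * plw l) \<partial>lborel)
       \<le> jac_omega a b p f x * ennreal (x powr (- (if x \<le> 1 then 2 * (a + 1) / p else 3 / p)))"
    using transform_window_bound[OF p f] g by blast
  define v where "v l = ennreal (cmod (g l) * plw l)" for l
  have vm: "v \<in> borel_measurable borel" unfolding v_def by measurable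
  have v0: "v l = 0" if "l \<le> 0" for l using that by (simp add: v_def plw_def)
  define J where "J x = (\<integral>\<^sup>+l\<in>{1/x..2/x}. v l \<partial>lborel) * ennreal (1 / x) * indicator {0<..} x" for x
  have Jm [measurable]: "J \<in> borel_measurable borel" unfolding J_def by (rule nn_integral_dyadic_average(1)[OF vm v0])
  have Jle: "ennreal c * J x \<le> jac_omega a b p f x * ennreal (x powr (- (if x \<le> 1 then 2 * (a + 1) / p else 3 / p))) * ennreal (1 / x) * indicator {0<..} x" for x
  proof (cases "x > 0")
    case True
    show ?thesis using mult_right_mono[OF c(2)[OF True], of "ennreal (1 / x)"] True by (simp add: J_def v_def mult.assoc)
  qed (simp add: J_def)
  \<comment> \<open>Applied to x \<le> 1 and to x > 1: on each range one of the two Besov conditions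
    has exactly the exponent of the window bound.\<close>
  have fin: "(\<integral>\<^sup>+x. J x * indicator S x \<partial>lborel) < \<infinity>"
    if S [measurable]: "S \<in> sets borel" and B: "jac_besov a b p 1 \<gamma> f"
      and SG: "\<And>x. x \<in> S \<Longrightarrow> (if x \<le> 1 then 2 * (a + 1) / p else 3 / p) = \<gamma>" for S \<gamma>
  proof -
    have "ennreal c * (\<integral>\<^sup>+x. J x * indicator S x \<partial>lborel) = (\<integral>\<^sup>+x. ennreal c * (J x * indicator S x) \<partial>lborel)"
      by (rule nn_integral_cmult[symmetric]) measurable
    also have "\<dots> \<le> (\<integral>\<^sup>+x\<in>{0<..}. enn_powr (jac_omega a b p f x * ennreal (x powr (- \<gamma>))) 1 * ennreal (1 / x) \<partial>lborel)"
    proof (intro nn_integral_mono)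
      fix x
      show "ennreal c * (J x * indicator S x) \<le> enn_powr (jac_omega a b p f x * ennreal (x powr (- \<gamma>))) 1 * ennreal (1 / x) * indicator {0<..} x"
        using Jle[of x] SG[of x] by (cases "x \<in> S") (simp_all add: enn_powr_1)
    qed
    also have "\<dots> < \<infinity>" using B by (simp add: jac_besov_def)
    finally show ?thesis using c(1) by (auto simp: ennreal_mult_less_top)
  qed
  have "(\<integral>\<^sup>+x. J x \<partial>lborel) = (\<integral>\<^sup>+x. J x * indicator {..1} x + J x * indicator {1<..} x \<partial>lborel)"
    by (rule nn_integral_cong) (auto simp: indicator_def)
  also have "\<dots> = (\<integral>\<^sup>+x. J x * indicator {..1} x \<partial>lborel) + (\<integral>\<^sup>+x. J x * indicator {1<..} x \<partial>lborel)"
    by (rule nn_integral_add) measurable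
  also have "\<dots> < \<infinity>" using fin[OF _ b1, of "{..1}"] fin[OF _ b2, of "{1<..}"] by simp
  finally have JJ: "(\<integral>\<^sup>+x. J x \<partial>lborel) < \<infinity>" .
  have "(\<integral>\<^sup>+t\<in>{0<..}. ennreal (cmod (g t) * jac_planch a b t) \<partial>lborel) = (\<integral>\<^sup>+l. v l \<partial>lborel)"
    unfolding nn_integral_plw v_def ..
  also have "\<dots> \<le> 2 * (\<integral>\<^sup>+x. J x \<partial>lborel)"
    using nn_integral_dyadic_average(2)[OF vm v0] by (simp add: J_def)
  also have "\<dots> < \<infinity>" using JJ by (simp add: ennreal_mult_less_top)
  finally show ?thesis .
qed

end

text \<open>The transform is determined up to null sets only, hence a statement about every version
  g; the existence part keeps it from being vacuous.\<close>

theorem theorem1: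
  fixes a b p :: real and f :: "real \<Rightarrow> complex"
  assumes "a \<ge> b" and "b \<ge> -1/2" and "a \<noteq> -1/2"
    and "1 < p" and "p \<le> 2"
    and "jac_besov a b p 1 (2 * (a + 1) / p) f"
    and "jac_besov a b p 1 (3 / p) f"
  shows "(\<exists>g. is_jac_FT a b p f g) \<and>
         (\<forall>g. is_jac_FT a b p f g \<longrightarrow>
            (\<integral>\<^sup>+ t\<in>{0<..}. ennreal (cmod (g t) * jac_planch a b t) \<partial>lborel) < \<infinity>)"
proof -
  interpret jacobi a b by unfold_locales (use assms in auto)
  have "jac_Lp a b p f" using assms(6) by (simp add: jac_besov_def)
  then show ?thesis
    using is_jac_FT_exists besov_transform_integrable assms(4-7) by blast
qed

end
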